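(* Let $k$ be an uncountable field and let $A$ be a finitely generated $k$-algebra that is a domain of Gelfand-Kirillov dimension strictly less than $3$, such that $A$ is not algebraic over $k$; fix $x \in A$ which is transcendental over $k$. If $\operatorname{char} k = p > 0$, assume in addition that $D := Q(A)$ does not contain an element $u$ such that $xux^{-1} = u+1$. If $A$ does not satisfy a polynomial identity, then $Q(A)$ contains a free $k$-algebra on two generators.
   Context: $Q(A)$ denotes the Ore quotient division ring of $A$ (a domain of finite Gelfand-Kirillov dimension is an Ore domain). $A$ is algebraic over $k$ if every element of $A$ is algebraic over $k$; an element of $A$ is transcendental over $k$ if it is not algebraic over $k$. "$Q(A)$ contains a free $k$-algebra on two generators" means there are $y,z\in Q(A)$ such that the $k$-subalgebra $k\langle y,z\rangle$ is free (noncommutative) on $y,z$. *)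

theory Defs
  imports
    "HOL-Analysis.Analysis"
    "HOL-Library.Poly_Mapping"
    "HOL-Computational_Algebra.Computational_Algebra"
begin

locale k_algebra = vector_space scale
  for scale :: "'k::field \<Rightarrow> 'a::ring_1 \<Rightarrow> 'a" +
  assumes scale_mult_left: "scale c a * b = scale c (a * b)"
    and scale_mult_right: "a * scale c b = scale c (a * b)"
begin

definition subalgebra :: "'a set \<Rightarrow> bool" where
  "subalgebra B \<longleftrightarrow> subspace B \<and> 1 \<in> B \<and> (\<forall>a\<in>B. \<forall>b\<in>B. a * b \<in> B)"

definition finitely_generated :: bool where
  "finitely_generated \<longleftrightarrow> (\<exists>S. finite S \<and> subalgebra hull S = UNIV)"

definition algebraic_elem :: "'a \<Rightarrow> bool" where
  "algebraic_elem a \<longleftrightarrow>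
     (\<exists>p :: 'k poly. p \<noteq> 0 \<and> (\<Sum>i\<le>degree p. scale (coeff p i) (a ^ i)) = 0)"

definition algebraic_algebra :: bool where
  "algebraic_algebra \<longleftrightarrow> (\<forall>a. algebraic_elem a)"

text \<open>
  If the finite set \<open>S\<close> spans the subspace \<open>V\<close>, then \<open>growth_space S n\<close> is
  \<open>k + V + V\<^sup>2 + \<dots> + V\<^sup>n\<close>.
\<close>

definition growth_space :: "'a set \<Rightarrow> nat \<Rightarrow> 'a set" where
  "growth_space S n = span {prod_list w | w. set w \<subseteq> S \<and> length w \<le> n}"

text \<open>
  The supremum runs over all finite-dimensional subspaces \<open>V\<close>, each given by a finite
  spanning set. The values at \<open>n = 0\<close> and \<open>n = 1\<close>, where \<open>ln n = 0\<close>, do not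
  affect the upper limit.
\<close>

definition gk_dim :: ereal where
  "gk_dim = (SUP S\<in>{S. finite S}.
     limsup (\<lambda>n. ereal (ln (real (dim (growth_space S n))) / ln (real n))))"

text \<open>
  Finitely supported functions on the words over \<open>'i\<close> are the elements of the free
  algebra \<open>k\<langle>'i\<rangle>\<close>; \<open>nc_eval y\<close> is the algebra homomorphism
  sending the variable \<open>i\<close> to \<open>y i\<close>.
\<close>

definition nc_eval :: "('i \<Rightarrow> 'a) \<Rightarrow> ('i list \<Rightarrow>\<^sub>0 'k) \<Rightarrow> 'a" where
  "nc_eval y f = (\<Sum>w\<in>Poly_Mapping.keys f. scale (Poly_Mapping.lookup f w) (prod_list (map y w)))"

definition satisfies_polynomial_identity :: bool where
  "satisfies_polynomial_identity \<longleftrightarrow>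
     (\<exists>f :: nat list \<Rightarrow>\<^sub>0 'k. f \<noteq> 0 \<and> (\<forall>y. nc_eval y f = 0))"

text \<open>
  The subalgebra generated by \<open>y\<close> and \<open>z\<close> is the range of the evaluation map, so
  it is free on \<open>y, z\<close> exactly when that map is injective.
\<close>

definition free_on :: "'a \<Rightarrow> 'a \<Rightarrow> bool" where
  "free_on y z \<longleftrightarrow>
     inj (nc_eval (\<lambda>b. if b then y else z) :: (bool list \<Rightarrow>\<^sub>0 'k) \<Rightarrow> 'a)"

definition contains_free_algebra :: bool where
  "contains_free_algebra \<longleftrightarrow> (\<exists>y z. free_on y z)"

end

text \<open>
  The division algebra \<open>'d\<close>, together with the embedding \<open>\<iota>\<close>, is the quotient
  division ring of the domain \<open>'a\<close>. This determines it up to isomorphism over \<open>'a\<close>.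
  It exists precisely when \<open>'a\<close> is right Ore, and then its \<open>k\<close>-structure is
  forced by linearity of \<open>\<iota>\<close>. If \<open>'a\<close> is also left Ore, as it is when its
  Gelfand-Kirillov dimension is finite, then every element is a left fraction too.
\<close>

locale ore_quotient =
  A: k_algebra scaleA + D: k_algebra scaleD
  for scaleA :: "'k::field \<Rightarrow> 'a::ring_1_no_zero_divisors \<Rightarrow> 'a"
    and scaleD :: "'k \<Rightarrow> 'd::division_ring \<Rightarrow> 'd" +
  fixes \<iota> :: "'a \<Rightarrow> 'd"
  assumes emb_add: "\<iota> (a + b) = \<iota> a + \<iota> b"
    and emb_mult: "\<iota> (a * b) = \<iota> a * \<iota> b"
    and emb_one: "\<iota> 1 = 1"
    and emb_scale: "\<iota> (scaleA c a) = scaleD c (\<iota> a)"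
    and emb_inj: "inj \<iota>"
    and fractions: "\<exists>a s. s \<noteq> 0 \<and> d = \<iota> a * inverse (\<iota> s)"

end

theory Submission imports Defs begin

text \<open>Let \<open>D\<close> be the quotient division ring, \<open>Z\<close> the image of the ground field in it, and \<open>E\<close> the
  centralizer of \<open>x\<close>. Suppose that \<open>D\<close> contains no free pair.

  First, every \<open>a\<close> in \<open>D\<close> is then algebraic over \<open>E\<close> on one side. Since \<open>Z\<close> is uncountable, it
  contains elements \<open>l\<close> and \<open>m\<close> that behave like independent central variables over a countable
  division ring containing \<open>x\<close> and \<open>a\<close>. The elements \<open>y = (1 - m x)\<^sup>-\<^sup>1\<close> and \<open>z = y (a - l)\<^sup>-\<^sup>1\<close> are not
  free, and the criterion \<open>words_independent\<close> turns this into an equation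
  \<open>e\<^sub>1 + e\<^sub>2 (a - l)\<^sup>-\<^sup>1 = x u x\<^sup>-\<^sup>1 - u\<close> with \<open>e\<^sub>1\<close> and \<open>e\<^sub>2\<close> in the centralizer of \<open>x\<close>
  (\<open>free_or_equation\<close>). When \<open>x u x\<^sup>-\<^sup>1 = u + 1\<close> has no solution, the pole of the left-hand side at
  \<open>l = a\<close> makes \<open>a\<close> algebraic over \<open>E\<close> (\<open>algebraic_over_centralizer\<close>). In characteristic zero a
  solution generates with \<open>x\<close> a skew Laurent ring over \<open>Z(u)\<close>, in which a free pair is written down
  explicitly (\<open>free_pair_of_shift\<close>).

  Second, \<open>D\<close> has finite dimension over \<open>E\<close> (\<open>finite_over_centralizer\<close>). Otherwise consider the
  tower \<open>Z \<subseteq> Z(x) \<subseteq> E \<subseteq> D\<close>. If the middle step is not locally finite, then each of the three steps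
  contributes a linear factor to the growth, which becomes cubic (\<open>centralizer_locally_finite\<close>). So
  all elements of \<open>D\<close> are algebraic over \<open>K = Z(x)\<close> on one side, the algebra is generated by a finite
  set \<open>V\<close> with \<open>K V \<subseteq> V K\<close>, and its growth over \<open>K\<close> is subquadratic. Bergman's gap argument then yields
  a word all of whose powers are normal (\<open>normal_power_exists\<close>), and such a word is transcendental
  over \<open>K\<close> on both sides.

  Third, as \<open>D\<close> is finite over \<open>E\<close>, the element \<open>x\<close> is algebraic over the center, which therefore
  contains an element transcendental over \<open>Z\<close> (\<open>central_transcendental\<close>). A second application of
  Bergman's argument makes \<open>D\<close> finite over a commutative subring (\<open>finite_over_commutative\<close>), and a
  standard identity holds (\<open>standard_identity\<close>).

  Dimensions are right dimensions throughout. The estimates use two devices. A subspace growing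
  least, relative to its dimension, under multiplication by a finite set keeps this property after
  multiplication by elements commuting with the set (\<open>petridis\<close>); and a subspace gains at least one
  dimension for each dimension of its span over a larger division ring (\<open>gain_per_layer\<close>).\<close>

section \<open>Right vector spaces over a division subring\<close>

definition rsubspace :: "'d::division_ring set \<Rightarrow> 'd set \<Rightarrow> bool" where
  "rsubspace F U \<longleftrightarrow> 0 \<in> U \<and> (\<forall>u\<in>U. \<forall>v\<in>U. u + v \<in> U) \<and> (\<forall>u\<in>U. \<forall>c\<in>F. u * c \<in> U)"

definition rspan :: "'d::division_ring set \<Rightarrow> 'd set \<Rightarrow> 'd set" where
  "rspan F X = \<Inter>{U. rsubspace F U \<and> X \<subseteq> U}"

definition rindep :: "'d::division_ring set \<Rightarrow> 'd set \<Rightarrow> bool" where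
  "rindep F B \<longleftrightarrow> finite B \<and>
     (\<forall>c. (\<forall>b\<in>B. c b \<in> F) \<longrightarrow> (\<Sum>b\<in>B. b * c b) = 0 \<longrightarrow> (\<forall>b\<in>B. c b = 0))"

definition rfin :: "'d::division_ring set \<Rightarrow> 'd set \<Rightarrow> bool" where
  "rfin F U \<longleftrightarrow> (\<exists>X. finite X \<and> U \<subseteq> rspan F X)"

text \<open>The maximum exists, and equals the dimension of the span, only for sets that are \<open>rfin\<close>.\<close>

definition rdim :: "'d::division_ring set \<Rightarrow> 'd set \<Rightarrow> nat" where
  "rdim F U = Max {card B | B. B \<subseteq> U \<and> rindep F B}"

lemma rsubspaceI:
  "0 \<in> U \<Longrightarrow> (\<And>u v. u \<in> U \<Longrightarrow> v \<in> U \<Longrightarrow> u + v \<in> U) \<Longrightarrow> (\<And>u c. u \<in> U \<Longrightarrow> c \<in> F \<Longrightarrow> u * c \<in> U)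
    \<Longrightarrow> rsubspace F U"
  by (auto simp: rsubspace_def)

lemma rsubspace_0: "rsubspace F U \<Longrightarrow> 0 \<in> U"
  and rsubspace_add: "rsubspace F U \<Longrightarrow> u \<in> U \<Longrightarrow> v \<in> U \<Longrightarrow> u + v \<in> U"
  and rsubspace_scale: "rsubspace F U \<Longrightarrow> u \<in> U \<Longrightarrow> c \<in> F \<Longrightarrow> u * c \<in> U"
  by (auto simp: rsubspace_def)

lemma rsubspace_sum:
  "rsubspace F U \<Longrightarrow> (\<And>i. i \<in> I \<Longrightarrow> f i \<in> U) \<Longrightarrow> (\<Sum>i\<in>I. f i) \<in> U"
  by (induction I rule: infinite_finite_induct) (auto simp: rsubspace_0 rsubspace_add)

lemma rsubspace_Int: "rsubspace F U \<Longrightarrow> rsubspace F W \<Longrightarrow> rsubspace F (U \<inter> W)"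
  by (auto simp: rsubspace_def)

lemma rsubspace_zero: "rsubspace F {0}"
  by (auto simp: rsubspace_def)

lemma rsubspace_rspan: "rsubspace F (rspan F X)"
  by (auto simp: rsubspace_def rspan_def)

lemma rspan_superset: "X \<subseteq> rspan F X"
  by (auto simp: rspan_def)

lemma rspan_base: "x \<in> X \<Longrightarrow> x \<in> rspan F X"
  by (auto simp: rspan_def)

lemma rspan_minimal: "rsubspace F U \<Longrightarrow> X \<subseteq> U \<Longrightarrow> rspan F X \<subseteq> U"
  by (auto simp: rspan_def)

lemma rspan_mono: "X \<subseteq> Y \<Longrightarrow> rspan F X \<subseteq> rspan F Y"
  by (auto simp: rspan_def)

lemma rsubspace_subfield: "rsubspace F U \<Longrightarrow> G \<subseteq> F \<Longrightarrow> rsubspace G U"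
  by (auto simp: rsubspace_def)

lemma rspan_field_mono: "G \<subseteq> F \<Longrightarrow> rspan G X \<subseteq> rspan F X"
  by (rule rspan_minimal) (auto intro: rsubspace_subfield rsubspace_rspan rspan_base)

lemma rspan_lmult:
  assumes "u \<in> rspan F X" shows "d * u \<in> rspan F ((*) d ` X)"
proof -
  have "rsubspace F {u. d * u \<in> rspan F ((*) d ` X)}"
    using rsubspace_rspan[of F "(*) d ` X"]
    by (auto simp: rsubspace_def distrib_left mult.assoc[symmetric])
  then have "rspan F X \<subseteq> {u. d * u \<in> rspan F ((*) d ` X)}"
    by (rule rspan_minimal) (auto intro: rspan_base)
  with assms show ?thesis by auto
qed

locale division_subring =
  fixes F :: "'d::division_ring set"
  assumes one_mem: "1 \<in> F"
    and diff_mem: "a \<in> F \<Longrightarrow> b \<in> F \<Longrightarrow> a - b \<in> F"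
    and mult_mem: "a \<in> F \<Longrightarrow> b \<in> F \<Longrightarrow> a * b \<in> F"
    and inverse_mem: "a \<in> F \<Longrightarrow> inverse a \<in> F"
begin

lemma zero_mem: "0 \<in> F"
  using diff_mem[OF one_mem one_mem] by simp

lemma uminus_mem: "a \<in> F \<Longrightarrow> - a \<in> F"
  using diff_mem[OF zero_mem] by simp

lemma add_mem: "a \<in> F \<Longrightarrow> b \<in> F \<Longrightarrow> a + b \<in> F"
  using diff_mem[of a "- b"] uminus_mem by simp

lemma sum_mem: "(\<And>i. i \<in> I \<Longrightarrow> f i \<in> F) \<Longrightarrow> (\<Sum>i\<in>I. f i) \<in> F"
  by (induction I rule: infinite_finite_induct) (auto simp: zero_mem add_mem)

lemma power_mem: "a \<in> F \<Longrightarrow> a ^ n \<in> F"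
  by (induction n) (auto simp: one_mem mult_mem)

lemma rsubspace_self: "rsubspace F F"
  by (auto simp: rsubspace_def zero_mem add_mem mult_mem)

lemma rsubspace_uminus: "rsubspace F U \<Longrightarrow> u \<in> U \<Longrightarrow> - u \<in> U"
  using rsubspace_scale[of F U u "-1"] uminus_mem[OF one_mem] by simp

lemma rsubspace_diff: "rsubspace F U \<Longrightarrow> u \<in> U \<Longrightarrow> v \<in> U \<Longrightarrow> u - v \<in> U"
  using rsubspace_add[of F U u "-v"] rsubspace_uminus by simp

lemma rspan_family:
  assumes "finite I"
  shows "rspan F (f ` I) = {(\<Sum>i\<in>I. f i * c i) | c. \<forall>i\<in>I. c i \<in> F}" (is "_ = ?S")
proof
  have "rsubspace F ?S"
  proof (rule rsubspaceI)
    show "0 \<in> ?S" by (auto intro!: exI[of _ "\<lambda>_. 0"] simp: zero_mem)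
    fix u v assume "u \<in> ?S" "v \<in> ?S"
    then obtain c d where "\<forall>i\<in>I. c i \<in> F" "u = (\<Sum>i\<in>I. f i * c i)"
       "\<forall>i\<in>I. d i \<in> F" "v = (\<Sum>i\<in>I. f i * d i)" by auto
    then show "u + v \<in> ?S"
      by (auto intro!: exI[of _ "\<lambda>i. c i + d i"] simp: add_mem distrib_left sum.distrib)
  next
    fix u e assume "u \<in> ?S" "e \<in> F"
    then obtain c where "\<forall>i\<in>I. c i \<in> F" "u = (\<Sum>i\<in>I. f i * c i)" by auto
    then show "u * e \<in> ?S" using \<open>e \<in> F\<close>
      by (auto intro!: exI[of _ "\<lambda>i. c i * e"] simp: mult_mem sum_distrib_right mult.assoc)
  qed
  moreover have "f ` I \<subseteq> ?S"
  proof clarify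
    fix i assume i: "i \<in> I"
    have "f i = (\<Sum>j\<in>I. f j * (if j = i then 1 else 0))"
      using assms i by (simp add: sum.delta if_distrib[where f = "\<lambda>z. f _ * z"] cong: if_cong)
    then show "\<exists>c. f i = (\<Sum>j\<in>I. f j * c j) \<and> (\<forall>j\<in>I. c j \<in> F)"
      by (intro exI[of _ "\<lambda>j. if j = i then 1 else 0"]) (auto simp: one_mem zero_mem)
  qed
  ultimately show "rspan F (f ` I) \<subseteq> ?S" by (rule rspan_minimal)
  show "?S \<subseteq> rspan F (f ` I)"
    by (auto intro!: rsubspace_sum[OF rsubspace_rspan] rsubspace_scale[OF rsubspace_rspan]
        intro: rspan_base)
qed

lemma rspan_finite: "finite B \<Longrightarrow> rspan F B = {(\<Sum>b\<in>B. b * c b) | c. \<forall>b\<in>B. c b \<in> F}"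
  using rspan_family[of B "\<lambda>x. x"] by simp

text \<open>Gaussian elimination on a pivot. The unknowns stand to the right of the coefficients here
  and to the left in the following version.\<close>

lemma homogeneous_system_right:
  fixes M :: "'i \<Rightarrow> 'j \<Rightarrow> 'd"
  assumes "finite J" "finite I" "card J < card I" "\<And>i j. i \<in> I \<Longrightarrow> j \<in> J \<Longrightarrow> M i j \<in> F"
  shows "\<exists>c. (\<forall>i\<in>I. c i \<in> F) \<and> (\<exists>i\<in>I. c i \<noteq> 0) \<and> (\<forall>j\<in>J. (\<Sum>i\<in>I. M i j * c i) = 0)"
  using assms
proof (induction J arbitrary: I M rule: finite_induct)
  case empty
  then obtain i where "i \<in> I" by fastforce
  then show ?case by (intro exI[of _ "\<lambda>_. 1"]) (auto simp: one_mem)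
next
  case (insert j J)
  show ?case
  proof (cases "\<forall>i\<in>I. M i j = 0")
    case True
    from insert.IH[of I M] insert.prems insert.hyps obtain c where
      c: "\<forall>i\<in>I. c i \<in> F" "\<exists>i\<in>I. c i \<noteq> 0" "\<forall>j\<in>J. (\<Sum>i\<in>I. M i j * c i) = 0" by auto
    then show ?thesis using True by (intro exI[of _ c]) auto
  next
    case False
    then obtain p where p: "p \<in> I" "M p j \<noteq> 0" by auto
    define N where "N = (\<lambda>i j'. M i j' - M p j' * inverse (M p j) * M i j)"
    have "card J < card (I - {p})" using insert.prems insert.hyps p by (simp add: card_Diff_singleton)
    moreover have "N i j' \<in> F" if "i \<in> I - {p}" "j' \<in> J" for i j'
      using that insert.prems p unfolding N_def by (auto intro!: diff_mem mult_mem inverse_mem)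
    ultimately obtain c where c: "\<forall>i\<in>I-{p}. c i \<in> F" "\<exists>i\<in>I-{p}. c i \<noteq> 0"
      "\<forall>j'\<in>J. (\<Sum>i\<in>I-{p}. N i j' * c i) = 0"
      using insert.IH[of "I - {p}" N] insert.prems by auto
    define cp where "cp = - (\<Sum>i\<in>I-{p}. inverse (M p j) * M i j * c i)"
    define e where "e = c(p := cp)"
    have cpF: "cp \<in> F" unfolding cp_def
      using c insert.prems p by (auto intro!: uminus_mem sum_mem mult_mem inverse_mem)
    have split: "(\<Sum>i\<in>I. M i j' * e i) = M p j' * cp + (\<Sum>i\<in>I-{p}. M i j' * c i)" for j'
      using insert.prems(1) p by (simp add: sum.remove[of I p] e_def)
    have "(\<Sum>i\<in>I. M i j * e i) = 0"
      unfolding split cp_def using p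
      by (simp add: sum_distrib_left mult.assoc[symmetric])
    moreover have "(\<Sum>i\<in>I. M i j' * e i) = 0" if "j' \<in> J" for j'
    proof -
      have "M p j' * cp = - (\<Sum>i\<in>I-{p}. M p j' * inverse (M p j) * M i j * c i)"
        unfolding cp_def by (simp add: sum_distrib_left mult.assoc)
      then have "(\<Sum>i\<in>I. M i j' * e i) = (\<Sum>i\<in>I-{p}. N i j' * c i)"
        unfolding split N_def by (simp add: left_diff_distrib sum_subtractf)
      then show ?thesis using c that by simp
    qed
    moreover have "\<forall>i\<in>I. e i \<in> F" using c cpF by (auto simp: e_def)
    moreover have "\<exists>i\<in>I. e i \<noteq> 0" using c by (auto simp: e_def)
    ultimately show ?thesis by (intro exI[of _ e]) auto
  qed
qed

lemma homogeneous_system_left: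
  fixes M :: "'i \<Rightarrow> 'j \<Rightarrow> 'd"
  assumes "finite J" "finite I" "card J < card I" "\<And>i j. i \<in> I \<Longrightarrow> j \<in> J \<Longrightarrow> M i j \<in> F"
  shows "\<exists>c. (\<forall>i\<in>I. c i \<in> F) \<and> (\<exists>i\<in>I. c i \<noteq> 0) \<and> (\<forall>j\<in>J. (\<Sum>i\<in>I. c i * M i j) = 0)"
  using assms
proof (induction J arbitrary: I M rule: finite_induct)
  case empty
  then obtain i where "i \<in> I" by fastforce
  then show ?case by (intro exI[of _ "\<lambda>_. 1"]) (auto simp: one_mem)
next
  case (insert j J)
  show ?case
  proof (cases "\<forall>i\<in>I. M i j = 0")
    case True
    from insert.IH[of I M] insert.prems insert.hyps obtain c where
      c: "\<forall>i\<in>I. c i \<in> F" "\<exists>i\<in>I. c i \<noteq> 0" "\<forall>j\<in>J. (\<Sum>i\<in>I. c i * M i j) = 0" by auto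
    then show ?thesis using True by (intro exI[of _ c]) auto
  next
    case False
    then obtain p where p: "p \<in> I" "M p j \<noteq> 0" by auto
    define N where "N = (\<lambda>i j'. M i j' - M i j * inverse (M p j) * M p j')"
    have "card J < card (I - {p})" using insert.prems insert.hyps p by (simp add: card_Diff_singleton)
    moreover have "N i j' \<in> F" if "i \<in> I - {p}" "j' \<in> J" for i j'
      using that insert.prems p unfolding N_def by (auto intro!: diff_mem mult_mem inverse_mem)
    ultimately obtain c where c: "\<forall>i\<in>I-{p}. c i \<in> F" "\<exists>i\<in>I-{p}. c i \<noteq> 0"
      "\<forall>j'\<in>J. (\<Sum>i\<in>I-{p}. c i * N i j') = 0"
      using insert.IH[of "I - {p}" N] insert.prems by auto
    define cp where "cp = - (\<Sum>i\<in>I-{p}. c i * M i j * inverse (M p j))"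
    define e where "e = c(p := cp)"
    have cpF: "cp \<in> F" unfolding cp_def
      using c insert.prems p by (auto intro!: uminus_mem sum_mem mult_mem inverse_mem)
    have split: "(\<Sum>i\<in>I. e i * M i j') = cp * M p j' + (\<Sum>i\<in>I-{p}. c i * M i j')" for j'
      using insert.prems(1) p by (simp add: sum.remove[of I p] e_def)
    have "(\<Sum>i\<in>I. e i * M i j) = 0"
      unfolding split cp_def using p
      by (simp add: sum_distrib_right mult.assoc)
    moreover have "(\<Sum>i\<in>I. e i * M i j') = 0" if "j' \<in> J" for j'
    proof -
      have "cp * M p j' = - (\<Sum>i\<in>I-{p}. c i * (M i j * inverse (M p j) * M p j'))"
        unfolding cp_def by (simp add: sum_distrib_right mult.assoc)
      then have "(\<Sum>i\<in>I. e i * M i j') = (\<Sum>i\<in>I-{p}. c i * N i j')"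
        unfolding split N_def by (simp add: right_diff_distrib sum_subtractf)
      then show ?thesis using c that by simp
    qed
    moreover have "\<forall>i\<in>I. e i \<in> F" using c cpF by (auto simp: e_def)
    moreover have "\<exists>i\<in>I. e i \<noteq> 0" using c by (auto simp: e_def)
    ultimately show ?thesis by (intro exI[of _ e]) auto
  qed
qed

lemma dependent_family:
  assumes "finite X" "finite I" "card X < card I" "\<And>i. i \<in> I \<Longrightarrow> v i \<in> rspan F X"
  shows "\<exists>c. (\<forall>i\<in>I. c i \<in> F) \<and> (\<exists>i\<in>I. c i \<noteq> 0) \<and> (\<Sum>i\<in>I. v i * c i) = 0"
proof -
  have "\<exists>m. \<forall>i\<in>I. v i = (\<Sum>x\<in>X. x * m i x) \<and> (\<forall>x\<in>X. m i x \<in> F)"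
  proof (rule bchoice, rule ballI)
    fix i assume "i \<in> I"
    from assms(4)[OF this] rspan_finite[OF assms(1)]
    show "\<exists>m. v i = (\<Sum>x\<in>X. x * m x) \<and> (\<forall>x\<in>X. m x \<in> F)" by auto
  qed
  then obtain m where m: "\<And>i. i \<in> I \<Longrightarrow> v i = (\<Sum>x\<in>X. x * m i x)"
    "\<And>i x. i \<in> I \<Longrightarrow> x \<in> X \<Longrightarrow> m i x \<in> F" by blast
  from homogeneous_system_right[OF assms(1,2,3), of m] m(2) obtain c where
    c: "\<forall>i\<in>I. c i \<in> F" "\<exists>i\<in>I. c i \<noteq> 0" "\<And>x. x \<in> X \<Longrightarrow> (\<Sum>i\<in>I. m i x * c i) = 0" by blast
  have "(\<Sum>i\<in>I. v i * c i) = (\<Sum>i\<in>I. \<Sum>x\<in>X. x * (m i x * c i))"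
    by (simp add: m(1) sum_distrib_right mult.assoc)
  also have "\<dots> = (\<Sum>x\<in>X. x * (\<Sum>i\<in>I. m i x * c i))"
    by (subst sum.swap) (simp add: sum_distrib_left)
  also have "\<dots> = 0" by (simp add: c(3))
  finally show ?thesis using c by blast
qed

lemma rindepD: "rindep F B \<Longrightarrow> \<forall>b\<in>B. c b \<in> F \<Longrightarrow> (\<Sum>b\<in>B. b * c b) = 0 \<Longrightarrow> \<forall>b\<in>B. c b = 0"
  by (auto simp: rindep_def)

lemma rindep_finite: "rindep F B \<Longrightarrow> finite B"
  by (simp add: rindep_def)

lemma rindep_empty: "rindep F {}"
  by (simp add: rindep_def)

lemma rindep_card_le:
  assumes "rindep F B" "finite X" "B \<subseteq> rspan F X"
  shows "card B \<le> card X"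
proof (rule ccontr)
  assume "\<not> card B \<le> card X"
  then have "card X < card B" by simp
  then have "\<exists>c. (\<forall>b\<in>B. c b \<in> F) \<and> (\<exists>b\<in>B. c b \<noteq> 0) \<and> (\<Sum>b\<in>B. b * c b) = 0"
    using assms by (intro dependent_family[of X]) (auto simp: rindep_def)
  with assms(1) show False by (auto simp: rindep_def)
qed

lemma rindep_family:
  assumes "finite I" "\<And>c. (\<And>i. i \<in> I \<Longrightarrow> c i \<in> F) \<Longrightarrow> (\<Sum>i\<in>I. v i * c i) = 0 \<Longrightarrow> \<forall>i\<in>I. c i = 0"
  shows "inj_on v I" "rindep F (v ` I)"
proof -
  show inj: "inj_on v I"
  proof (rule inj_onI, rule ccontr)
    fix i j assume ij: "i \<in> I" "j \<in> I" "v i = v j" "i \<noteq> j"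
    define c :: "_ \<Rightarrow> 'd" where "c = (\<lambda>l. if l = i then 1 else if l = j then -1 else 0)"
    have "(\<Sum>l\<in>I. v l * c l) = (\<Sum>l\<in>{i,j}. v l * c l)"
      by (rule sum.mono_neutral_right) (use ij assms(1) in \<open>auto simp: c_def\<close>)
    also have "\<dots> = 0" using ij by (simp add: c_def)
    finally have "\<forall>l\<in>I. c l = 0"
      by (intro assms(2)) (auto simp: c_def one_mem zero_mem uminus_mem)
    then show False using ij by (auto simp: c_def)
  qed
  show "rindep F (v ` I)" unfolding rindep_def
  proof (intro conjI allI impI)
    show "finite (v ` I)" using assms(1) by simp
    fix c assume "\<forall>b\<in>v ` I. c b \<in> F" "(\<Sum>b\<in>v ` I. b * c b) = 0"
    then have "(\<Sum>i\<in>I. v i * c (v i)) = 0" "\<And>i. i \<in> I \<Longrightarrow> c (v i) \<in> F"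
      by (simp_all add: sum.reindex[OF inj])
    with assms(2)[of "\<lambda>i. c (v i)"] show "\<forall>b\<in>v ` I. c b = 0" by blast
  qed
qed

lemma rindep_insert:
  assumes "rindep F B" "v \<notin> rspan F B"
  shows "rindep F (insert v B)"
proof -
  have fin: "finite B" and vB: "v \<notin> B" using assms rspan_superset by (auto simp: rindep_def)
  show ?thesis unfolding rindep_def
  proof (intro conjI allI impI)
    show "finite (insert v B)" using fin by simp
    fix c assume c: "\<forall>b\<in>insert v B. c b \<in> F" "(\<Sum>b\<in>insert v B. b * c b) = 0"
    then have eq: "v * c v + (\<Sum>b\<in>B. b * c b) = 0" using fin vB by simp
    have S: "(\<Sum>b\<in>B. b * c b) \<in> rspan F B"
      using c rspan_finite[OF fin] by auto
    have "c v = 0"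
    proof (rule ccontr)
      assume "c v \<noteq> 0"
      then have "v = v * c v * inverse (c v)" by (simp add: mult.assoc)
      also have "v * c v = - (\<Sum>b\<in>B. b * c b)" using eq by (simp add: eq_neg_iff_add_eq_0)
      finally have "v \<in> rspan F B"
        using S c by (metis insertI1 inverse_mem rsubspace_rspan rsubspace_scale rsubspace_uminus)
      with assms show False by simp
    qed
    moreover from this eq have "(\<Sum>b\<in>B. b * c b) = 0" by simp
    then have "\<forall>b\<in>B. c b = 0" by (rule rindepD[OF assms(1), rotated]) (use c in auto)
    ultimately show "\<forall>b\<in>insert v B. c b = 0" by auto
  qed
qed

lemma rindep_subset: 
  assumes "rindep F B" "C \<subseteq> B" shows "rindep F C"
  unfolding rindep_def
proof (intro conjI allI impI)
  show "finite C" using assms finite_subset rindep_finite by blast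
  fix c assume c: "\<forall>b\<in>C. c b \<in> F" "(\<Sum>b\<in>C. b * c b) = 0"
  have "(\<Sum>b\<in>B. b * (if b \<in> C then c b else 0)) = (\<Sum>b\<in>C. b * c b)"
    by (rule sum.mono_neutral_cong_right) (use assms rindep_finite in auto)
  then have "\<forall>b\<in>B. (if b \<in> C then c b else 0) = 0"
    by (intro rindepD[OF assms(1)]) (use c zero_mem in auto)
  then show "\<forall>b\<in>C. c b = 0" using assms(2) by (metis subsetD)
qed

lemma rindep_card_bounded:
  assumes "rfin F U" shows "\<exists>N. \<forall>B. B \<subseteq> U \<longrightarrow> rindep F B \<longrightarrow> card B \<le> N"
  using assms rindep_card_le unfolding rfin_def by (meson order_trans)

lemma finite_rdim_set:
  assumes "rfin F U" shows "finite {card B | B. B \<subseteq> U \<and> rindep F B}"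
proof -
  from rindep_card_bounded[OF assms] obtain N where "\<forall>B. B \<subseteq> U \<longrightarrow> rindep F B \<longrightarrow> card B \<le> N" by blast
  then have "{card B | B. B \<subseteq> U \<and> rindep F B} \<subseteq> {..N}" by auto
  then show ?thesis using finite_subset by blast
qed

lemma rindep_card_le_rdim:
  assumes "rfin F U" "B \<subseteq> U" "rindep F B" shows "card B \<le> rdim F U"
  unfolding rdim_def by (rule Max_ge[OF finite_rdim_set]) (use assms in auto)

lemma rindep_extend_basis:
  assumes "rfin F U" "C \<subseteq> U" "rindep F C"
  obtains B where "C \<subseteq> B" "B \<subseteq> U" "rindep F B" "U \<subseteq> rspan F B"
proof -
  from rindep_card_bounded[OF assms(1)] obtain N where N: "\<forall>B. B \<subseteq> U \<longrightarrow> rindep F B \<longrightarrow> card B \<le> N" by blast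
  define P where "P = (\<lambda>B. C \<subseteq> B \<and> B \<subseteq> U \<and> rindep F B)"
  have "\<exists>B. P B \<and> (\<forall>B'. P B' \<longrightarrow> card B' \<le> card B)"
    by (rule ex_has_greatest_nat[of P C card "Suc N"]) (use assms N in \<open>auto simp: P_def less_Suc_eq_le\<close>)
  then obtain B where B: "P B" "\<And>B'. P B' \<Longrightarrow> card B' \<le> card B" by blast
  have "U \<subseteq> rspan F B"
  proof
    fix v assume v: "v \<in> U"
    show "v \<in> rspan F B"
    proof (rule ccontr)
      assume nv: "v \<notin> rspan F B"
      then have "P (insert v B)" using B(1) v rindep_insert[of B v] by (auto simp: P_def)
      moreover have "v \<notin> B" using nv rspan_base by blast
      ultimately show False using B(2)[of "insert v B"] B(1) rindep_finite[of B] by (auto simp: P_def)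
    qed
  qed
  with B(1) that show ?thesis by (auto simp: P_def)
qed

lemma rdim_eq_card:
  assumes "B \<subseteq> U" "rindep F B" "U \<subseteq> rspan F B" shows "rdim F U = card B"
proof -
  have fin: "rfin F U" using assms rindep_finite by (auto simp: rfin_def)
  show ?thesis unfolding rdim_def
  proof (rule Max_eqI[OF finite_rdim_set[OF fin]])
    fix n assume "n \<in> {card B | B. B \<subseteq> U \<and> rindep F B}"
    then show "n \<le> card B" using rindep_card_le[of _ B] assms rindep_finite by auto
  qed (use assms in auto)
qed

lemma rbasis:
  assumes "rfin F U" "rsubspace F U"
  obtains B where "B \<subseteq> U" "rindep F B" "U = rspan F B" "card B = rdim F U"
proof -
  from rindep_extend_basis[OF assms(1) _ rindep_empty] obtain B where
    B: "B \<subseteq> U" "rindep F B" "U \<subseteq> rspan F B" by auto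
  with rspan_minimal[OF assms(2)] have "U = rspan F B" by blast
  with that B rdim_eq_card[of B U] show ?thesis by metis
qed

lemma rfin_subset: "rfin F W \<Longrightarrow> U \<subseteq> W \<Longrightarrow> rfin F U"
  by (auto simp: rfin_def)

lemma rfin_rspan: "finite X \<Longrightarrow> rfin F (rspan F X)"
  by (auto simp: rfin_def)

lemma rdim_mono: "rfin F W \<Longrightarrow> U \<subseteq> W \<Longrightarrow> rdim F U \<le> rdim F W"
proof -
  assume a: "rfin F W" "U \<subseteq> W"
  from rindep_extend_basis[OF rfin_subset[OF a] _ rindep_empty] obtain B where
    B: "B \<subseteq> U" "rindep F B" "U \<subseteq> rspan F B" by auto
  with rdim_eq_card[OF B] rindep_card_le_rdim[OF a(1), of B] a show ?thesis by auto
qed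

lemma rdim_le_card: "finite X \<Longrightarrow> U \<subseteq> rspan F X \<Longrightarrow> rdim F U \<le> card X"
proof -
  assume a: "finite X" "U \<subseteq> rspan F X"
  then have "rfin F U" by (auto simp: rfin_def)
  from rindep_extend_basis[OF this _ rindep_empty] obtain B where
    B: "B \<subseteq> U" "rindep F B" "U \<subseteq> rspan F B" by auto
  with rdim_eq_card[OF B] rindep_card_le[of B X] a show ?thesis by auto
qed

lemma rdim_eq_imp_eq:
  assumes "rfin F W" "rsubspace F U" "U \<subseteq> W" "rdim F W \<le> rdim F U"
  shows "U = W"
proof -
  from rbasis[OF rfin_subset[OF assms(1,3)] assms(2)] obtain B where
    B: "B \<subseteq> U" "rindep F B" "U = rspan F B" "card B = rdim F U" .
  have "W \<subseteq> rspan F B"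
  proof
    fix v assume v: "v \<in> W"
    show "v \<in> rspan F B"
    proof (rule ccontr)
      assume "v \<notin> rspan F B"
      then have "rindep F (insert v B)" "v \<notin> B" using rindep_insert[OF B(2)] rspan_base by auto
      then show False
        using rindep_card_le_rdim[OF assms(1), of "insert v B"] v B assms rindep_finite[OF B(2)] by auto
    qed
  qed
  with B assms show ?thesis by auto
qed

lemma rdim_pos:
  assumes "rfin F U" "u \<in> U" "u \<noteq> 0" shows "1 \<le> rdim F U"
  using rindep_card_le_rdim[OF assms(1), of "{u}"] assms by (auto simp: rindep_def)

lemma rdim_zero_imp: "rfin F U \<Longrightarrow> rdim F U = 0 \<Longrightarrow> U \<subseteq> {0}"
  using rdim_pos by fastforce

lemma rdim_zero [simp]: "rdim F {0} = 0" "rdim F {} = 0"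
  using rdim_le_card[of "{}" "{0}"] rdim_le_card[of "{}" "{}"] rsubspace_0[OF rsubspace_rspan, of F "{}"] by auto

lemma rank_nullity:
  assumes "rfin F U" "rsubspace F U"
    and add: "\<And>u v. u \<in> U \<Longrightarrow> v \<in> U \<Longrightarrow> f (u + v) = f u + f v"
    and scale: "\<And>u c. u \<in> U \<Longrightarrow> c \<in> F \<Longrightarrow> f (u * c) = f u * c"
  shows "rdim F U = rdim F {u\<in>U. f u = 0} + rdim F (f ` U)" and "rfin F (f ` U)" and "rsubspace F (f ` U)"
proof -
  have f0: "f 0 = 0" using add[of 0 0] rsubspace_0[OF assms(2)] by simp
  have fsum: "f (\<Sum>i\<in>I. g i * c i) = (\<Sum>i\<in>I. f (g i) * c i)"
    if "\<And>i. i \<in> I \<Longrightarrow> g i \<in> U" "\<And>i. i \<in> I \<Longrightarrow> c i \<in> F" for I :: "'d set" and g c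
    using that
  proof (induction I rule: infinite_finite_induct)
    case (insert i I)
    have "(\<Sum>i\<in>I. g i * c i) \<in> U"
      by (intro rsubspace_sum[OF assms(2)] rsubspace_scale[OF assms(2)]) (use insert in auto)
    then show ?case using insert add scale rsubspace_scale[OF assms(2)] by simp
  qed (simp_all add: f0)
  define N where "N = {u\<in>U. f u = 0}"
  have N: "rsubspace F N" using assms(2) f0 by (auto simp: rsubspace_def N_def add scale)
  have NU: "N \<subseteq> U" by (auto simp: N_def)
  from rbasis[OF rfin_subset[OF assms(1) NU] N] obtain C where
    C: "C \<subseteq> N" "rindep F C" "N = rspan F C" "card C = rdim F N" .
  from rindep_extend_basis[OF assms(1) _ C(2)] C(1) NU obtain B where
    B: "C \<subseteq> B" "B \<subseteq> U" "rindep F B" "U \<subseteq> rspan F B" by blast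
  note finB = rindep_finite[OF B(3)]
  have ind: "\<forall>b\<in>B-C. c b = 0" if c: "\<And>b. b \<in> B - C \<Longrightarrow> c b \<in> F" "(\<Sum>b\<in>B-C. f b * c b) = 0" for c
  proof -
    have "f (\<Sum>b\<in>B-C. b * c b) = 0" using fsum[of "B - C" "\<lambda>b. b" c] c B by auto
    moreover have "(\<Sum>b\<in>B-C. b * c b) \<in> U"
      by (intro rsubspace_sum[OF assms(2)] rsubspace_scale[OF assms(2)]) (use c B(2) in auto)
    ultimately have "(\<Sum>b\<in>B-C. b * c b) \<in> N" by (simp add: N_def)
    then obtain d where d: "(\<Sum>b\<in>B-C. b * c b) = (\<Sum>b\<in>C. b * d b)" "\<forall>b\<in>C. d b \<in> F"
      using C(3) rspan_finite[of C] rindep_finite[OF C(2)] by auto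
    define e where "e = (\<lambda>b. if b \<in> C then - d b else c b)"
    have "(\<Sum>b\<in>B. b * e b) = (\<Sum>b\<in>B-C. b * e b) + (\<Sum>b\<in>C. b * e b)"
      by (rule sum.subset_diff) (use B finB in auto)
    also have "\<dots> = 0" using d(1) by (simp add: e_def sum_negf)
    finally have "\<forall>b\<in>B. e b = 0"
      by (intro rindepD[OF B(3)]) (use c d in \<open>auto simp: e_def uminus_mem\<close>)
    then show ?thesis by (auto simp: e_def)
  qed
  from rindep_family[of "B - C" f] ind finB have fi: "inj_on f (B - C)" "rindep F (f ` (B - C))" by auto
  have sub: "f ` U \<subseteq> rspan F (f ` (B - C))"
  proof clarify
    fix u assume "u \<in> U"
    then obtain c where c: "u = (\<Sum>b\<in>B. b * c b)" "\<forall>b\<in>B. c b \<in> F" using B(4) rspan_finite[OF finB] by auto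
    have "f u = (\<Sum>b\<in>B. f b * c b)" using fsum[of B "\<lambda>b. b" c] c B by auto
    also have "\<dots> = (\<Sum>b\<in>B-C. f b * c b)"
      by (rule sum.mono_neutral_right) (use finB C(1) in \<open>auto simp: N_def\<close>)
    also have "\<dots> \<in> rspan F (f ` (B - C))" using c finB by (subst rspan_family) auto
    finally show "f u \<in> rspan F (f ` (B - C))" .
  qed
  have "rdim F (f ` U) = card (f ` (B - C))"
    by (rule rdim_eq_card[OF _ fi(2) sub]) (use B in auto)
  also have "\<dots> = card B - card C" using card_image[OF fi(1)] B finB by (simp add: card_Diff_subset finite_subset)
  finally have "rdim F (f ` U) = rdim F U - rdim F N" using rdim_eq_card[OF B(2,3,4)] C by simp
  moreover have "rdim F N \<le> rdim F U" using rdim_mono[OF assms(1) NU] .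
  ultimately show "rdim F U = rdim F {u\<in>U. f u = 0} + rdim F (f ` U)" by (simp add: N_def)
  show "rfin F (f ` U)" unfolding rfin_def
    by (rule exI[of _ "f ` (B - C)"], intro conjI finite_imageI finite_Diff finB sub)
  show "rsubspace F (f ` U)"
  proof (rule rsubspaceI)
    show "0 \<in> f ` U" using f0 rsubspace_0[OF assms(2)] by (metis imageI)
    fix a b assume "a \<in> f ` U" "b \<in> f ` U"
    then obtain u v where "a = f u" "b = f v" "u \<in> U" "v \<in> U" by blast
    with add[of u v] rsubspace_add[OF assms(2), of u v] show "a + b \<in> f ` U" by (metis imageI)
  next
    fix a c assume "a \<in> f ` U" "c \<in> F"
    then obtain u where "a = f u" "u \<in> U" by blast
    with scale[of u c] rsubspace_scale[OF assms(2), of u c] \<open>c \<in> F\<close> show "a * c \<in> f ` U" by (metis imageI)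
  qed
qed

lemma rdim_image_inj:
  assumes "rfin F U" "rsubspace F U"
    and "\<And>u v. u \<in> U \<Longrightarrow> v \<in> U \<Longrightarrow> f (u + v) = f u + f v"
    and "\<And>u c. u \<in> U \<Longrightarrow> c \<in> F \<Longrightarrow> f (u * c) = f u * c"
    and "\<And>u. u \<in> U \<Longrightarrow> f u = 0 \<Longrightarrow> u = 0"
  shows "rdim F (f ` U) = rdim F U" "rfin F (f ` U)" "rsubspace F (f ` U)"
proof -
  have "f 0 = 0" using assms(3)[of 0 0] rsubspace_0[OF assms(2)] by simp
  then have "{u\<in>U. f u = 0} = {0}" using assms(5) rsubspace_0[OF assms(2)] by auto
  with rank_nullity[OF assms(1-4)]
  show "rdim F (f ` U) = rdim F U" "rfin F (f ` U)" "rsubspace F (f ` U)" by auto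
qed

definition ssum :: "'d set \<Rightarrow> 'd set \<Rightarrow> 'd set" where
  "ssum U W = {u + w | u w. u \<in> U \<and> w \<in> W}"

lemma rsubspace_ssum: 
  assumes "rsubspace F U" "rsubspace F W" shows "rsubspace F (ssum U W)"
proof (rule rsubspaceI)
  show "0 \<in> ssum U W" using assms rsubspace_0 by (force simp: ssum_def)
  fix u v assume "u \<in> ssum U W" "v \<in> ssum U W"
  then obtain a b c d where "u = a + b" "v = c + d" "a \<in> U" "c \<in> U" "b \<in> W" "d \<in> W" by (auto simp: ssum_def)
  then have "u + v = (a + c) + (b + d)" "a + c \<in> U" "b + d \<in> W"
    using assms by (auto intro: rsubspace_add)
  then show "u + v \<in> ssum U W" unfolding ssum_def by blast
next
  fix u e assume "u \<in> ssum U W" "e \<in> F"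
  then show "u * e \<in> ssum U W" using assms rsubspace_scale by (fastforce simp: ssum_def distrib_right)
qed

lemma ssum_superset: "rsubspace F U \<Longrightarrow> rsubspace F W \<Longrightarrow> U \<subseteq> ssum U W \<and> W \<subseteq> ssum U W"
  using rsubspace_0[of F U] rsubspace_0[of F W] by (force simp: ssum_def)

lemma ssum_subset: "rsubspace F X \<Longrightarrow> U \<subseteq> X \<Longrightarrow> W \<subseteq> X \<Longrightarrow> ssum U W \<subseteq> X"
  by (auto simp: ssum_def intro: rsubspace_add)

lemma rfin_ssum:
  assumes "rfin F U" "rfin F W" shows "rfin F (ssum U W)"
proof -
  from assms obtain X Y where "finite X" "U \<subseteq> rspan F X" "finite Y" "W \<subseteq> rspan F Y" by (auto simp: rfin_def)
  then have "ssum U W \<subseteq> rspan F (X \<union> Y)"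
    using rspan_mono[of X "X \<union> Y" F] rspan_mono[of Y "X \<union> Y" F] ssum_subset[OF rsubspace_rspan] by blast
  then show ?thesis using \<open>finite X\<close> \<open>finite Y\<close> by (auto simp: rfin_def)
qed

lemma rdim_ssum:
  assumes "rfin F U" "rfin F W" "rsubspace F U" "rsubspace F W"
  shows "rdim F (ssum U W) + rdim F (U \<inter> W) = rdim F U + rdim F W"
proof -
  from rbasis[OF rfin_subset[OF assms(1), of "U \<inter> W"] rsubspace_Int[OF assms(3,4)]] obtain C where
    C: "C \<subseteq> U \<inter> W" "rindep F C" "U \<inter> W = rspan F C" "card C = rdim F (U \<inter> W)" by auto
  from rindep_extend_basis[OF assms(1) _ C(2)] C(1) obtain B where
    B: "C \<subseteq> B" "B \<subseteq> U" "rindep F B" "U \<subseteq> rspan F B" by blast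
  from rbasis[OF assms(2,4)] obtain D where
    D: "D \<subseteq> W" "rindep F D" "W = rspan F D" "card D = rdim F W" .
  note finB = rindep_finite[OF B(3)] and finD = rindep_finite[OF D(2)]
  note sub = ssum_superset[OF assms(3,4)]
  have key: "(\<forall>b\<in>B-C. c b = 0) \<and> (\<forall>b\<in>D. d b = 0)"
    if c: "\<And>b. b \<in> B - C \<Longrightarrow> c b \<in> F" "\<And>b. b \<in> D \<Longrightarrow> d b \<in> F"
      "(\<Sum>b\<in>B-C. b * c b) + (\<Sum>b\<in>D. b * d b) = 0" for c d
  proof -
    have "(\<Sum>b\<in>B-C. b * c b) = - (\<Sum>b\<in>D. b * d b)" using c(3) by (simp add: eq_neg_iff_add_eq_0)
    moreover have "- (\<Sum>b\<in>D. b * d b) \<in> W"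
      by (intro rsubspace_uminus[OF assms(4)] rsubspace_sum[OF assms(4)] rsubspace_scale[OF assms(4)])
        (use c D in auto)
    moreover have "(\<Sum>b\<in>B-C. b * c b) \<in> U"
      by (intro rsubspace_sum[OF assms(3)] rsubspace_scale[OF assms(3)]) (use c B in auto)
    ultimately have "(\<Sum>b\<in>B-C. b * c b) \<in> rspan F C" using C(3) by auto
    then obtain e where e: "(\<Sum>b\<in>B-C. b * c b) = (\<Sum>b\<in>C. b * e b)" "\<forall>b\<in>C. e b \<in> F"
      using rspan_finite[of C] rindep_finite[OF C(2)] by auto
    define g where "g = (\<lambda>b. if b \<in> C then - e b else c b)"
    have "(\<Sum>b\<in>B. b * g b) = (\<Sum>b\<in>B-C. b * g b) + (\<Sum>b\<in>C. b * g b)"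
      by (rule sum.subset_diff) (use B finB in auto)
    also have "\<dots> = 0" using e(1) by (simp add: g_def sum_negf)
    finally have "\<forall>b\<in>B. g b = 0"
      by (intro rindepD[OF B(3)]) (use c e in \<open>auto simp: g_def uminus_mem\<close>)
    then have 1: "\<forall>b\<in>B-C. c b = 0" by (auto simp: g_def)
    then have "(\<Sum>b\<in>D. b * d b) = 0" using c(3) by simp
    then have "\<forall>b\<in>D. d b = 0" by (intro rindepD[OF D(2)]) (use c in auto)
    with 1 show ?thesis by auto
  qed
  have disj: "(B - C) \<inter> D = {}"
  proof -
    have "B - C \<inter> D = {}" if "b \<in> B - C" "b \<in> D" for b
    proof -
      have "b \<in> U \<inter> W" using that B D by auto
      then have "b \<in> rspan F C" using C by simp
      moreover have "b \<notin> rspan F C"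
      proof
        assume "b \<in> rspan F C"
        moreover have "finite C" "C \<subseteq> B - {b}" using that B C rindep_finite by auto
        ultimately have "b \<in> rspan F (B - {b})" using rspan_mono by blast
        then obtain c where c: "b = (\<Sum>a\<in>B-{b}. a * c a)" "\<forall>a\<in>B-{b}. c a \<in> F" using rspan_finite finB by auto
        have "(\<Sum>a\<in>B. a * (c(b := -1)) a) = b * (-1) + (\<Sum>a\<in>B-{b}. a * c a)"
          using that finB by (simp add: sum.remove[of B b])
        also have "\<dots> = 0" using c(1) by simp
        finally have "\<forall>a\<in>B. (c(b := -1)) a = 0"
          by (intro rindepD[OF B(3)]) (use c in \<open>auto simp: one_mem uminus_mem\<close>)
        with that have "(-1 :: 'd) = 0" by force
        then show False by simp
      qed
      ultimately show ?thesis by simp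
    qed
    then show ?thesis by blast
  qed
  have "rindep F ((B - C) \<union> D)" unfolding rindep_def
  proof (intro conjI allI impI)
    fix c assume c: "\<forall>b\<in>B - C \<union> D. c b \<in> F" "(\<Sum>b\<in>B - C \<union> D. b * c b) = 0"
    then have "(\<Sum>b\<in>B-C. b * c b) + (\<Sum>b\<in>D. b * c b) = 0"
      using sum.union_disjoint[OF _ _ disj, of "\<lambda>b. b * c b"] finB finD by simp
    with key[of c c] c show "\<forall>b\<in>B - C \<union> D. c b = 0" by auto
  qed (use finB finD in auto)
  moreover have "(B - C) \<union> D \<subseteq> ssum U W" using B D sub by blast
  moreover have "ssum U W \<subseteq> rspan F ((B - C) \<union> D)"
  proof (rule ssum_subset[OF rsubspace_rspan])
    show "W \<subseteq> rspan F ((B - C) \<union> D)" using D(3) rspan_mono[of D "(B-C) \<union> D" F] by auto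
    moreover have "C \<subseteq> W" using C by auto
    ultimately have "B \<subseteq> rspan F ((B - C) \<union> D)" using rspan_superset[of "(B - C) \<union> D" F] by blast
    then show "U \<subseteq> rspan F ((B - C) \<union> D)" using B(4) rspan_minimal[OF rsubspace_rspan] by blast
  qed
  ultimately have "rdim F (ssum U W) = card ((B - C) \<union> D)" using rdim_eq_card by blast
  also have "\<dots> = card B - card C + card D"
    using card_Un_disjoint[OF _ _ disj] finB finD B rindep_finite[OF C(2)] by (simp add: card_Diff_subset)
  finally show ?thesis using C D rdim_eq_card[OF B(2,3,4)] card_mono[OF finB B(1)] by simp
qed

end

section \<open>Polynomials and fractions over a division subring\<close>

definition centralizer :: "'d::division_ring set \<Rightarrow> 'd set" where
  "centralizer S = {d. \<forall>s\<in>S. d * s = s * d}"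

lemma division_subring_centralizer: "division_subring (centralizer S)"
proof
  fix a b assume a: "a \<in> centralizer S" and b: "b \<in> centralizer S"
  show "a - b \<in> centralizer S" using a b by (auto simp: centralizer_def left_diff_distrib right_diff_distrib)
  show "a * b \<in> centralizer S" using a b by (auto simp: centralizer_def mult.assoc) (simp add: mult.assoc[symmetric])
next
  fix a assume a: "a \<in> centralizer S"
  show "inverse a \<in> centralizer S"
  proof (cases "a = 0")
    case False
    have "inverse a * s = s * inverse a" if "s \<in> S" for s
    proof -
      have "inverse a * s = inverse a * (s * a) * inverse a" using False by (simp add: mult.assoc)
      also have "s * a = a * s" using a that by (auto simp: centralizer_def)
      also have "inverse a * (a * s) = s" using False by (simp add: mult.assoc[symmetric])
      finally show ?thesis .
    qed
    then show ?thesis by (auto simp: centralizer_def)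
  qed (auto simp: centralizer_def)
qed (auto simp: centralizer_def)

lemma division_subring_Int: "division_subring F \<Longrightarrow> division_subring G \<Longrightarrow> division_subring (F \<inter> G)"
  by (auto simp: division_subring_def)

lemma division_subring_UNIV: "division_subring UNIV"
  by (auto simp: division_subring_def)

definition polyb :: "'d::division_ring set \<Rightarrow> 'd \<Rightarrow> nat \<Rightarrow> 'd set" where
  "polyb F l n = rspan F ((\<lambda>i. l ^ i) ` {..<n})"

definition polys :: "'d::division_ring set \<Rightarrow> 'd \<Rightarrow> 'd set" where
  "polys F l = (\<Union>n. polyb F l n)"

text \<open>Right fractions \<open>p q\<^sup>-\<^sup>1\<close>; the right Ore condition makes them a division ring.\<close>

definition fracs :: "'d::division_ring set \<Rightarrow> 'd \<Rightarrow> 'd set" where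
  "fracs F l = {d. \<exists>q\<in>polys F l. q \<noteq> 0 \<and> d * q \<in> polys F l}"

text \<open>Algebraic independence with coefficients on the right; \<open>left_transc\<close> is the mirror image, and the
  two differ when \<open>l\<close> does not commute with \<open>F\<close>.\<close>

definition transc :: "'d::division_ring set \<Rightarrow> 'd \<Rightarrow> bool" where
  "transc F l \<longleftrightarrow> (\<forall>n c. (\<forall>i<n. c i \<in> F) \<longrightarrow> (\<Sum>i<n. l ^ i * c i) = 0 \<longrightarrow> (\<forall>i<n. c i = 0))"

lemma transcD: "transc F l \<Longrightarrow> (\<And>i. i < n \<Longrightarrow> c i \<in> F) \<Longrightarrow> (\<Sum>i<n. l ^ i * c i) = 0 \<Longrightarrow> i < n \<Longrightarrow> c i = 0"
  unfolding transc_def by blast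

lemma transc_mono: "transc F l \<Longrightarrow> G \<subseteq> F \<Longrightarrow> transc G l"
  unfolding transc_def by blast

lemma polyb_subset_polys: "polyb F l n \<subseteq> polys F l"
  by (auto simp: polys_def)

lemma polyb_mono: "m \<le> n \<Longrightarrow> polyb F l m \<subseteq> polyb F l n"
  unfolding polyb_def by (rule rspan_mono) auto

lemma rsubspace_polyb: "rsubspace F (polyb F l n)"
  by (simp add: polyb_def rsubspace_rspan)

lemma polys_cases:
  assumes "p \<in> polys F l" obtains n where "p \<in> polyb F l n"
  using assms by (auto simp: polys_def)

lemma polys_common:
  assumes "p \<in> polys F l" "q \<in> polys F l"
  obtains n where "p \<in> polyb F l n" "q \<in> polyb F l n"
proof -
  from assms obtain m k where "p \<in> polyb F l m" "q \<in> polyb F l k" by (auto simp: polys_def)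
  moreover have "polyb F l m \<subseteq> polyb F l (max m k)" "polyb F l k \<subseteq> polyb F l (max m k)"
    by (simp_all add: polyb_mono)
  ultimately show ?thesis using that by blast
qed

lemma rsubspace_polys: "rsubspace F (polys F l)"
proof (rule rsubspaceI)
  show "0 \<in> polys F l" using rsubspace_0[OF rsubspace_polyb[of F l 0]] polyb_subset_polys[of F l 0] by blast
  fix u v assume "u \<in> polys F l" "v \<in> polys F l"
  then obtain n where "u \<in> polyb F l n" "v \<in> polyb F l n" by (rule polys_common)
  then show "u + v \<in> polys F l"
    using rsubspace_add[OF rsubspace_polyb, of u F l n v] polyb_subset_polys[of F l n] by blast
next
  fix u c assume "u \<in> polys F l" "c \<in> F"
  from this(1) obtain n where "u \<in> polyb F l n" by (rule polys_cases)
  with \<open>c \<in> F\<close> show "u * c \<in> polys F l"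
    using rsubspace_scale[OF rsubspace_polyb, of u F l n c] polyb_subset_polys[of F l n] by blast
qed

context division_subring
begin

lemma polyb_iff: "p \<in> polyb F l n \<longleftrightarrow> (\<exists>c. (\<forall>i. c i \<in> F) \<and> p = (\<Sum>i<n. l ^ i * c i))"
proof
  assume "p \<in> polyb F l n"
  then obtain c where c: "p = (\<Sum>i<n. l ^ i * c i)" "\<forall>i\<in>{..<n}. c i \<in> F"
    unfolding polyb_def rspan_family[OF finite_lessThan] by blast
  have "p = (\<Sum>i<n. l ^ i * (if i < n then c i else 0))" unfolding c(1) by (rule sum.cong) auto
  then show "\<exists>c. (\<forall>i. c i \<in> F) \<and> p = (\<Sum>i<n. l ^ i * c i)"
    using c(2) zero_mem by (intro exI[of _ "\<lambda>i. if i < n then c i else 0"]) auto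
next
  assume "\<exists>c. (\<forall>i. c i \<in> F) \<and> p = (\<Sum>i<n. l ^ i * c i)"
  then show "p \<in> polyb F l n" unfolding polyb_def rspan_family[OF finite_lessThan] by blast
qed

lemma polybI: "(\<And>i. i < n \<Longrightarrow> c i \<in> F) \<Longrightarrow> (\<Sum>i<n. l ^ i * c i) \<in> polyb F l n"
  unfolding polyb_def rspan_family[OF finite_lessThan] by blast

lemma power_polyb: "i < n \<Longrightarrow> l ^ i \<in> polyb F l n"
  unfolding polyb_def by (rule rspan_base) auto

lemma monom_polyb: "i < n \<Longrightarrow> c \<in> F \<Longrightarrow> l ^ i * c \<in> polyb F l n"
  using rsubspace_scale[OF rsubspace_polyb power_polyb] .

lemma const_polys: "c \<in> F \<Longrightarrow> c \<in> polys F l"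
  using monom_polyb[of 0 1 c l] polyb_subset_polys by auto

lemma const_polyb1: "p \<in> polyb F l (Suc 0) \<longleftrightarrow> p \<in> F"
  by (auto simp: polyb_iff intro: exI[of _ "\<lambda>_. p"])

lemma var_polys: "l \<in> polys F l"
  using power_polyb[of 1 2 l] polyb_subset_polys by auto

lemma polyb_SucE:
  assumes "p \<in> polyb F l (Suc n)"
  obtains c r where "c \<in> F" "r \<in> polyb F l n" "p = l ^ n * c + r"
proof -
  from assms obtain c where "\<forall>i. c i \<in> F" "p = (\<Sum>i<Suc n. l ^ i * c i)" by (auto simp: polyb_iff)
  then show ?thesis using that[of "c n" "\<Sum>i<n. l ^ i * c i"] polybI[of n c l] by (simp add: add.commute)
qed

lemma polys_lead:
  assumes "p \<in> polys F l" "p \<noteq> 0"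
  obtains n c r where "c \<in> F" "c \<noteq> 0" "r \<in> polyb F l n" "p = l ^ n * c + r"
proof -
  define n where "n = (LEAST n. p \<in> polyb F l n)"
  have ex: "\<exists>n. p \<in> polyb F l n" using assms by (auto simp: polys_def)
  have n: "p \<in> polyb F l n" unfolding n_def by (rule LeastI_ex[OF ex])
  have "n \<noteq> 0"
  proof
    assume "n = 0"
    with n have "p = 0" by (simp add: polyb_iff)
    with assms show False by simp
  qed
  then obtain m where m: "n = Suc m" by (cases n) auto
  with n obtain c r where cr: "c \<in> F" "r \<in> polyb F l m" "p = l ^ m * c + r" by (auto elim: polyb_SucE)
  have "c \<noteq> 0"
  proof
    assume "c = 0"
    then have "p \<in> polyb F l m" using cr by simp
    then have "n \<le> m" unfolding n_def by (rule Least_le)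
    with m show False by simp
  qed
  with cr that show ?thesis by blast
qed

lemma polys_subset:
  assumes "division_subring G" "F \<subseteq> G" "l \<in> G"
  shows "polys F l \<subseteq> G" "fracs F l \<subseteq> G"
proof -
  interpret G: division_subring G by fact
  show P: "polys F l \<subseteq> G"
    unfolding polys_def polyb_def using rsubspace_subfield[OF G.rsubspace_self assms(2)] assms(3)
    by (intro UN_least rspan_minimal) (auto intro: G.power_mem)
  show "fracs F l \<subseteq> G"
  proof
    fix d assume "d \<in> fracs F l"
    then obtain q where q: "q \<in> polys F l" "q \<noteq> 0" "d * q \<in> polys F l" by (auto simp: fracs_def)
    have "d = d * q * inverse q" using q by (simp add: mult.assoc)
    also have "\<dots> \<in> G" using G.mult_mem[of "d * q" "inverse q"] G.inverse_mem[of q] q P by blast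
    finally show "d \<in> G" .
  qed
qed

end

lemma polyb_field_mono: "F \<subseteq> G \<Longrightarrow> polyb F l n \<subseteq> polyb G l n"
  unfolding polyb_def by (rule rspan_field_mono)

lemma polys_field_mono: "F \<subseteq> G \<Longrightarrow> polys F l \<subseteq> polys G l"
  unfolding polys_def by (intro UN_mono subset_refl polyb_field_mono)

lemma fracs_field_mono: "F \<subseteq> G \<Longrightarrow> fracs F l \<subseteq> fracs G l"
  using polys_field_mono[of F G l] by (auto simp: fracs_def)

locale transcendental_ext = division_subring F for F :: "'d::division_ring set" +
  fixes l :: 'd
  assumes comm: "c \<in> F \<Longrightarrow> c * l = l * c"
    and transc: "transc F l"
begin

lemma comm_power: "c \<in> F \<Longrightarrow> c * l ^ i = l ^ i * c"
  using comm by (induction i) (auto simp: mult.assoc[symmetric], simp add: mult.assoc)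

lemma power_mult_polyb: "p \<in> polyb F l n \<Longrightarrow> l ^ i * p \<in> polyb F l (i + n)"
proof -
  assume "p \<in> polyb F l n"
  then obtain c where c: "\<forall>i. c i \<in> F" "p = (\<Sum>i<n. l ^ i * c i)" by (auto simp: polyb_iff)
  have "l ^ i * p = (\<Sum>j<n. l ^ (i + j) * c j)"
    by (simp add: c(2) sum_distrib_left mult.assoc[symmetric] power_add)
  also have "\<dots> \<in> polyb F l (i + n)"
    by (rule rsubspace_sum[OF rsubspace_polyb]) (use c monom_polyb in auto)
  finally show ?thesis .
qed

lemma const_mult_polyb: "c \<in> F \<Longrightarrow> p \<in> polyb F l n \<Longrightarrow> c * p \<in> polyb F l n"
proof -
  assume c: "c \<in> F" "p \<in> polyb F l n"
  then obtain d where d: "\<forall>i. d i \<in> F" "p = (\<Sum>i<n. l ^ i * d i)" by (auto simp: polyb_iff)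
  have "c * p = (\<Sum>i<n. l ^ i * (c * d i))"
    using c by (simp add: d(2) sum_distrib_left comm_power mult.assoc[symmetric])
  also have "\<dots> \<in> polyb F l n" by (rule polybI) (use c d mult_mem in auto)
  finally show ?thesis .
qed

lemma mult_polyb: "p \<in> polyb F l m \<Longrightarrow> q \<in> polyb F l (Suc n) \<Longrightarrow> p * q \<in> polyb F l (m + n)"
proof -
  assume p: "p \<in> polyb F l m" and q: "q \<in> polyb F l (Suc n)"
  from p obtain c where c: "\<forall>i. c i \<in> F" "p = (\<Sum>i<m. l ^ i * c i)" by (auto simp: polyb_iff)
  have "l ^ i * c i * q \<in> polyb F l (m + n)" if "i < m" for i
  proof -
    have "l ^ i * (c i * q) \<in> polyb F l (i + Suc n)"
      using c q by (intro power_mult_polyb const_mult_polyb) auto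
    moreover have "polyb F l (i + Suc n) \<subseteq> polyb F l (m + n)" by (rule polyb_mono) (use that in simp)
    ultimately show ?thesis by (auto simp: mult.assoc)
  qed
  then show ?thesis unfolding c(2) sum_distrib_right by (intro rsubspace_sum[OF rsubspace_polyb]) auto
qed

lemma mult_polys: "p \<in> polys F l \<Longrightarrow> q \<in> polys F l \<Longrightarrow> p * q \<in> polys F l"
proof -
  assume p: "p \<in> polys F l" and q: "q \<in> polys F l"
  from q obtain n where "q \<in> polyb F l n" by (rule polys_cases)
  then have n: "q \<in> polyb F l (Suc n)" using polyb_mono[of n "Suc n"] by auto
  from p obtain m where "p \<in> polyb F l m" by (rule polys_cases)
  from mult_polyb[OF this n] show ?thesis using polyb_subset_polys by blast
qed

lemma add_polys: "p \<in> polys F l \<Longrightarrow> q \<in> polys F l \<Longrightarrow> p + q \<in> polys F l"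
  using rsubspace_add[OF rsubspace_polys] .

lemma diff_polys: "p \<in> polys F l \<Longrightarrow> q \<in> polys F l \<Longrightarrow> p - q \<in> polys F l"
  using rsubspace_diff[OF rsubspace_polys] .

lemma sum_polys: "(\<And>i. i \<in> I \<Longrightarrow> f i \<in> polys F l) \<Longrightarrow> (\<Sum>i\<in>I. f i) \<in> polys F l"
  using rsubspace_sum[OF rsubspace_polys] .

lemma zero_polys: "0 \<in> polys F l"
  using rsubspace_0[OF rsubspace_polys] .

lemma power_polys: "l ^ n \<in> polys F l"
  using power_polyb[of n "Suc n"] polyb_subset_polys by blast

lemma lead_zero: "c \<in> F \<Longrightarrow> r \<in> polyb F l n \<Longrightarrow> l ^ n * c + r = 0 \<Longrightarrow> c = 0"
proof -
  assume c: "c \<in> F" "r \<in> polyb F l n" "l ^ n * c + r = 0"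
  then obtain d where d: "\<forall>i. d i \<in> F" "r = (\<Sum>i<n. l ^ i * d i)" by (auto simp: polyb_iff)
  have "(\<Sum>i<Suc n. l ^ i * (if i = n then c else d i)) = 0"
    using c(3) d(2) by (simp add: add.commute)
  then have "(if n = n then c else d n) = 0"
    by (rule transcD[OF transc, rotated]) (use c d in auto)
  then show ?thesis by simp
qed

lemma lead_polyb: "c \<in> F \<Longrightarrow> r \<in> polyb F l n \<Longrightarrow> l ^ n * c + r \<in> polyb F l n \<Longrightarrow> c = 0"
proof -
  assume c: "c \<in> F" "r \<in> polyb F l n" "l ^ n * c + r \<in> polyb F l n"
  then have "r - (l ^ n * c + r) \<in> polyb F l n" using rsubspace_diff[OF rsubspace_polyb] by blast
  from lead_zero[OF c(1) this] show ?thesis by simp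
qed

lemma lead_mult:
  assumes "c \<in> F" "d \<in> F" "r \<in> polyb F l n" "s \<in> polyb F l m"
  shows "\<exists>t\<in>polyb F l (n + m). (l ^ n * c + r) * (l ^ m * d + s) = l ^ (n + m) * (c * d) + t"
proof -
  define t where "t = l ^ n * (c * s) + r * (l ^ m * d + s)"
  have "s \<in> polyb F l (Suc m)" using polyb_mono[of m "Suc m" F l] assms(4) by auto
  then have "l ^ m * d + s \<in> polyb F l (Suc m)"
    by (intro rsubspace_add[OF rsubspace_polyb] monom_polyb assms(2)) auto
  then have "r * (l ^ m * d + s) \<in> polyb F l (n + m)" by (rule mult_polyb[OF assms(3)])
  moreover have "l ^ n * (c * s) \<in> polyb F l (n + m)"
    by (intro power_mult_polyb const_mult_polyb assms)
  ultimately have "t \<in> polyb F l (n + m)" unfolding t_def by (rule rsubspace_add[OF rsubspace_polyb, rotated])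
  moreover have "l ^ n * c * (l ^ m * d) = l ^ (n + m) * (c * d)"
    using comm_power[OF assms(1)] by (simp add: power_add mult.assoc) (simp add: mult.assoc[symmetric])
  then have "(l ^ n * c + r) * (l ^ m * d + s) = l ^ (n + m) * (c * d) + t"
    by (simp add: t_def distrib_left distrib_right add.assoc mult.assoc)
  ultimately show ?thesis by blast
qed

lemma mult_small_zero:
  assumes "c \<in> F" "c \<noteq> 0" "r \<in> polyb F l n" "g \<in> polys F l" "(l ^ n * c + r) * g \<in> polyb F l n"
  shows "g = 0"
proof (rule ccontr)
  assume "g \<noteq> 0"
  with assms(4) obtain m d s where ds: "d \<in> F" "d \<noteq> 0" "s \<in> polyb F l m" "g = l ^ m * d + s"
    by (rule polys_lead)
  from lead_mult[OF assms(1) ds(1) assms(3) ds(3)] obtain t where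
    t: "t \<in> polyb F l (n + m)" "(l ^ n * c + r) * g = l ^ (n + m) * (c * d) + t" using ds by auto
  then have "l ^ (n + m) * (c * d) + t \<in> polyb F l (n + m)"
    using assms(5) polyb_mono[of n "n + m"] by auto
  from lead_polyb[OF mult_mem[OF assms(1) ds(1)] t(1) this] have "c * d = 0" .
  with assms ds show False by simp
qed

lemma mult_small_zero_right:
  assumes "c \<in> F" "c \<noteq> 0" "r \<in> polyb F l n" "g \<in> polys F l" "g * (l ^ n * c + r) \<in> polyb F l n"
  shows "g = 0"
proof (rule ccontr)
  assume "g \<noteq> 0"
  with assms(4) obtain m d s where ds: "d \<in> F" "d \<noteq> 0" "s \<in> polyb F l m" "g = l ^ m * d + s"
    by (rule polys_lead)
  from lead_mult[OF ds(1) assms(1) ds(3) assms(3)] obtain t where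
    t: "t \<in> polyb F l (m + n)" "g * (l ^ n * c + r) = l ^ (m + n) * (d * c) + t" using ds by auto
  then have "l ^ (m + n) * (d * c) + t \<in> polyb F l (m + n)"
    using assms(5) polyb_mono[of n "m + n"] by auto
  from lead_polyb[OF mult_mem[OF ds(1) assms(1)] t(1) this] have "d * c = 0" .
  with assms ds show False by simp
qed

lemma division_with_remainder:
  assumes "s = l ^ n + r" "r \<in> polyb F l n" "h \<in> polys F l"
  shows "\<exists>g\<in>polys F l. \<exists>\<rho>\<in>polyb F l n. h = s * g + \<rho>"
proof -
  have "\<exists>g\<in>polys F l. \<exists>\<rho>\<in>polyb F l n. h = s * g + \<rho>" if "h \<in> polyb F l m" for m h
    using that
  proof (induction m arbitrary: h)
    case 0
    then have "h \<in> polyb F l n" using polyb_mono[of 0 n] by auto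
    then show ?case using zero_polys by (intro bexI[of _ 0] bexI[of _ h]) auto
  next
    case (Suc m)
    show ?case
    proof (cases "m < n")
      case True
      then have "h \<in> polyb F l n" using Suc.prems polyb_mono[of "Suc m" n] by auto
      then show ?thesis using zero_polys by (intro bexI[of _ 0] bexI[of _ h]) auto
    next
      case False
      obtain c h' where c: "c \<in> F" "h' \<in> polyb F l m" "h = l ^ m * c + h'"
        using Suc.prems by (rule polyb_SucE)
      define e where "e = l ^ (m - n) * c"
      have "l ^ (m - n) * c \<in> polyb F l (Suc (m - n))" using c by (intro monom_polyb) auto
      then have "r * e \<in> polyb F l (n + (m - n))" unfolding e_def by (rule mult_polyb[OF assms(2)])
      then have re: "r * e \<in> polyb F l m" using False by simp
      have "l ^ n * l ^ (m - n) = l ^ m" using False by (simp add: power_add[symmetric])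
      then have "s * e = l ^ m * c + r * e" by (simp add: assms(1) e_def distrib_right mult.assoc[symmetric])
      then have "h - s * e = h' - r * e" using c(3) by simp
      then have "h - s * e \<in> polyb F l m" using rsubspace_diff[OF rsubspace_polyb c(2) re] by simp
      from Suc.IH[OF this] obtain g \<rho> where g: "g \<in> polys F l" "\<rho> \<in> polyb F l n" "h - s * e = s * g + \<rho>"
        by blast
      have "e \<in> polys F l" unfolding e_def by (intro mult_polys power_polys const_polys c)
      then have "g + e \<in> polys F l" by (rule add_polys[OF g(1)])
      moreover have "h = s * (g + e) + \<rho>" using g(3) by (simp add: distrib_left algebra_simps)
      ultimately show ?thesis using g(2) by blast
    qed
  qed
  then show ?thesis using assms(3) by (auto simp: polys_def)
qed

text \<open>The right Ore condition follows by counting: the products of \<open>p\<close> and of \<open>q\<close> with enough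
  powers of \<open>l\<close> are too many to be independent.\<close>

lemma right_Ore:
  assumes p: "p \<in> polys F l" and q: "q \<in> polys F l" "q \<noteq> 0"
  shows "\<exists>p'\<in>polys F l. \<exists>q'\<in>polys F l. q' \<noteq> 0 \<and> p * q' = q * p'"
proof -
  from polys_common[OF p q(1)] obtain n where n: "p \<in> polyb F l n" "q \<in> polyb F l n" .
  define v where "v = (\<lambda>(b, j). (if b then p else q) * l ^ j)"
  let ?I = "UNIV \<times> {..n} :: (bool \<times> nat) set"
  have "v i \<in> rspan F ((\<lambda>i. l ^ i) ` {..<n + n})" if "i \<in> ?I" for i
  proof -
    obtain b j where i: "i = (b, j)" "j \<le> n" using \<open>i \<in> ?I\<close> by auto
    have "l ^ j \<in> polyb F l (Suc n)" using i by (intro power_polyb) auto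
    from mult_polyb[OF _ this, of "if b then p else q" n] n show ?thesis by (simp add: v_def i polyb_def)
  qed
  moreover have "card ((\<lambda>i. l ^ i) ` {..<n + n}) < card ?I"
    using card_image_le[of "{..<n+n}" "\<lambda>i. l ^ i"] by (simp add: card_cartesian_product)
  ultimately obtain c where c: "\<forall>i\<in>?I. c i \<in> F" "\<exists>i\<in>?I. c i \<noteq> 0" "(\<Sum>i\<in>?I. v i * c i) = 0"
    using dependent_family[of "(\<lambda>i. l ^ i) ` {..<n + n}" ?I v] by auto
  define s where "s = (\<lambda>b. \<Sum>j\<le>n. l ^ j * c (b, j))"
  have sP: "s b \<in> polys F l" for b
    unfolding s_def using c by (intro sum_polys mult_polys power_polys const_polys) auto
  have "(\<Sum>i\<in>?I. v i * c i) = (\<Sum>b\<in>UNIV. \<Sum>j\<le>n. v (b, j) * c (b, j))"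
    by (simp add: sum.cartesian_product)
  also have "\<dots> = p * s True + q * s False"
    by (simp add: UNIV_bool v_def s_def sum_distrib_left mult.assoc)
  finally have eq: "p * s True = q * (- s False)" using c(3) by (simp add: eq_neg_iff_add_eq_0)
  have "s True \<noteq> 0"
  proof
    assume T: "s True = 0"
    with eq q have F: "s False = 0" by simp
    have "s b = 0" for b using T F by (cases b) auto
    then have "(\<Sum>j<Suc n. l ^ j * c (b, j)) = 0" for b by (simp add: s_def lessThan_Suc_atMost)
    moreover have "c (b, j) \<in> F" if "j < Suc n" for b j using c(1) that by (auto simp: less_Suc_eq_le)
    ultimately have "c (b, j) = 0" if "j < Suc n" for b j
      using transcD[OF transc, of "Suc n" "\<lambda>j. c (b, j)" j] that by blast
    then have "\<forall>i\<in>?I. c i = 0" by (auto simp: less_Suc_eq_le)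
    with c(2) show False by blast
  qed
  moreover have "- s False \<in> polys F l" using diff_polys[OF zero_polys sP] by simp
  ultimately show ?thesis using eq sP[of True] by blast
qed

lemma common_multiple:
  assumes "p \<in> polys F l" "p \<noteq> 0" "q \<in> polys F l" "q \<noteq> 0"
  obtains a b where "a \<in> polys F l" "b \<in> polys F l" "p * a = q * b" "p * a \<noteq> 0"
proof -
  from right_Ore[OF assms(1,3,4)] obtain p' q' where
    pq: "p' \<in> polys F l" "q' \<in> polys F l" "q' \<noteq> 0" "p * q' = q * p'" by blast
  have "p * q' \<noteq> 0" using assms(2) pq(3) by simp
  from that[OF pq(2,1,4) this] show ?thesis .
qed

lemma common_denominator:
  assumes "finite I" "\<And>i. i \<in> I \<Longrightarrow> f i \<in> fracs F l"
  shows "\<exists>q\<in>polys F l. q \<noteq> 0 \<and> (\<forall>i\<in>I. f i * q \<in> polys F l)"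
  using assms
proof (induction I rule: finite_induct)
  case empty
  then show ?case using const_polys[OF one_mem] by (intro bexI[of _ 1]) auto
next
  case (insert i I)
  then obtain q where q: "q \<in> polys F l" "q \<noteq> 0" "\<forall>i\<in>I. f i * q \<in> polys F l" by auto
  from insert.prems obtain q' where q': "q' \<in> polys F l" "q' \<noteq> 0" "f i * q' \<in> polys F l"
    by (auto simp: fracs_def)
  from common_multiple[OF q(1,2) q'(1,2)] obtain a b where
    ab: "a \<in> polys F l" "b \<in> polys F l" "q * a = q' * b" "q * a \<noteq> 0" .
  have "f j * (q * a) \<in> polys F l" if "j \<in> insert i I" for j
  proof (cases "j = i")
    case True
    have "f i * q' * b \<in> polys F l" by (rule mult_polys[OF q'(3) ab(2)])
    then show ?thesis using True ab(3) by (simp add: mult.assoc)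
  next
    case False
    then have "f j * q \<in> polys F l" using that q by auto
    then have "f j * q * a \<in> polys F l" by (rule mult_polys[OF _ ab(1)])
    then show ?thesis by (simp add: mult.assoc)
  qed
  then show ?case using mult_polys[OF q(1) ab(1)] ab(4) by blast
qed

lemma polys_fracs: "p \<in> polys F l \<Longrightarrow> p \<in> fracs F l"
  unfolding fracs_def using const_polys[OF one_mem] by (auto intro!: bexI[of _ 1])

lemma const_fracs: "c \<in> F \<Longrightarrow> c \<in> fracs F l"
  using polys_fracs const_polys by blast

lemma var_fracs: "l \<in> fracs F l"
  using polys_fracs var_polys by blast

lemma division_subring_fracs: "division_subring (fracs F l)"
proof
  show "1 \<in> fracs F l" using const_fracs one_mem by blast
  fix a b assume a: "a \<in> fracs F l" and b: "b \<in> fracs F l"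
  from common_denominator[of "{a, b}" "\<lambda>x. x"] a b obtain q where
    q: "q \<in> polys F l" "q \<noteq> 0" "a * q \<in> polys F l" "b * q \<in> polys F l" by auto
  then have "(a - b) * q \<in> polys F l" using diff_polys by (simp add: left_diff_distrib)
  with q show "a - b \<in> fracs F l" unfolding fracs_def by blast
  from a obtain r where r: "r \<in> polys F l" "r \<noteq> 0" "a * r \<in> polys F l" by (auto simp: fracs_def)
  from right_Ore[OF q(4) r(1,2)] obtain p' q' where
    pq: "p' \<in> polys F l" "q' \<in> polys F l" "q' \<noteq> 0" "b * q * q' = r * p'" by blast
  have "a * r * p' \<in> polys F l" by (rule mult_polys[OF r(3) pq(1)])
  then have "a * b * (q * q') \<in> polys F l" using pq(4) by (simp add: mult.assoc)
  moreover have "q * q' \<in> polys F l" "q * q' \<noteq> 0" using q pq mult_polys[of q q'] by auto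
  ultimately show "a * b \<in> fracs F l" unfolding fracs_def by blast
next
  fix a assume a: "a \<in> fracs F l"
  show "inverse a \<in> fracs F l"
  proof (cases "a = 0")
    case False
    from a obtain r where r: "r \<in> polys F l" "r \<noteq> 0" "a * r \<in> polys F l" by (auto simp: fracs_def)
    have "inverse a * (a * r) = r" using False by (simp add: mult.assoc[symmetric])
    moreover have "a * r \<noteq> 0" using False r by simp
    ultimately have "a * r \<in> polys F l" "a * r \<noteq> 0" "inverse a * (a * r) \<in> polys F l" using r by auto
    then show ?thesis unfolding fracs_def by blast
  qed (use a in simp)
qed

lemma fracs_centralizer:
  assumes "F \<subseteq> centralizer S" "l \<in> centralizer S" shows "fracs F l \<subseteq> centralizer S"
  by (rule polys_subset[OF division_subring_centralizer assms])

lemma fracs_commutative: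
  assumes "F \<subseteq> centralizer F" shows "fracs F l \<subseteq> centralizer (fracs F l)"
proof -
  have "fracs F l \<subseteq> centralizer (insert l F)"
    by (rule fracs_centralizer) (use assms comm in \<open>auto simp: centralizer_def\<close>)
  then have "F \<subseteq> centralizer (fracs F l)" "l \<in> centralizer (fracs F l)" by (auto simp: centralizer_def)
  then show ?thesis by (rule fracs_centralizer)
qed

end

section \<open>A criterion for freeness\<close>

definition words_upto :: "nat \<Rightarrow> bool list set" where
  "words_upto n = {w. length w \<le> n}"

definition nonempty_words_upto :: "nat \<Rightarrow> bool list set" where
  "nonempty_words_upto n = {w. w \<noteq> [] \<and> length w \<le> n}"

lemma finite_words_upto: "finite (words_upto n)"
  unfolding words_upto_def using finite_lists_length_le[of "UNIV :: bool set" n] by simp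

lemma finite_nonempty_words_upto: "finite (nonempty_words_upto n)"
  by (rule finite_subset[OF _ finite_words_upto[of n]]) (auto simp: nonempty_words_upto_def words_upto_def)

lemma words_upto_eq: "words_upto n = insert [] (nonempty_words_upto n)"
  by (auto simp: nonempty_words_upto_def words_upto_def)

lemma sum_nonempty_words_Suc:
  "(\<Sum>w\<in>nonempty_words_upto (Suc n). f w) = (\<Sum>u\<in>words_upto n. \<Sum>i\<in>UNIV. f (i # u))"
proof -
  have eq: "nonempty_words_upto (Suc n) = (\<lambda>(u, i). i # u) ` (words_upto n \<times> UNIV)"
  proof safe
    fix w :: "bool list" assume "w \<in> nonempty_words_upto (Suc n)"
    then obtain i u where "w = i # u" "length u \<le> n" by (cases w) (auto simp: nonempty_words_upto_def)
    then show "w \<in> (\<lambda>(u, i). i # u) ` (words_upto n \<times> UNIV)" by (force simp: words_upto_def)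
  qed (auto simp: nonempty_words_upto_def words_upto_def)
  have inj: "inj_on (\<lambda>(u, i). i # u) (words_upto n \<times> UNIV)" by (auto simp: inj_on_def)
  show ?thesis unfolding eq sum.reindex[OF inj] by (simp add: sum.cartesian_product case_prod_unfold)
qed

text \<open>A criterion for the elements \<open>(1 - t)\<^sup>-\<^sup>1 b\<^sub>i\<close> to be free: no combination of the \<open>b\<^sub>i\<close> with
  coefficients commuting with \<open>t\<close> may have the form \<open>t v t\<^sup>-\<^sup>1 - v\<close>. The set \<open>R\<close> plays the role of a
  polynomial ring containing \<open>t\<close>, modulo which relations are considered; by \<open>base\<close> the poles of
  \<open>(1 - t)\<^sup>-\<^sup>1\<close> do not cancel in it.\<close>

locale free_criterion = division_subring F for F :: "'d::division_ring set" +
  fixes t :: 'd and R :: "'d set" and b :: "bool \<Rightarrow> 'd"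
  assumes t0: "t \<noteq> 0" and t1: "t \<noteq> 1"
    and conj_mem: "c \<in> F \<Longrightarrow> t * c * inverse t \<in> F"
    and R_one: "1 \<in> R"
    and R_diff: "r \<in> R \<Longrightarrow> s \<in> R \<Longrightarrow> r - s \<in> R"
    and R_mult: "c \<in> F \<Longrightarrow> r \<in> R \<Longrightarrow> c * r \<in> R"
    and R_t: "r \<in> R \<Longrightarrow> t * r \<in> R"
    and b_mem: "b i \<in> F"
    and indep: "(\<And>i. e i \<in> F) \<Longrightarrow> (\<And>i. t * e i = e i * t) \<Longrightarrow> v \<in> F \<Longrightarrow>
       (\<Sum>i\<in>UNIV. e i * b i) = t * v * inverse t - v \<Longrightarrow> e j = 0"
    and base: "c \<in> F \<Longrightarrow> inverse (1 - t) * c \<in> R \<Longrightarrow> c = 0"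
begin

definition \<sigma> :: "'d \<Rightarrow> 'd" where "\<sigma> c = t * c * inverse t"

definition W :: "bool list \<Rightarrow> 'd" where
  "W w = prod_list (map (\<lambda>i. inverse (1 - t) * b i) w)"

lemma \<sigma>_mem: "c \<in> F \<Longrightarrow> \<sigma> c \<in> F"
  by (simp add: \<sigma>_def conj_mem)

lemma t_mult: "t * c = \<sigma> c * t"
  using t0 by (simp add: \<sigma>_def mult.assoc)

lemma \<sigma>_fix: "\<sigma> c = c \<Longrightarrow> t * c = c * t"
  using t_mult[of c] by simp

lemma \<sigma>_one: "\<sigma> 1 = 1" and \<sigma>_zero: "\<sigma> 0 = 0"
  using t0 by (auto simp: \<sigma>_def)

lemma const_R: "c \<in> F \<Longrightarrow> c \<in> R"
  using R_mult[OF _ R_one] by simp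

lemma R_zero: "0 \<in> R" using const_R zero_mem by blast

lemma R_add: "r \<in> R \<Longrightarrow> s \<in> R \<Longrightarrow> r + s \<in> R"
  using R_diff[of r "0 - s"] R_diff[OF R_zero, of s] by simp

lemma W_Nil: "W [] = 1" and W_Cons: "W (i # w) = inverse (1 - t) * b i * W w"
  by (simp_all add: W_def)

lemma W_step: "(1 - t) * W (i # w) = b i * W w"
proof -
  have "1 - t \<noteq> 0" using t1 by simp
  then show ?thesis by (simp add: W_Cons mult.assoc[symmetric])
qed

lemma one_minus_t_mult: "(1 - t) * (c * s) = (c - \<sigma> c) * s + \<sigma> c * ((1 - t) * s)"
  using t_mult[of c] by (simp add: left_diff_distrib right_diff_distrib mult.assoc[symmetric])

definition relation_sum :: "nat \<Rightarrow> (bool list \<Rightarrow> 'd) \<Rightarrow> 'd" where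
  "relation_sum n d = (\<Sum>w\<in>nonempty_words_upto n. d w * W w)"

text \<open>Multiplication by \<open>1 - t\<close> on the left shortens the words by one letter and twists the
  coefficients by the conjugation \<open>\<sigma>\<close>.\<close>

definition shift_coeff :: "nat \<Rightarrow> (bool list \<Rightarrow> 'd) \<Rightarrow> bool list \<Rightarrow> 'd" where
  "shift_coeff m d w = (d w - \<sigma> (d w)) + (if length w \<le> m then \<Sum>i\<in>UNIV. \<sigma> (d (i # w)) * b i else 0)"

lemma relation_shift:
  assumes d: "\<And>w. d w \<in> F" and rel: "relation_sum (Suc m) d \<in> R"
  shows "relation_sum (Suc m) (shift_coeff m d) \<in> R"
proof -
  let ?g = "\<lambda>w. \<Sum>i\<in>UNIV. \<sigma> (d (i # w)) * b i"
  let ?N = "nonempty_words_upto"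
  have 1: "(1 - t) * relation_sum (Suc m) d
    = (\<Sum>w\<in>?N (Suc m). (d w - \<sigma> (d w)) * W w) + (\<Sum>w\<in>?N (Suc m). \<sigma> (d w) * ((1 - t) * W w))"
    unfolding relation_sum_def sum_distrib_left one_minus_t_mult by (rule sum.distrib)
  have 2: "(\<Sum>w\<in>?N (Suc m). \<sigma> (d w) * ((1 - t) * W w)) = (\<Sum>u\<in>words_upto m. ?g u * W u)"
    unfolding sum_nonempty_words_Suc W_step by (simp add: sum_distrib_right mult.assoc)
  have 3: "(\<Sum>u\<in>words_upto m. ?g u * W u) = ?g [] + (\<Sum>u\<in>?N m. ?g u * W u)"
    unfolding words_upto_eq
    by (subst sum.insert) (auto simp: finite_nonempty_words_upto W_Nil, simp add: nonempty_words_upto_def)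
  have 4: "(\<Sum>u\<in>?N m. ?g u * W u) = (\<Sum>w\<in>?N (Suc m). (if length w \<le> m then ?g w else 0) * W w)"
    by (rule sum.mono_neutral_cong_left) (auto simp: finite_nonempty_words_upto, auto simp: nonempty_words_upto_def)
  have "relation_sum (Suc m) (shift_coeff m d) = (1 - t) * relation_sum (Suc m) d - ?g []"
    unfolding 1 2 3 4 by (simp add: relation_sum_def shift_coeff_def distrib_right sum.distrib)
  also have "(1 - t) * relation_sum (Suc m) d = relation_sum (Suc m) d - t * relation_sum (Suc m) d"
    by (simp add: left_diff_distrib)
  also have "\<dots> - ?g [] \<in> R"
    by (intro R_diff rel R_t const_R sum_mem mult_mem \<sigma>_mem b_mem d)
  finally show ?thesis .
qed

lemma shift_coeff_mem: "(\<And>w. d w \<in> F) \<Longrightarrow> shift_coeff m d w \<in> F"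
  unfolding shift_coeff_def
  by (auto intro!: add_mem diff_mem sum_mem mult_mem \<sigma>_mem b_mem simp del: sum.insert UNIV_bool)

text \<open>If the shifted relation is trivial, then its top coefficients commute with \<open>t\<close>, and the coefficient
  of the tail \<open>u\<close> of \<open>v\<close> exhibits a combination of the \<open>b\<^sub>i\<close> in the form excluded by \<open>indep\<close>. If \<open>u\<close>
  is empty, \<open>base\<close> takes its place.\<close>

lemma top_fixed_contradiction:
  assumes d: "\<And>w. d w \<in> F" and rel: "relation_sum (Suc m) d \<in> R"
    and zero: "\<And>w. w \<in> nonempty_words_upto (Suc m) \<Longrightarrow> shift_coeff m d w = 0"
    and v: "length v = Suc m"
  shows "d v = 0"
proof -
  from v obtain j u where ju: "v = j # u" "length u = m" by (cases v) auto
  have fix_top: "\<sigma> (d w) = d w" if "length w = Suc m" for w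
  proof -
    have "w \<in> nonempty_words_upto (Suc m)" using that by (auto simp: nonempty_words_upto_def)
    from zero[OF this] that show ?thesis by (simp add: shift_coeff_def)
  qed
  define e where "e = (\<lambda>i. d (i # u))"
  have e: "\<sigma> (e i) = e i" "e i \<in> F" "t * e i = e i * t" for i
    using fix_top[of "i # u"] ju d \<sigma>_fix[of "e i"] by (auto simp: e_def)
  have "\<exists>w\<in>F. (\<Sum>i\<in>UNIV. e i * b i) = t * w * inverse t - w"
  proof (cases "m = 0")
    case True
    then have u: "u = []" using ju by simp
    have "relation_sum (Suc m) d = (\<Sum>i\<in>UNIV. d [i] * W [i])"
      unfolding relation_sum_def sum_nonempty_words_Suc by (simp add: True words_upto_def)
    also have "\<dots> = (\<Sum>i\<in>UNIV. inverse (1 - t) * (e i * b i))"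
    proof (rule sum.cong[OF refl])
      fix i
      have "e i * (1 - t) = (1 - t) * e i" using e(3)[of i] by (simp add: left_diff_distrib right_diff_distrib)
      moreover have nz: "1 - t \<noteq> 0" using t1 by simp
      ultimately have "inverse (1 - t) * (e i * (1 - t)) * inverse (1 - t) = inverse (1 - t) * ((1 - t) * e i) * inverse (1 - t)"
        by simp
      moreover have "inverse (1 - t) * (e i * (1 - t)) * inverse (1 - t) = inverse (1 - t) * e i"
        using nz by (simp add: mult.assoc)
      moreover have "inverse (1 - t) * ((1 - t) * e i) * inverse (1 - t) = e i * inverse (1 - t)"
        using nz by (simp add: mult.assoc[symmetric])
      ultimately have "e i * inverse (1 - t) = inverse (1 - t) * e i" by simp
      then show "d [i] * W [i] = inverse (1 - t) * (e i * b i)"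
        by (simp add: W_Cons W_Nil e_def u mult.assoc[symmetric])
    qed
    also have "\<dots> = inverse (1 - t) * (\<Sum>i\<in>UNIV. e i * b i)" by (simp add: sum_distrib_left)
    finally have "inverse (1 - t) * (\<Sum>i\<in>UNIV. e i * b i) \<in> R" using rel by simp
    moreover have "(\<Sum>i\<in>UNIV. e i * b i) \<in> F" by (intro sum_mem mult_mem e(2) b_mem)
    ultimately have "(\<Sum>i\<in>UNIV. e i * b i) = 0" using base by blast
    then show ?thesis using zero_mem by (intro bexI[of _ 0]) auto
  next
    case False
    then have "u \<in> nonempty_words_upto (Suc m)" using ju by (auto simp: nonempty_words_upto_def)
    from zero[OF this] ju have "(d u - \<sigma> (d u)) + (\<Sum>i\<in>UNIV. \<sigma> (d (i # u)) * b i) = 0"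
      by (simp add: shift_coeff_def)
    moreover have "\<sigma> (d (i # u)) = e i" for i using e(1)[of i] by (simp add: e_def)
    ultimately have "(\<Sum>i\<in>UNIV. e i * b i) = \<sigma> (d u) - d u"
      by (simp del: UNIV_bool add: algebra_simps)
    then show ?thesis using d unfolding \<sigma>_def by blast
  qed
  then obtain w where "w \<in> F" "(\<Sum>i\<in>UNIV. e i * b i) = t * w * inverse t - w" by blast
  with indep[of e w j] e have "e j = 0" by blast
  then show ?thesis by (simp add: e_def ju)
qed

text \<open>Normalize a relation so that the coefficient of some longest word is \<open>1\<close>. The shifted relation has
  fewer words of that length, so it is trivial by induction, which contradicts the previous lemma.\<close>

theorem words_independent:
  assumes "\<And>w. d w \<in> F" "relation_sum n d \<in> R" "w \<in> nonempty_words_upto n"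
  shows "d w = 0"
  using assms
proof (induction n arbitrary: d w)
  case 0
  then show ?case by (auto simp: nonempty_words_upto_def)
next
  case (Suc m)
  define top where "top = (\<lambda>d :: bool list \<Rightarrow> 'd. {w. length w = Suc m \<and> d w \<noteq> 0})"
  have fin: "finite (top d)" for d
    by (rule finite_subset[OF _ finite_words_upto[of "Suc m"]]) (auto simp: top_def words_upto_def)
  have "\<forall>w\<in>nonempty_words_upto (Suc m). d w = 0"
    if "\<And>w. d w \<in> F" "relation_sum (Suc m) d \<in> R" for d
    using that
  proof (induction "card (top d)" arbitrary: d rule: less_induct)
    case less
    have "top d = {}"
    proof (rule ccontr)
      assume "top d \<noteq> {}"
      then obtain v where v: "length v = Suc m" "d v \<noteq> 0" by (auto simp: top_def)
      define d1 where "d1 = (\<lambda>w. inverse (d v) * d w)"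
      have d1F: "d1 w \<in> F" for w unfolding d1_def by (intro mult_mem inverse_mem less.prems)
      have "relation_sum (Suc m) d1 = inverse (d v) * relation_sum (Suc m) d"
        by (simp add: relation_sum_def d1_def sum_distrib_left mult.assoc)
      then have d1R: "relation_sum (Suc m) d1 \<in> R"
        using R_mult[OF inverse_mem[OF less.prems(1)] less.prems(2)] by simp
      have d1v: "d1 v = 1" using v by (simp add: d1_def)
      have "top (shift_coeff m d1) \<subseteq> top d - {v}"
      proof
        fix w assume "w \<in> top (shift_coeff m d1)"
        then have w: "length w = Suc m" "d1 w - \<sigma> (d1 w) \<noteq> 0" by (auto simp: top_def shift_coeff_def)
        then have "w \<noteq> v" using d1v \<sigma>_one by auto
        moreover have "d w \<noteq> 0" using w(2) \<sigma>_zero by (auto simp: d1_def)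
        ultimately show "w \<in> top d - {v}" using w by (auto simp: top_def)
      qed
      moreover have "v \<in> top d" using v by (simp add: top_def)
      ultimately have "card (top (shift_coeff m d1)) < card (top d)"
        using fin psubset_card_mono[of "top d" "top (shift_coeff m d1)"] by blast
      from less.hyps[OF this shift_coeff_mem[of d1, OF d1F] relation_shift[of d1, OF d1F d1R]]
      have "shift_coeff m d1 w = 0" if "w \<in> nonempty_words_upto (Suc m)" for w using that by blast
      from top_fixed_contradiction[of d1, OF d1F d1R this v(1)] d1v show False by simp
    qed
    then have top0: "d w = 0" if "length w = Suc m" for w using that by (auto simp: top_def)
    have "relation_sum (Suc m) d = relation_sum m d"
      unfolding relation_sum_def
      by (rule sum.mono_neutral_right)
        (auto simp: finite_nonempty_words_upto, auto simp: nonempty_words_upto_def top0 le_Suc_eq)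
    with less.prems have "relation_sum m d \<in> R" by simp
    from Suc.IH[of d, OF less.prems(1) this] top0 show ?case
      by (auto simp: nonempty_words_upto_def le_Suc_eq)
  qed
  with Suc.prems show ?case by blast
qed

text \<open>The left \<open>F\<close>-span of the words of length at most \<open>m\<close>, modulo \<open>R\<close>.\<close>

definition M :: "nat \<Rightarrow> 'd set" where
  "M m = {relation_sum m d + r | d r. (\<forall>w. d w \<in> F) \<and> r \<in> R}"

lemma M_zero_imp:
  assumes "\<And>w. d w \<in> F" "(\<Sum>w\<in>{w. length w = Suc m}. d w * W w) \<in> M m" "length v = Suc m"
  shows "d v = 0"
proof -
  from assms(2) obtain e r where e: "\<forall>w. e w \<in> F" "r \<in> R"
    "(\<Sum>w\<in>{w. length w = Suc m}. d w * W w) = relation_sum m e + r" by (auto simp: M_def)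
  define f where "f = (\<lambda>w. if length w = Suc m then d w else - e w)"
  have disj: "nonempty_words_upto (Suc m) = nonempty_words_upto m \<union> {w. length w = Suc m}"
    by (auto simp: nonempty_words_upto_def)
  have fin: "finite {w :: bool list. length w = Suc m}"
    by (rule finite_subset[OF _ finite_words_upto[of "Suc m"]]) (auto simp: words_upto_def)
  have "relation_sum (Suc m) f = (\<Sum>w\<in>nonempty_words_upto m. f w * W w) + (\<Sum>w\<in>{w. length w = Suc m}. f w * W w)"
    unfolding relation_sum_def disj
    by (rule sum.union_disjoint) (auto simp: fin finite_nonempty_words_upto, auto simp: nonempty_words_upto_def)
  also have "(\<Sum>w\<in>nonempty_words_upto m. f w * W w) = - relation_sum m e"
    unfolding relation_sum_def sum_negf[symmetric]
    by (rule sum.cong) (auto simp: f_def nonempty_words_upto_def)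
  also have "(\<Sum>w\<in>{w. length w = Suc m}. f w * W w) = relation_sum m e + r"
    unfolding e(3)[symmetric] by (rule sum.cong) (auto simp: f_def)
  finally have "relation_sum (Suc m) f \<in> R" using e(2) by simp
  moreover have "f w \<in> F" for w using assms(1) e(1) by (auto simp: f_def uminus_mem)
  moreover have "v \<in> nonempty_words_upto (Suc m)" using assms(3) by (auto simp: nonempty_words_upto_def)
  ultimately have "f v = 0" using words_independent[of f "Suc m" v] by blast
  then show ?thesis using assms(3) by (simp add: f_def)
qed

lemma M_add: assumes "u \<in> M m" "v \<in> M m" shows "u + v \<in> M m"
proof -
  from assms obtain d r e s where "\<forall>w. d w \<in> F" "r \<in> R" "\<forall>w. e w \<in> F" "s \<in> R"
    and uv: "u = relation_sum m d + r" "v = relation_sum m e + s" by (auto simp: M_def)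
  then have "\<forall>w. d w + e w \<in> F" "r + s \<in> R" by (auto intro: add_mem R_add)
  moreover have "u + v = relation_sum m (\<lambda>w. d w + e w) + (r + s)"
    unfolding uv by (simp add: relation_sum_def distrib_right sum.distrib)
  ultimately show ?thesis unfolding M_def by blast
qed

lemma M_mult: assumes "u \<in> M m" "c \<in> F" shows "c * u \<in> M m"
proof -
  from assms obtain d r where d: "\<forall>w. d w \<in> F" "r \<in> R" and u: "u = relation_sum m d + r" by (auto simp: M_def)
  then have "\<forall>w. c * d w \<in> F" "c * r \<in> R" using assms(2) by (auto intro: mult_mem R_mult)
  moreover have "c * u = relation_sum m (\<lambda>w. c * d w) + c * r"
    unfolding u by (simp add: relation_sum_def distrib_left sum_distrib_left mult.assoc)
  ultimately show ?thesis unfolding M_def by blast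
qed

lemma R_M: "r \<in> R \<Longrightarrow> r \<in> M m"
  unfolding M_def using zero_mem
  by (auto intro!: exI[of _ "\<lambda>_. 0"] exI[of _ r] simp: relation_sum_def)

lemma M_sum: "(\<And>i. i \<in> I \<Longrightarrow> f i \<in> M m) \<Longrightarrow> (\<Sum>i\<in>I. f i) \<in> M m"
  by (induction I rule: infinite_finite_induct) (auto intro: M_add R_M R_zero)

lemma W_M: assumes "length w \<le> m" shows "W w \<in> M m"
proof (cases "w = []")
  case True
  then show ?thesis using R_M[OF R_one] W_Nil by simp
next
  case False
  define d :: "bool list \<Rightarrow> 'd" where "d = (\<lambda>v. if v = w then 1 else 0)"
  have "relation_sum m d = (\<Sum>v\<in>{w}. d v * W v)" unfolding relation_sum_def
    by (rule sum.mono_neutral_right)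
      (use False assms in \<open>auto simp: finite_nonempty_words_upto d_def\<close>, auto simp: nonempty_words_upto_def)
  then have "W w = relation_sum m d + 0" by (simp add: d_def)
  moreover have "\<forall>w. d w \<in> F" by (auto simp: d_def one_mem zero_mem)
  ultimately show ?thesis unfolding M_def using R_zero by blast
qed

lemma tW_M: assumes "length w \<le> Suc m" shows "t * W w - W w \<in> M m"
proof (cases w)
  case Nil
  have "t * 1 - 1 \<in> R" by (rule R_diff[OF R_t[OF R_one] R_one])
  then show ?thesis using R_M Nil W_Nil by simp
next
  case (Cons i u)
  have "t * W w - W w = - b i * W u" using W_step[of i u] Cons by (simp add: left_diff_distrib algebra_simps)
  moreover have "- b i * W u \<in> M m"
    by (rule M_mult[OF W_M uminus_mem[OF b_mem]]) (use Cons assms in simp)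
  ultimately show ?thesis by simp
qed

lemma M_t: assumes "u \<in> M m" shows "t * u \<in> M m"
proof -
  from assms obtain d r where d: "\<forall>w. d w \<in> F" "r \<in> R" and u: "u = relation_sum m d + r" by (auto simp: M_def)
  have "t * (d w * W w) \<in> M m" if "w \<in> nonempty_words_upto m" for w
  proof -
    have l: "length w \<le> m" using that by (simp add: nonempty_words_upto_def)
    then have "(t * W w - W w) + W w \<in> M m" by (intro M_add tW_M W_M) auto
    then have "\<sigma> (d w) * (t * W w) \<in> M m" using M_mult \<sigma>_mem d by simp
    then show ?thesis using t_mult[of "d w"] by (simp add: mult.assoc[symmetric])
  qed
  then have "(\<Sum>w\<in>nonempty_words_upto m. t * (d w * W w)) \<in> M m" by (rule M_sum)
  then have "(\<Sum>w\<in>nonempty_words_upto m. t * (d w * W w)) + t * r \<in> M m"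
    by (rule M_add[OF _ R_M[OF R_t[OF d(2)]]])
  then show ?thesis by (simp add: u relation_sum_def distrib_left sum_distrib_left)
qed

text \<open>From \<open>(1 - t) W (i # w) = b\<^sub>i W w\<close>: modulo shorter words, \<open>t\<close> acts as the identity.\<close>

lemma t_power_W: "length w \<le> Suc m \<Longrightarrow> t ^ j * W w - W w \<in> M m"
proof (induction j)
  case 0
  then show ?case using R_M[OF R_zero] by simp
next
  case (Suc j)
  have eq: "t ^ Suc j * W w - W w = t * (t ^ j * W w - W w) + (t * W w - W w)"
    by (simp add: right_diff_distrib mult.assoc)
  show ?case unfolding eq by (rule M_add[OF M_t[OF Suc.IH[OF Suc.prems]] tW_M[OF Suc.prems]])
qed

end

section \<open>Generic central elements\<close>

lemma divide_out_root:
  fixes c :: "nat \<Rightarrow> 'd::division_ring"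
  shows "\<exists>e. e n = c (Suc n) \<and> (\<forall>l. l * r = r * l \<longrightarrow>
     (\<Sum>i<Suc (Suc n). l ^ i * c i) - (\<Sum>i<Suc (Suc n). r ^ i * c i) = (l - r) * (\<Sum>i<Suc n. l ^ i * e i))"
proof (induction n arbitrary: c)
  case 0
  show ?case by (intro exI[of _ "\<lambda>_. c 1"]) (auto simp: algebra_simps)
next
  case (Suc n)
  from Suc.IH[of "\<lambda>i. c (Suc i)"] obtain e where e: "e n = c (Suc (Suc n))"
    "\<And>l. l * r = r * l \<Longrightarrow> (\<Sum>i<Suc (Suc n). l ^ i * c (Suc i)) - (\<Sum>i<Suc (Suc n). r ^ i * c (Suc i)) = (l - r) * (\<Sum>i<Suc n. l ^ i * e i)"
    by blast
  define f where "f = (\<lambda>i. c (Suc i) + (if i < Suc n then r * e i else 0))"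
  have "(\<Sum>i<Suc (Suc (Suc n)). l ^ i * c i) - (\<Sum>i<Suc (Suc (Suc n)). r ^ i * c i)
      = (l - r) * (\<Sum>i<Suc (Suc n). l ^ i * f i)" if l: "l * r = r * l" for l
  proof -
    define p where "p = (\<lambda>l. \<Sum>i<Suc (Suc n). l ^ i * c (Suc i))"
    have split: "(\<Sum>i<Suc (Suc (Suc n)). l ^ i * c i) = c 0 + l * p l" for l
      unfolding p_def by (subst sum.lessThan_Suc_shift) (simp add: sum_distrib_left distrib_left mult.assoc)
    have lr: "l ^ i * r = r * l ^ i" for i
    proof (induction i)
      case (Suc i)
      have "l ^ Suc i * r = l * (l ^ i * r)" by (simp add: mult.assoc)
      also have "\<dots> = (l * r) * l ^ i" by (simp add: Suc mult.assoc)
      finally show ?case by (simp add: l mult.assoc)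
    qed simp
    have "(\<Sum>i<Suc (Suc n). l ^ i * f i) = p l + (\<Sum>i<Suc (Suc n). l ^ i * (if i < Suc n then r * e i else 0))"
      by (simp add: f_def p_def distrib_left sum.distrib)
    also have "(\<Sum>i<Suc (Suc n). l ^ i * (if i < Suc n then r * e i else 0)) = (\<Sum>i<Suc n. l ^ i * (r * e i))"
      by simp
    also have "\<dots> = r * (\<Sum>i<Suc n. l ^ i * e i)"
      unfolding sum_distrib_left by (rule sum.cong[OF refl]) (simp add: mult.assoc[symmetric] lr)
    finally have "(l - r) * (\<Sum>i<Suc (Suc n). l ^ i * f i) = (l - r) * p l + r * ((l - r) * (\<Sum>i<Suc n. l ^ i * e i))"
      using l by (simp add: distrib_left left_diff_distrib right_diff_distrib mult.assoc[symmetric])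
    also have "(l - r) * (\<Sum>i<Suc n. l ^ i * e i) = p l - p r" using e(2)[OF l] by (simp add: p_def)
    finally show ?thesis unfolding split by (simp add: algebra_simps)
  qed
  moreover have "f (Suc n) = c (Suc (Suc n))" by (simp add: f_def)
  ultimately show ?case by blast
qed

text \<open>A central root can be divided out, so there are at most \<open>n\<close> of them.\<close>

lemma finite_central_roots:
  fixes c :: "nat \<Rightarrow> 'd::division_ring"
  assumes "c n \<noteq> 0" and central: "\<And>l m. l \<in> Z \<Longrightarrow> m \<in> Z \<Longrightarrow> l * m = m * l"
  shows "finite {l \<in> Z. (\<Sum>i<Suc n. l ^ i * c i) = 0}"
  using assms(1)
proof (induction n arbitrary: c)
  case 0
  then show ?case by simp
next
  case (Suc n)
  show ?case
  proof (cases "\<exists>r\<in>Z. (\<Sum>i<Suc (Suc n). r ^ i * c i) = 0")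
    case True
    then obtain r where r: "r \<in> Z" "(\<Sum>i<Suc (Suc n). r ^ i * c i) = 0" by blast
    from divide_out_root[of n c r] obtain e where e: "e n = c (Suc n)"
      "\<And>l. l * r = r * l \<Longrightarrow> (\<Sum>i<Suc (Suc n). l ^ i * c i) - (\<Sum>i<Suc (Suc n). r ^ i * c i) = (l - r) * (\<Sum>i<Suc n. l ^ i * e i)"
      by blast
    have "{l \<in> Z. (\<Sum>i<Suc (Suc n). l ^ i * c i) = 0} \<subseteq> insert r {l \<in> Z. (\<Sum>i<Suc n. l ^ i * e i) = 0}"
    proof
      fix l assume "l \<in> {l \<in> Z. (\<Sum>i<Suc (Suc n). l ^ i * c i) = 0}"
      then have l: "l \<in> Z" "(\<Sum>i<Suc (Suc n). l ^ i * c i) = 0" by blast+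
      have "(l - r) * (\<Sum>i<Suc n. l ^ i * e i) = 0"
        using e(2)[OF central[OF l(1) r(1)]] unfolding l(2) r(2) by simp
      then show "l \<in> insert r {l \<in> Z. (\<Sum>i<Suc n. l ^ i * e i) = 0}" using l(1) by simp
    qed
    moreover have "finite {l \<in> Z. (\<Sum>i<Suc n. l ^ i * e i) = 0}" by (rule Suc.IH) (use e Suc.prems in simp)
    ultimately show ?thesis by (meson finite_insert finite_subset)
  next
    case False
    then have "{l \<in> Z. (\<Sum>i<Suc (Suc n). l ^ i * c i) = 0} = {}" by blast
    then show ?thesis by (metis finite.emptyI)
  qed
qed

text \<open>There are countably many polynomials over \<open>F\<close>, each with finitely many roots in \<open>Z\<close>.\<close>

lemma exists_generic:
  fixes F :: "'d::division_ring set"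
  assumes "countable F" "uncountable Z" and central: "\<And>l m. l \<in> Z \<Longrightarrow> m \<in> Z \<Longrightarrow> l * m = m * l"
  shows "\<exists>l\<in>Z. transc F l"
proof -
  define bad where "bad = (\<lambda>xs :: 'd list. {l \<in> Z. xs \<noteq> [] \<and> last xs \<noteq> 0 \<and> (\<Sum>i<length xs. l ^ i * xs ! i) = 0})"
  have "countable (bad xs)" for xs
  proof (cases "xs \<noteq> [] \<and> last xs \<noteq> 0")
    case True
    then obtain n where n: "length xs = Suc n" by (cases "length xs") auto
    have "last xs = xs ! n" using True n by (metis last_conv_nth diff_Suc_1)
    then have "xs ! n \<noteq> 0" using True by metis
    from finite_central_roots[where c = "(!) xs", OF this central]
    have "finite (bad xs)" by (simp add: bad_def n True del: sum.lessThan_Suc)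
    then show ?thesis by (rule countable_finite)
  next
    case False
    then have "bad xs = {}" by (auto simp: bad_def)
    then show ?thesis by simp
  qed
  then have "countable (\<Union>xs\<in>lists F. bad xs)"
    by (intro countable_UN countable_lists assms(1))
  with assms(2) obtain l where l: "l \<in> Z" "l \<notin> (\<Union>xs\<in>lists F. bad xs)"
    by (meson countable_subset subsetI)
  have "transc F l" unfolding transc_def
  proof (intro allI impI, rule ccontr)
    fix n i c assume c: "\<forall>i<n. c i \<in> F" "(\<Sum>i<n. l ^ i * c i) = 0" "i < n" "c i \<noteq> 0"
    define m where "m = Max {i. i < n \<and> c i \<noteq> 0}"
    have fin: "finite {i. i < n \<and> c i \<noteq> 0}" by simp
    have mem: "i \<in> {i. i < n \<and> c i \<noteq> 0}" using c by simp
    then have "m \<in> {i. i < n \<and> c i \<noteq> 0}" unfolding m_def by (intro Max_in fin) blast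
    then have m: "m < n" "c m \<noteq> 0" by auto
    have above: "c j = 0" if "m < j" "j < n" for j
    proof (rule ccontr)
      assume "c j \<noteq> 0"
      then have "j \<le> m" unfolding m_def using fin that by (intro Max_ge) auto
      then show False using that by simp
    qed
    define xs where "xs = map c [0..<Suc m]"
    have nth: "xs ! i = c i" if "i < Suc m" for i
      using that unfolding xs_def by (subst nth_map) (simp_all del: upt_Suc)
    have len: "length xs = Suc m" by (simp add: xs_def)
    have "(\<Sum>i<length xs. l ^ i * xs ! i) = (\<Sum>i<Suc m. l ^ i * c i)"
      unfolding len by (rule sum.cong[OF refl]) (simp add: nth)
    also have "\<dots> = (\<Sum>i<n. l ^ i * c i)"
      by (rule sum.mono_neutral_left) (use m above in auto)
    finally have "(\<Sum>i<length xs. l ^ i * xs ! i) = 0" using c(2) by simp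
    moreover have "last xs \<noteq> 0" using m(2) by (simp add: xs_def)
    moreover have "xs \<noteq> []" by (simp add: xs_def)
    ultimately have "l \<in> bad xs" using l(1) by (simp add: bad_def)
    moreover have "xs \<in> lists F" unfolding xs_def using c(1) m(1) by (auto simp: in_lists_conv_set)
    ultimately show False using l(2) by blast
  qed
  with l(1) show ?thesis by blast
qed

lemma countable_polys:
  fixes F :: "'d::division_ring set"
  assumes "division_subring F" "countable F" shows "countable (polys F l)"
proof -
  interpret division_subring F by fact
  have "polys F l \<subseteq> (\<lambda>xs. \<Sum>i<length xs. l ^ i * xs ! i) ` lists F"
  proof
    fix p assume "p \<in> polys F l"
    then obtain n c where c: "\<forall>i. c i \<in> F" "p = (\<Sum>i<n. l ^ i * c i)" by (auto simp: polys_def polyb_iff)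
    have "p = (\<Sum>i<length (map c [0..<n]). l ^ i * (map c [0..<n]) ! i)" by (simp add: c(2))
    moreover have "map c [0..<n] \<in> lists F" using c(1) by (auto simp: in_lists_conv_set)
    ultimately show "p \<in> (\<lambda>xs. \<Sum>i<length xs. l ^ i * xs ! i) ` lists F" by (rule image_eqI)
  qed
  then show ?thesis by (rule countable_subset) (intro countable_image countable_lists assms(2))
qed

lemma countable_fracs:
  fixes F :: "'d::division_ring set"
  assumes "division_subring F" "countable F" shows "countable (fracs F l)"
proof -
  have "fracs F l \<subseteq> (\<lambda>(p, q). p * inverse q) ` (polys F l \<times> polys F l)"
  proof
    fix d assume "d \<in> fracs F l"
    then obtain q where q: "q \<in> polys F l" "q \<noteq> 0" "d * q \<in> polys F l" by (auto simp: fracs_def)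
    have "d = d * q * inverse q" using q by (simp add: mult.assoc)
    with q show "d \<in> (\<lambda>(p, q). p * inverse q) ` (polys F l \<times> polys F l)"
      by (intro image_eqI[of _ _ "(d * q, q)"]) auto
  qed
  then show ?thesis by (rule countable_subset) (intro countable_image countable_SIGMA countable_polys assms)
qed

text \<open>Gaussian elimination takes place inside \<open>F\<close>, wherever the given solution lies.\<close>

lemma (in division_subring) system_descent:
  fixes M :: "'i \<Rightarrow> 'j \<Rightarrow> 'd"
  assumes "finite I" "\<And>i j. i \<in> I \<Longrightarrow> j \<in> J \<Longrightarrow> M i j \<in> F"
    "\<exists>i\<in>I. c i \<noteq> 0" "\<And>j. j \<in> J \<Longrightarrow> (\<Sum>i\<in>I. M i j * c i) = 0"
  shows "\<exists>c. (\<forall>i\<in>I. c i \<in> F) \<and> (\<exists>i\<in>I. c i \<noteq> 0) \<and> (\<forall>j\<in>J. (\<Sum>i\<in>I. M i j * c i) = 0)"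
  using assms
proof (induction I arbitrary: M c rule: finite_induct)
  case empty
  then show ?case by simp
next
  case (insert p I)
  show ?case
  proof (cases "\<forall>j\<in>J. M p j = 0")
    case True
    have "(\<Sum>i\<in>insert p I. M i j * (if i = p then 1 else 0)) = 0" if "j \<in> J" for j
      using True that insert.hyps by (intro sum.neutral) auto
    then show ?thesis using one_mem zero_mem by (intro exI[of _ "\<lambda>i. if i = p then 1 else 0"]) auto
  next
    case False
    then obtain k where k: "k \<in> J" "M p k \<noteq> 0" by auto
    define N where "N = (\<lambda>i j. M i j - M p j * inverse (M p k) * M i k)"
    have elim: "(\<Sum>i\<in>I. N i j * c i) = 0 \<longleftrightarrow> M p j * cp + (\<Sum>i\<in>I. M i j * c i) = 0"
      if "cp = - (\<Sum>i\<in>I. inverse (M p k) * M i k * c i)" for j c cp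
    proof -
      have "M p j * cp = - (\<Sum>i\<in>I. M p j * inverse (M p k) * M i k * c i)"
        unfolding that by (simp add: sum_distrib_left mult.assoc)
      then show ?thesis unfolding N_def by (simp add: left_diff_distrib sum_subtractf)
    qed
    have rel: "M p j * c p + (\<Sum>i\<in>I. M i j * c i) = 0" if "j \<in> J" for j
      using insert.prems(3)[OF that] insert.hyps by simp
    have cp: "c p = - (\<Sum>i\<in>I. inverse (M p k) * M i k * c i)"
    proof -
      have "M p k * c p = - (\<Sum>i\<in>I. M i k * c i)" using rel[OF k(1)] by (simp add: eq_neg_iff_add_eq_0)
      then have "inverse (M p k) * (M p k * c p) = inverse (M p k) * - (\<Sum>i\<in>I. M i k * c i)" by simp
      moreover have "inverse (M p k) * (M p k * c p) = c p" using k by (simp add: mult.assoc[symmetric])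
      ultimately show ?thesis by (simp add: sum_distrib_left mult.assoc)
    qed
    have "\<exists>i\<in>I. c i \<noteq> 0"
    proof (rule ccontr)
      assume "\<not> ?thesis"
      then have "\<forall>i\<in>I. c i = 0" by blast
      with cp have "c p = 0" by simp
      with \<open>\<forall>i\<in>I. c i = 0\<close> insert.prems(2) show False by auto
    qed
    moreover have "(\<Sum>i\<in>I. N i j * c i) = 0" if "j \<in> J" for j using elim[OF cp] rel[OF that] by blast
    moreover have "N i j \<in> F" if "i \<in> I" "j \<in> J" for i j
      unfolding N_def using that k insert.prems(1) by (intro diff_mem mult_mem inverse_mem) auto
    ultimately obtain e where e: "\<forall>i\<in>I. e i \<in> F" "\<exists>i\<in>I. e i \<noteq> 0" "\<forall>j\<in>J. (\<Sum>i\<in>I. N i j * e i) = 0"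
      using insert.IH[of N c] by blast
    define ep where "ep = - (\<Sum>i\<in>I. inverse (M p k) * M i k * e i)"
    define f where "f = e(p := ep)"
    have epF: "ep \<in> F" unfolding ep_def
      using e(1) k insert.prems(1) by (intro uminus_mem sum_mem mult_mem inverse_mem) auto
    have same: "(\<Sum>i\<in>I. M i j * f i) = (\<Sum>i\<in>I. M i j * e i)" for j
      by (rule sum.cong[OF refl]) (use insert.hyps in \<open>auto simp: f_def\<close>)
    have "(\<Sum>i\<in>insert p I. M i j * f i) = 0" if "j \<in> J" for j
      using elim[OF ep_def, of j] e(3) that insert.hyps by (simp add: same) (simp add: f_def)
    moreover have "\<forall>i\<in>insert p I. f i \<in> F" using e(1) epF by (auto simp: f_def)
    moreover have "\<exists>i\<in>insert p I. f i \<noteq> 0" using e(2) insert.hyps by (auto simp: f_def)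
    ultimately show ?thesis by blast
  qed
qed

text \<open>For \<open>G = Z \<inter> F\<close> this says that \<open>F\<close> and \<open>Z\<close> are linearly disjoint over \<open>G\<close>.\<close>

definition descends :: "'d::division_ring set \<Rightarrow> 'd set \<Rightarrow> 'd set \<Rightarrow> bool" where
  "descends Z F G \<longleftrightarrow> (\<forall>(n::nat) f. (\<forall>i<n. f i \<in> F) \<longrightarrow>
     (\<exists>c. (\<forall>i<n. c i \<in> Z) \<and> (\<exists>i<n. c i \<noteq> 0) \<and> (\<Sum>i<n. f i * c i) = 0) \<longrightarrow>
     (\<exists>c. (\<forall>i<n. c i \<in> G) \<and> (\<exists>i<n. c i \<noteq> 0) \<and> (\<Sum>i<n. f i * c i) = 0))"

lemma descendsD:
  assumes "descends Z F G" "finite I" "\<forall>i\<in>I. f i \<in> F" "\<forall>i\<in>I. c i \<in> Z" "\<exists>i\<in>I. c i \<noteq> 0" "(\<Sum>i\<in>I. f i * c i) = 0"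
  shows "\<exists>c. (\<forall>i\<in>I. c i \<in> G) \<and> (\<exists>i\<in>I. c i \<noteq> 0) \<and> (\<Sum>i\<in>I. f i * c i) = 0"
proof -
  from ex_bij_betw_nat_finite[OF assms(2)] obtain h where h: "bij_betw h {0..<card I} I" by blast
  let ?n = "card I"
  have hI: "h i \<in> I" if "i < ?n" for i using h that by (auto simp: bij_betw_def)
  have surj: "\<exists>i<?n. j = h i" if "j \<in> I" for j
  proof -
    from that h have "j \<in> h ` {0..<?n}" by (simp add: bij_betw_def)
    then show ?thesis by auto
  qed
  have sum: "(\<Sum>i\<in>I. g i) = (\<Sum>i<?n. g (h i))" for g :: "_ \<Rightarrow> 'a"
    using sum.reindex_bij_betw[OF h, of g] by (simp add: atLeast0LessThan)
  have fF: "\<forall>i<?n. f (h i) \<in> F" using assms(3) hI by auto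
  have "\<forall>i<?n. c (h i) \<in> Z" using assms(4) hI by auto
  moreover have "\<exists>i<?n. c (h i) \<noteq> 0" using assms(5) surj by blast
  moreover have "(\<Sum>i<?n. f (h i) * c (h i)) = 0" using assms(6) sum[of "\<lambda>i. f i * c i"] by simp
  ultimately have ex: "\<exists>c. (\<forall>i<?n. c i \<in> Z) \<and> (\<exists>i<?n. c i \<noteq> 0) \<and> (\<Sum>i<?n. f (h i) * c i) = 0"
    by (intro exI[of _ "\<lambda>i. c (h i)"] conjI) assumption+
  from assms(1) have "(\<forall>i<?n. f (h i) \<in> F) \<longrightarrow>
     (\<exists>c. (\<forall>i<?n. c i \<in> Z) \<and> (\<exists>i<?n. c i \<noteq> 0) \<and> (\<Sum>i<?n. f (h i) * c i) = 0) \<longrightarrow>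
     (\<exists>c. (\<forall>i<?n. c i \<in> G) \<and> (\<exists>i<?n. c i \<noteq> 0) \<and> (\<Sum>i<?n. f (h i) * c i) = 0)"
    unfolding descends_def by (elim allE)
  with fF ex have "\<exists>e. (\<forall>i<?n. e i \<in> G) \<and> (\<exists>i<?n. e i \<noteq> 0) \<and> (\<Sum>i<?n. f (h i) * e i) = 0"
    by (elim impE) assumption+
  then obtain e where e: "\<forall>i<?n. e i \<in> G" "\<exists>i<?n. e i \<noteq> 0" "(\<Sum>i<?n. f (h i) * e i) = 0"
    by blast
  define k where "k = inv_into {0..<?n} h"
  have kh: "k (h i) = i" if "i < ?n" for i
    using h that by (simp add: k_def bij_betw_def)
  have "\<forall>j\<in>I. e (k j) \<in> G" using e(1) surj kh by metis
  moreover have "\<exists>j\<in>I. e (k j) \<noteq> 0" using e(2) hI kh by metis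
  moreover have "(\<Sum>j\<in>I. f j * e (k j)) = 0"
    unfolding sum[of "\<lambda>j. f j * e (k j)"] e(3)[symmetric] by (rule sum.cong[OF refl]) (simp add: kh)
  ultimately show ?thesis by (intro exI[of _ "\<lambda>j. e (k j)"]) blast
qed

text \<open>Clear denominators and expand the coefficients, which lie in \<open>F\<close>, in a basis over \<open>G\<close>. By the
  hypothesis the basis stays independent over \<open>Z\<close>, so the relation is a linear system with
  coefficients in \<open>G(l)\<close>, and its solvability descends.\<close>

lemma descends_fracs:
  fixes F :: "'d::division_ring set"
  assumes F: "division_subring F" and G: "division_subring G" and Z: "division_subring Z"
    and GF: "G \<subseteq> F" and GZ: "G \<subseteq> Z"
    and central: "\<And>z d. z \<in> Z \<Longrightarrow> z * d = d * z"
    and desc: "descends Z F G" and l: "l \<in> Z" "transc F l"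
  shows "descends Z (fracs F l) (fracs G l)"
  unfolding descends_def
proof (intro allI impI)
  fix n :: nat and f :: "nat \<Rightarrow> 'd"
  assume f: "\<forall>i<n. f i \<in> fracs F l"
  assume "\<exists>c. (\<forall>i<n. c i \<in> Z) \<and> (\<exists>i<n. c i \<noteq> 0) \<and> (\<Sum>i<n. f i * c i) = 0"
  then obtain c where c: "\<forall>i<n. c i \<in> Z" "\<exists>i<n. c i \<noteq> 0" "(\<Sum>i<n. f i * c i) = 0" by blast
  interpret Z: division_subring Z by fact
  interpret F: transcendental_ext F l
    using F l central[of l] by (simp add: transcendental_ext_def transcendental_ext_axioms_def)
  interpret G: transcendental_ext G l
    using G l central[of l] transc_mono[OF l(2) GF] by (simp add: transcendental_ext_def transcendental_ext_axioms_def)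
  from F.common_denominator[of "{..<n}" f] f obtain q where
    q: "q \<in> polys F l" "q \<noteq> 0" "\<forall>i<n. f i * q \<in> polys F l" by auto
  have "\<exists>N. \<forall>i<n. f i * q \<in> polyb F l N"
  proof -
    from q(3) have "\<forall>i\<in>{..<n}. \<exists>N. f i * q \<in> polyb F l N" by (auto simp: polys_def)
    then obtain N where N: "\<forall>i\<in>{..<n}. f i * q \<in> polyb F l (N i)" by metis
    have "f i * q \<in> polyb F l (Max (N ` {..<n}))" if "i < n" for i
    proof -
      have "N i \<le> Max (N ` {..<n})" using that by simp
      then show ?thesis using polyb_mono[of "N i" "Max (N ` {..<n})" F l] N that by auto
    qed
    then show ?thesis by blast
  qed
  then obtain N where N: "\<forall>i<n. f i * q \<in> polyb F l N" by blast
  then have "\<forall>i\<in>{..<n}. \<exists>a. (\<forall>j. a j \<in> F) \<and> f i * q = (\<Sum>j<N. l ^ j * a j)" by (auto simp: F.polyb_iff)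
  then obtain a where a: "\<forall>i\<in>{..<n}. (\<forall>j. a i j \<in> F) \<and> f i * q = (\<Sum>j<N. l ^ j * a i j)" by metis
  define X where "X = (\<lambda>(i, j). a i j) ` ({..<n} \<times> {..<N})"
  have XF: "X \<subseteq> F" using a by (auto simp: X_def)
  have finX: "finite X" by (simp add: X_def)
  from G.rbasis[OF G.rfin_rspan[OF finX] rsubspace_rspan] obtain B where
    B: "B \<subseteq> rspan G X" "rindep G B" "rspan G X = rspan G B" by metis
  have finB: "finite B" using B(2) by (rule G.rindep_finite)
  have BF: "B \<subseteq> F"
    using B(1) rspan_minimal[OF rsubspace_subfield[OF F.rsubspace_self GF] XF] by blast
  have "\<forall>p\<in>{..<n} \<times> {..<N}. \<exists>s. (\<forall>b\<in>B. s b \<in> G) \<and> a (fst p) (snd p) = (\<Sum>b\<in>B. b * s b)"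
  proof
    fix p assume "p \<in> {..<n} \<times> {..<N}"
    then have "a (fst p) (snd p) \<in> X" by (force simp: X_def)
    then have "a (fst p) (snd p) \<in> rspan G B" using B(3) rspan_superset[of X G] by blast
    then show "\<exists>s. (\<forall>b\<in>B. s b \<in> G) \<and> a (fst p) (snd p) = (\<Sum>b\<in>B. b * s b)"
      unfolding G.rspan_finite[OF finB] by blast
  qed
  then obtain s where s: "\<forall>p\<in>{..<n} \<times> {..<N}. (\<forall>b\<in>B. s p b \<in> G) \<and> a (fst p) (snd p) = (\<Sum>b\<in>B. b * s p b)"
    by metis
  define S where "S = (\<lambda>i b. \<Sum>j<N. l ^ j * s (i, j) b)"
  have SG: "S i b \<in> polys G l" if "i < n" "b \<in> B" for i b
    unfolding S_def by (rule subsetD[OF polyb_subset_polys G.polybI]) (use s that in auto)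
  have SZ: "S i b \<in> Z" if "i < n" "b \<in> B" for i b
    using SG[OF that] G.polys_subset(1)[OF Z GZ l(1)] by blast
  have lz: "l ^ j * d = d * l ^ j" for j d using central[OF Z.power_mem[OF l(1)]] .
  have pS: "f i * q = (\<Sum>b\<in>B. b * S i b)" if "i < n" for i
  proof -
    have "f i * q = (\<Sum>j<N. l ^ j * (\<Sum>b\<in>B. b * s (i, j) b))"
      using a s that by (intro trans[OF conjunct2[OF a[rule_format, of i]] sum.cong]) auto
    also have "\<dots> = (\<Sum>j<N. \<Sum>b\<in>B. b * (l ^ j * s (i, j) b))"
      unfolding sum_distrib_left by (intro sum.cong refl) (metis lz mult.assoc)
    also have "\<dots> = (\<Sum>b\<in>B. b * S i b)"
      by (subst sum.swap) (simp add: S_def sum_distrib_left)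
    finally show ?thesis .
  qed
  have comb: "(\<Sum>i<n. f i * e i) * q = (\<Sum>b\<in>B. b * (\<Sum>i<n. S i b * e i))" if "\<forall>i<n. e i \<in> Z" for e
  proof -
    have "(\<Sum>i<n. f i * e i) * q = (\<Sum>i<n. f i * q * e i)"
      unfolding sum_distrib_right using that central by (intro sum.cong refl) (simp add: mult.assoc)
    also have "\<dots> = (\<Sum>i<n. \<Sum>b\<in>B. b * (S i b * e i))"
      by (intro sum.cong refl) (simp add: pS sum_distrib_right mult.assoc)
    also have "\<dots> = (\<Sum>b\<in>B. b * (\<Sum>i<n. S i b * e i))"
      by (subst sum.swap) (simp add: sum_distrib_left)
    finally show ?thesis .
  qed
  have "(\<Sum>i<n. S i b * c i) = 0" if "b \<in> B" for b
  proof (rule ccontr)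
    assume nz: "(\<Sum>i<n. S i b * c i) \<noteq> 0"
    have "\<forall>b\<in>B. (\<Sum>i<n. S i b * c i) \<in> Z" using SZ c(1) by (auto intro!: Z.sum_mem Z.mult_mem)
    moreover have "(\<Sum>b\<in>B. b * (\<Sum>i<n. S i b * c i)) = 0" using comb[OF c(1)] c(3) by simp
    moreover have "\<exists>b\<in>B. (\<Sum>i<n. S i b * c i) \<noteq> 0" using that nz by (rule bexI[rotated])
    moreover have "\<forall>b\<in>B. b \<in> F" using BF by auto
    ultimately have "\<exists>d. (\<forall>b\<in>B. d b \<in> G) \<and> (\<exists>b\<in>B. d b \<noteq> 0) \<and> (\<Sum>b\<in>B. b * d b) = 0"
      by (intro descendsD[OF desc finB, where c = "\<lambda>b. \<Sum>i<n. S i b * c i"])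
    then obtain d where d: "\<forall>b\<in>B. d b \<in> G" "\<exists>b\<in>B. d b \<noteq> 0" "(\<Sum>b\<in>B. b * d b) = 0"
      by blast
    with G.rindepD[OF B(2) d(1) d(3)] show False by auto
  qed
  moreover interpret G1: division_subring "fracs G l" by (rule G.division_subring_fracs)
  have "S i b \<in> fracs G l" if "i \<in> {..<n}" "b \<in> B" for i b using SG that G.polys_fracs by auto
  moreover have "\<exists>i\<in>{..<n}. c i \<noteq> 0" using c(2) by auto
  ultimately have "\<exists>e. (\<forall>i\<in>{..<n}. e i \<in> fracs G l) \<and> (\<exists>i\<in>{..<n}. e i \<noteq> 0) \<and>
      (\<forall>b\<in>B. (\<Sum>i<n. S i b * e i) = 0)"
    by (intro G1.system_descent[where c = c]) auto
  then obtain e where e: "\<forall>i\<in>{..<n}. e i \<in> fracs G l" "\<exists>i\<in>{..<n}. e i \<noteq> 0"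
    "\<forall>b\<in>B. (\<Sum>i<n. S i b * e i) = 0" by blast
  have "\<forall>i<n. e i \<in> Z" using e(1) G.polys_subset(2)[OF Z GZ l(1)] by auto
  from comb[OF this] e(3) have "(\<Sum>i<n. f i * e i) * q = 0" by simp
  then have "(\<Sum>i<n. f i * e i) = 0" using q(2) by simp
  with e show "\<exists>c. (\<forall>i<n. c i \<in> fracs G l) \<and> (\<exists>i<n. c i \<noteq> 0) \<and> (\<Sum>i<n. f i * c i) = 0"
    by (intro exI[of _ e]) auto
qed

section \<open>Free subalgebras from generic central elements\<close>

text \<open>Terms for the elements of a countable division ring that is closed also under a choice of
  coefficients: \<open>HCoeff ts n\<close> stands for the \<open>n\<close>-th coefficient of a relation over \<open>Z\<close> between the
  values of \<open>ts\<close>.\<close>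

datatype hull_term = HGen nat | HOne | HDiff hull_term hull_term | HMult hull_term hull_term
  | HInv hull_term | HCoeff "hull_term list" nat

instance hull_term :: countable
  by countable_datatype

primrec hull_eval :: "(nat \<Rightarrow> 'd::division_ring) \<Rightarrow> ('d list \<Rightarrow> nat \<Rightarrow> 'd) \<Rightarrow> hull_term \<Rightarrow> 'd" where
  "hull_eval g k (HGen n) = g n"
| "hull_eval g k HOne = 1"
| "hull_eval g k (HDiff s t) = hull_eval g k s - hull_eval g k t"
| "hull_eval g k (HMult s t) = hull_eval g k s * hull_eval g k t"
| "hull_eval g k (HInv s) = inverse (hull_eval g k s)"
| "hull_eval g k (HCoeff ts n) = k (map (hull_eval g k) ts) n"

lemma countable_hull:
  fixes Z :: "'d::division_ring set"
  assumes Z: "division_subring Z"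
  shows "\<exists>F. division_subring F \<and> countable F \<and> x \<in> F \<and> a \<in> F \<and> descends Z F (Z \<inter> F)"
proof -
  interpret Z: division_subring Z by fact
  \<comment> \<open>A relation over \<open>Z\<close> between the entries of \<open>xs\<close>; \<open>k xs\<close> is a chosen one, if any exists.\<close>
  define ok where "ok = (\<lambda>(xs :: 'd list) c. (\<forall>i. c i \<in> Z) \<and> (\<exists>i<length xs. c i \<noteq> 0) \<and> (\<Sum>i<length xs. xs ! i * c i) = 0)"
  define k where "k = (\<lambda>xs. SOME c. ok xs c)"
  define g where "g = (\<lambda>n::nat. if n = 0 then x else a)"
  define F where "F = range (hull_eval g k)"
  have "division_subring F"
  proof
    show "1 \<in> F" unfolding F_def by (rule range_eqI[of _ _ HOne]) simp
    fix s t assume "s \<in> F" "t \<in> F"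
    then obtain p q where pq: "s = hull_eval g k p" "t = hull_eval g k q" by (auto simp: F_def)
    show "s - t \<in> F" unfolding F_def by (rule range_eqI[of _ _ "HDiff p q"]) (simp add: pq)
    show "s * t \<in> F" unfolding F_def by (rule range_eqI[of _ _ "HMult p q"]) (simp add: pq)
  next
    fix s assume "s \<in> F"
    then obtain p where pq: "s = hull_eval g k p" by (auto simp: F_def)
    show "inverse s \<in> F" unfolding F_def by (rule range_eqI[of _ _ "HInv p"]) (simp add: pq)
  qed
  moreover have "countable F" by (simp add: F_def)
  moreover have "x \<in> F" unfolding F_def by (rule range_eqI[of _ _ "HGen 0"]) (simp add: g_def)
  moreover have "a \<in> F" unfolding F_def by (rule range_eqI[of _ _ "HGen 1"]) (simp add: g_def)
  moreover have "descends Z F (Z \<inter> F)" unfolding descends_def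
  proof (intro allI impI)
    fix n :: nat and f assume f: "\<forall>i<n. f i \<in> F"
    assume "\<exists>c. (\<forall>i<n. c i \<in> Z) \<and> (\<exists>i<n. c i \<noteq> 0) \<and> (\<Sum>i<n. f i * c i) = 0"
    then obtain c where c: "\<forall>i<n. c i \<in> Z" "\<exists>i<n. c i \<noteq> 0" "(\<Sum>i<n. f i * c i) = 0" by blast
    have "\<forall>i\<in>{..<n}. \<exists>t. f i = hull_eval g k t" using f by (auto simp: F_def)
    then obtain t where t: "\<forall>i\<in>{..<n}. f i = hull_eval g k (t i)" by metis
    define ts where "ts = map t [0..<n]"
    define xs where "xs = map (hull_eval g k) ts"
    have len: "length xs = n" by (simp add: xs_def ts_def)
    have nth: "xs ! i = f i" if "i < n" for i using that t by (simp add: xs_def ts_def)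
    have "ok xs (\<lambda>i. if i < n then c i else 0)"
      unfolding ok_def len using c Z.zero_mem nth by auto
    then have "ok xs (k xs)" unfolding k_def by (rule someI[of "ok xs"])
    then have "\<forall>i. k xs i \<in> Z" "\<exists>i<n. k xs i \<noteq> 0" "(\<Sum>i<n. xs ! i * k xs i) = 0"
      unfolding ok_def len by auto
    moreover have "k xs i \<in> F" for i
      unfolding F_def by (rule range_eqI[of _ _ "HCoeff ts i"]) (simp add: xs_def)
    moreover have "(\<Sum>i<n. f i * k xs i) = (\<Sum>i<n. xs ! i * k xs i)"
      by (rule sum.cong[OF refl]) (simp add: nth)
    ultimately show "\<exists>c. (\<forall>i<n. c i \<in> Z \<inter> F) \<and> (\<exists>i<n. c i \<noteq> 0) \<and> (\<Sum>i<n. f i * c i) = 0"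
      by (intro exI[of _ "k xs"]) auto
  qed
  ultimately show ?thesis by blast
qed

definition free_pair :: "'d::division_ring set \<Rightarrow> 'd \<Rightarrow> 'd \<Rightarrow> bool" where
  "free_pair Z y z \<longleftrightarrow> (\<forall>n c. (\<forall>w. c w \<in> Z) \<longrightarrow>
     (\<Sum>w\<in>words_upto n. c w * prod_list (map (\<lambda>b. if b then y else z) w)) = 0 \<longrightarrow>
     (\<forall>w\<in>words_upto n. c w = 0))"

lemma transc_nonzero:
  assumes "transc Z x" "1 \<in> Z" "0 \<in> Z" shows "x \<noteq> 0"
proof
  assume "x = 0"
  have "(\<lambda>i. if i = 1 then 1 else 0) (1::nat) = (0::'a)"
    by (rule transcD[OF assms(1), of 2]) (use assms \<open>x = 0\<close> in \<open>auto simp: numeral_2_eq_2\<close>)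
  then show False by simp
qed

lemma transc_inverse_powers:
  assumes "transc Z x" "x \<noteq> 0" and comm: "\<And>c. c \<in> Z \<Longrightarrow> c * x = x * c"
    and c: "\<And>j. j < N \<Longrightarrow> c j \<in> Z" "(\<Sum>j<N. c j * inverse x ^ j) = 0" and j: "j < N"
  shows "c j = 0"
proof -
  have cx: "c j * x ^ i = x ^ i * c j" if "j < N" for i j
    using comm[OF c(1)[OF that]] by (induction i) (auto simp: mult.assoc[symmetric], simp add: mult.assoc)
  have "c j * inverse x ^ j * x ^ (N - 1) = x ^ (N - 1 - j) * c j" if "j < N" for j
  proof -
    have "x ^ (N - 1) = x ^ j * x ^ (N - 1 - j)" using that by (simp add: power_add[symmetric])
    moreover have "inverse x ^ j * x ^ j = 1" using assms(2) by (simp add: power_inverse)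
    ultimately have "inverse x ^ j * x ^ (N - 1) = x ^ (N - 1 - j)" by (simp add: mult.assoc[symmetric])
    then show ?thesis using cx[OF that] by (simp add: mult.assoc)
  qed
  then have "(\<Sum>j<N. c j * inverse x ^ j) * x ^ (N - 1) = (\<Sum>j<N. x ^ (N - 1 - j) * c j)"
    unfolding sum_distrib_right by (intro sum.cong) auto
  also have "\<dots> = (\<Sum>i<N. x ^ i * c (N - 1 - i))"
    by (rule sum.reindex_bij_witness[of _ "\<lambda>i. N - 1 - i" "\<lambda>i. N - 1 - i"]) auto
  finally have "(\<Sum>i<N. x ^ i * c (N - 1 - i)) = 0" using c(2) by simp
  moreover have "c (N - 1 - i) \<in> Z" if "i < N" for i using c(1)[of "N - 1 - i"] that by simp
  ultimately have "c (N - 1 - (N - 1 - j)) = 0"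
    using transcD[OF assms(1), of N "\<lambda>i. c (N - 1 - i)" "N - 1 - j"] j by simp
  then show ?thesis using j by simp
qed

text \<open>Coefficients polynomial in \<open>m\<close> are absorbed: \<open>m\<^sup>j = x\<^sup>-\<^sup>j t\<^sup>j\<close>, and \<open>t\<^sup>j\<close> acts as the identity on the
  longest words modulo shorter ones. So a relation gives one over \<open>F\<close> whose top coefficients are
  polynomials in \<open>x\<^sup>-\<^sup>1\<close> over \<open>G\<close>, and these vanish only trivially.\<close>

lemma (in free_criterion) free_over_generic:
  fixes m x :: 'd
  assumes G: "division_subring G" "G \<subseteq> F" and R: "R = polys F m"
    and m: "transc F m" and m0: "m \<noteq> 0" and t: "t = m * x" and mc: "\<And>d. m * d = d * m"
    and Gc: "\<And>g d. g \<in> G \<Longrightarrow> g * d = d * g" and x: "x \<in> F" "transc G x"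
    and rel: "\<And>w. c w \<in> polys G m" "(\<Sum>w\<in>words_upto n. W w * c w) = 0" and w: "w \<in> words_upto n"
  shows "c w = 0"
proof (rule ccontr)
  assume "c w \<noteq> 0"
  interpret G: division_subring G by fact
  have x0: "x \<noteq> 0" using t t0 by auto
  have "\<forall>w. \<exists>N. c w \<in> polyb G m N" using rel(1) by (auto simp: polys_def)
  then obtain N' where N': "\<And>w. c w \<in> polyb G m (N' w)" by metis
  define N where "N = Max (N' ` words_upto n)"
  have "c v \<in> polyb G m N" if "v \<in> words_upto n" for v
    using N'[of v] polyb_mono[of "N' v" N G m] finite_words_upto[of n] that by (auto simp: N_def)
  then have "\<forall>v\<in>words_upto n. \<exists>g. (\<forall>j. g j \<in> G) \<and> c v = (\<Sum>j<N. m ^ j * g j)" by (auto simp: G.polyb_iff)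
  then obtain g where g: "\<And>v j. v \<in> words_upto n \<Longrightarrow> g v j \<in> G"
    "\<And>v. v \<in> words_upto n \<Longrightarrow> c v = (\<Sum>j<N. m ^ j * g v j)" by metis
  define L where "L = Max (length ` {v \<in> words_upto n. c v \<noteq> 0})"
  have finL: "finite {v \<in> words_upto n. c v \<noteq> 0}" using finite_words_upto[of n] by simp
  have wmem: "w \<in> {v \<in> words_upto n. c v \<noteq> 0}" using w \<open>c w \<noteq> 0\<close> by blast
  have "L \<in> length ` {v \<in> words_upto n. c v \<noteq> 0}"
    unfolding L_def by (rule Max_in) (use finL wmem in blast)+
  then obtain v where v: "v \<in> words_upto n" "c v \<noteq> 0" "length v = L" by blast
  have above: "c u = 0" if "u \<in> words_upto n" "length u > L" for u
  proof (rule ccontr)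
    assume "c u \<noteq> 0"
    then have "length u \<le> L" unfolding L_def using finL that by (intro Max_ge) auto
    then show False using that by simp
  qed
  have Ln: "L \<le> n" using v by (auto simp: words_upto_def)
  define h where "h = (\<lambda>v. \<Sum>j<N. g v j * inverse x ^ j)"
  have hF: "h u \<in> F" if "u \<in> words_upto n" for u
    unfolding h_def using g(1)[OF that] G(2) x by (intro sum_mem mult_mem power_mem inverse_mem) auto
  have mj: "m ^ j * d = d * m ^ j" for j d by (rule power_commuting_commutes[OF mc])
  have tx: "inverse x ^ j * t ^ j = m ^ j" for j
  proof -
    have "t ^ j = m ^ j * x ^ j"
    proof (induction j)
      case (Suc j)
      have "t ^ Suc j = m * (x * m ^ j) * x ^ j" by (simp add: Suc) (simp add: t mult.assoc)
      also have "\<dots> = m * (m ^ j * x) * x ^ j" by (simp only: mj)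
      finally show ?case by (simp add: mult.assoc)
    qed simp
    moreover have "inverse x ^ j * (m ^ j * x ^ j) = m ^ j * (inverse x ^ j * x ^ j)"
    proof -
      show ?thesis by (metis mj mult.assoc)
    qed
    moreover have "inverse x ^ j * x ^ j = 1" using x0 by (simp add: power_inverse)
    ultimately show ?thesis by simp
  qed
  have expand: "W u * c u = (\<Sum>j<N. g u j * inverse x ^ j * (t ^ j * W u))" if "u \<in> words_upto n" for u
  proof -
    have "W u * (m ^ j * g u j) = g u j * inverse x ^ j * (t ^ j * W u)" for j
    proof -
      have "W u * (m ^ j * g u j) = (m ^ j * g u j) * W u"
        using mj[of j "W u"] Gc[OF g(1)[OF that], of j "W u"] by (metis mult.assoc)
      also have "\<dots> = g u j * (m ^ j * W u)" by (metis mj mult.assoc)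
      also have "\<dots> = g u j * inverse x ^ j * (t ^ j * W u)" using tx[of j] by (metis mult.assoc)
      finally show ?thesis .
    qed
    then show ?thesis unfolding g(2)[OF that] sum_distrib_left by (intro sum.cong) auto
  qed
  have hv: "h v \<noteq> 0"
  proof
    assume "h v = 0"
    have "g v j = 0" if "j < N" for j
    proof (rule transc_inverse_powers[OF x(2) x0, of N "g v"])
      show "c * x = x * c" if "c \<in> G" for c by (rule Gc[OF that])
      show "(\<Sum>j<N. g v j * inverse x ^ j) = 0" using \<open>h v = 0\<close> by (simp add: h_def)
    qed (use g(1)[OF v(1)] that in auto)
    then have "c v = 0" by (simp add: g(2)[OF v(1)])
    with v show False by simp
  qed
  show False
  proof (cases L)
    case 0
    then have vN: "v = []" using v by simp
    have "(\<Sum>w\<in>words_upto n. W w * c w) = W [] * c []"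
      unfolding words_upto_eq using finite_nonempty_words_upto[of n]
      by (subst sum.insert)
        (auto simp: nonempty_words_upto_def words_upto_def above[unfolded 0] intro!: sum.neutral)
    with rel(2) have "c [] = 0" by (simp add: W_Nil)
    with v vN show False by simp
  next
    case (Suc l)
    have part: "W u * c u - (if length u = Suc l then h u * W u else 0) \<in> M l" if u: "u \<in> words_upto n" for u
    proof (cases "length u > L")
      case True
      then show ?thesis using above[OF u] Suc R_M[OF R_zero] by simp
    next
      case False
      then have lu: "length u \<le> Suc l" using Suc by simp
      have "W u * c u - h u * W u = (\<Sum>j<N. g u j * inverse x ^ j * (t ^ j * W u - W u))"
        unfolding expand[OF u] h_def by (simp add: sum_distrib_right right_diff_distrib sum_subtractf)
      also have "\<dots> \<in> M l"
        using g(1)[OF u] G(2) x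
        by (intro M_sum M_mult t_power_W[OF lu] mult_mem power_mem inverse_mem) auto
      finally have 1: "W u * c u - h u * W u \<in> M l" .
      show ?thesis
      proof (cases "length u = Suc l")
        case False
        then have "h u * W u \<in> M l" using lu hF[OF u] by (intro M_mult W_M) auto
        from M_add[OF 1 this] False show ?thesis by simp
      qed (use 1 in simp)
    qed
    have "(\<Sum>u\<in>words_upto n. W u * c u - (if length u = Suc l then h u * W u else 0)) \<in> M l"
      by (rule M_sum) (rule part)
    moreover have "(\<Sum>u\<in>words_upto n. (if length u = Suc l then h u * W u else 0))
        = (\<Sum>u\<in>{u. length u = Suc l}. h u * W u)"
      by (rule sum.mono_neutral_cong_right)
        (use Ln Suc in \<open>auto simp: finite_words_upto\<close>, auto simp: words_upto_def)
    ultimately have "- (\<Sum>u\<in>{u. length u = Suc l}. h u * W u) \<in> M l"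
      using rel(2) by (simp add: sum_subtractf)
    from M_mult[OF this uminus_mem[OF one_mem]]
    have sumM: "(\<Sum>u\<in>{u. length u = Suc l}. h u * W u) \<in> M l" by simp
    define h' where "h' = (\<lambda>u. if length u = Suc l then h u else 0)"
    have "(\<Sum>u\<in>{u. length u = Suc l}. h' u * W u) = (\<Sum>u\<in>{u. length u = Suc l}. h u * W u)"
      by (rule sum.cong) (auto simp: h'_def)
    with sumM have sumM': "(\<Sum>u\<in>{u. length u = Suc l}. h' u * W u) \<in> M l" by simp
    have "h' u \<in> F" for u
      using hF[of u] Ln Suc by (auto simp: h'_def zero_mem words_upto_def)
    from M_zero_imp[OF this sumM', of v] v Suc hv show False by (simp add: h'_def)
  qed
qed

text \<open>With \<open>t = m x\<close> conjugation by \<open>t\<close> is conjugation by \<open>x\<close>. If the equation has no solution, the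
  criterion applies to \<open>(1 - t)\<^sup>-\<^sup>1\<close> and \<open>(1 - t)\<^sup>-\<^sup>1 (a - l)\<^sup>-\<^sup>1\<close>. It excludes relations with coefficients
  in \<open>G(l)(m)\<close>, where \<open>G\<close> is countable, and by linear disjointness those over \<open>Z\<close>.\<close>

theorem free_or_equation:
  fixes Z :: "'d::division_ring set"
  assumes Z: "division_subring Z" and central: "\<And>z d. z \<in> Z \<Longrightarrow> z * d = d * z"
    and unc: "uncountable Z" and x: "transc Z x" and no_free: "\<And>y z. \<not> free_pair Z y z"
  shows "\<exists>F l. division_subring F \<and> x \<in> F \<and> a \<in> F \<and> l \<in> Z \<and> transc F l \<and>
    (\<exists>e u. (\<forall>i. e i \<in> fracs F l \<and> x * e i = e i * x) \<and> (\<exists>i. e i \<noteq> 0) \<and> u \<in> fracs F l \<and>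
       e True + e False * inverse (a - l) = x * u * inverse x - u)"
proof -
  interpret Z: division_subring Z by fact
  have x0: "x \<noteq> 0" using transc_nonzero[OF x Z.one_mem Z.zero_mem] .
  from countable_hull[OF Z, of x a] obtain F where
    F: "division_subring F" "countable F" "x \<in> F" "a \<in> F" "descends Z F (Z \<inter> F)" by blast
  have Zc: "l * m = m * l" if "l \<in> Z" for l m using central that .
  from exists_generic[OF F(2) unc Zc] obtain l where l: "l \<in> Z" "transc F l" by blast
  interpret F: transcendental_ext F l
    using F l central[of l] by (simp add: transcendental_ext_def transcendental_ext_axioms_def)
  define F1 where "F1 = fracs F l"
  have F1: "division_subring F1" "countable F1"
    using F.division_subring_fracs countable_fracs[OF F(1,2)] by (auto simp: F1_def)
  from exists_generic[OF F1(2) unc Zc] obtain m where m: "m \<in> Z" "transc F1 m" by blast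
  interpret F1: transcendental_ext F1 m
    using F1 m central[of m] by (simp add: transcendental_ext_def transcendental_ext_axioms_def)
  have xF1: "x \<in> F1" and aF1: "a \<in> F1" and lF1: "l \<in> F1"
    using F.const_fracs F.var_fracs F by (auto simp: F1_def)
  define G where "G = Z \<inter> F"
  have G: "division_subring G" unfolding G_def by (rule division_subring_Int[OF Z F(1)])
  interpret G: transcendental_ext G l
    using G l central[of l] transc_mono[OF l(2), of G]
    by (simp add: transcendental_ext_def transcendental_ext_axioms_def G_def)
  define G1 where "G1 = fracs G l"
  have G1: "division_subring G1" "G1 \<subseteq> F1" "G1 \<subseteq> Z"
    unfolding G1_def F1_def using G.division_subring_fracs fracs_field_mono[of G F l] G.polys_subset(2)[OF Z _ l(1)]
    by (auto simp: G_def)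
  interpret G1: transcendental_ext G1 m
    using G1 m central[of m] transc_mono[OF m(2) G1(2)]
    by (simp add: transcendental_ext_def transcendental_ext_axioms_def)
  have desc: "descends Z (fracs F1 m) (fracs G1 m)"
  proof (rule descends_fracs[OF F1(1) G1(1) Z G1(2,3) central _ m])
    show "descends Z F1 G1" unfolding F1_def G1_def
      by (rule descends_fracs[OF F(1) G Z _ _ central F(5)[folded G_def] l]) (auto simp: G_def)
  qed
  have m0: "m \<noteq> 0" using transc_nonzero[OF m(2) F1.one_mem F1.zero_mem] .
  have mc: "m * d = d * m" for d using central m by blast
  define t where "t = m * x"
  define b where "b = (\<lambda>i. if i then 1 else inverse (a - l))"
  have bF1: "b i \<in> F1" for i
    using F1.one_mem F1.inverse_mem[OF F1.diff_mem[OF aF1 lF1]] by (auto simp: b_def)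
  have t0: "t \<noteq> 0" using x0 m0 by (simp add: t_def)
  have conj: "t * c * inverse t = x * c * inverse x" for c
  proof -
    have "inverse t = inverse x * inverse m" using x0 m0 by (simp add: t_def nonzero_inverse_mult_distrib)
    then have "t * c * inverse t = m * (x * c * inverse x) * inverse m" by (simp add: t_def mult.assoc)
    also have "\<dots> = x * c * inverse x" using m0 by (simp only: mc) (simp add: mult.assoc)
    finally show ?thesis .
  qed
  have tc: "t * c = c * t \<longleftrightarrow> x * c = c * x" for c
  proof -
    have "t * c = m * (x * c)" "c * t = m * (c * x)" using mc[of c] by (simp_all add: t_def mult.assoc[symmetric])
    then show ?thesis using m0 by simp
  qed
  have lead: "c = 0" if "c \<in> F1" "p \<in> polys F1 m" "c = (1 - t) * p" for c p
  proof -
    have "c = (m ^ 1 * (- x) + 1) * p" using that(3) by (simp add: t_def algebra_simps)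
    moreover have "c \<in> polyb F1 m 1" using that(1) F1.const_polyb1 by simp
    moreover have "1 \<in> polyb F1 m 1" using F1.one_mem F1.const_polyb1 by simp
    ultimately have "p = 0"
      using F1.mult_small_zero[of "- x" 1 1 p] F1.uminus_mem[OF xF1] x0 that(2) by simp
    then show ?thesis using that(3) by simp
  qed
  have t1: "t \<noteq> 1"
  proof
    assume "t = 1"
    then have "m ^ 1 * x + (-1) = 0" by (simp add: t_def)
    moreover have "-1 \<in> polyb F1 m 1" using F1.uminus_mem[OF F1.one_mem] F1.const_polyb1 by simp
    ultimately show False using F1.lead_zero[OF xF1] x0 by blast
  qed
  show ?thesis
  proof (rule ccontr)
    assume contr: "\<not> ?thesis"
    interpret crit: free_criterion F1 t "polys F1 m" b
    proof
      fix c assume c: "c \<in> F1"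
      show "t * c * inverse t \<in> F1"
        unfolding conj using c xF1 F1.mult_mem F1.inverse_mem by blast
      show "c * r \<in> polys F1 m" if "r \<in> polys F1 m" for r
        using F1.mult_polys[OF F1.const_polys[OF c] that] .
      show "c = 0" if "inverse (1 - t) * c \<in> polys F1 m"
      proof (rule lead[OF c that])
        have "1 - t \<noteq> 0" using t1 by simp
        then show "c = (1 - t) * (inverse (1 - t) * c)" by (simp add: mult.assoc[symmetric])
      qed
    next
      fix r assume r: "r \<in> polys F1 m"
      have "m * (x * r) \<in> polys F1 m"
        by (intro F1.mult_polys F1.var_polys F1.const_polys xF1 r)
      then show "t * r \<in> polys F1 m" by (simp add: t_def mult.assoc)
    next
      fix e v j
      assume e: "\<And>i. e i \<in> F1" "\<And>i. t * e i = e i * t" and v: "v \<in> F1"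
        and eq: "(\<Sum>i\<in>UNIV. e i * b i) = t * v * inverse t - v"
      show "e j = 0"
      proof (rule ccontr)
        assume "e j \<noteq> 0"
        moreover have "e True + e False * inverse (a - l) = x * v * inverse x - v"
          using eq unfolding conj by (simp add: b_def UNIV_bool add.commute)
        ultimately show False using contr F l e v tc unfolding F1_def by blast
      qed
    qed (use t0 t1 bF1 F1.const_polys[OF F1.one_mem] F1.diff_polys in auto)
    define y where "y = inverse (1 - t) * b True"
    define z where "z = inverse (1 - t) * b False"
    have yz: "(\<lambda>i. inverse (1 - t) * b i) = (\<lambda>i. if i then y else z)" by (auto simp: y_def z_def)
    have Weq: "prod_list (map (\<lambda>i. if i then y else z) w) = crit.W w" for w
      unfolding crit.W_def yz ..
    interpret H: division_subring "fracs F1 m" by (rule F1.division_subring_fracs)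
    have tH: "t \<in> fracs F1 m"
      unfolding t_def using H.mult_mem F1.var_fracs F1.const_fracs[OF xF1] by blast
    have WH: "crit.W w \<in> fracs F1 m" for w
    proof (induction w)
      case Nil
      then show ?case using H.one_mem by (simp add: crit.W_Nil)
    next
      case (Cons i w)
      then show ?case unfolding crit.W_Cons
        by (intro H.mult_mem H.inverse_mem H.diff_mem H.one_mem tH F1.const_fracs[OF bF1])
    qed
    have "free_pair Z y z" unfolding free_pair_def Weq
    proof (intro allI impI, rule ccontr)
      fix n c assume c: "\<forall>w. c w \<in> Z" "(\<Sum>w\<in>words_upto n. c w * crit.W w) = 0"
        and nz: "\<not> (\<forall>w\<in>words_upto n. c w = 0)"
      have "(\<Sum>w\<in>words_upto n. crit.W w * c w) = 0"
        unfolding c(2)[symmetric] by (intro sum.cong refl central[symmetric] c(1)[rule_format])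
      then have "\<exists>d. (\<forall>w\<in>words_upto n. d w \<in> fracs G1 m) \<and> (\<exists>w\<in>words_upto n. d w \<noteq> 0)
          \<and> (\<Sum>w\<in>words_upto n. crit.W w * d w) = 0"
        using c(1) nz WH by (intro descendsD[OF desc finite_words_upto, where c = c]) auto
      then obtain d where d: "\<forall>w\<in>words_upto n. d w \<in> fracs G1 m" "\<exists>w\<in>words_upto n. d w \<noteq> 0"
        "(\<Sum>w\<in>words_upto n. crit.W w * d w) = 0" by blast
      have "\<exists>q\<in>polys G1 m. q \<noteq> 0 \<and> (\<forall>w\<in>words_upto n. d w * q \<in> polys G1 m)"
        by (rule G1.common_denominator[OF finite_words_upto]) (rule d(1)[rule_format])
      then obtain q where
        q: "q \<in> polys G1 m" "q \<noteq> 0" "\<forall>w\<in>words_upto n. d w * q \<in> polys G1 m"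
        by (elim bexE conjE)
      define p where "p = (\<lambda>w. if w \<in> words_upto n then d w * q else 0)"
      have pP: "p w \<in> polys G1 m" for w using q(3) G1.zero_polys by (simp add: p_def)
      have "(\<Sum>w\<in>words_upto n. crit.W w * p w) = (\<Sum>w\<in>words_upto n. crit.W w * d w) * q"
        unfolding sum_distrib_right by (intro sum.cong refl) (simp add: p_def mult.assoc)
      then have psum: "(\<Sum>w\<in>words_upto n. crit.W w * p w) = 0" using d(3) by simp
      have "p w = 0" if "w \<in> words_upto n" for w
        by (rule crit.free_over_generic[OF G1(1,2) refl m(2) m0 t_def mc _ xF1 transc_mono[OF x G1(3)] pP psum that])
          (use G1(3) central in blast)
      then have "\<forall>w\<in>words_upto n. d w = 0" using q(2) by (simp add: p_def)
      with d(2) show False by blast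
    qed
    with no_free show False by blast
  qed
qed

section \<open>Poles and algebraicity over the centralizer\<close>

definition left_transc :: "'d::division_ring set \<Rightarrow> 'd \<Rightarrow> bool" where
  "left_transc F l \<longleftrightarrow> (\<forall>n c. (\<forall>i<n. c i \<in> F) \<longrightarrow> (\<Sum>i<n. c i * l ^ i) = 0 \<longrightarrow> (\<forall>i<n. c i = 0))"

lemma left_transcD:
  "left_transc F l \<Longrightarrow> \<forall>i<n. c i \<in> F \<Longrightarrow> (\<Sum>i<n. c i * l ^ i) = 0 \<Longrightarrow> i < n \<Longrightarrow> c i = 0"
  unfolding left_transc_def by blast

lemma centralizer_singleton: "c \<in> centralizer {x} \<longleftrightarrow> c * x = x * c"
  by (auto simp: centralizer_def)

text \<open>If \<open>l - a\<close> divides a polynomial on the left, then \<open>a\<close> is a root of it.\<close>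

lemma (in transcendental_ext) root_of_left_factor:
  assumes a: "a \<in> F" and c: "\<And>i. i < n \<Longrightarrow> c i \<in> F" and g: "g \<in> polys F l"
    and eq: "(\<Sum>i<n. l ^ i * c i) = (a - l) * g"
  shows "(\<Sum>i<n. a ^ i * c i) = 0"
proof -
  from g obtain m d where d: "\<forall>i. d i \<in> F" "g = (\<Sum>i<m. l ^ i * d i)" by (auto simp: polys_def polyb_iff)
  define N where "N = n + Suc m"
  define G where "G = (\<lambda>i. if i < m then d i else 0)"
  define C where "C = (\<lambda>i. if i < n then c i else 0)"
  define H where "H = (\<lambda>i. case i of 0 \<Rightarrow> 0 | Suc j \<Rightarrow> G j)"
  have GF: "G i \<in> F" for i using d(1) zero_mem by (simp add: G_def)
  have CF: "C i \<in> F" for i using c zero_mem by (simp add: C_def)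
  have HF: "H i \<in> F" for i using GF zero_mem by (cases i) (auto simp: H_def)
  have pad: "(\<Sum>i<n. f i * c i) = (\<Sum>i<N. f i * C i)" for f
    by (rule sum.mono_neutral_cong_left) (auto simp: N_def C_def)
  have gG: "g = (\<Sum>i<N. l ^ i * G i)" unfolding d(2)
    by (rule sum.mono_neutral_cong_left) (auto simp: N_def G_def)
  have GN: "G i = 0" if "N \<le> Suc i" for i using that by (simp add: G_def N_def)
  have shift: "(\<Sum>i<N. p * (p ^ i * G i)) = (\<Sum>i<N. p ^ i * H i)" for p
  proof -
    have "(\<Sum>i<N. p ^ i * H i) = (\<Sum>i<n + m. p ^ Suc i * G i)"
      unfolding N_def add_Suc_right by (subst sum.lessThan_Suc_shift) (simp add: H_def)
    also have "\<dots> = (\<Sum>i<N. p ^ Suc i * G i)"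
      by (simp add: N_def GN)
    finally show ?thesis by (simp add: mult.assoc)
  qed
  have "(a - l) * g = (\<Sum>i<N. l ^ i * (a * G i)) - (\<Sum>i<N. l * (l ^ i * G i))"
    unfolding gG left_diff_distrib sum_distrib_left using comm_power[OF a]
    by (simp add: mult.assoc[symmetric] sum_subtractf)
  also have "\<dots> = (\<Sum>i<N. l ^ i * (a * G i - H i))"
    unfolding shift by (simp add: right_diff_distrib sum_subtractf)
  finally have "(\<Sum>i<N. l ^ i * (C i - (a * G i - H i))) = 0"
    using eq pad[of "\<lambda>i. l ^ i"] by (simp add: right_diff_distrib sum_subtractf)
  moreover have "C i - (a * G i - H i) \<in> F" for i by (intro diff_mem mult_mem CF GF HF a)
  ultimately have "C i = a * G i - H i" if "i < N" for i
    using transcD[OF transc, of N "\<lambda>i. C i - (a * G i - H i)" i] that by simp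
  then have "(\<Sum>i<N. a ^ i * C i) = (\<Sum>i<N. a ^ i * (a * G i)) - (\<Sum>i<N. a ^ i * H i)"
    by (simp add: right_diff_distrib sum_subtractf)
  also have "(\<Sum>i<N. a ^ i * (a * G i)) = (\<Sum>i<N. a * (a ^ i * G i))"
    by (rule sum.cong[OF refl]) (simp add: mult.assoc[symmetric] power_commutes)
  finally show ?thesis unfolding pad shift by simp
qed

text \<open>If \<open>x\<close> is algebraic over the centralizer of \<open>a\<close>, then all \<open>x\<^sup>k\<close> are combinations of finitely many with
  coefficients commuting with \<open>a\<close>. Hence finitely many equations \<open>\<Sum>\<^sub>j g\<^sub>j x\<^sup>i a\<^sup>j = 0\<close> imply those for all
  exponents \<open>i\<close>, and they have a nonzero solution. A solution of least support with a coefficient \<open>1\<close>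
  commutes with \<open>x\<close>, because its commutator with \<open>x\<close> is a shorter solution.\<close>

lemma algebraic_dual:
  fixes a x :: "'d::division_ring"
  assumes d: "\<And>i. i \<le> m \<Longrightarrow> d i * a = a * d i" "d m = 1" "(\<Sum>i\<le>m. x ^ i * d i) = 0"
  shows "\<not> left_transc (centralizer {x}) a"
proof -
  have powers: "\<exists>e. (\<forall>i<m. e i * a = a * e i) \<and> x ^ k = (\<Sum>i<m. x ^ i * e i)" for k
  proof (induction k)
    case 0
    have "m \<noteq> 0"
    proof
      assume "m = 0"
      with d(2,3) show False by simp
    qed
    then show ?case
      by (intro exI[of _ "\<lambda>i. if i = 0 then 1 else 0"])
        (auto simp: if_distrib[where f = "\<lambda>z. _ * z"] sum.delta cong: if_cong)
  next
    case (Suc k)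
    then obtain e where e: "\<forall>i<m. e i * a = a * e i" "x ^ k = (\<Sum>i<m. x ^ i * e i)" by blast
    show ?case
    proof (cases m)
      case 0
      with e(2) have "x ^ k = 0" by simp
      then have "x ^ Suc k = 0" by simp
      with 0 show ?thesis by (intro exI[of _ "\<lambda>_. 0"]) (simp del: power_Suc)
    next
      case (Suc n)
      have top: "x ^ m = - (\<Sum>i<m. x ^ i * d i)"
        using d(2,3) by (simp add: lessThan_Suc_atMost[symmetric] eq_neg_iff_add_eq_0 add.commute)
      define e' where "e' = (\<lambda>i. case i of 0 \<Rightarrow> 0 | Suc j \<Rightarrow> e j)"
      have "x ^ Suc k = (\<Sum>i<Suc n. x ^ Suc i * e i)"
        using e(2) by (simp add: Suc sum_distrib_left distrib_left mult.assoc)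
      also have "\<dots> = (\<Sum>i<n. x ^ Suc i * e i) + x ^ m * e n" by (simp add: Suc)
      also have "(\<Sum>i<n. x ^ Suc i * e i) = (\<Sum>i<m. x ^ i * e' i)"
        unfolding Suc by (subst sum.lessThan_Suc_shift) (simp add: e'_def)
      also have "x ^ m * e n = - (\<Sum>i<m. x ^ i * (d i * e n))"
        unfolding top by (simp add: sum_distrib_right mult.assoc)
      finally have "x ^ Suc k = (\<Sum>i<m. x ^ i * (e' i - d i * e n))"
        by (simp add: right_diff_distrib sum_subtractf)
      moreover have "(e' i - d i * e n) * a = a * (e' i - d i * e n)" if "i < m" for i
      proof -
        have en: "e n * a = a * e n" using e(1) Suc by simp
        have "e' i * a = a * e' i" using e(1) that by (cases i) (auto simp: e'_def)
        moreover have "d i * e n * a = a * (d i * e n)"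
          using d(1)[of i] that en by (metis less_imp_le mult.assoc)
        ultimately show ?thesis by (simp add: left_diff_distrib right_diff_distrib)
      qed
      ultimately show ?thesis by (intro exI[of _ "\<lambda>i. e' i - d i * e n"]) simp
    qed
  qed
  interpret U: division_subring "UNIV :: 'd set" by (rule division_subring_UNIV)
  obtain g where g: "\<exists>j\<in>{..m}. g j \<noteq> 0" "\<forall>i\<in>{..<m}. (\<Sum>j\<in>{..m}. g j * (x ^ i * a ^ j)) = 0"
  proof -
    have "\<exists>c. (\<forall>j\<in>{..m}. c j \<in> (UNIV :: 'd set)) \<and> (\<exists>j\<in>{..m}. c j \<noteq> 0) \<and>
        (\<forall>i\<in>{..<m}. (\<Sum>j\<in>{..m}. c j * (x ^ i * a ^ j)) = 0)"
      by (rule U.homogeneous_system_left) auto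
    then show ?thesis using that by (elim exE conjE)
  qed
  define rel where "rel = (\<lambda>g. \<forall>k. (\<Sum>j\<le>m. g j * (x ^ k * a ^ j)) = 0)"
  have "rel g" unfolding rel_def
  proof
    fix k
    obtain e where e: "\<forall>i<m. e i * a = a * e i" "x ^ k = (\<Sum>i<m. x ^ i * e i)" using powers by blast
    have "(\<Sum>j\<le>m. g j * (x ^ k * a ^ j)) = (\<Sum>j\<le>m. \<Sum>i<m. g j * (x ^ i * a ^ j) * e i)"
    proof (rule sum.cong[OF refl])
      fix j
      have "x ^ i * e i * a ^ j = x ^ i * a ^ j * e i" if "i < m" for i
        using power_commuting_commutes[of a "e i" j] e(1) that by (metis mult.assoc)
      then have "x ^ k * a ^ j = (\<Sum>i<m. x ^ i * a ^ j * e i)" unfolding e(2) sum_distrib_right by simp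
      then show "g j * (x ^ k * a ^ j) = (\<Sum>i<m. g j * (x ^ i * a ^ j) * e i)"
        by (simp add: sum_distrib_left mult.assoc)
    qed
    also have "\<dots> = (\<Sum>i<m. (\<Sum>j\<le>m. g j * (x ^ i * a ^ j)) * e i)"
      by (subst sum.swap) (simp add: sum_distrib_right)
    also have "\<dots> = 0" using g(2) by simp
    finally show "(\<Sum>j\<le>m. g j * (x ^ k * a ^ j)) = 0" .
  qed
  define supp where "supp = (\<lambda>g :: nat \<Rightarrow> 'd. {j. j \<le> m \<and> g j \<noteq> 0})"
  have fin: "finite (supp g)" for g by (simp add: supp_def)
  define P where "P = (\<lambda>n. \<exists>g. rel g \<and> supp g \<noteq> {} \<and> card (supp g) = n)"
  have "P (card (supp g))" using \<open>rel g\<close> g(1) by (auto simp: P_def supp_def)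
  then have "P (LEAST n. P n)" by (rule LeastI[of P])
  then obtain f where f: "rel f" "supp f \<noteq> {}" "card (supp f) = (LEAST n. P n)" unfolding P_def by blast
  then obtain v where v: "v \<le> m" "f v \<noteq> 0" by (auto simp: supp_def)
  define h where "h = (\<lambda>j. inverse (f v) * f j)"
  have hrel: "rel h" unfolding rel_def
  proof
    fix k
    have "(\<Sum>j\<le>m. h j * (x ^ k * a ^ j)) = inverse (f v) * (\<Sum>j\<le>m. f j * (x ^ k * a ^ j))"
      by (simp add: h_def sum_distrib_left mult.assoc)
    then show "(\<Sum>j\<le>m. h j * (x ^ k * a ^ j)) = 0" using f(1) by (simp add: rel_def)
  qed
  have hv: "h v = 1" using v by (simp add: h_def)
  define c where "c = (\<lambda>j. x * h j - h j * x)"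
  have crel: "rel c" unfolding rel_def
  proof
    fix k
    have "(\<Sum>j\<le>m. c j * (x ^ k * a ^ j)) = x * (\<Sum>j\<le>m. h j * (x ^ k * a ^ j)) - (\<Sum>j\<le>m. h j * (x ^ Suc k * a ^ j))"
      by (simp add: c_def sum_distrib_left left_diff_distrib sum_subtractf mult.assoc)
    then show "(\<Sum>j\<le>m. c j * (x ^ k * a ^ j)) = 0" using hrel by (simp add: rel_def del: power_Suc)
  qed
  have "supp c \<subseteq> supp f - {v}" using hv v by (auto simp: supp_def c_def h_def)
  moreover have "v \<in> supp f" using v by (simp add: supp_def)
  ultimately have "card (supp c) < card (supp f)" using psubset_card_mono[OF fin, of "supp c" f] by blast
  then have "\<not> P (card (supp c))" using f(3) not_less_Least by metis
  then have c0: "supp c = {}" using crel by (auto simp: P_def)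
  have "\<forall>j<Suc m. h j \<in> centralizer {x}"
    using c0 by (auto simp: supp_def c_def centralizer_singleton less_Suc_eq_le)
  moreover have "(\<Sum>j<Suc m. h j * a ^ j) = 0"
    using hrel[unfolded rel_def, rule_format, of 0] by (simp add: lessThan_Suc_atMost)
  moreover have "h v \<noteq> 0" "v < Suc m" using hv v by auto
  ultimately show ?thesis using left_transcD[of "centralizer {x}" a "Suc m" h v] by auto
qed

text \<open>Let \<open>s\<close> be a monic common denominator of \<open>e\<close> and \<open>u\<close> of least degree in \<open>l\<close>, and \<open>b = (a - l)\<^sup>-\<^sup>1\<close>. If
  \<open>b s\<close> is a polynomial, then \<open>x s x\<^sup>-\<^sup>1\<close> is another denominator, hence equal to \<open>s\<close>; so the
  coefficients of \<open>s\<close> lie in the centralizer of \<open>x\<close>, and \<open>a\<close> is a root of \<open>s\<close>. Otherwise the shifted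
  denominators lead to a polynomial of the form \<open>\<Sum>\<^sub>i x\<^sup>i b \<epsilon>\<^sub>i\<close>. In a shortest one the coefficients
  commute with \<open>a\<close>, so it is \<open>(\<Sum>\<^sub>i x\<^sup>i \<epsilon>\<^sub>i) b\<close>, which has a pole unless the sum vanishes; then the
  preceding lemma applies.\<close>

lemma (in transcendental_ext) algebraic_of_pole_equation:
  fixes x a e u :: 'd
  assumes xa: "x \<in> F" "a \<in> F" and x0: "x \<noteq> 0" and lc: "\<And>d. l * d = d * l"
    and eu: "e \<in> fracs F l" "u \<in> fracs F l" "e * x = x * e"
    and eq: "inverse (a - l) = e + x * u - u * x"
  shows "\<not> transc (centralizer {x}) a \<or> \<not> left_transc (centralizer {x}) a"
proof -
  define b where "b = inverse (a - l)"
  let ?P = "polys F l"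
  note P = add_polys diff_polys mult_polys sum_polys zero_polys
  have xP: "x \<in> ?P" "inverse x \<in> ?P" "a \<in> ?P" using xa by (auto intro: const_polys inverse_mem)
  have al: "a - l \<noteq> 0"
  proof
    assume "a - l = 0"
    then have "l ^ 1 * (-1) + a = 0" by (simp add: algebra_simps)
    moreover have "a \<in> polyb F l 1" using xa const_polyb1 by simp
    ultimately have "(-1 :: 'd) = 0" using lead_zero[of "-1" a 1] uminus_mem[OF one_mem] by blast
    then show False by simp
  qed
  have bl: "b * (a - l) = 1" "(a - l) * b = 1" using al by (simp_all add: b_def)
  have ux: "u * x = x * u + e - b" using eq by (simp add: b_def)
  \<comment> \<open>The right ideal of common denominators of \<open>u\<close> and \<open>e\<close>.\<close>
  define I where "I = {h \<in> ?P. u * h \<in> ?P \<and> e * h \<in> ?P}"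
  have I_right: "h * c \<in> I" if "h \<in> I" "c \<in> ?P" for h c
    using that P(3)[of "u * h" c] P(3)[of "e * h" c] P(3)[of h c] by (auto simp: I_def mult.assoc)
  have I_diff: "h - k \<in> I" if "h \<in> I" "k \<in> I" for h k
    using that P(2)[of h k] P(2)[of "u * h" "u * k"] P(2)[of "e * h" "e * k"]
    by (auto simp: I_def right_diff_distrib)
  from common_denominator[of "{u, e}" "\<lambda>d. d"] eu obtain q where
    q: "q \<in> ?P" "q \<noteq> 0" "u * q \<in> ?P" "e * q \<in> ?P" by auto
  define Q where "Q = (\<lambda>n. \<exists>h\<in>I. h \<noteq> 0 \<and> h \<in> polyb F l (Suc n))"
  from q(1) obtain k where "q \<in> polyb F l k" by (rule polys_cases)
  then have "q \<in> polyb F l (Suc k)" using polyb_mono[of k "Suc k" F l] by auto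
  then have "Q k" using q by (auto simp: Q_def I_def)
  define n where "n = (LEAST n. Q n)"
  have "Q n" unfolding n_def by (rule LeastI[of Q, OF \<open>Q k\<close>])
  have small: "h = 0" if "h \<in> I" "h \<in> polyb F l n" for h
  proof (rule ccontr)
    assume h0: "h \<noteq> 0"
    show False
    proof (cases n)
      case 0
      with that h0 show False by (simp add: polyb_iff)
    next
      case (Suc m)
      then have "Q m" using that h0 by (auto simp: Q_def)
      then have "n \<le> m" unfolding n_def by (rule Least_le)
      with Suc show False by simp
    qed
  qed
  from \<open>Q n\<close> obtain h where h: "h \<in> I" "h \<noteq> 0" "h \<in> polyb F l (Suc n)" by (auto simp: Q_def)
  from h(3) obtain c r' where cr: "c \<in> F" "r' \<in> polyb F l n" "h = l ^ n * c + r'" by (rule polyb_SucE)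
  have c0: "c \<noteq> 0" using small[OF h(1)] cr h(2) by auto
  define s where "s = h * inverse c"
  define r where "r = r' * inverse c"
  have r: "r \<in> polyb F l n" unfolding r_def by (rule rsubspace_scale[OF rsubspace_polyb cr(2) inverse_mem[OF cr(1)]])
  have s: "s = l ^ n + r" using c0 by (simp add: s_def r_def cr(3) distrib_right mult.assoc)
  have sI: "s \<in> I" unfolding s_def by (rule I_right[OF h(1) const_polys[OF inverse_mem[OF cr(1)]]])
  then have sP: "s \<in> ?P" "u * s \<in> ?P" "e * s \<in> ?P" by (auto simp: I_def)
  show ?thesis
  proof (cases "b * s \<in> ?P")
    case True
    have "u * (x * s) = x * (u * s) + e * s - b * s"
      by (simp add: mult.assoc[symmetric] ux left_diff_distrib distrib_right)
    moreover have "x * (u * s) + e * s - b * s \<in> ?P" by (intro P(1-3) xP sP True)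
    ultimately have uxs: "u * (x * s) \<in> ?P" by simp
    have "e * (x * s) = x * (e * s)" using eu(3) by (simp add: mult.assoc[symmetric])
    moreover have "x * (e * s) \<in> ?P" by (intro P(3) xP sP)
    ultimately have "x * s \<in> I" using uxs P(3)[OF xP(1) sP(1)] by (simp add: I_def)
    then have "x * s * inverse x \<in> I" by (rule I_right[OF _ xP(2)])
    then have "x * s * inverse x - s \<in> I" by (rule I_diff[OF _ sI])
    moreover have "x * s * inverse x - s = x * r * inverse x - r"
    proof -
      have "x * l ^ n * inverse x = l ^ n"
        using comm_power[OF xa(1), of n] x0 by (simp add: mult.assoc)
      then show ?thesis by (simp add: s distrib_left distrib_right)
    qed
    moreover have "x * r * inverse x - r \<in> polyb F l n"
      by (intro rsubspace_diff[OF rsubspace_polyb] rsubspace_scale[OF rsubspace_polyb]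
          const_mult_polyb xa(1) inverse_mem r)
    ultimately have "x * r * inverse x - r = 0" using small[of "x * r * inverse x - r"] by metis
    then have "x * r * inverse x = r" by simp
    then have xr: "x * r = r * x" using x0 by (metis mult.assoc left_inverse mult.right_neutral)
    from r obtain d where d: "\<forall>i. d i \<in> F" "r = (\<Sum>i<n. l ^ i * d i)" by (auto simp: polyb_iff)
    have "(\<Sum>i<n. l ^ i * (x * d i - d i * x)) = x * r - r * x"
      using comm_power[OF xa(1)]
      by (simp add: d(2) sum_distrib_left sum_distrib_right right_diff_distrib sum_subtractf mult.assoc[symmetric])
    then have "x * d i - d i * x = 0" if "i < n" for i
      using transcD[OF transc, of n "\<lambda>i. x * d i - d i * x" i] that xr d(1) xa(1)
      by (simp add: diff_mem mult_mem)
    then have dE: "d i \<in> centralizer {x}" if "i < n" for i using that by (auto simp: centralizer_singleton)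
    define c where "c = (\<lambda>i. if i = n then 1 else d i)"
    have "s = (\<Sum>i<Suc n. l ^ i * c i)" by (simp add: s d(2) c_def add.commute)
    moreover have "s = (a - l) * (b * s)" using bl by (simp add: mult.assoc[symmetric])
    ultimately have eqs: "(\<Sum>i<Suc n. l ^ i * c i) = (a - l) * (b * s)" by simp
    have cF: "c i \<in> F" for i using d(1) one_mem by (simp add: c_def)
    from root_of_left_factor[OF xa(2) cF True eqs] have "(\<Sum>i<Suc n. a ^ i * c i) = 0" .
    moreover have "\<forall>i<Suc n. c i \<in> centralizer {x}" using dE by (auto simp: c_def centralizer_singleton)
    moreover have "c n \<noteq> 0" "n < Suc n" by (auto simp: c_def)
    ultimately show ?thesis using transcD[of "centralizer {x}" a "Suc n" c n] by blast
  next
    case False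
    have rem: "\<exists>c\<in>F. b * h - b * c \<in> ?P" if "h \<in> ?P" for h
    proof -
      have "- a \<in> polyb F l 1" using uminus_mem[OF xa(2)] const_polyb1 by simp
      from division_with_remainder[OF _ this that, of "l - a"] obtain g \<rho> where
        g: "g \<in> ?P" "\<rho> \<in> F" "h = (l - a) * g + \<rho>" using const_polyb1 by auto
      have "b * ((l - a) * g) = - g" using bl(1) by (simp add: mult.assoc[symmetric]) (simp add: right_diff_distrib algebra_simps)
      then have "b * h - b * \<rho> = 0 - g" by (simp add: g(3) distrib_left)
      then show ?thesis using g P(2)[OF P(5) g(1)] by (intro bexI[of _ \<rho>]) auto
    qed
    have xs: "x ^ j * s \<in> ?P" for j by (intro P(3) sP const_polys power_mem xa(1))
    have "\<forall>j. \<exists>c. c \<in> F \<and> b * (x ^ j * s) - b * c \<in> ?P" using rem[OF xs] by blast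
    then obtain c where c: "\<And>j. c j \<in> F" "\<And>j. b * (x ^ j * s) - b * c j \<in> ?P" by metis
    have c00: "c 0 \<noteq> 0" using c(2)[of 0] False by auto
    have unfold_u: "u * (x ^ j * s) + (\<Sum>k<j. x ^ k * (b * (x ^ (j - 1 - k) * s))) \<in> ?P" for j
    proof (induction j)
      case 0
      then show ?case using sP by simp
    next
      case (Suc j)
      let ?S = "\<Sum>k<j. x ^ k * (b * (x ^ (j - 1 - k) * s))"
      have "u * (x ^ Suc j * s) = x * (u * (x ^ j * s)) + e * (x ^ j * s) - b * (x ^ j * s)"
        by (simp add: mult.assoc[symmetric] ux left_diff_distrib distrib_right)
      moreover have "(\<Sum>k<Suc j. x ^ k * (b * (x ^ (Suc j - 1 - k) * s))) = b * (x ^ j * s) + x * ?S"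
        by (subst sum.lessThan_Suc_shift) (simp add: sum_distrib_left mult.assoc)
      moreover have "e * (x ^ j * s) = x ^ j * (e * s)"
        using power_commuting_commutes[of x e j] eu(3) by (metis mult.assoc)
      ultimately have "u * (x ^ Suc j * s) + (\<Sum>k<Suc j. x ^ k * (b * (x ^ (Suc j - 1 - k) * s)))
         = x * (u * (x ^ j * s) + ?S) + x ^ j * (e * s)" by (simp add: distrib_left)
      moreover have "x * (u * (x ^ j * s) + ?S) + x ^ j * (e * s) \<in> ?P"
        by (intro P(1) P(3) Suc.IH xP sP const_polys power_mem xa(1))
      ultimately show ?case by simp
    qed
    have "\<forall>j. \<exists>g \<rho>. g \<in> ?P \<and> \<rho> \<in> polyb F l n \<and> x ^ Suc j * s = s * g + \<rho>"
      using division_with_remainder[OF s r] xs by blast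
    then obtain g \<rho> where g: "\<And>j. g j \<in> ?P" "\<And>j. \<rho> j \<in> polyb F l n" "\<And>j. x ^ Suc j * s = s * g j + \<rho> j"
      by metis
    have "card ((\<lambda>i. l ^ i) ` {..<n}) < card {..<Suc n}"
      using card_image_le[of "{..<n}" "\<lambda>i. l ^ i"] by simp
    then have "\<exists>c. (\<forall>j\<in>{..<Suc n}. c j \<in> F) \<and> (\<exists>j\<in>{..<Suc n}. c j \<noteq> 0) \<and> (\<Sum>j<Suc n. \<rho> j * c j) = 0"
      by (intro dependent_family[of "(\<lambda>i. l ^ i) ` {..<n}"] g(2)[unfolded polyb_def]) auto
    then obtain \<kappa> where \<kappa>: "\<forall>j\<in>{..<Suc n}. \<kappa> j \<in> F" "\<exists>j\<in>{..<Suc n}. \<kappa> j \<noteq> 0" "(\<Sum>j<Suc n. \<rho> j * \<kappa> j) = 0"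
      by (elim exE conjE)
    have \<kappa>P: "\<kappa> j \<in> ?P" if "j < Suc n" for j using \<kappa>(1) that const_polys by auto
    have "(\<Sum>j<Suc n. x ^ Suc j * s * \<kappa> j) = (\<Sum>j<Suc n. s * (g j * \<kappa> j))"
      unfolding g(3) distrib_right sum.distrib \<kappa>(3) by (simp add: mult.assoc)
    then have "(\<Sum>j<Suc n. u * (x ^ Suc j * s) * \<kappa> j) = (\<Sum>j<Suc n. (u * s) * (g j * \<kappa> j))"
      by (simp only: mult.assoc sum_distrib_left[symmetric])
    moreover have "(\<Sum>j<Suc n. (u * s) * (g j * \<kappa> j)) \<in> ?P"
      by (intro P(4) P(3) sP g(1) \<kappa>P) auto
    ultimately have uP: "(\<Sum>j<Suc n. u * (x ^ Suc j * s) * \<kappa> j) \<in> ?P" by simp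
    define T where "T = (\<lambda>j. \<Sum>k<Suc j. x ^ k * (b * (x ^ (j - k) * s)))"
    have "(\<Sum>j<Suc n. (u * (x ^ Suc j * s) + T j) * \<kappa> j) \<in> ?P"
      using unfold_u[of "Suc _"] by (intro P(4) P(3) \<kappa>P) (auto simp: T_def)
    then have "(\<Sum>j<Suc n. u * (x ^ Suc j * s) * \<kappa> j) + (\<Sum>j<Suc n. T j * \<kappa> j) \<in> ?P"
      by (simp add: distrib_right sum.distrib del: sum.lessThan_Suc)
    from P(2)[OF this uP] have TP: "(\<Sum>j<Suc n. T j * \<kappa> j) \<in> ?P" by (simp only: add_diff_cancel_left')
    define T' where "T' = (\<lambda>j. \<Sum>k<Suc j. x ^ k * (b * c (j - k)))"
    have "T j - T' j \<in> ?P" for j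
    proof -
      have "T j - T' j = (\<Sum>k<Suc j. x ^ k * (b * (x ^ (j - k) * s) - b * c (j - k)))"
        by (simp add: T_def T'_def right_diff_distrib sum_subtractf del: sum.lessThan_Suc)
      also have "\<dots> \<in> ?P" by (intro P(4) P(3) c(2) const_polys power_mem xa(1))
      finally show ?thesis .
    qed
    then have "(\<Sum>j<Suc n. (T j - T' j) * \<kappa> j) \<in> ?P" by (intro P(4) P(3) \<kappa>P) auto
    then have "(\<Sum>j<Suc n. T j * \<kappa> j) - (\<Sum>j<Suc n. (T j - T' j) * \<kappa> j) \<in> ?P" by (rule P(2)[OF TP])
    then have T'P: "(\<Sum>j<Suc n. T' j * \<kappa> j) \<in> ?P"
      by (simp add: left_diff_distrib sum_subtractf del: sum.lessThan_Suc)
    define \<delta> where "\<delta> = (\<lambda>k. \<Sum>j<Suc n. if k \<le> j then c (j - k) * \<kappa> j else 0)"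
    have \<delta>F: "\<delta> k \<in> F" for k unfolding \<delta>_def
      using c(1) \<kappa>(1) by (intro sum_mem) (auto intro: mult_mem zero_mem)
    have "(\<Sum>j<Suc n. T' j * \<kappa> j) = (\<Sum>j<Suc n. \<Sum>k<Suc n. if k \<le> j then x ^ k * (b * (c (j - k) * \<kappa> j)) else 0)"
    proof (rule sum.cong[OF refl])
      fix j assume "j \<in> {..<Suc n}"
      then show "T' j * \<kappa> j = (\<Sum>k<Suc n. if k \<le> j then x ^ k * (b * (c (j - k) * \<kappa> j)) else 0)"
        unfolding T'_def sum_distrib_right
        by (intro sum.mono_neutral_cong_left) (auto simp: mult.assoc)
    qed
    also have "\<dots> = (\<Sum>k<Suc n. x ^ k * (b * \<delta> k))"
      by (subst sum.swap) (simp add: \<delta>_def sum_distrib_left if_distrib[where f = "\<lambda>z. _ * z"] cong: if_cong del: sum.lessThan_Suc)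
    finally have \<delta>P: "(\<Sum>k<Suc n. x ^ k * (b * \<delta> k)) \<in> ?P" using T'P by simp
    define J where "J = Max {j. j < Suc n \<and> \<kappa> j \<noteq> 0}"
    have finJ: "finite {j. j < Suc n \<and> \<kappa> j \<noteq> 0}" by simp
    have "J \<in> {j. j < Suc n \<and> \<kappa> j \<noteq> 0}" unfolding J_def by (rule Max_in[OF finJ]) (use \<kappa>(2) in auto)
    then have J: "J < Suc n" "\<kappa> J \<noteq> 0" by auto
    have aboveJ: "\<kappa> j = 0" if "J < j" "j < Suc n" for j
    proof (rule ccontr)
      assume "\<kappa> j \<noteq> 0"
      then have "j \<le> J" unfolding J_def using that by (intro Max_ge[OF finJ]) auto
      with that show False by simp
    qed
    have "\<delta> J = (\<Sum>j\<in>{J}. c 0 * \<kappa> j)" unfolding \<delta>_def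
      by (rule sum.mono_neutral_cong_right) (use J aboveJ in \<open>auto simp: not_le le_less\<close>)
    then have \<delta>J: "\<delta> J \<noteq> 0" using J c00 by simp
    have above\<delta>: "\<delta> k = 0" if "J < k" for k unfolding \<delta>_def
      by (intro sum.neutral) (use that aboveJ in auto)
    \<comment> \<open>The least \<open>m\<close> gives the shortest combination of the \<open>x\<^sup>i b\<close> that is a polynomial.\<close>
    define R where "R = (\<lambda>m. \<exists>\<delta>. (\<forall>i. \<delta> i \<in> F) \<and> \<delta> m \<noteq> 0 \<and> (\<Sum>i\<le>m. x ^ i * (b * \<delta> i)) \<in> ?P)"
    have "(\<Sum>k<Suc n. x ^ k * (b * \<delta> k)) = (\<Sum>k\<le>J. x ^ k * (b * \<delta> k))"
      by (rule sum.mono_neutral_right) (use J above\<delta> in auto)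
    then have "R J" using \<delta>P \<delta>J \<delta>F by (auto simp: R_def)
    define m where "m = (LEAST m. R m)"
    have "R m" unfolding m_def by (rule LeastI[of R, OF \<open>R J\<close>])
    then obtain \<epsilon>' where \<epsilon>': "\<forall>i. \<epsilon>' i \<in> F" "\<epsilon>' m \<noteq> 0" "(\<Sum>i\<le>m. x ^ i * (b * \<epsilon>' i)) \<in> ?P" by (auto simp: R_def)
    define \<epsilon> where "\<epsilon> = (\<lambda>i. \<epsilon>' i * inverse (\<epsilon>' m))"
    have \<epsilon>F: "\<epsilon> i \<in> F" for i unfolding \<epsilon>_def using \<epsilon>'(1) by (simp add: mult_mem inverse_mem)
    have \<epsilon>m: "\<epsilon> m = 1" using \<epsilon>'(2) by (simp add: \<epsilon>_def)
    define p where "p = (\<Sum>i\<le>m. x ^ i * (b * \<epsilon> i))"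
    have "p = (\<Sum>i\<le>m. x ^ i * (b * \<epsilon>' i)) * inverse (\<epsilon>' m)"
      by (simp add: p_def \<epsilon>_def sum_distrib_right mult.assoc)
    also have "\<dots> \<in> ?P" by (rule P(3)[OF \<epsilon>'(3) const_polys[OF inverse_mem[OF \<epsilon>'(1)[rule_format]]]])
    finally have pP: "p \<in> ?P" .
    have ab: "a * b = b * a" 
    proof -
      have "a * (a - l) = (a - l) * a" using lc[of a] by (simp add: left_diff_distrib right_diff_distrib)
      then have "b * (a * (a - l)) * b = b * ((a - l) * a) * b" by simp
      then show ?thesis using bl by (metis mult.assoc mult.left_neutral mult.right_neutral)
    qed
    have lb: "l * b = b * a - 1" using bl(2) ab by (simp add: left_diff_distrib) (metis add_diff_cancel_left' diff_add_cancel add.commute)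
    have commute: "a * \<epsilon> i = \<epsilon> i * a" if "i \<le> m" for i
    proof (rule ccontr)
      assume "a * \<epsilon> i \<noteq> \<epsilon> i * a"
      define D where "D = {i. i \<le> m \<and> a * \<epsilon> i \<noteq> \<epsilon> i * a}"
      define k where "k = Max D"
      have finD: "finite D" by (simp add: D_def)
      have "k \<in> D" unfolding k_def by (rule Max_in[OF finD]) (use that \<open>a * \<epsilon> i \<noteq> \<epsilon> i * a\<close> in \<open>auto simp: D_def\<close>)
      then have k: "k \<le> m" "a * \<epsilon> k - \<epsilon> k * a \<noteq> 0" by (auto simp: D_def)
      have above: "a * \<epsilon> j - \<epsilon> j * a = 0" if "k < j" "j \<le> m" for j
      proof (rule ccontr)
        assume "a * \<epsilon> j - \<epsilon> j * a \<noteq> 0"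
        then have "j \<le> k" unfolding k_def using that by (intro Max_ge[OF finD]) (auto simp: D_def)
        with that show False by simp
      qed
      have "k \<noteq> m" using k(2) \<epsilon>m by auto
      have "l * (x ^ i * (b * \<epsilon> i)) = x ^ i * (b * (a * \<epsilon> i)) - x ^ i * \<epsilon> i" for i
      proof -
        have "l * (x ^ i * (b * \<epsilon> i)) = x ^ i * ((l * b) * \<epsilon> i)" using lc by (metis mult.assoc)
        then show ?thesis unfolding lb by (simp add: left_diff_distrib right_diff_distrib mult.assoc)
      qed
      then have "l * p = (\<Sum>i\<le>m. x ^ i * (b * (a * \<epsilon> i))) - (\<Sum>i\<le>m. x ^ i * \<epsilon> i)"
        by (simp add: p_def sum_distrib_left sum_subtractf)
      then have "(\<Sum>i\<le>m. x ^ i * (b * (a * \<epsilon> i - \<epsilon> i * a))) = l * p + (\<Sum>i\<le>m. x ^ i * \<epsilon> i) - p * a"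
        by (simp add: p_def sum_distrib_right right_diff_distrib sum_subtractf mult.assoc)
      moreover have "l * p + (\<Sum>i\<le>m. x ^ i * \<epsilon> i) - p * a \<in> ?P"
        by (intro P(1-4) var_polys pP xP const_polys power_mem xa(1) \<epsilon>F)
      moreover have "(\<Sum>i\<le>m. x ^ i * (b * (a * \<epsilon> i - \<epsilon> i * a))) = (\<Sum>i\<le>k. x ^ i * (b * (a * \<epsilon> i - \<epsilon> i * a)))"
        by (rule sum.mono_neutral_right) (use k(1) above in auto)
      ultimately have "R k" unfolding R_def
        using k(2) \<epsilon>F xa by (intro exI[of _ "\<lambda>i. a * \<epsilon> i - \<epsilon> i * a"]) (auto intro!: diff_mem mult_mem)
      then have "m \<le> k" unfolding m_def by (rule Least_le)
      with \<open>k \<noteq> m\<close> k(1) show False by simp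
    qed
    define S where "S = (\<Sum>i\<le>m. x ^ i * \<epsilon> i)"
    have SF: "S \<in> F" unfolding S_def by (intro sum_mem mult_mem power_mem xa(1) \<epsilon>F)
    have "b * \<epsilon> i = \<epsilon> i * b" if "i \<le> m" for i
    proof -
      have "\<epsilon> i * (a - l) = (a - l) * \<epsilon> i" using commute[OF that] lc[of "\<epsilon> i"] by (simp add: left_diff_distrib right_diff_distrib)
      then have "b * (\<epsilon> i * (a - l)) * b = b * ((a - l) * \<epsilon> i) * b" by simp
      then show ?thesis using bl by (metis mult.assoc mult.left_neutral mult.right_neutral)
    qed
    then have "p = S * b" unfolding p_def S_def sum_distrib_right by (intro sum.cong refl) (simp add: mult.assoc)
    then have pS: "p * (l ^ 1 * (-1) + a) = S" using bl by (simp add: mult.assoc)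
    have "p = 0"
      by (rule mult_small_zero_right[of "-1" a 1 p])
        (use pS SF xa pP const_polyb1 uminus_mem[OF one_mem] in auto)
    then have "S = 0" using pS by simp
    then show ?thesis using algebraic_dual[of m \<epsilon> a x] commute \<epsilon>m by (simp add: S_def)
  qed
qed

text \<open>The coefficient of \<open>(a - l)\<^sup>-\<^sup>1\<close> is nonzero, since otherwise a multiple of \<open>u\<close> solves the excluded
  shift equation. Divide by it.\<close>

theorem algebraic_over_centralizer:
  fixes Z :: "'d::division_ring set"
  assumes Z: "division_subring Z" and central: "\<And>z d. z \<in> Z \<Longrightarrow> z * d = d * z"
    and unc: "uncountable Z" and x: "transc Z x" and no_free: "\<And>y z. \<not> free_pair Z y z"
    and no_shift: "\<not> (\<exists>u. x * u * inverse x = u + 1)"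
  shows "\<not> transc (centralizer {x}) a \<or> \<not> left_transc (centralizer {x}) a"
proof -
  interpret Z: division_subring Z by fact
  have x0: "x \<noteq> 0" using transc_nonzero[OF x Z.one_mem Z.zero_mem] .
  from free_or_equation[OF Z central unc x no_free, of a] obtain F l e u where
    F: "division_subring F" "x \<in> F" "a \<in> F" and l: "l \<in> Z" "transc F l"
    and e: "\<And>i. e i \<in> fracs F l" "\<And>i. x * e i = e i * x" "\<exists>i. e i \<noteq> 0" and u: "u \<in> fracs F l"
    and eq: "e True + e False * inverse (a - l) = x * u * inverse x - u" by blast
  interpret F: transcendental_ext F l
    using F l central[of l] by (simp add: transcendental_ext_def transcendental_ext_axioms_def)
  interpret F1: division_subring "fracs F l" by (rule F.division_subring_fracs)
  have comm_inv: "x * inverse (e i) = inverse (e i) * x" for i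
  proof -
    interpret C: division_subring "centralizer {x}" by (rule division_subring_centralizer)
    have "e i \<in> centralizer {x}" using e(2)[of i] by (simp add: centralizer_singleton)
    from C.inverse_mem[OF this] show ?thesis by (simp add: centralizer_singleton)
  qed
  have eF: "e False \<noteq> 0"
  proof
    assume "e False = 0"
    with e(3) have eT: "e True \<noteq> 0" by (metis (full_types))
    have "x * (inverse (e True) * u) * inverse x = inverse (e True) * (x * u * inverse x)"
      using comm_inv[of True] by (metis mult.assoc)
    also have "x * u * inverse x = e True + u" using eq \<open>e False = 0\<close> by (simp add: eq_diff_eq)
    also have "inverse (e True) * (e True + u) = inverse (e True) * u + 1" using eT by (simp add: distrib_left)
    finally show False using no_shift by blast
  qed
  define f where "f = inverse (e False)"
  define w where "w = f * u * inverse x"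
  define g where "g = - (f * e True)"
  have fF: "f \<in> fracs F l" unfolding f_def by (intro F1.inverse_mem e(1))
  have xF: "x \<in> fracs F l" using F.const_fracs[OF F(2)] .
  have wF: "w \<in> fracs F l" unfolding w_def by (intro F1.mult_mem F1.inverse_mem fF u xF)
  have gF: "g \<in> fracs F l" unfolding g_def by (intro F1.uminus_mem F1.mult_mem fF e(1))
  have fx: "x * f = f * x" using comm_inv by (simp add: f_def)
  have gx: "g * x = x * g" unfolding g_def using fx e(2)[of True] by (simp) (metis mult.assoc)
  have "f * (e True + e False * inverse (a - l)) = f * e True + inverse (a - l)"
    using eF by (simp add: distrib_left mult.assoc[symmetric] f_def)
  moreover have "f * (x * u * inverse x - u) = x * w - w * x"
  proof -
    have "f * (x * u * inverse x) = x * w" unfolding w_def using fx by (metis mult.assoc)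
    moreover have "w * x = f * u" using x0 by (simp add: w_def mult.assoc)
    ultimately show ?thesis by (simp add: right_diff_distrib)
  qed
  ultimately have "f * e True + inverse (a - l) = x * w - w * x" using eq by simp
  then have "inverse (a - l) = g + x * w - w * x" by (simp add: g_def algebra_simps)
  from F.algebraic_of_pole_equation[OF F(2,3) x0 central[OF l(1)] gF wF gx this] show ?thesis .
qed

section \<open>The shift relation in characteristic zero\<close>

lemma ex_top_index:
  fixes i n :: nat
  assumes "i < n" "P i" shows "\<exists>m<n. P m \<and> (\<forall>j. m < j \<longrightarrow> j < n \<longrightarrow> \<not> P j)"
proof -
  define D where "D = {i. i < n \<and> P i}"
  have fin: "finite D" by (simp add: D_def)
  have "Max D \<in> D" by (rule Max_in[OF fin]) (use assms in \<open>auto simp: D_def\<close>)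
  moreover have "\<not> P j" if "Max D < j" "j < n" for j
  proof
    assume "P j"
    then have "j \<le> Max D" using that by (intro Max_ge[OF fin]) (auto simp: D_def)
    with that show False by simp
  qed
  moreover have "\<forall>i\<in>D. i < n \<and> P i" by (simp add: D_def)
  ultimately show ?thesis by blast
qed

text \<open>The scalars enter through a homomorphism \<open>\<phi>\<close> with central values.\<close>

locale shift_pair =
  fixes \<phi> :: "'k::field \<Rightarrow> 'd::division_ring" and x \<theta> :: 'd
  assumes \<phi>_add: "\<phi> (a + b) = \<phi> a + \<phi> b" and \<phi>_mult: "\<phi> (a * b) = \<phi> a * \<phi> b" and \<phi>_one: "\<phi> 1 = 1"
    and \<phi>_central: "\<phi> a * d = d * \<phi> a"
    and char0: "CHAR('k) = 0" and x0: "x \<noteq> 0" and shift: "x * \<theta> = (\<theta> + 1) * x"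
begin

lemma \<phi>_zero: "\<phi> 0 = 0"
  using \<phi>_add[of 0 0] by simp

lemma \<phi>_diff: "\<phi> (a - b) = \<phi> a - \<phi> b"
  using \<phi>_add[of "a - b" b] by simp

lemma \<phi>_eq_0: "\<phi> a = 0 \<longleftrightarrow> a = 0"
proof
  assume "\<phi> a = 0"
  show "a = 0"
  proof (rule ccontr)
    assume "a \<noteq> 0"
    then have "\<phi> a * \<phi> (inverse a) = 1" using \<phi>_mult[of a "inverse a"] \<phi>_one by simp
    with \<open>\<phi> a = 0\<close> show False by simp
  qed
qed (simp add: \<phi>_zero)

lemma \<phi>_of_nat: "\<phi> (of_nat n) = of_nat n"
  by (induction n) (simp_all add: \<phi>_zero \<phi>_add \<phi>_one)

lemma of_nat_eq_0: "(of_nat n :: 'd) = 0 \<longleftrightarrow> n = 0"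
proof -
  have "(of_nat n :: 'd) = 0 \<longleftrightarrow> (of_nat n :: 'k) = 0" using \<phi>_eq_0[of "of_nat n"] \<phi>_of_nat by simp
  also have "\<dots> \<longleftrightarrow> n = 0" using char0 of_nat_eq_0_iff_char_dvd[where 'a = 'k, of n] by simp
  finally show ?thesis .
qed

definition Z :: "'d set" where "Z = range \<phi>"

lemma division_subring_Z: "division_subring Z"
proof
  show "1 \<in> Z" unfolding Z_def by (rule range_eqI[of _ _ 1]) (simp add: \<phi>_one)
  fix a b assume "a \<in> Z" "b \<in> Z"
  then obtain c d where cd: "a = \<phi> c" "b = \<phi> d" by (auto simp: Z_def)
  show "a - b \<in> Z" unfolding Z_def by (rule range_eqI[of _ _ "c - d"]) (simp add: cd \<phi>_diff)
  show "a * b \<in> Z" unfolding Z_def by (rule range_eqI[of _ _ "c * d"]) (simp add: cd \<phi>_mult)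
next
  fix a assume "a \<in> Z"
  then obtain c where c: "a = \<phi> c" by (auto simp: Z_def)
  have "inverse a = \<phi> (inverse c)"
  proof (cases "c = 0")
    case False
    then have "a * \<phi> (inverse c) = 1" using \<phi>_mult[of c "inverse c"] \<phi>_one by (simp add: c)
    then show ?thesis by (rule inverse_unique)
  qed (simp add: c \<phi>_zero)
  then show "inverse a \<in> Z" by (simp add: Z_def)
qed

lemma Z_central: "z \<in> Z \<Longrightarrow> z * d = d * z"
  unfolding Z_def using \<phi>_central by blast

text \<open>The conjugates of \<open>\<theta>\<close> by powers of \<open>x\<close> are the translates \<open>\<theta> + n\<close>, which are
  too many for the roots of one polynomial.\<close>

lemma transc_\<theta>: "transc Z \<theta>"
  unfolding transc_def
proof (intro allI impI, rule ccontr)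
  fix n c i assume c: "\<forall>i<n. c i \<in> Z" "(\<Sum>i<n. \<theta> ^ i * c i) = 0" "i < n" "c i \<noteq> 0"
  from ex_top_index[of i n "\<lambda>i. c i \<noteq> 0"] c(3,4) obtain m where
    m: "m < n" "c m \<noteq> 0" "\<forall>j. m < j \<longrightarrow> j < n \<longrightarrow> c j = 0" by auto
  have "(\<Sum>i<Suc m. \<theta> ^ i * c i) = (\<Sum>i<n. \<theta> ^ i * c i)"
    by (rule sum.mono_neutral_left) (use m in auto)
  then have 0: "(\<Sum>i<Suc m. \<theta> ^ i * c i) = 0" using c(2) by simp
  define T where "T = range (\<lambda>k. \<theta> + of_nat k)"
  have root: "(\<Sum>i<Suc m. (\<theta> + of_nat k) ^ i * c i) = 0" for k
  proof (induction k)
    case 0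
    then show ?case using \<open>(\<Sum>i<Suc m. \<theta> ^ i * c i) = 0\<close> by simp
  next
    case (Suc k)
    have step: "x * (\<theta> + of_nat k) = (\<theta> + of_nat (Suc k)) * x"
      using shift mult_of_nat_commute[of k x] by (simp add: distrib_left distrib_right add.assoc)
    have pw: "x * (\<theta> + of_nat k) ^ i = (\<theta> + of_nat (Suc k)) ^ i * x" for i
    proof (induction i)
      case (Suc i)
      have "x * (\<theta> + of_nat k) ^ Suc i = x * (\<theta> + of_nat k) * (\<theta> + of_nat k) ^ i" by (simp add: mult.assoc)
      also have "\<dots> = (\<theta> + of_nat (Suc k)) * (x * (\<theta> + of_nat k) ^ i)" unfolding step by (simp add: mult.assoc)
      also have "\<dots> = (\<theta> + of_nat (Suc k)) ^ Suc i * x" unfolding Suc by (simp add: mult.assoc)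
      finally show ?case .
    qed simp
    have "(\<Sum>i<Suc m. (\<theta> + of_nat (Suc k)) ^ i * c i) * x = (\<Sum>i<Suc m. (\<theta> + of_nat (Suc k)) ^ i * x * c i)"
      unfolding sum_distrib_right
    proof (rule sum.cong[OF refl])
      fix i assume "i \<in> {..<Suc m}"
      then have "c i * x = x * c i" using c(1) m(1) Z_central by auto
      then show "(\<theta> + of_nat (Suc k)) ^ i * c i * x = (\<theta> + of_nat (Suc k)) ^ i * x * c i" by (simp only: mult.assoc)
    qed
    also have "\<dots> = x * (\<Sum>i<Suc m. (\<theta> + of_nat k) ^ i * c i)"
      unfolding sum_distrib_left pw[symmetric] by (simp only: mult.assoc)
    also have "\<dots> = 0" using Suc.IH by simp
    finally show ?case using x0 by simp
  qed
  have comm: "l * k = k * l" if lk: "l \<in> T" "k \<in> T" for l k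
  proof -
    from lk obtain i j where "l = \<theta> + of_nat i" "k = \<theta> + of_nat j" by (auto simp: T_def)
    then show ?thesis using mult_of_nat_commute[of i \<theta>] mult_of_nat_commute[of j \<theta>] mult_of_nat_commute[of i "of_nat j"]
      by (simp add: distrib_left distrib_right add.assoc add.left_commute add.commute)
  qed
  have "finite {l \<in> T. (\<Sum>i<Suc m. l ^ i * c i) = 0}"
    by (rule finite_central_roots[where Z = T and c = c, OF m(2)]) (rule comm)
  moreover have "{l \<in> T. (\<Sum>i<Suc m. l ^ i * c i) = 0} = T" using root by (auto simp: T_def)
  ultimately have "finite T" by (simp del: sum.lessThan_Suc)
  moreover have "inj (\<lambda>k. \<theta> + of_nat k)"
  proof (rule injI)
    fix i j assume ij: "\<theta> + of_nat i = \<theta> + of_nat j"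
    show "i = j"
    proof (rule ccontr)
      assume "i \<noteq> j"
      have neq: "(of_nat a :: 'd) \<noteq> of_nat b" if "a < b" for a b
      proof
        assume "(of_nat a :: 'd) = of_nat b"
        then have "(of_nat (b - a) :: 'd) = 0" using that by (simp add: of_nat_diff)
        then have "b - a = 0" by (rule of_nat_eq_0[THEN iffD1])
        with that show False by simp
      qed
      have "(of_nat i :: 'd) = of_nat j" using ij by simp
      with neq[of i j] neq[of j i] \<open>i \<noteq> j\<close> show False by (metis linorder_neqE_nat)
    qed
  qed
  then have "infinite T" unfolding T_def by (rule range_inj_infinite)
  ultimately show False by simp
qed

sublocale K: transcendental_ext Z \<theta>
  by (intro transcendental_ext.intro transcendental_ext_axioms.intro division_subring_Z transc_\<theta>)
    (rule Z_central)

abbreviation K :: "'d set" where "K \<equiv> fracs Z \<theta>"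

sublocale KK: division_subring K
  by (rule K.division_subring_fracs)

lemma K_comm: "a \<in> K \<Longrightarrow> b \<in> K \<Longrightarrow> a * b = b * a"
proof -
  have "Z \<subseteq> centralizer Z" using Z_central by (auto simp: centralizer_def)
  from K.fracs_commutative[OF this] show "a \<in> K \<Longrightarrow> b \<in> K \<Longrightarrow> a * b = b * a" by (auto simp: centralizer_def)
qed

text \<open>As \<open>\<phi>\<close> has central values, evaluation at \<open>\<theta>\<close> is a ring homomorphism.\<close>

definition h :: "'k poly \<Rightarrow> 'd" where
  "h p = (\<Sum>i\<le>degree p. \<theta> ^ i * \<phi> (coeff p i))"

lemma h_eq: assumes "degree p < n" shows "h p = (\<Sum>i<n. \<theta> ^ i * \<phi> (coeff p i))"
  unfolding h_def
  by (rule sum.mono_neutral_left) (use assms in \<open>auto simp: coeff_eq_0 \<phi>_zero\<close>)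

lemma h_0: "h 0 = 0"
  by (simp add: h_def \<phi>_zero)

lemma h_pCons: "h (pCons a p) = \<phi> a + \<theta> * h p"
proof -
  have "h (pCons a p) = (\<Sum>i<Suc (Suc (degree p)). \<theta> ^ i * \<phi> (coeff (pCons a p) i))"
    by (rule h_eq) (simp add: degree_pCons_le le_imp_less_Suc)
  also have "\<dots> = \<phi> a + (\<Sum>i<Suc (degree p). \<theta> ^ Suc i * \<phi> (coeff p i))"
    by (subst sum.lessThan_Suc_shift) simp
  also have "(\<Sum>i<Suc (degree p). \<theta> ^ Suc i * \<phi> (coeff p i)) = \<theta> * h p"
    by (simp add: h_def sum_distrib_left mult.assoc lessThan_Suc_atMost del: sum.lessThan_Suc)
  finally show ?thesis .
qed

lemma h_add: "h (p + q) = h p + h q"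
  by (induction p q rule: poly_induct2) (simp_all add: h_0 h_pCons \<phi>_add distrib_left algebra_simps)

lemma h_smult: "h (smult a p) = \<phi> a * h p"
proof (induction p)
  case (pCons b p)
  have "\<theta> * (\<phi> a * h p) = \<phi> a * (\<theta> * h p)" using \<phi>_central[of a \<theta>] by (metis mult.assoc)
  then show ?case by (simp add: h_pCons pCons \<phi>_mult distrib_left)
qed (simp add: h_0)

lemma h_mult: "h (p * q) = h p * h q"
proof (induction p)
  case (pCons a p)
  then show ?case by (simp add: h_pCons h_add h_smult \<phi>_zero distrib_right mult.assoc)
qed (simp add: h_0)

lemma h_diff: "h (p - q) = h p - h q"
  using h_add[of "p - q" q] by simp

lemma h_X: "h [:0, 1:] = \<theta>" and h_1: "h 1 = 1"
  by (simp_all add: h_pCons h_0 \<phi>_zero \<phi>_one one_pCons)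

lemma h_eq_0: "h p = 0 \<longleftrightarrow> p = 0"
proof
  assume "h p = 0"
  then have s: "(\<Sum>i<Suc (degree p). \<theta> ^ i * \<phi> (coeff p i)) = 0" using h_eq[of p "Suc (degree p)"] by simp
  have "\<phi> (coeff p (degree p)) = 0"
    by (rule transcD[OF transc_\<theta> _ s, of "degree p"]) (auto simp: Z_def)
  then show "p = 0" by (simp add: \<phi>_eq_0)
qed (simp add: h_0)

lemma h_inj: "h p = h q \<Longrightarrow> p = q"
  using h_eq_0[of "p - q"] h_diff by simp

lemma polys_range_h: "d \<in> polys Z \<theta> \<longleftrightarrow> (\<exists>p. d = h p)"
proof
  assume "d \<in> polys Z \<theta>"
  then obtain n c where c: "\<forall>i. c i \<in> Z" "d = (\<Sum>i<n. \<theta> ^ i * c i)" by (auto simp: polys_def K.polyb_iff)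
  from c(1) have "\<forall>i. \<exists>a. c i = \<phi> a" by (auto simp: Z_def)
  then obtain a where a: "\<And>i. c i = \<phi> (a i)" by (auto dest: choice)
  have "\<exists>p. (\<Sum>i<n. \<theta> ^ i * c i) = h p"
  proof (induction n)
    case 0
    then show ?case by (intro exI[of _ 0]) (simp add: h_0)
  next
    case (Suc n)
    then obtain p where p: "(\<Sum>i<n. \<theta> ^ i * c i) = h p" by blast
    have "h (monom b n) = \<theta> ^ n * \<phi> b" for b
      by (induction n) (simp_all add: monom_0 monom_Suc h_pCons h_0 \<phi>_zero mult.assoc)
    then have "(\<Sum>i<Suc n. \<theta> ^ i * c i) = h (p + monom (a n) n)" by (simp add: p[unfolded a] h_add a)
    then show ?case by blast
  qed
  with c show "\<exists>p. d = h p" by simp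
next
  assume "\<exists>p. d = h p"
  then show "d \<in> polys Z \<theta>"
    using K.polybI[of "Suc _" "\<lambda>i. \<phi> (coeff _ i)" \<theta>] polyb_subset_polys[of Z \<theta>]
    by (auto simp: h_def lessThan_Suc_atMost Z_def)
qed

lemma hK: "h p \<in> K"
  by (rule K.polys_fracs) (use polys_range_h in blast)

text \<open>A fraction whose denominator has minimal degree is reduced: a common root could be divided out.\<close>

lemma K_reduced:
  assumes "d \<in> K"
  shows "\<exists>p q. q \<noteq> 0 \<and> (\<forall>a. poly p a = 0 \<longrightarrow> poly q a \<noteq> 0) \<and> d * h q = h p"
proof -
  define P where "P = (\<lambda>n. \<exists>q p. q \<noteq> 0 \<and> degree q = n \<and> d * h q = h p)"
  from assms obtain r where r: "r \<in> polys Z \<theta>" "r \<noteq> 0" "d * r \<in> polys Z \<theta>" by (auto simp: fracs_def)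
  from r(1) obtain q where q: "r = h q" by (auto simp: polys_range_h)
  from r(3) obtain p where "d * r = h p" by (auto simp: polys_range_h)
  moreover have "q \<noteq> 0" using r(2) q h_0 by auto
  ultimately have "P (degree q)" using q unfolding P_def by blast
  then have "P (LEAST n. P n)" by (rule LeastI[of P])
  then obtain q p where pq: "q \<noteq> 0" "degree q = (LEAST n. P n)" "d * h q = h p" unfolding P_def by blast
  have "False" if a: "poly p a = 0" "poly q a = 0" for a
  proof -
    from a obtain p' q' where pq': "p = [:-a, 1:] * p'" "q = [:-a, 1:] * q'"
      by (auto simp: poly_eq_0_iff_dvd elim!: dvdE)
    then have q'0: "q' \<noteq> 0" using pq(1) by auto
    have comm: "h q' * h [:-a, 1:] = h [:-a, 1:] * h q'" "h p' * h [:-a, 1:] = h [:-a, 1:] * h p'"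
      by (simp_all only: h_mult[symmetric] mult.commute)
    have "d * h q' * h [:-a, 1:] = h p' * h [:-a, 1:]"
      using pq(3) comm by (simp only: pq' h_mult mult.assoc)
    moreover have "h [:-a, 1:] \<noteq> 0" using h_eq_0 by simp
    ultimately have "d * h q' = h p'" by (metis mult_right_cancel)
    then have "P (degree q')" using q'0 unfolding P_def by blast
    then have "(LEAST n. P n) \<le> degree q'" by (rule Least_le)
    moreover have "degree q = degree [:-a, 1:] + degree q'"
      unfolding pq'(2) by (rule degree_mult_eq) (use q'0 in auto)
    ultimately show False using pq(2) by simp
  qed
  with pq show ?thesis by blast
qed

abbreviation sh :: "'k poly \<Rightarrow> 'k poly" where "sh p \<equiv> pcompose p [:1, 1:]"

lemma x_h: "x * h p = h (sh p) * x"
proof (induction p)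
  case (pCons a p)
  have "x * h (pCons a p) = \<phi> a * x + (\<theta> + 1) * (x * h p)"
    by (simp add: h_pCons distrib_left \<phi>_central mult.assoc[symmetric] shift)
  also have "\<dots> = (\<phi> a + (\<theta> + 1) * h (sh p)) * x" by (simp add: pCons distrib_right mult.assoc)
  also have "\<phi> a + (\<theta> + 1) * h (sh p) = h (sh (pCons a p))"
    by (simp add: pcompose_pCons h_add h_mult h_pCons h_0 \<phi>_one \<phi>_zero distrib_right add.commute algebra_simps)
  finally show ?case .
qed (simp add: h_0)

lemma sh_eq_0: "sh p = 0 \<longleftrightarrow> p = 0"
proof
  assume "sh p = 0"
  then have "x * h p = 0" by (simp add: x_h h_0)
  then show "p = 0" using x0 h_eq_0 by simp
qed simp

lemma poly_sh: "poly (sh p) a = poly p (a + 1)"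
  by (simp add: poly_pcompose add.commute)

lemma of_int_inj: "inj (of_int :: int \<Rightarrow> 'k)"
proof (rule injI)
  fix m n :: int assume "(of_int m :: 'k) = of_int n"
  then have "(of_int (m - n) :: 'k) = 0" by simp
  then show "m = n" using char0 of_int_eq_0_iff_char_dvd[where 'a = 'k, of "m - n"] by simp
qed

lemma finite_int_roots:
  fixes p :: "'k poly"
  assumes "p \<noteq> 0" shows "finite {n :: int. poly p (of_int n) = 0}"
proof -
  have "finite ((of_int :: int \<Rightarrow> 'k) -` {a. poly p a = 0})"
    by (rule finite_vimageI[OF poly_roots_finite[OF assms] of_int_inj])
  then show ?thesis by (simp add: vimage_def)
qed

lemma conj_frac:
  assumes "d * h q = h p" shows "x * d * inverse x * h (sh q) = h (sh p)"
proof -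
  have "x * (d * h q) = h (sh p) * x" using assms x_h by simp
  moreover have "x * (d * h q) = x * d * inverse x * (x * h q)"
  proof -
    have "x * d * inverse x * x = x * d" using x0 by (simp add: mult.assoc)
    then show ?thesis by (metis mult.assoc)
  qed
  ultimately have "x * d * inverse x * h (sh q) * x = h (sh p) * x" unfolding x_h by (simp only: mult.assoc)
  then show ?thesis using x0 by simp
qed

lemma conj_K: assumes "d \<in> K" shows "x * d * inverse x \<in> K"
proof -
  from K_reduced[OF assms] obtain p q where q: "q \<noteq> 0" "d * h q = h p" by blast
  have "h (sh q) \<noteq> 0" using q h_eq_0 sh_eq_0 by simp
  then have "x * d * inverse x = x * d * inverse x * h (sh q) * inverse (h (sh q))" by (simp add: mult.assoc)
  also have "\<dots> = h (sh p) * inverse (h (sh q))" unfolding conj_frac[OF q(2)] ..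
  also have "\<dots> \<in> K" by (rule KK.mult_mem[OF hK KK.inverse_mem[OF hK]])
  finally show ?thesis .
qed

text \<open>An invariant of the translation \<open>\<theta> \<mapsto> \<theta> + 1\<close> takes the same value at all integers outside its poles,
  and it has no integer pole, as that would propagate to infinitely many.\<close>

lemma fixed_const:
  assumes d: "d \<in> K" and x: "x * d = d * x" shows "\<exists>c. d = \<phi> c"
proof -
  from K_reduced[OF d] obtain p q where q: "q \<noteq> 0" "\<And>a. poly p a = 0 \<Longrightarrow> poly q a = 0 \<Longrightarrow> False" "d * h q = h p" by blast
  have "x * d * inverse x = d" using x x0 by (simp add: mult.assoc)
  then have d2: "d * h (sh q) = h (sh p)" using conj_frac[OF q(3)] by simp
  have "h (sh p * q) = h (p * sh q)"
  proof -
    have "h (sh p * q) = d * (h (sh q) * h q)" using d2 by (simp add: h_mult mult.assoc[symmetric])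
    also have "h (sh q) * h q = h q * h (sh q)" by (rule K_comm[OF hK hK])
    also have "d * (h q * h (sh q)) = h (p * sh q)" using q(3) by (simp add: h_mult mult.assoc[symmetric])
    finally show ?thesis .
  qed
  then have eq: "sh p * q = p * sh q" by (rule h_inj)
  have rel: "poly p (a + 1) * poly q a = poly p a * poly q (a + 1)" for a
    using arg_cong[OF eq, of "\<lambda>r. poly r a"] by (simp add: poly_sh)
  have noroot: "poly q (of_int n) \<noteq> 0" for n
  proof
    assume r: "poly q (of_int n) = 0"
    have up: "poly q (of_int (n + int k)) = 0" for k
    proof (induction k)
      case (Suc k)
      have "poly p (of_int (n + int k)) * poly q (of_int (n + int k) + 1) = 0"
        using rel[of "of_int (n + int k)"] Suc by simp
      moreover have "poly p (of_int (n + int k)) \<noteq> 0" using q(2) Suc by blast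
      ultimately show ?case by (simp add: add_ac)
    qed (use r in simp)
    have "{n..} \<subseteq> {n :: int. poly q (of_int n) = 0}"
    proof
      fix m assume "m \<in> {n..}"
      then have "m = n + int (nat (m - n))" by simp
      with up[of "nat (m - n)"] show "m \<in> {n. poly q (of_int n) = 0}" by simp
    qed
    with finite_int_roots[OF q(1)] have "finite {n..}" by (rule finite_subset[rotated])
    then show False by (simp add: infinite_Ici)
  qed
  define c where "c = poly p 0 / poly q 0"
  have q0: "poly q 0 \<noteq> 0" using noroot[of 0] by simp
  have val: "poly p (of_nat n) = c * poly q (of_nat n)" for n
  proof (induction n)
    case 0
    then show ?case using q0 by (simp add: c_def)
  next
    case (Suc n)
    have "poly p (of_nat n + 1) * poly q (of_nat n) = c * poly q (of_nat n) * poly q (of_nat n + 1)"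
      using rel[of "of_nat n"] Suc by simp
    then have "poly q (of_nat n) * (poly p (of_nat n + 1) - c * poly q (of_nat n + 1)) = 0"
      by (simp add: algebra_simps)
    moreover have "poly q (of_nat n) \<noteq> 0" using noroot[of "int n"] by simp
    ultimately show ?case by (simp add: add.commute)
  qed
  have "p - smult c q = 0"
  proof (rule ccontr)
    assume "p - smult c q \<noteq> 0"
    then have "finite {n :: int. poly (p - smult c q) (of_int n) = 0}" by (rule finite_int_roots)
    moreover have "{0..} \<subseteq> {n :: int. poly (p - smult c q) (of_int n) = 0}"
    proof
      fix m :: int assume "m \<in> {0..}"
      then have "m = int (nat m)" by simp
      with val[of "nat m"] show "m \<in> {n. poly (p - smult c q) (of_int n) = 0}"
        by (metis (mono_tags, lifting) mem_Collect_eq of_int_of_nat_eq poly_diff poly_smult right_minus_eq)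
    qed
    ultimately have "finite {0 :: int..}" by (rule finite_subset[rotated])
    then show False by (simp add: infinite_Ici)
  qed
  then have "h p = \<phi> c * h q" using h_smult[of c q] by simp
  with q(3) have "(d - \<phi> c) * h q = 0" by (simp add: left_diff_distrib)
  then show ?thesis using q(1) h_eq_0 by auto
qed

text \<open>A telescoping difference \<open>v(\<theta> + 1) - v(\<theta>)\<close> cannot have its only integer pole at \<open>0\<close>: the
  largest and the smallest integer pole of \<open>v\<close> would give two different ones.\<close>

lemma no_telescoping:
  assumes v: "v \<in> K" and eq: "\<phi> c1 * inverse \<theta> + \<phi> c2 * inverse (\<theta> * \<theta>) = x * v * inverse x - v"
  shows "c1 = 0 \<and> c2 = 0"
proof -
  from K_reduced[OF v] obtain p q where q: "q \<noteq> 0" "\<And>a. poly p a = 0 \<Longrightarrow> poly q a = 0 \<Longrightarrow> False" "v * h q = h p" by blast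
  have \<theta>0: "\<theta> \<noteq> 0" using h_X h_eq_0[of "[:0, 1:]"] by simp
  have "h ([:c2, c1:] * (q * sh q)) = h ([:0, 1:] * [:0, 1:] * (sh p * q - p * sh q))"
  proof -
    let ?b = "\<phi> c1 * inverse \<theta> + \<phi> c2 * inverse (\<theta> * \<theta>)"
    have tb: "\<theta> * \<theta> * ?b = h [:c2, c1:]"
    proof -
      have 1: "\<theta> * \<theta> * (\<phi> c1 * inverse \<theta>) = \<theta> * \<phi> c1"
        using \<theta>0 \<phi>_central[of c1 "inverse \<theta>"] by (simp add: mult.assoc) (metis mult.assoc right_inverse mult.left_neutral)
      have 2: "\<theta> * \<theta> * (\<phi> c2 * inverse (\<theta> * \<theta>)) = \<phi> c2"
        using \<theta>0 \<phi>_central[of c2 "inverse (\<theta> * \<theta>)"] by (metis mult.assoc right_inverse mult.left_neutral no_zero_divisors)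
      show ?thesis unfolding distrib_left 1 2 by (simp add: h_pCons h_0 add.commute)
    qed
    have L: "h ([:c2, c1:] * (q * sh q)) = \<theta> * \<theta> * (?b * (h q * h (sh q)))"
      unfolding h_mult tb[symmetric] by (simp only: mult.assoc)
    have diff: "(x * v * inverse x - v) * (h q * h (sh q)) = h (sh p * q - p * sh q)"
    proof -
      have "x * v * inverse x * (h q * h (sh q)) = x * v * inverse x * h (sh q) * h q"
        using K_comm[OF hK[of q] hK[of "sh q"]] by (simp add: mult.assoc)
      also have "\<dots> = h (sh p * q)" using conj_frac[OF q(3)] by (simp add: h_mult)
      finally have 1: "x * v * inverse x * (h q * h (sh q)) = h (sh p * q)" .
      have 2: "v * (h q * h (sh q)) = h (p * sh q)" using q(3) by (simp add: h_mult mult.assoc[symmetric])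
      show ?thesis unfolding left_diff_distrib 1 2 h_diff ..
    qed
    show ?thesis unfolding L eq diff by (simp only: h_mult h_X mult.assoc)
  qed
  then have peq: "[:c2, c1:] * (q * sh q) = [:0, 1:] * [:0, 1:] * (sh p * q - p * sh q)" by (rule h_inj)
  have rel: "(c2 + a * c1) * (poly q a * poly q (a + 1)) = a * a * (poly p (a + 1) * poly q a - poly p a * poly q (a + 1))" for a
    using arg_cong[OF peq, of "\<lambda>r. poly r a"] by (simp add: poly_sh distrib_right mult.assoc)
  define R where "R = {n :: int. poly q (of_int n) = 0}"
  have finR: "finite R" unfolding R_def by (rule finite_int_roots[OF q(1)])
  have "R = {}"
  proof (rule ccontr)
    assume ne: "R \<noteq> {}"
    define N where "N = Max R"
    define M where "M = Min R"
    have NR: "N \<in> R" and MR: "M \<in> R" using ne finR by (auto simp: N_def M_def)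
    have "N + 1 \<notin> R"
    proof
      assume "N + 1 \<in> R"
      then have "N + 1 \<le> N" unfolding N_def by (rule Max_ge[OF finR])
      then show False by simp
    qed
    moreover have "poly p (of_int N) \<noteq> 0" using q(2) NR by (auto simp: R_def)
    ultimately have "(of_int N :: 'k) = 0" using rel[of "of_int N"] NR by (simp add: R_def)
    then have "N = 0" using of_int_inj unfolding inj_def by (metis of_int_0)
    have "M - 1 \<notin> R"
    proof
      assume "M - 1 \<in> R"
      then have "M \<le> M - 1" unfolding M_def by (rule Min_le[OF finR])
      then show False by simp
    qed
    moreover have "poly p (of_int M) \<noteq> 0" using q(2) MR by (auto simp: R_def)
    ultimately have "(of_int (M - 1) :: 'k) = 0" using rel[of "of_int (M - 1)"] MR by (simp add: R_def)
    then have "M - 1 = 0" using of_int_inj unfolding inj_def by (metis of_int_0)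
    moreover have "M \<le> N" unfolding M_def by (rule Min_le[OF finR NR])
    ultimately show False using \<open>N = 0\<close> by simp
  qed
  then have "0 \<notin> R" "1 \<notin> R" by auto
  then have q0: "poly q 0 \<noteq> 0" "poly q 1 \<noteq> 0" by (simp_all add: R_def)
  have c2: "c2 = 0" using rel[of 0] q0 by simp
  have "[:0, 1:] * ([:c1:] * (q * sh q)) = [:0, 1:] * ([:0, 1:] * (sh p * q - p * sh q))"
    using peq unfolding c2 by (simp add: mult.assoc)
  then have "[:c1:] * (q * sh q) = [:0, 1:] * (sh p * q - p * sh q)" by (subst (asm) mult_left_cancel) auto
  from arg_cong[OF this, of "\<lambda>r. poly r 0"] have "c1 * (poly q 0 * poly q 1) = 0" by (simp add: poly_sh)
  with q0 c2 show ?thesis by simp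
qed

text \<open>Commutation with \<open>\<theta>\<close> multiplies the coefficient of \<open>x\<^sup>n\<close> by \<open>n\<close>, so a relation
  can be shortened.\<close>

lemma left_powers_independent:
  assumes "\<And>n. n < N \<Longrightarrow> k n \<in> K" "(\<Sum>n<N. k n * x ^ n) = 0" "n < N"
  shows "k n = 0"
  using assms
proof (induction N arbitrary: k n)
  case (Suc N)
  have x\<theta>: "x ^ n * \<theta> = (\<theta> + of_nat n) * x ^ n" for n
  proof (induction n)
    case (Suc n)
    have "x ^ Suc n * \<theta> = x * (x ^ n * \<theta>)" by (simp add: mult.assoc)
    also have "\<dots> = (x * \<theta> + x * of_nat n) * x ^ n" unfolding Suc by (simp add: distrib_left distrib_right mult.assoc)
    also have "x * of_nat n = of_nat n * x" by (rule mult_of_nat_commute[symmetric])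
    finally show ?case unfolding shift by (simp add: distrib_right mult.assoc add.assoc)
  qed simp
  let ?S = "\<Sum>n<Suc N. k n * x ^ n"
  have \<theta>K: "\<theta> \<in> K" by (rule K.var_fracs)
  have "?S * \<theta> - \<theta> * ?S = (\<Sum>n<Suc N. of_nat n * k n * x ^ n)"
    unfolding sum_distrib_left sum_distrib_right sum_subtractf[symmetric]
  proof (rule sum.cong[OF refl])
    fix n assume "n \<in> {..<Suc N}"
    then have "k n * \<theta> = \<theta> * k n" using Suc.prems(1) K_comm \<theta>K by simp
    then have "k n * x ^ n * \<theta> = \<theta> * k n * x ^ n + k n * of_nat n * x ^ n"
      by (simp add: mult.assoc x\<theta> distrib_left distrib_right) (simp add: mult.assoc[symmetric])
    then show "k n * x ^ n * \<theta> - \<theta> * (k n * x ^ n) = of_nat n * k n * x ^ n"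
      by (simp add: mult.assoc[symmetric] mult_of_nat_commute)
  qed
  then have "(\<Sum>n<Suc N. of_nat n * k n * x ^ n) = 0" using Suc.prems(2) by simp
  moreover have "of_nat N * ?S = 0" using Suc.prems(2) by simp
  ultimately have "(\<Sum>n<Suc N. (of_nat N - of_nat n) * k n * x ^ n) = 0"
    by (simp add: sum_distrib_left left_diff_distrib sum_subtractf mult.assoc del: sum.lessThan_Suc)
  then have s: "(\<Sum>n<N. (of_nat N - of_nat n) * k n * x ^ n) = 0" by simp
  have nK: "of_nat m \<in> K" for m by (induction m) (auto intro: KK.zero_mem KK.add_mem KK.one_mem)
  have below: "k n = 0" if "n < N" for n
  proof -
    have "(of_nat N - of_nat n) * k n = 0"
      by (rule Suc.IH[OF _ s that]) (use Suc.prems(1) nK in \<open>auto intro!: KK.mult_mem KK.diff_mem\<close>)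
    moreover have "(of_nat N - of_nat n :: 'd) = of_nat (N - n)" using that by (simp add: of_nat_diff)
    moreover have "(of_nat (N - n) :: 'd) \<noteq> 0"
      unfolding of_nat_eq_0 using that by simp
    ultimately show ?thesis by (metis mult_eq_0_iff)
  qed
  then have "(\<Sum>n<N. k n * x ^ n) = 0" by (intro sum.neutral) simp
  then have "k N * x ^ N = 0" using Suc.prems(2) by simp
  then have "k N = 0" using x0 by simp
  with below Suc.prems(3) show ?case by (cases "n = N") auto
qed simp

definition skew_polys :: "'d set" where
  "skew_polys = {(\<Sum>n<N. k n * x ^ n) | N k. \<forall>n. k n \<in> K}"

lemma skew_polysI: assumes "\<And>n. n < N \<Longrightarrow> k n \<in> K" shows "(\<Sum>n<N. k n * x ^ n) \<in> skew_polys"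
proof -
  have "(\<Sum>n<N. k n * x ^ n) = (\<Sum>n<N. (if n < N then k n else 0) * x ^ n)" by (rule sum.cong) auto
  moreover have "\<forall>n. (if n < N then k n else 0) \<in> K" using assms KK.zero_mem by simp
  ultimately show ?thesis unfolding skew_polys_def mem_Collect_eq
    by (intro exI[of _ N] exI[of _ "\<lambda>n. if n < N then k n else 0"] conjI)
qed

lemma skew_polysE:
  assumes "r \<in> skew_polys"
  shows "\<exists>N k. (\<forall>n. k n \<in> K) \<and> (\<forall>n\<ge>N. k n = 0) \<and> (\<forall>M\<ge>N. r = (\<Sum>n<M. k n * x ^ n))"
proof -
  from assms obtain N k where k: "\<forall>n. k n \<in> K" "r = (\<Sum>n<N. k n * x ^ n)" by (auto simp: skew_polys_def)
  have "r = (\<Sum>n<M. (if n < N then k n else 0) * x ^ n)" if "N \<le> M" for M unfolding k(2)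
    by (rule sum.mono_neutral_cong_left) (use that in auto)
  moreover have "\<forall>n. (if n < N then k n else 0) \<in> K" using k(1) KK.zero_mem by simp
  ultimately show ?thesis by (intro exI[of _ N] exI[of _ "\<lambda>n. if n < N then k n else 0"]) simp
qed

text \<open>The pair is \<open>(1 - x)\<^sup>-\<^sup>1 \<theta>\<^sup>-\<^sup>1\<close> and \<open>(1 - x)\<^sup>-\<^sup>1 \<theta>\<^sup>-\<^sup>2\<close>. In the criterion, \<open>R\<close> is the skew polynomial ring
  over \<open>K\<close>, the coefficients commuting with \<open>x\<close> are constants, and a single pole at \<open>0\<close> excludes a
  telescoping difference.\<close>

theorem free_pair_of_shift: "\<exists>y z. free_pair Z y z"
proof -
  have \<theta>K: "\<theta> \<in> K" by (rule K.var_fracs)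
  have \<theta>0: "\<theta> \<noteq> 0" using h_X h_eq_0[of "[:0, 1:]"] by simp
  define b where "b = (\<lambda>i. if i then inverse \<theta> else inverse (\<theta> * \<theta>))"
  have x1: "x \<noteq> 1" using shift by auto
  have xk: "x * k = x * k * inverse x * x" for k using x0 by (simp add: mult.assoc)
  interpret crit: free_criterion K x skew_polys b
  proof
    show "x * c * inverse x \<in> K" if "c \<in> K" for c by (rule conj_K[OF that])
    show "1 \<in> skew_polys" using skew_polysI[of 1 "\<lambda>_. 1"] KK.one_mem by simp
    show "b i \<in> K" for i by (simp add: b_def KK.inverse_mem KK.mult_mem \<theta>K)
    fix r assume r: "r \<in> skew_polys"
    from skew_polysE[OF r] obtain N k where k': "\<forall>n. k n \<in> K" "\<forall>n\<ge>N. k n = 0" "\<forall>M\<ge>N. r = (\<Sum>n<M. k n * x ^ n)"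
      by (elim exE conjE)
    note k = k'[rule_format]
    show "c * r \<in> skew_polys" if "c \<in> K" for c
      using skew_polysI[of N "\<lambda>n. c * k n"] k(1) k(3)[of N] that KK.mult_mem
      by (simp add: sum_distrib_left mult.assoc)
    define k1 where "k1 = (\<lambda>n. case n of 0 \<Rightarrow> 0 | Suc m \<Rightarrow> x * k m * inverse x)"
    have kK': "k1 n \<in> K" for n using k(1) conj_K KK.zero_mem by (cases n) (auto simp: k1_def)
    have xr: "x * r = (\<Sum>n<Suc N. k1 n * x ^ n)"
    proof -
      have "x * r = (\<Sum>n<N. x * k n * inverse x * x ^ Suc n)"
        unfolding k(3)[OF order_refl] sum_distrib_left
        by (rule sum.cong[OF refl]) (metis mult.assoc power_Suc xk)
      then show ?thesis by (subst sum.lessThan_Suc_shift) (simp add: k1_def)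
    qed
    show "x * r \<in> skew_polys" unfolding xr by (rule skew_polysI[OF kK'])
    show "r - s \<in> skew_polys" if "s \<in> skew_polys" for s
    proof -
      from skew_polysE[OF that] obtain M j where j': "\<forall>n. j n \<in> K" "\<forall>n\<ge>M. j n = 0" "\<forall>m\<ge>M. s = (\<Sum>n<m. j n * x ^ n)"
        by (elim exE conjE)
      note j = j'[rule_format]
      have "r - s = (\<Sum>n<max N M. (k n - j n) * x ^ n)"
        using k(3)[of "max N M"] j(3)[of "max N M"] by (simp add: left_diff_distrib sum_subtractf)
      then show ?thesis using skew_polysI[of "max N M" "\<lambda>n. k n - j n"] k(1) j(1) KK.diff_mem by simp
    qed
  next
    fix c assume c: "c \<in> K" "inverse (1 - x) * c \<in> skew_polys"
    from skew_polysE[OF c(2)] obtain N k where k': "\<forall>n. k n \<in> K" "\<forall>n\<ge>N. k n = 0"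
      "\<forall>M\<ge>N. inverse (1 - x) * c = (\<Sum>n<M. k n * x ^ n)" by (elim exE conjE)
    note k = k'[rule_format]
    let ?r = "\<Sum>n<N. k n * x ^ n"
    have "1 - x \<noteq> 0" using x1 by simp
    then have "c = (1 - x) * (inverse (1 - x) * c)" by (simp add: mult.assoc[symmetric])
    then have cr: "c = ?r - x * ?r" using k(3)[OF order_refl] by (simp add: left_diff_distrib)
    define j where "j = (\<lambda>n. case n of 0 \<Rightarrow> c | Suc m \<Rightarrow> x * k m * inverse x)"
    have jK: "j n \<in> K" for n using k(1) conj_K c(1) by (cases n) (auto simp: j_def)
    have "(\<Sum>n<Suc N. j n * x ^ n) = c + x * ?r"
      by (subst sum.lessThan_Suc_shift)
        (simp add: j_def sum_distrib_left, metis (no_types, lifting) mult.assoc xk)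
    moreover have "?r = (\<Sum>n<Suc N. k n * x ^ n)" using k(2)[of N] by simp
    ultimately have "(\<Sum>n<Suc N. (k n - j n) * x ^ n) = 0"
      using cr by (simp add: left_diff_distrib sum_subtractf del: sum.lessThan_Suc)
    then have kj: "k n = j n" if "n < Suc N" for n
      using left_powers_independent[of "Suc N" "\<lambda>n. k n - j n" n] k(1) jK KK.diff_mem that by simp
    have "k (N - i) = 0" if "i \<le> N" for i
      using that
    proof (induction i)
      case 0
      then show ?case using k(2) by simp
    next
      case (Suc i)
      then have "N - i = Suc (N - Suc i)" by simp
      then have "x * k (N - Suc i) * inverse x = 0"
        using kj[of "N - i"] Suc by (simp add: j_def)
      then show ?case using x0 by simp
    qed
    from this[of N] kj[of 0] show "c = 0" by (simp add: j_def)
  next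
    fix e v i assume e: "\<And>i. e i \<in> K" "\<And>i. x * e i = e i * x" and v: "v \<in> K"
      and eq: "(\<Sum>i\<in>UNIV. e i * b i) = x * v * inverse x - v"
    from fixed_const[OF e(1) e(2)] obtain c where c: "\<And>i. e i = \<phi> (c i)" by metis
    have "c True = 0 \<and> c False = 0"
      by (rule no_telescoping[OF v]) (use eq in \<open>simp add: UNIV_bool c b_def add.commute\<close>)
    then show "e i = 0" by (cases i) (simp_all add: c \<phi>_zero)
  qed (use x0 x1 in auto)
  define y where "y = inverse (1 - x) * b True"
  define z where "z = inverse (1 - x) * b False"
  have yz: "(\<lambda>i. inverse (1 - x) * b i) = (\<lambda>i. if i then y else z)" by (auto simp: y_def z_def)
  have Weq: "prod_list (map (\<lambda>i. if i then y else z) w) = crit.W w" for w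
    unfolding crit.W_def yz ..
  have "free_pair Z y z" unfolding free_pair_def Weq
  proof (intro allI impI ballI)
    fix n c w assume c: "\<forall>w. c w \<in> Z" "(\<Sum>w\<in>words_upto n. c w * crit.W w) = 0" and w: "w \<in> words_upto n"
    have cK: "c w \<in> K" for w using c(1) K.const_fracs by blast
    have split: "c [] + crit.relation_sum n c = 0"
      using c(2) unfolding words_upto_eq crit.relation_sum_def
      by (subst (asm) sum.insert) (auto simp: finite_nonempty_words_upto crit.W_Nil, simp add: nonempty_words_upto_def)
    then have "crit.relation_sum n c = - c []" by (simp add: eq_neg_iff_add_eq_0 add.commute)
    also have "- c [] \<in> skew_polys" by (rule crit.const_R[OF KK.uminus_mem[OF cK]])
    finally have R: "crit.relation_sum n c \<in> skew_polys" .
    have zero: "c w = 0" if "w \<in> nonempty_words_upto n" for w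
      by (rule crit.words_independent[OF cK R that])
    then have "crit.relation_sum n c = 0" by (simp add: crit.relation_sum_def)
    with split have "c [] = 0" by simp
    with zero w show "c w = 0" unfolding words_upto_eq by blast
  qed
  then show ?thesis by blast
qed

end

section \<open>Products of subspaces\<close>

definition prodspan :: "'d::division_ring set \<Rightarrow> 'd set \<Rightarrow> 'd set \<Rightarrow> 'd set" where
  "prodspan F X Y = rspan F {x * y | x y. x \<in> X \<and> y \<in> Y}"

lemma rsubspace_prodspan: "rsubspace F (prodspan F X Y)"
  by (simp add: prodspan_def rsubspace_rspan)

lemma prodspanI: "x \<in> X \<Longrightarrow> y \<in> Y \<Longrightarrow> x * y \<in> prodspan F X Y"
  unfolding prodspan_def by (rule rspan_base) blast

lemma prodspan_minimal:
  "rsubspace F U \<Longrightarrow> (\<And>x y. x \<in> X \<Longrightarrow> y \<in> Y \<Longrightarrow> x * y \<in> U) \<Longrightarrow> prodspan F X Y \<subseteq> U"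
  unfolding prodspan_def by (rule rspan_minimal) blast+

lemma prodspan_mono: "X \<subseteq> X' \<Longrightarrow> Y \<subseteq> Y' \<Longrightarrow> prodspan F X Y \<subseteq> prodspan F X' Y'"
  by (rule prodspan_minimal[OF rsubspace_prodspan]) (auto intro: prodspanI)

lemma rsubspace_lmult_preimage:
  assumes "rsubspace F U" shows "rsubspace F {u. d * u \<in> U}"
  using assms by (auto simp: rsubspace_def distrib_left mult.assoc[symmetric])

lemma rsubspace_rmult_preimage:
  assumes "rsubspace F U" "\<forall>c\<in>F. c * d = d * c" shows "rsubspace F {u. u * d \<in> U}"
proof (rule rsubspaceI)
  fix u c assume "u \<in> {u. u * d \<in> U}" "c \<in> F"
  then have "u * d * c \<in> U" using assms(1) rsubspace_scale by blast
  then show "u * c \<in> {u. u * d \<in> U}" using bspec[OF assms(2) \<open>c \<in> F\<close>] by (simp add: mult.assoc)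
qed (use assms(1) in \<open>auto simp: rsubspace_def distrib_right\<close>)

lemma rfin_rspan_field:
  assumes "rfin Z X" "Z \<subseteq> H" shows "rfin H (rspan H X)"
proof -
  from assms(1) obtain Y where Y: "finite Y" "X \<subseteq> rspan Z Y" by (auto simp: rfin_def)
  have "rspan H X \<subseteq> rspan H Y"
    by (rule rspan_minimal[OF rsubspace_rspan]) (use Y(2) rspan_field_mono[OF assms(2), of Y] in simp)
  then show ?thesis using Y(1) by (auto simp: rfin_def)
qed

context division_subring
begin

lemma rfin_prodspan:
  assumes "rfin F X" "finite Y" and comm: "\<And>c y. c \<in> F \<Longrightarrow> y \<in> Y \<Longrightarrow> c * y = y * c"
  shows "rfin F (prodspan F X Y)"
proof -
  from assms(1) obtain B where B: "finite B" "X \<subseteq> rspan F B" by (auto simp: rfin_def)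
  have "prodspan F X Y \<subseteq> rspan F ((\<lambda>(b, y). b * y) ` (B \<times> Y))"
  proof (rule prodspan_minimal[OF rsubspace_rspan])
    fix x y assume "x \<in> X" "y \<in> Y"
    have "\<forall>c\<in>F. c * y = y * c" using comm \<open>y \<in> Y\<close> by blast
    then have "rspan F B \<subseteq> {u. u * y \<in> rspan F ((\<lambda>(b, y). b * y) ` (B \<times> Y))}"
      by (intro rspan_minimal[OF rsubspace_rmult_preimage[OF rsubspace_rspan]])
        (use \<open>y \<in> Y\<close> in \<open>auto intro!: rspan_base\<close>)
    then show "x * y \<in> rspan F ((\<lambda>(b, y). b * y) ` (B \<times> Y))" using B(2) \<open>x \<in> X\<close> by blast
  qed
  moreover have "finite ((\<lambda>(b, y). b * y) ` (B \<times> Y))" using B(1) assms(2) by simp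
  ultimately show ?thesis unfolding rfin_def by blast
qed

lemma rmult_image:
  assumes "rfin F X" "rsubspace F X" "d \<noteq> 0" and comm: "\<forall>c\<in>F. c * d = d * c"
  shows "rdim F ((\<lambda>v. v * d) ` X) = rdim F X" "rfin F ((\<lambda>v. v * d) ` X)" "rsubspace F ((\<lambda>v. v * d) ` X)"
proof -
  have c: "u * c * d = u * d * c" if "c \<in> F" for u c using bspec[OF comm that] by (simp add: mult.assoc)
  show "rdim F ((\<lambda>v. v * d) ` X) = rdim F X" "rfin F ((\<lambda>v. v * d) ` X)" "rsubspace F ((\<lambda>v. v * d) ` X)"
    using rdim_image_inj[OF assms(1,2), of "\<lambda>v. v * d"] assms(3) c by (simp_all add: distrib_right)
qed

lemma lmult_image:
  assumes "rfin F X" "rsubspace F X" "d \<noteq> 0"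
  shows "rdim F ((*) d ` X) = rdim F X" "rfin F ((*) d ` X)" "rsubspace F ((*) d ` X)"
  using rdim_image_inj[OF assms(1,2), of "(*) d"] assms(3) by (simp_all add: distrib_left mult.assoc)

text \<open>The linear form of an argument of Petridis: if \<open>X\<close> grows least, relative to its dimension,
  under multiplication by \<open>\<Omega>\<close>, then so do all its products with elements commuting with \<open>\<Omega>\<close>.\<close>

lemma petridis:
  fixes q :: real
  assumes X: "rfin F X" "rsubspace F X" and Om: "finite \<Omega>" "\<And>c y. c \<in> F \<Longrightarrow> y \<in> \<Omega> \<Longrightarrow> c * y = y * c"
    and least: "\<And>Y. rsubspace F Y \<Longrightarrow> Y \<subseteq> X \<Longrightarrow> q * rdim F Y \<le> rdim F (prodspan F Y \<Omega>)"
    and eq: "rdim F (prodspan F X \<Omega>) \<le> q * rdim F X"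
    and C: "finite C" "\<And>c d. c \<in> F \<Longrightarrow> d \<in> C \<Longrightarrow> c * d = d * c" "\<And>y d. y \<in> \<Omega> \<Longrightarrow> d \<in> C \<Longrightarrow> y * d = d * y"
  shows "rdim F (prodspan F (prodspan F X C) \<Omega>) \<le> q * rdim F (prodspan F X C)"
  using C
proof (induction C rule: finite_induct)
  case empty
  have 1: "prodspan F X {} = {0}"
  proof
    show "prodspan F X {} \<subseteq> {0}" by (rule prodspan_minimal[OF rsubspace_zero]) simp
    show "{0} \<subseteq> prodspan F X {}" using rsubspace_0[OF rsubspace_prodspan] by blast
  qed
  have "prodspan F {0} \<Omega> \<subseteq> {0}" by (rule prodspan_minimal[OF rsubspace_zero]) simp
  then have "rdim F (prodspan F {0} \<Omega>) \<le> rdim F {0}"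
    by (rule rdim_mono[rotated]) (auto simp: rfin_def intro!: exI[of _ "{0}"] rspan_base)
  then show ?case by (simp add: 1)
next
  case (insert d C)
  let ?P = "prodspan F X C"
  let ?PO = "prodspan F ?P \<Omega>"
  let ?XO = "prodspan F X \<Omega>"
  have comm_d: "\<forall>c\<in>F. c * d = d * c" using insert.prems by blast
  have finP: "rfin F ?P" by (rule rfin_prodspan[OF X(1) insert.hyps(1)]) (use insert.prems in blast)
  have finPO: "rfin F ?PO" by (rule rfin_prodspan[OF finP Om(1)]) (use Om(2) in blast)
  have finXO: "rfin F ?XO" by (rule rfin_prodspan[OF X(1) Om(1)]) (use Om(2) in blast)
  have IH: "rdim F ?PO \<le> q * rdim F ?P" using insert by blast
  show ?case
  proof (cases "d = 0")
    case True
    have "prodspan F X (insert d C) = ?P"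
    proof
      show "prodspan F X (insert d C) \<subseteq> ?P"
        by (rule prodspan_minimal[OF rsubspace_prodspan])
          (use True rsubspace_0[OF rsubspace_prodspan] in \<open>auto intro: prodspanI\<close>)
      show "?P \<subseteq> prodspan F X (insert d C)" by (rule prodspan_mono) auto
    qed
    then show ?thesis using IH by simp
  next
    case d0: False
    define Xd where "Xd = (\<lambda>v. v * d) ` X"
    define XOd where "XOd = (\<lambda>v. v * d) ` ?XO"
    define X' where "X' = {v \<in> X. v * d \<in> ?P}"
    note Xd = rmult_image[OF X d0 comm_d, folded Xd_def]
    note XOd = rmult_image[OF finXO rsubspace_prodspan d0 comm_d, folded XOd_def]
    have X': "rsubspace F X'" "X' \<subseteq> X" unfolding X'_def
      using rsubspace_Int[OF X(2) rsubspace_rmult_preimage[OF rsubspace_prodspan comm_d, of X C]]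
      by (auto simp: Int_def)
    have eq1: "prodspan F X (insert d C) = ssum ?P Xd"
    proof
      show "prodspan F X (insert d C) \<subseteq> ssum ?P Xd"
      proof (rule prodspan_minimal[OF rsubspace_ssum[OF rsubspace_prodspan Xd(3)]])
        fix x y assume "x \<in> X" "y \<in> insert d C"
        then have "x * y \<in> ?P \<or> x * y \<in> Xd" by (auto simp: Xd_def intro: prodspanI)
        then show "x * y \<in> ssum ?P Xd" using ssum_superset[OF rsubspace_prodspan Xd(3), of X C] by blast
      qed
      show "ssum ?P Xd \<subseteq> prodspan F X (insert d C)"
      proof (rule ssum_subset[OF rsubspace_prodspan])
        show "?P \<subseteq> prodspan F X (insert d C)" by (rule prodspan_mono) auto
        show "Xd \<subseteq> prodspan F X (insert d C)" unfolding Xd_def by (auto intro: prodspanI)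
      qed
    qed
    have "?P \<inter> Xd = (\<lambda>v. v * d) ` X'" by (auto simp: Xd_def X'_def)
    then have int: "rdim F (?P \<inter> Xd) = rdim F X'"
      using rmult_image(1)[OF rfin_subset[OF X(1) X'(2)] X'(1) d0 comm_d] by simp
    have dim1: "rdim F (ssum ?P Xd) + rdim F X' = rdim F ?P + rdim F X"
      using rdim_ssum[OF finP Xd(2) rsubspace_prodspan Xd(3)] int Xd(1) by simp
    have sub: "prodspan F (ssum ?P Xd) \<Omega> \<subseteq> ssum ?PO XOd"
    proof (rule prodspan_minimal[OF rsubspace_ssum[OF rsubspace_prodspan XOd(3)]])
      fix w y assume w: "w \<in> ssum ?P Xd" and y: "y \<in> \<Omega>"
      then obtain p v where "p \<in> ?P" "v \<in> X" "w = p + v * d" by (auto simp: ssum_def Xd_def)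
      moreover from this have "p * y \<in> ?PO" using y by (auto intro: prodspanI)
      moreover have "v * d * y = v * y * d" using insert.prems(2)[OF y, of d] by (simp add: mult.assoc)
      moreover have "v * y * d \<in> XOd" unfolding XOd_def using \<open>v \<in> X\<close> y by (auto intro!: imageI prodspanI)
      ultimately show "w * y \<in> ssum ?PO XOd" by (auto simp: ssum_def distrib_right)
    qed
    have sub2: "(\<lambda>v. v * d) ` prodspan F X' \<Omega> \<subseteq> ?PO \<inter> XOd"
    proof -
      have "prodspan F X' \<Omega> \<subseteq> {u. u * d \<in> ?PO} \<inter> ?XO"
      proof (rule prodspan_minimal[OF rsubspace_Int[OF rsubspace_rmult_preimage[OF rsubspace_prodspan comm_d] rsubspace_prodspan]])
        fix v y assume v: "v \<in> X'" and y: "y \<in> \<Omega>"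
        have "v * y * d = v * d * y" using insert.prems(2)[OF y, of d] by (simp add: mult.assoc)
        moreover have "v * d * y \<in> ?PO" using v y by (auto simp: X'_def intro: prodspanI)
        ultimately show "v * y \<in> {u. u * d \<in> ?PO} \<inter> ?XO" using v y by (auto simp: X'_def intro: prodspanI)
      qed
      then show ?thesis by (auto simp: XOd_def)
    qed
    have finX'O: "rfin F (prodspan F X' \<Omega>)"
      by (rule rfin_prodspan[OF rfin_subset[OF X(1) X'(2)] Om(1)]) (use Om(2) in blast)
    have "rdim F (prodspan F X' \<Omega>) = rdim F ((\<lambda>v. v * d) ` prodspan F X' \<Omega>)"
      using rmult_image(1)[OF finX'O rsubspace_prodspan d0 comm_d] by simp
    also have "\<dots> \<le> rdim F (?PO \<inter> XOd)"
      by (rule rdim_mono[OF rfin_subset[OF finPO] sub2]) auto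
    finally have int2: "rdim F (prodspan F X' \<Omega>) \<le> rdim F (?PO \<inter> XOd)" .
    have "rdim F (prodspan F (ssum ?P Xd) \<Omega>) \<le> rdim F (ssum ?PO XOd)"
      by (rule rdim_mono[OF rfin_ssum[OF finPO XOd(2)] sub])
    moreover have "rdim F (ssum ?PO XOd) + rdim F (?PO \<inter> XOd) = rdim F ?PO + rdim F ?XO"
      using rdim_ssum[OF finPO XOd(2) rsubspace_prodspan XOd(3)] XOd(1) by simp
    ultimately have "rdim F (prodspan F (ssum ?P Xd) \<Omega>) + rdim F (prodspan F X' \<Omega>) \<le> rdim F ?PO + rdim F ?XO"
      using int2 by linarith
    then have "real (rdim F (prodspan F (ssum ?P Xd) \<Omega>)) + rdim F (prodspan F X' \<Omega>) \<le> q * rdim F ?P + q * rdim F X"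
      using IH eq by linarith
    moreover have "q * rdim F X' \<le> rdim F (prodspan F X' \<Omega>)" by (rule least[OF X'])
    moreover have "q * rdim F (ssum ?P Xd) = q * rdim F ?P + q * rdim F X - q * rdim F X'"
    proof -
      have "real (rdim F (ssum ?P Xd)) + rdim F X' = real (rdim F ?P) + rdim F X"
        using dim1 by (metis of_nat_add)
      then have "q * rdim F (ssum ?P Xd) + q * rdim F X' = q * rdim F ?P + q * rdim F X"
        by (metis distrib_left)
      then show ?thesis by linarith
    qed
    ultimately show ?thesis unfolding eq1 by linarith
  qed
qed

text \<open>Every layer over the larger division ring \<open>H\<close> contributes at least one new dimension over \<open>F\<close>
  to \<open>U S\<close>, unless it contains a finite-dimensional subspace stable under \<open>S\<close>.\<close>

lemma gain_per_layer:
  assumes H: "division_subring H" "F \<subseteq> H" and S: "finite S" "S \<subseteq> H" "1 \<in> S"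
    and comm: "\<And>c s. c \<in> F \<Longrightarrow> s \<in> S \<Longrightarrow> c * s = s * c"
    and unstable: "\<And>T. T \<subseteq> H \<Longrightarrow> rsubspace F T \<Longrightarrow> rfin F T \<Longrightarrow> (\<And>t s. t \<in> T \<Longrightarrow> s \<in> S \<Longrightarrow> t * s \<in> T) \<Longrightarrow> T \<subseteq> {0}"
    and U: "rfin F U" "rsubspace F U"
  shows "rdim F U + rdim H (rspan H U) \<le> rdim F (prodspan F U S)"
proof -
  interpret H: division_subring H by fact
  have main: "rdim F U + card B \<le> rdim F (prodspan F U S)"
    if "finite B" "rindep H B" "B \<subseteq> U" "U \<subseteq> rspan H B" "rfin F U" "rsubspace F U" for B U
    using that
  proof (induction B arbitrary: U rule: finite_induct)
    case empty
    have "U \<subseteq> prodspan F U S" using prodspanI[OF _ S(3), of _ U F] by force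
    moreover have "rfin F (prodspan F U S)" by (rule rfin_prodspan[OF empty.prems(4) S(1) comm])
    ultimately show ?case using rdim_mono by simp
  next
    case (insert u B)
    let ?US = "prodspan F U S"
    have finB: "finite B" by fact
    have indB: "rindep H B" by (rule H.rindep_subset[OF insert.prems(1)]) auto
    have notin: "u \<notin> rspan H B"
    proof
      assume "u \<in> rspan H B"
      then obtain c where c: "u = (\<Sum>b\<in>B. b * c b)" "\<forall>b\<in>B. c b \<in> H" unfolding H.rspan_finite[OF finB] by blast
      have "(\<Sum>b\<in>insert u B. b * (c(u := -1)) b) = u * (-1) + (\<Sum>b\<in>B. b * c b)"
        using finB insert.hyps by (simp) (rule sum.cong, auto)
      also have "\<dots> = 0" using c(1) by simp
      finally have s0: "(\<Sum>b\<in>insert u B. b * (c(u := -1)) b) = 0" .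
      have "\<forall>b\<in>insert u B. (c(u := -1)) b = 0"
        by (rule H.rindepD[OF insert.prems(1) _ s0]) (use c(2) H.one_mem in \<open>auto simp: H.uminus_mem\<close>)
      then show False by simp
    qed
    have decomp: "\<exists>h\<in>H. v - u * h \<in> rspan H B" if "v \<in> rspan H (insert u B)" for v
    proof -
      from that obtain c where c: "v = (\<Sum>b\<in>insert u B. b * c b)" "\<forall>b\<in>insert u B. c b \<in> H"
        unfolding H.rspan_finite[OF finite.insertI[OF finB]] by blast
      then have "v - u * c u = (\<Sum>b\<in>B. b * c b)" using finB insert.hyps by simp
      then show ?thesis using c(2) unfolding H.rspan_finite[OF finB] by blast
    qed
    have unique: "h = h'" if "h \<in> H" "h' \<in> H" "v - u * h \<in> rspan H B" "v - u * h' \<in> rspan H B" for v h h'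
    proof (rule ccontr)
      assume ne: "h \<noteq> h'"
      have "(v - u * h') - (v - u * h) \<in> rspan H B" by (rule H.rsubspace_diff[OF rsubspace_rspan that(4,3)])
      then have "u * (h - h') \<in> rspan H B" by (simp add: right_diff_distrib)
      then have "u * (h - h') * inverse (h - h') \<in> rspan H B"
        using rsubspace_scale[OF rsubspace_rspan] H.inverse_mem H.diff_mem that(1,2) by blast
      then have "u \<in> rspan H B" using ne by (simp add: mult.assoc)
      with notin show False by simp
    qed
    define e where "e = (\<lambda>v. SOME h. h \<in> H \<and> v - u * h \<in> rspan H B)"
    have e: "e v \<in> H" "v - u * e v \<in> rspan H B" if "v \<in> rspan H (insert u B)" for v
      using someI_ex[of "\<lambda>h. h \<in> H \<and> v - u * h \<in> rspan H B"] decomp[OF that] by (auto simp: e_def)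
    have e_eq: "e v = h" if "v \<in> rspan H (insert u B)" "h \<in> H" "v - u * h \<in> rspan H B" for v h
      using unique[OF e(1)[OF that(1)] that(2) e(2)[OF that(1)] that(3)] .
    let ?L = "rspan H (insert u B)"
    note Lsub = rsubspace_rspan[of H "insert u B"]
    have e_add: "e (v + w) = e v + e w" if "v \<in> ?L" "w \<in> ?L" for v w
    proof (rule e_eq[OF rsubspace_add[OF Lsub that]])
      show "e v + e w \<in> H" using e(1) that H.add_mem by blast
      have eq: "v + w - u * (e v + e w) = (v - u * e v) + (w - u * e w)" by (simp add: distrib_left)
      show "v + w - u * (e v + e w) \<in> rspan H B"
        unfolding eq by (rule rsubspace_add[OF rsubspace_rspan e(2)[OF that(1)] e(2)[OF that(2)]])
    qed
    have e_scale: "e (v * c) = e v * c" if "v \<in> ?L" "c \<in> H" for v c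
    proof (rule e_eq[OF rsubspace_scale[OF Lsub that]])
      show "e v * c \<in> H" using e(1) that H.mult_mem by blast
      have eq: "v * c - u * (e v * c) = (v - u * e v) * c" by (simp add: left_diff_distrib mult.assoc)
      show "v * c - u * (e v * c) \<in> rspan H B"
        unfolding eq by (rule rsubspace_scale[OF rsubspace_rspan e(2)[OF that(1)] that(2)])
    qed
    have eB: "e v = 0" if "v \<in> rspan H B" for v
      by (rule e_eq) (use that H.zero_mem rspan_mono[of B "insert u B" H] in auto)
    have e0: "v \<in> rspan H B" if "v \<in> ?L" "e v = 0" for v using e(2)[OF that(1)] that(2) by simp
    have eu: "e u = 1"
      by (rule e_eq) (use H.one_mem rspan_base[of u "insert u B" H] rsubspace_0[OF rsubspace_rspan] in auto)
    have UL: "U \<subseteq> ?L" by fact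
    have USL: "?US \<subseteq> ?L"
      by (rule prodspan_minimal[OF rsubspace_subfield[OF Lsub H(2)]])
        (use UL S(2) in \<open>auto intro: rsubspace_scale[OF Lsub]\<close>)
    note finU = insert.prems(4) and subU = insert.prems(5)
    have finUS: "rfin F ?US" by (rule rfin_prodspan[OF finU S(1) comm])
    define U0 where "U0 = {v \<in> U. e v = 0}"
    have rnU: "rdim F U = rdim F U0 + rdim F (e ` U)" "rfin F (e ` U)" "rsubspace F (e ` U)"
      unfolding U0_def by (rule rank_nullity[OF finU subU, of e]; (rule e_add e_scale)?; use UL H(2) in blast)+
    have rnUS: "rdim F ?US = rdim F {v \<in> ?US. e v = 0} + rdim F (e ` ?US)" "rfin F (e ` ?US)" "rsubspace F (e ` ?US)"
      by (rule rank_nullity[OF finUS rsubspace_prodspan, of e]; (rule e_add e_scale)?; use USL H(2) in blast)+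
    have "U0 = U \<inter> rspan H B" using eB e0 UL by (auto simp: U0_def)
    then have U0: "rsubspace F U0" "U0 \<subseteq> rspan H B" "B \<subseteq> U0" "U0 \<subseteq> U"
      using rsubspace_Int[OF subU rsubspace_subfield[OF rsubspace_rspan H(2)]] rspan_superset[of B H] insert.prems(2)
      by auto
    have IH: "rdim F U0 + card B \<le> rdim F (prodspan F U0 S)"
      by (rule insert.IH[OF indB U0(3,2) rfin_subset[OF finU U0(4)] U0(1)])
    have "prodspan F U0 S \<subseteq> ?US" by (rule prodspan_mono[OF U0(4) subset_refl])
    moreover have "prodspan F U0 S \<subseteq> rspan H B"
      by (rule prodspan_minimal[OF rsubspace_subfield[OF rsubspace_rspan H(2)]])
        (use U0(2) S(2) in \<open>auto intro: rsubspace_scale[OF rsubspace_rspan]\<close>)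
    ultimately have "prodspan F U0 S \<subseteq> {v \<in> ?US. e v = 0}" using eB by blast
    then have 1: "rdim F (prodspan F U0 S) \<le> rdim F {v \<in> ?US. e v = 0}"
      by (rule rdim_mono[rotated]) (rule rfin_subset[OF finUS], blast)
    have eUS: "t * s \<in> e ` ?US" if "t \<in> e ` U" "s \<in> S" for t s
    proof -
      from that obtain v where v: "v \<in> U" "t = e v" by blast
      have "e (v * s) = e v * s" by (rule e_scale) (use v UL S(2) that in auto)
      then have "t * s = e (v * s)" using v by simp
      moreover have "v * s \<in> ?US" using v that by (auto intro: prodspanI)
      ultimately show ?thesis by blast
    qed
    have sub: "e ` U \<subseteq> e ` ?US" using eUS[OF _ S(3)] by force
    have "rdim F (e ` U) \<noteq> rdim F (e ` ?US)"
    proof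
      assume "rdim F (e ` U) = rdim F (e ` ?US)"
      then have "e ` U = e ` ?US" using rdim_eq_imp_eq[OF rnUS(2) rnU(3) sub] by simp
      moreover have "e ` U \<subseteq> H" using e(1) UL by blast
      moreover have "t * s \<in> e ` U" if "t \<in> e ` U" "s \<in> S" for t s
        unfolding \<open>e ` U = e ` ?US\<close> using eUS[OF that] .
      ultimately have "e ` U \<subseteq> {0}" by (intro unstable[OF _ rnU(3,2)])
      moreover have "e u \<in> e ` U" using insert.prems(2) by blast
      ultimately have "e u \<in> {0}" by (rule subsetD)
      then show False using eu by simp
    qed
    moreover have "rdim F (e ` U) \<le> rdim F (e ` ?US)" by (rule rdim_mono[OF rnUS(2) sub])
    ultimately have "rdim F (e ` U) + 1 \<le> rdim F (e ` ?US)" by simp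
    then show ?case using 1 IH rnU(1) rnUS(1) insert.hyps by simp
  qed
  have finH: "rfin H U" by (rule H.rfin_subset[OF rfin_rspan_field[OF U(1) H(2)] rspan_superset])
  from H.rindep_extend_basis[OF finH empty_subsetI H.rindep_empty] obtain B where
    B: "B \<subseteq> U" "rindep H B" "U \<subseteq> rspan H B" by metis
  have "rspan H U \<subseteq> rspan H B" by (rule rspan_minimal[OF rsubspace_rspan B(3)])
  then have "rdim H (rspan H U) = card B"
    by (intro H.rdim_eq_card B(2)) (use B(1) rspan_superset[of U H] in blast)+
  with main[OF H.rindep_finite[OF B(2)] B(2,1,3) U] show ?thesis by simp
qed

end

section \<open>Growth\<close>

context transcendental_ext
begin

text \<open>The products of a basis over the fractions with the powers of \<open>l\<close> are independent over \<open>F\<close>.\<close>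

lemma dim_over_fracs_lower:
  assumes Y: "rfin (fracs F l) Y" and T: "rfin F T" "\<And>y i. y \<in> Y \<Longrightarrow> i < m \<Longrightarrow> y * l ^ i \<in> T"
  shows "m * rdim (fracs F l) (rspan (fracs F l) Y) \<le> rdim F T"
proof -
  interpret K: division_subring "fracs F l" by (rule division_subring_fracs)
  from K.rindep_extend_basis[OF Y empty_subsetI K.rindep_empty] obtain B where
    B: "B \<subseteq> Y" "rindep (fracs F l) B" "Y \<subseteq> rspan (fracs F l) B" by metis
  have finB: "finite B" by (rule K.rindep_finite[OF B(2)])
  have cardB: "rdim (fracs F l) (rspan (fracs F l) Y) = card B"
    by (rule K.rdim_eq_card[OF _ B(2) rspan_minimal[OF rsubspace_rspan B(3)]]) (use B(1) rspan_superset in blast)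
  have fam: "\<forall>p\<in>B \<times> {..<m}. c p = 0"
    if c: "\<And>p. p \<in> B \<times> {..<m} \<Longrightarrow> c p \<in> F" "(\<Sum>p\<in>B \<times> {..<m}. (fst p * l ^ snd p) * c p) = 0" for c
  proof -
    have "(\<Sum>p\<in>B \<times> {..<m}. (fst p * l ^ snd p) * c p) = (\<Sum>b\<in>B. \<Sum>i<m. (b * l ^ i) * c (b, i))"
      by (simp add: sum.cartesian_product case_prod_unfold)
    also have "\<dots> = (\<Sum>b\<in>B. b * (\<Sum>i<m. l ^ i * c (b, i)))"
      by (simp add: sum_distrib_left mult.assoc)
    finally have s: "(\<Sum>b\<in>B. b * (\<Sum>i<m. l ^ i * c (b, i))) = 0" using c(2) by simp
    have "\<forall>b\<in>B. (\<Sum>i<m. l ^ i * c (b, i)) = 0"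
      by (rule K.rindepD[OF B(2) _ s])
        (use c(1) in \<open>auto intro!: polys_fracs subsetD[OF polyb_subset_polys polybI]\<close>)
    then have "c (b, i) = 0" if "b \<in> B" "i < m" for b i
      using transcD[OF transc, of m "\<lambda>i. c (b, i)" i] c(1) that by simp
    then show ?thesis by auto
  qed
  have fin: "finite (B \<times> {..<m})" using finB by simp
  have inj: "inj_on (\<lambda>p. fst p * l ^ snd p) (B \<times> {..<m})"
    by (rule rindep_family(1)[OF fin fam])
  have ind: "rindep F ((\<lambda>p. fst p * l ^ snd p) ` (B \<times> {..<m}))"
    by (rule rindep_family(2)[OF fin fam])
  have "card ((\<lambda>p. fst p * l ^ snd p) ` (B \<times> {..<m})) \<le> rdim F T"
    by (rule rindep_card_le_rdim[OF T(1) _ ind]) (use T(2) B(1) in auto)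
  moreover have "card ((\<lambda>p. fst p * l ^ snd p) ` (B \<times> {..<m})) = card B * m"
    unfolding card_image[OF inj] by (simp add: card_cartesian_product)
  ultimately show ?thesis unfolding cardB by (simp add: mult.commute)
qed

text \<open>After multiplication by a common denominator, the coordinates of \<open>X\<close> are polynomials of bounded
  degree, and the bound \<open>D\<close> is independent of \<open>m\<close>.\<close>

lemma dim_over_fracs_upper:
  assumes comm_F: "F \<subseteq> centralizer F" and X: "rfin F X" "rsubspace F X"
  shows "\<exists>D. \<forall>m. rdim F (prodspan F X ((\<lambda>i. l ^ i) ` {..<m})) \<le> rdim (fracs F l) (rspan (fracs F l) X) * (m + D)"
proof -
  interpret K: division_subring "fracs F l" by (rule division_subring_fracs)
  have Kcomm: "a * b = b * a" if "a \<in> fracs F l" "b \<in> fracs F l" for a b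
    using fracs_commutative[OF comm_F] that by (auto simp: centralizer_def)
  have FK: "F \<subseteq> fracs F l" using const_fracs by blast
  from rbasis[OF X] obtain V where V: "V \<subseteq> X" "rindep F V" "X = rspan F V" by metis
  have finV: "finite V" by (rule rindep_finite[OF V(2)])
  have "X \<subseteq> rspan (fracs F l) V" using V(3) rspan_field_mono[OF FK, of V] by simp
  then have "rfin (fracs F l) X" using finV by (auto simp: rfin_def)
  from K.rindep_extend_basis[OF this empty_subsetI K.rindep_empty] obtain B where
    B: "B \<subseteq> X" "rindep (fracs F l) B" "X \<subseteq> rspan (fracs F l) B" by metis
  have finB: "finite B" by (rule K.rindep_finite[OF B(2)])
  have cardB: "rdim (fracs F l) (rspan (fracs F l) X) = card B"
    by (rule K.rdim_eq_card[OF _ B(2) rspan_minimal[OF rsubspace_rspan B(3)]]) (use B(1) rspan_superset in blast)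
  have "\<forall>v\<in>V. \<exists>k. (\<forall>b\<in>B. k b \<in> fracs F l) \<and> v = (\<Sum>b\<in>B. b * k b)"
  proof
    fix v assume "v \<in> V"
    then have "v \<in> rspan (fracs F l) B" using V(1) B(3) by blast
    then show "\<exists>k. (\<forall>b\<in>B. k b \<in> fracs F l) \<and> v = (\<Sum>b\<in>B. b * k b)" unfolding K.rspan_finite[OF finB] by blast
  qed
  then obtain k where k: "\<forall>v\<in>V. (\<forall>b\<in>B. k v b \<in> fracs F l) \<and> v = (\<Sum>b\<in>B. b * k v b)" by metis
  have "\<exists>q\<in>polys F l. q \<noteq> 0 \<and> (\<forall>p\<in>V \<times> B. k (fst p) (snd p) * q \<in> polys F l)"
    by (rule common_denominator) (use finV finB k in auto)
  then obtain f where f: "f \<in> polys F l" "f \<noteq> 0" "\<forall>p\<in>V \<times> B. k (fst p) (snd p) * f \<in> polys F l" by blast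
  then have "\<forall>p\<in>V \<times> B. \<exists>D. k (fst p) (snd p) * f \<in> polyb F l D" by (auto simp: polys_def)
  then obtain D' where D': "\<forall>p\<in>V \<times> B. k (fst p) (snd p) * f \<in> polyb F l (D' p)" by metis
  define D where "D = Max (insert 0 (D' ` (V \<times> B)))"
  have D: "k v b * f \<in> polyb F l D" if "v \<in> V" "b \<in> B" for v b
  proof -
    have "D' (v, b) \<le> D" unfolding D_def using finV finB that by (intro Max_ge) auto
    then show ?thesis using D' that polyb_mono[of "D' (v, b)" D F l] by fastforce
  qed
  have fK: "f \<in> fracs F l" by (rule polys_fracs[OF f(1)])
  have lK: "l ^ i \<in> fracs F l" for i by (rule K.power_mem[OF var_fracs])
  have "rdim F (prodspan F X ((\<lambda>i. l ^ i) ` {..<m})) \<le> card B * (m + D)" for m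
  proof -
    let ?P = "prodspan F X ((\<lambda>i. l ^ i) ` {..<m})"
    let ?G = "(\<lambda>(b, j). b * l ^ j) ` (B \<times> {..<m + D})"
    have "X \<subseteq> {v. v * (l ^ i * f) \<in> rspan F ?G}" if i: "i < m" for i
      unfolding V(3)
    proof (rule rspan_minimal[OF rsubspace_rmult_preimage[OF rsubspace_rspan]])
      show "\<forall>c\<in>F. c * (l ^ i * f) = l ^ i * f * c"
        by (rule ballI, rule Kcomm[OF const_fracs K.mult_mem[OF lK fK]])
      show "V \<subseteq> {v. v * (l ^ i * f) \<in> rspan F ?G}"
      proof
        fix v assume v: "v \<in> V"
        have "v * (l ^ i * f) = (\<Sum>b\<in>B. b * k v b) * (l ^ i * f)" using k v by simp
        also have "\<dots> = (\<Sum>b\<in>B. b * (l ^ i * (k v b * f)))"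
          unfolding sum_distrib_right
        proof (rule sum.cong[OF refl])
          fix b assume "b \<in> B"
          then have "k v b * l ^ i = l ^ i * k v b" using k v Kcomm lK by blast
          then show "b * k v b * (l ^ i * f) = b * (l ^ i * (k v b * f))" by (metis mult.assoc)
        qed
        also have "\<dots> \<in> rspan F ?G"
        proof (rule rsubspace_sum[OF rsubspace_rspan])
          fix b assume b: "b \<in> B"
          have "l ^ i * (k v b * f) \<in> polyb F l (i + D)" by (rule power_mult_polyb[OF D[OF v b]])
          then have "l ^ i * (k v b * f) \<in> polyb F l (m + D)" using polyb_mono[of "i + D" "m + D" F l] i by auto
          then have "b * (l ^ i * (k v b * f)) \<in> rspan F ((*) b ` ((\<lambda>i. l ^ i) ` {..<m + D}))"
            unfolding polyb_def by (rule rspan_lmult)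
          moreover have "rspan F ((*) b ` ((\<lambda>i. l ^ i) ` {..<m + D})) \<subseteq> rspan F ?G"
            by (rule rspan_mono) (use b in auto)
          ultimately show "b * (l ^ i * (k v b * f)) \<in> rspan F ?G" by blast
        qed
        finally show "v \<in> {v. v * (l ^ i * f) \<in> rspan F ?G}" by simp
      qed
    qed
    moreover have Ff: "\<forall>c\<in>F. c * f = f * c" by (rule ballI, rule Kcomm[OF const_fracs fK])
    ultimately have "?P \<subseteq> {u. u * f \<in> rspan F ?G}"
      by (intro prodspan_minimal rsubspace_rmult_preimage rsubspace_rspan) (auto simp: mult.assoc)
    then have sub: "(\<lambda>u. u * f) ` ?P \<subseteq> rspan F ?G" by blast
    have cl: "c * y = y * c" if "c \<in> F" "y \<in> (\<lambda>i. l ^ i) ` {..<m}" for c y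
      using comm_power[OF that(1)] that(2) by auto
    have finP: "rfin F ?P" by (rule rfin_prodspan[OF X(1) _ cl]) auto
    have "rdim F ?P = rdim F ((\<lambda>u. u * f) ` ?P)"
      using rmult_image(1)[OF finP rsubspace_prodspan f(2) Ff] by simp
    also have "\<dots> \<le> card ?G" by (rule rdim_le_card[OF _ sub]) (use finB in auto)
    also have "\<dots> \<le> card B * (m + D)" using card_image_le[of "B \<times> {..<m + D}" "\<lambda>(b, j). b * l ^ j"] finB
      by (simp add: card_cartesian_product)
    finally show ?thesis .
  qed
  then show ?thesis unfolding cardB by blast
qed

text \<open>The growth rate of a minimizing subspace is inherited by its span over the fractions, because
  the products with long segments of powers of \<open>l\<close> have dimension asymptotically proportional to
  the dimension over the fractions.\<close>

lemma petridis_over_fracs: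
  fixes q :: real
  assumes comm_F: "F \<subseteq> centralizer F" and X: "rfin F X" "rsubspace F X"
    and Om: "finite \<Omega>" "\<And>c y. c \<in> F \<Longrightarrow> y \<in> \<Omega> \<Longrightarrow> c * y = y * c" "\<And>y. y \<in> \<Omega> \<Longrightarrow> y * l = l * y"
    and least: "\<And>Y. rsubspace F Y \<Longrightarrow> Y \<subseteq> X \<Longrightarrow> q * rdim F Y \<le> rdim F (prodspan F Y \<Omega>)"
    and eq: "rdim F (prodspan F X \<Omega>) \<le> q * rdim F X"
    and q: "0 \<le> q"
  shows "rdim (fracs F l) (rspan (fracs F l) (prodspan F X \<Omega>)) \<le> q * rdim (fracs F l) (rspan (fracs F l) X)"
proof -
  let ?K = "fracs F l"
  interpret K: division_subring "fracs F l" by (rule division_subring_fracs)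
  have FK: "F \<subseteq> ?K" using const_fracs by blast
  let ?C = "\<lambda>m. (\<lambda>i. l ^ i) ` {..<m}"
  let ?r = "rdim ?K (rspan ?K X)"
  let ?s = "rdim ?K (rspan ?K (prodspan F X \<Omega>))"
  from dim_over_fracs_upper[OF comm_F X] obtain D where
    D: "\<And>m. rdim F (prodspan F X (?C m)) \<le> ?r * (m + D)" by blast
  have finY: "rfin F (prodspan F X \<Omega>)" by (rule rfin_prodspan[OF X(1) Om(1,2)])
  have finKY: "rfin ?K (prodspan F X \<Omega>)"
    by (rule K.rfin_subset[OF rfin_rspan_field[OF finY FK] rspan_superset])
  have bound: "m * ?s \<le> q * (?r * (m + D))" for m
  proof -
    have cl: "c * y = y * c" if "c \<in> F" "y \<in> ?C m" for c y
      using comm_power[OF that(1)] that(2) by auto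
    have ol: "y * d = d * y" if "y \<in> \<Omega>" "d \<in> ?C m" for y d
    proof -
      from that(2) obtain i where "d = l ^ i" by blast
      then show ?thesis using power_commuting_commutes[of l y i] Om(3)[OF that(1)] by simp
    qed
    let ?T = "prodspan F (prodspan F X (?C m)) \<Omega>"
    have finC: "rfin F (prodspan F X (?C m))" by (rule rfin_prodspan[OF X(1) _ cl]) auto
    have finT: "rfin F ?T" by (rule rfin_prodspan[OF finC Om(1,2)])
    have "m * ?s \<le> rdim F ?T"
    proof (rule dim_over_fracs_lower[OF finKY finT])
      fix y i assume y: "y \<in> prodspan F X \<Omega>" and i: "i < m"
      have "prodspan F X \<Omega> \<subseteq> {u. u * l ^ i \<in> ?T}"
      proof (rule prodspan_minimal[OF rsubspace_rmult_preimage[OF rsubspace_prodspan ballI[OF comm_power]]])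
        fix v w assume v: "v \<in> X" and w: "w \<in> \<Omega>"
        have "v * w * l ^ i = v * l ^ i * w" using ol[OF w, of "l ^ i"] i by (simp add: mult.assoc)
        moreover have "v * l ^ i * w \<in> ?T" using v w i by (intro prodspanI) auto
        ultimately show "v * w \<in> {u. u * l ^ i \<in> ?T}" by simp
      qed
      with y show "y * l ^ i \<in> ?T" by blast
    qed
    then have "real (m * ?s) \<le> rdim F ?T" by linarith
    also have "\<dots> \<le> q * rdim F (prodspan F X (?C m))"
      by (rule petridis[OF X Om(1,2) least eq _ cl ol]) auto
    also have "\<dots> \<le> q * (?r * (m + D))" using D[of m] q by (intro mult_left_mono) (simp_all add: of_nat_mult[symmetric] del: of_nat_mult)
    finally show ?thesis by simp
  qed
  show ?thesis
  proof (rule ccontr)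
    assume "\<not> ?thesis"
    then have d: "0 < ?s - q * ?r" by simp
    obtain m :: nat where m: "q * ?r * D / (?s - q * ?r) < m" using reals_Archimedean2 by blast
    then have "q * ?r * D < m * (?s - q * ?r)" using d by (simp add: field_simps)
    moreover have "m * (?s - q * ?r) \<le> q * ?r * D" using bound[of m] by (simp add: algebra_simps)
    ultimately show False by simp
  qed
qed

end

text \<open>A filtration by finite-dimensional subspaces of an algebra for which \<open>D\<close> is a right quotient ring,
  with growth of exponent less than three. The assumption \<open>A_gen\<close> says that the first term generates.\<close>

locale filtered_growth = division_subring Z for Z :: "'d::division_ring set" +
  fixes A :: "nat \<Rightarrow> 'd set" and \<gamma> :: real
  assumes central: "z \<in> Z \<Longrightarrow> z * d = d * z"
    and A_sub: "rsubspace Z (A n)" and A_fin: "rfin Z (A n)" and one_A: "1 \<in> A 0"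
    and A_mono: "A n \<subseteq> A (Suc n)" and A_mult: "a \<in> A m \<Longrightarrow> b \<in> A n \<Longrightarrow> a * b \<in> A (m + n)"
    and A_gen: "rsubspace Z U \<Longrightarrow> (\<And>a b. a \<in> A 1 \<Longrightarrow> b \<in> A n \<Longrightarrow> a * b \<in> U) \<Longrightarrow> A (Suc n) \<subseteq> U"
    and A_frac: "\<exists>n. \<exists>s\<in>A n. s \<noteq> 0 \<and> d * s \<in> A n"
    and gamma: "\<gamma> < 3" "\<exists>n0. \<forall>n\<ge>n0. rdim Z (A n) \<le> real n powr \<gamma>"
begin

abbreviation g :: "nat \<Rightarrow> nat" where "g n \<equiv> rdim Z (A n)"

lemma central': "\<forall>z\<in>Z. z * d = d * z"
  using central by blast

lemma A_le: "m \<le> n \<Longrightarrow> A m \<subseteq> A n"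
  by (induction rule: dec_induct) (use A_mono in auto)

lemma Z_comm: "Z \<subseteq> centralizer Z"
  using central by (auto simp: centralizer_def)

lemma one_A': "1 \<in> A n"
  using A_le[of 0 n] one_A by auto

lemma g_pos: "1 \<le> g n"
  by (rule rdim_pos[OF A_fin one_A']) simp

lemma g_mono: "m \<le> n \<Longrightarrow> g m \<le> g n"
  by (rule rdim_mono[OF A_fin A_le])

lemma common_right_denominator:
  assumes "finite \<Omega>" shows "\<exists>c. \<exists>s\<in>A c. s \<noteq> 0 \<and> (\<forall>w\<in>\<Omega>. w * s \<in> A c)"
  using assms
proof (induction \<Omega> rule: finite_induct)
  case empty
  then show ?case using one_A by (intro exI[of _ 0] bexI[of _ 1]) auto
next
  case (insert w \<Omega>)
  then obtain c s where s: "s \<in> A c" "s \<noteq> 0" "\<forall>w\<in>\<Omega>. w * s \<in> A c" by blast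
  obtain n t where t: "t \<in> A n" "t \<noteq> 0" "w * t \<in> A n" using A_frac by blast
  obtain k b where b: "b \<in> A k" "b \<noteq> 0" "inverse s * t * b \<in> A k" using A_frac by blast
  define a where "a = inverse s * t * b"
  have sa: "s * a = t * b" using s(2) by (simp add: a_def mult.assoc[symmetric])
  have "a \<in> A k" using b by (simp add: a_def)
  let ?m = "c + n + k"
  have "s * a \<in> A (c + k)" "w * t * b \<in> A (n + k)" using A_mult s(1) \<open>a \<in> A k\<close> t(3) b(1) by blast+
  then have "s * a \<in> A ?m" "w * (s * a) \<in> A ?m"
    using A_le[of "c + k" ?m] A_le[of "n + k" ?m] by (auto simp: sa mult.assoc)
  moreover have "w' * (s * a) \<in> A ?m" if "w' \<in> \<Omega>" for w'
  proof -
    have "w' * s * a \<in> A (c + k)" using A_mult s(3) \<open>a \<in> A k\<close> that by blast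
    then show ?thesis using A_le[of "c + k" ?m] by (auto simp: mult.assoc)
  qed
  moreover have "s * a \<noteq> 0" using t b by (simp add: sa)
  ultimately show ?case by (intro exI[of _ ?m] bexI[of _ "s * a"]) auto
qed

text \<open>For a contradiction, cubic lower bounds are needed at arbitrarily large \<open>n\<close> only.\<close>

lemma growth_bound:
  fixes C :: real
  assumes "\<And>N. \<exists>n\<ge>N. C * real n ^ 3 \<le> g (d * n)" "0 < C" "0 < d"
  shows False
proof -
  from gamma(2) obtain n0 where n0: "\<And>n. n0 \<le> n \<Longrightarrow> g n \<le> real n powr \<gamma>" by blast
  define M where "M = real d powr \<gamma> / C + 1"
  have M: "0 < M" using assms(2) by (simp add: M_def add_nonneg_pos)
  obtain N :: nat where N': "M powr (1 / (3 - \<gamma>)) \<le> real N" using real_arch_simple by blast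
  have N: "real d powr \<gamma> / C + 1 \<le> real n powr (3 - \<gamma>)" if "N \<le> n" for n
  proof -
    have "M powr (1 / (3 - \<gamma>)) \<le> real n" using N' that by linarith
    then have "(M powr (1 / (3 - \<gamma>))) powr (3 - \<gamma>) \<le> real n powr (3 - \<gamma>)"
      using gamma(1) by (intro powr_mono2) auto
    then show ?thesis using gamma(1) M by (simp add: powr_powr M_def)
  qed
  obtain n where n: "n \<ge> max (max N n0) 1" "C * real n ^ 3 \<le> g (d * n)" using assms(1) by blast
  have "n0 \<le> d * n" using n(1) assms(3) by (metis One_nat_def Suc_leI le_trans max.bounded_iff mult_le_mono1 nat_mult_1)
  from n0[OF this] n(2) have "C * real n ^ 3 \<le> real (d * n) powr \<gamma>" by linarith
  also have "\<dots> = real d powr \<gamma> * real n powr \<gamma>" by (simp add: powr_mult)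
  finally have 1: "C * real n ^ 3 \<le> real d powr \<gamma> * real n powr \<gamma>" .
  have npos: "0 < real n" using n(1) by simp
  have "real n ^ 3 = real n powr ((3 - \<gamma>) + \<gamma>)"
    using npos powr_numeral[of "real n" "num.Bit1 num.One"] by simp
  then have "real n ^ 3 = real n powr (3 - \<gamma>) * real n powr \<gamma>" by (simp only: powr_add)
  then have "C * real n powr (3 - \<gamma>) * real n powr \<gamma> \<le> real d powr \<gamma> * real n powr \<gamma>" using 1 by (simp only: mult.assoc)
  then have "C * real n powr (3 - \<gamma>) \<le> real d powr \<gamma>" using npos by simp
  moreover have "real d powr \<gamma> / C + 1 \<le> real n powr (3 - \<gamma>)" using N n(1) by simp
  then have "C * (real d powr \<gamma> / C + 1) \<le> C * real n powr (3 - \<gamma>)" using assms(2) by (intro mult_left_mono) auto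
  ultimately have "C * (real d powr \<gamma> / C + 1) \<le> real d powr \<gamma>" by linarith
  then show False using assms(2) by (simp add: distrib_left)
qed

text \<open>Since the growth is slower than cubic, there are arbitrarily large \<open>n\<close> at which the relative
  increase of the dimension is at most \<open>4 c / n\<close>.\<close>

lemma folner:
  assumes c: "0 < c" shows "\<exists>n\<ge>N. real n * g (n + c) \<le> (real n + 4 * c) * g n"
proof (rule ccontr)
  assume "\<not> ?thesis"
  then have fast: "(real n + 4 * c) * g n < real n * g (n + c)" if "N \<le> n" for n
    using that by (meson not_le)
  \<comment> \<open>From here on \<open>(n + c)\<^sup>3 n \<le> (n + 4 c) n\<^sup>3\<close>, so failure of the claim would propagate a cubic bound.\<close>
  define M where "M = max N (4 * c)"
  have M: "N \<le> M" "4 * c \<le> M" "0 < M" using c by (auto simp: M_def)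
  have step: "real (m + c) ^ 3 * m \<le> (real m + 4 * c) * real m ^ 3" if "4 * c \<le> m" for m :: nat
  proof -
    have "real c * 4 \<le> m" using that by linarith
    then have "real m * (3 * c) + c * c \<le> real m * m"
    proof -
      have "real c * c \<le> real m * c" using \<open>real c * 4 \<le> m\<close> by (intro mult_right_mono) auto
      moreover have "real m * (4 * c) \<le> real m * m" using \<open>real c * 4 \<le> m\<close> by (intro mult_left_mono) auto
      ultimately show ?thesis by (simp add: algebra_simps)
    qed
    then have "real m * c * (real m * (3 * c) + c * c) \<le> real m * c * (real m * m)" by (intro mult_left_mono) auto
    then show ?thesis by (simp add: power3_eq_cube algebra_simps)
  qed
  have low: "real (M + j * c) ^ 3 \<le> real M ^ 3 * g (M + j * c)" for j
  proof (induction j)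
    case 0
    have "real M ^ 3 * 1 \<le> real M ^ 3 * g M" using g_pos[of M] by (intro mult_left_mono) auto
    then show ?case by simp
  next
    case (Suc j)
    let ?m = "M + j * c"
    have m: "N \<le> ?m" "4 * c \<le> ?m" "0 < ?m" using M by linarith+
    have "real (?m + c) ^ 3 * ?m \<le> (real ?m + 4 * c) * real ?m ^ 3" by (rule step[OF m(2)])
    also have "\<dots> \<le> (real ?m + 4 * c) * (real M ^ 3 * g ?m)" using Suc by (intro mult_left_mono) auto
    also have "\<dots> = real M ^ 3 * ((real ?m + 4 * c) * g ?m)" by simp
    also have "\<dots> \<le> real M ^ 3 * (real ?m * g (?m + c))" using fast[OF m(1)] by (intro mult_left_mono) auto
    finally have "real (?m + c) ^ 3 * ?m \<le> real M ^ 3 * g (?m + c) * ?m" by (simp only: mult_ac)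
    then have "real (?m + c) ^ 3 \<le> real M ^ 3 * g (?m + c)" using m(3) by (simp only: mult_le_cancel_right)
    then show ?case by (simp add: algebra_simps)
  qed
  have "\<exists>n\<ge>K. (1 / real M ^ 3) * real n ^ 3 \<le> g (1 * n)" for K
  proof (intro exI conjI)
    show "K \<le> M + K * c" using c by (metis One_nat_def Suc_leI le_add2 mult.right_neutral mult_le_mono2 trans_le_add2)
    show "(1 / real M ^ 3) * real (M + K * c) ^ 3 \<le> g (1 * (M + K * c))"
      using low[of K] M(3) by (simp add: divide_le_eq mult.commute)
  qed
  then show False by (rule growth_bound) (use M(3) in auto)
qed

text \<open>A finite-dimensional subspace stable under the generators is stable under all of \<open>D\<close>: elements of
  the filtration act injectively and hence bijectively, so their inverses act as well.\<close>

lemma stable_imp_finite: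
  assumes H: "division_subring H" and Q: "rfin H Q" "rsubspace H Q" "y \<in> Q" "y \<noteq> 0"
    and stable: "\<And>a v. a \<in> A 1 \<Longrightarrow> v \<in> Q \<Longrightarrow> a * v \<in> Q" and ZH: "Z \<subseteq> H"
  shows "rfin H UNIV"
proof -
  interpret H: division_subring H by fact
  have Qsub: "rsubspace Z {a. \<forall>v\<in>Q. a * v \<in> Q}"
  proof (rule rsubspaceI)
    fix u c assume u: "u \<in> {a. \<forall>v\<in>Q. a * v \<in> Q}" "c \<in> Z"
    have "u * c * v \<in> Q" if "v \<in> Q" for v
    proof -
      have "u * c * v = u * v * c" using central[OF u(2), of v] by (simp add: mult.assoc)
      moreover have "u * v \<in> Q" using u that by blast
      ultimately show ?thesis using rsubspace_scale[OF Q(2)] u(2) ZH by auto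
    qed
    then show "u * c \<in> {a. \<forall>v\<in>Q. a * v \<in> Q}" by blast
  qed (use Q(2) in \<open>auto simp: rsubspace_def distrib_right\<close>)
  have one: "A 1 \<subseteq> {a. \<forall>v\<in>Q. a * v \<in> Q}" using stable by blast
  have all: "A n \<subseteq> {a. \<forall>v\<in>Q. a * v \<in> Q}" for n
  proof (induction n)
    case 0
    then show ?case using A_mono[of 0] one by simp
  next
    case (Suc n)
    show ?case by (rule A_gen[OF Qsub]) (use one Suc in \<open>auto simp: mult.assoc\<close>)
  qed
  have "d * v \<in> Q" if v: "v \<in> Q" for d v
  proof -
    obtain n s where s: "s \<in> A n" "s \<noteq> 0" "d * s \<in> A n" using A_frac by blast
    have "(*) s ` Q \<subseteq> Q" using all s(1) by blast
    moreover have "rsubspace H ((*) s ` Q)" "rdim H ((*) s ` Q) = rdim H Q"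
      using H.lmult_image[OF Q(1,2) s(2)] by auto
    ultimately have "(*) s ` Q = Q" using H.rdim_eq_imp_eq[OF Q(1), of "(*) s ` Q"] by simp
    with v obtain w where w: "w \<in> Q" "v = s * w" by blast
    then have "d * v = d * s * w" by (simp add: mult.assoc)
    then show ?thesis using all s(3) w(1) by auto
  qed
  then have "d * inverse y * y \<in> Q" for d using Q(3) by blast
  then have "UNIV \<subseteq> Q" using Q(4) by (auto simp: mult.assoc)
  then show ?thesis using Q(1) by (auto simp: rfin_def)
qed

text \<open>Among the subspaces with at least \<open>\<kappa>\<close> dimensions in each layer over \<open>H\<close>, let \<open>Y\<close> have the fewest
  layers. Then the sum of the translates \<open>v Y\<close> keeps the density \<open>\<kappa>\<close>: what the translates share has
  fewer layers and therefore smaller density. Multiplication by \<open>A j\<close> produces at least \<open>j + 1\<close> layers,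
  because a stable number of layers would make \<open>D\<close> finite over \<open>H\<close>.\<close>

lemma spreading:
  fixes \<kappa> :: real
  assumes H: "division_subring H" "Z \<subseteq> H" and inf: "\<not> rfin H UNIV" and \<kappa>: "0 \<le> \<kappa>"
    and X: "rsubspace Z X" "X \<subseteq> A n" "x \<in> X" "x \<noteq> 0" "\<kappa> * rdim H (rspan H X) \<le> rdim Z X"
  shows "\<kappa> * (j + 1) \<le> g (j + n)"
proof -
  interpret H: division_subring H by fact
  have finX: "rfin Z X" if "X \<subseteq> A n" for X by (rule rfin_subset[OF A_fin that])
  have finH: "rfin H (rspan H X)" if "X \<subseteq> A n" for X by (rule rfin_rspan_field[OF finX[OF that] H(2)])
  define good where "good = (\<lambda>r. \<exists>Y. rsubspace Z Y \<and> Y \<subseteq> A n \<and> Y \<noteq> {0} \<and> rdim H (rspan H Y) = r \<and> \<kappa> * r \<le> rdim Z Y)"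
  have "good (rdim H (rspan H X))" using X unfolding good_def by blast
  then have "good (LEAST r. good r)" by (rule LeastI[of good])
  then obtain Y where Y: "rsubspace Z Y" "Y \<subseteq> A n" "Y \<noteq> {0}" "rdim H (rspan H Y) = (LEAST r. good r)"
    "\<kappa> * (LEAST r. good r) \<le> rdim Z Y" unfolding good_def by blast
  define r where "r = rdim H (rspan H Y)"
  have rY: "\<kappa> * r \<le> rdim Z Y" using Y(4,5) by (simp add: r_def)
  have small: "rdim Z Y' \<le> \<kappa> * rdim H (rspan H Y')" if "rsubspace Z Y'" "Y' \<subseteq> Y" "rdim H (rspan H Y') < r" for Y'
  proof (cases "Y' = {0}")
    case True
    then show ?thesis using \<kappa> by simp
  next
    case False
    have "\<not> good (rdim H (rspan H Y'))" using that(3) not_less_Least Y(4) unfolding r_def by metis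
    then have "\<not> \<kappa> * rdim H (rspan H Y') \<le> rdim Z Y'"
      unfolding good_def using that False Y(2) by blast
    then show ?thesis by simp
  qed
  obtain y where y: "y \<in> Y" "y \<noteq> 0" using Y(1,3) rsubspace_0 by blast
  have spread: "\<kappa> * rdim H (prodspan H V Y) \<le> rdim Z (prodspan Z V Y) \<and> rfin H (prodspan H V Y) \<and> rfin Z (prodspan Z V Y)"
    if "finite V" for V
    using that
  proof (induction V rule: finite_induct)
    case empty
    have 0: "prodspan G {} Y = {0}" for G
    proof
      show "prodspan G {} Y \<subseteq> {0}" by (rule prodspan_minimal[OF rsubspace_zero]) simp
      show "{0} \<subseteq> prodspan G {} Y" using rsubspace_0[OF rsubspace_prodspan] by blast
    qed
    have "rfin G {0}" for G :: "'d set" by (auto simp: rfin_def intro!: exI[of _ "{0}"] rspan_base)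
    then show ?case by (simp add: 0)
  next
    case (insert v V)
    let ?P = "prodspan Z V Y"
    let ?Q = "prodspan H V Y"
    show ?case
    proof (cases "v = 0")
      case True
      have "prodspan G (insert v V) Y = prodspan G V Y" for G
      proof
        show "prodspan G (insert v V) Y \<subseteq> prodspan G V Y"
          by (rule prodspan_minimal[OF rsubspace_prodspan])
            (use True rsubspace_0[OF rsubspace_prodspan] in \<open>auto intro: prodspanI\<close>)
        show "prodspan G V Y \<subseteq> prodspan G (insert v V) Y" by (rule prodspan_mono) auto
      qed
      then show ?thesis using insert.IH by simp
    next
      case v0: False
      define vY where "vY = (*) v ` Y"
      define vH where "vH = (*) v ` rspan H Y"
      note vY = lmult_image[OF finX[OF Y(2)] Y(1) v0, folded vY_def]
      note vH = H.lmult_image[OF finH[OF Y(2)] rsubspace_rspan v0, folded vH_def]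
      define Y' where "Y' = {u \<in> Y. v * u \<in> ?Q}"
      have ZQ: "rsubspace Z ?Q" by (rule rsubspace_subfield[OF rsubspace_prodspan H(2)])
      have Y': "rsubspace Z Y'" "Y' \<subseteq> Y"
        using rsubspace_Int[OF Y(1) rsubspace_lmult_preimage[OF ZQ, of v]] by (auto simp: Y'_def Int_def)
      have eqP: "prodspan Z (insert v V) Y = ssum ?P vY"
      proof
        show "prodspan Z (insert v V) Y \<subseteq> ssum ?P vY"
        proof (rule prodspan_minimal[OF rsubspace_ssum[OF rsubspace_prodspan vY(3)]])
          fix a b assume "a \<in> insert v V" "b \<in> Y"
          then have "a * b \<in> ?P \<or> a * b \<in> vY" by (auto simp: vY_def intro: prodspanI)
          then show "a * b \<in> ssum ?P vY" using ssum_superset[OF rsubspace_prodspan vY(3), of V Y] by blast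
        qed
        show "ssum ?P vY \<subseteq> prodspan Z (insert v V) Y"
          by (rule ssum_subset[OF rsubspace_prodspan prodspan_mono]) (auto simp: vY_def intro: prodspanI)
      qed
      have eqQ: "prodspan H (insert v V) Y = H.ssum ?Q vH"
      proof
        have vYH: "vY \<subseteq> vH" using rspan_superset[of Y H] by (auto simp: vY_def vH_def)
        show "prodspan H (insert v V) Y \<subseteq> H.ssum ?Q vH"
        proof (rule prodspan_minimal[OF H.rsubspace_ssum[OF rsubspace_prodspan vH(3)]])
          fix a b assume "a \<in> insert v V" "b \<in> Y"
          then have "a * b \<in> ?Q \<or> a * b \<in> vH" using vYH by (auto simp: vY_def intro: prodspanI)
          then show "a * b \<in> H.ssum ?Q vH" using H.ssum_superset[OF rsubspace_prodspan vH(3), of V Y] by blast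
        qed
        have "rspan H Y \<subseteq> {u. v * u \<in> prodspan H (insert v V) Y}"
          by (rule rspan_minimal[OF rsubspace_lmult_preimage[OF rsubspace_prodspan]]) (auto intro: prodspanI)
        then have "vH \<subseteq> prodspan H (insert v V) Y" by (auto simp: vH_def)
        then show "H.ssum ?Q vH \<subseteq> prodspan H (insert v V) Y"
          by (intro H.ssum_subset[OF rsubspace_prodspan] prodspan_mono) auto
      qed
      have finP: "rfin Z ?P" and finQ: "rfin H ?Q" using insert.IH by auto
      have PQ: "?P \<subseteq> ?Q"
        by (rule prodspan_minimal[OF ZQ]) (auto intro: prodspanI)
      have dP: "rdim Z (ssum ?P vY) + rdim Z (?P \<inter> vY) = rdim Z ?P + rdim Z Y"
        using rdim_ssum[OF finP vY(2) rsubspace_prodspan vY(3)] vY(1) by simp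
      have "?P \<inter> vY \<subseteq> (*) v ` Y'" using PQ by (auto simp: vY_def Y'_def)
      moreover note lmult_image[OF finX Y'(1) v0] Y'(2) Y(2)
      ultimately have iP: "rdim Z (?P \<inter> vY) \<le> rdim Z Y'" using rdim_mono[of "(*) v ` Y'" "?P \<inter> vY"] by auto
      have dQ: "rdim H (H.ssum ?Q vH) + rdim H (?Q \<inter> vH) = rdim H ?Q + r"
        using H.rdim_ssum[OF finQ vH(2) rsubspace_prodspan vH(3)] vH(1) by (simp add: r_def)
      have Y'H: "rspan H Y' \<subseteq> rspan H Y" by (rule rspan_mono[OF Y'(2)])
      have "rspan H Y' \<subseteq> {u. v * u \<in> ?Q}"
        by (rule rspan_minimal[OF rsubspace_lmult_preimage[OF rsubspace_prodspan]]) (auto simp: Y'_def)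
      then have "(*) v ` rspan H Y' \<subseteq> ?Q \<inter> vH" using Y'H by (auto simp: vH_def)
      then have iQ: "rdim H (rspan H Y') \<le> rdim H (?Q \<inter> vH)"
        using H.lmult_image(1)[OF finH rsubspace_rspan v0, of Y'] Y'(2) Y(2)
          H.rdim_mono[OF H.rfin_subset[OF finQ], of "?Q \<inter> vH" "(*) v ` rspan H Y'"] by auto
      have rY': "rdim H (rspan H Y') \<le> r" unfolding r_def by (rule H.rdim_mono[OF finH[OF Y(2)] Y'H])
      have gain: "\<kappa> * (r - rdim H (rspan H Y')) \<le> real (rdim Z Y) - rdim Z Y'"
      proof (cases "rdim H (rspan H Y') < r")
        case True
        then show ?thesis using small[OF Y' True] rY by (simp add: right_diff_distrib)
      next
        case False
        then have "rdim H (rspan H Y') = r" using rY' by simp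
        moreover have "rdim Z Y' \<le> rdim Z Y" by (rule rdim_mono[OF finX[OF Y(2)] Y'(2)])
        ultimately show ?thesis by simp
      qed
      have "real (rdim H (H.ssum ?Q vH)) \<le> rdim H ?Q + (r - rdim H (rspan H Y'))" using dQ iQ rY' by linarith
      then have "\<kappa> * rdim H (H.ssum ?Q vH) \<le> \<kappa> * (rdim H ?Q + (r - rdim H (rspan H Y')))" using \<kappa> by (rule mult_left_mono)
      also have "\<dots> \<le> rdim Z ?P + (real (rdim Z Y) - rdim Z Y')"
        using insert.IH gain by (simp add: distrib_left)
      also have "\<dots> \<le> rdim Z (ssum ?P vY)" using dP iP by linarith
      finally show ?thesis unfolding eqP eqQ using rfin_ssum[OF finP vY(2)] H.rfin_ssum[OF finQ vH(2)] by blast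
    qed
  qed
  define Q where "Q = (\<lambda>j. prodspan H (A j) Y)"
  have basis: "\<exists>V. finite V \<and> V \<subseteq> A j \<and> Q j = prodspan H V Y" for j
  proof -
    from rbasis[OF A_fin A_sub] obtain V where V: "V \<subseteq> A j" "rindep Z V" "A j = rspan Z V" by metis
    have "Q j \<subseteq> prodspan H V Y" unfolding Q_def
    proof (rule prodspan_minimal[OF rsubspace_prodspan])
      fix a b assume a: "a \<in> A j" and b: "b \<in> Y"
      have "rspan Z V \<subseteq> {u. u * b \<in> prodspan H V Y}"
        by (rule rspan_minimal[OF rsubspace_rmult_preimage[OF rsubspace_subfield[OF rsubspace_prodspan H(2)] central']])
          (use b in \<open>auto intro: prodspanI\<close>)
      then show "a * b \<in> prodspan H V Y" using a V(3) by blast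
    qed
    moreover have "prodspan H V Y \<subseteq> Q j" unfolding Q_def by (rule prodspan_mono[OF V(1)]) simp
    ultimately show ?thesis using V(1) rindep_finite[OF V(2)] by blast
  qed
  have finQ: "rfin H (Q j)" and boundQ: "\<kappa> * rdim H (Q j) \<le> g (j + n)" for j
  proof -
    from basis obtain V where V: "finite V" "V \<subseteq> A j" "Q j = prodspan H V Y" by blast
    show "rfin H (Q j)" using spread[OF V(1)] V(3) by simp
    have "prodspan Z V Y \<subseteq> A (j + n)"
      by (rule prodspan_minimal[OF A_sub]) (use V(2) Y(2) A_mult in blast)
    then have "rdim Z (prodspan Z V Y) \<le> g (j + n)" by (rule rdim_mono[OF A_fin])
    then show "\<kappa> * rdim H (Q j) \<le> g (j + n)" unfolding V(3) using spread[OF V(1)] by linarith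
  qed
  have yQ: "y \<in> Q j" for j using prodspanI[OF one_A' y(1), of H j] by (simp add: Q_def)
  have grow: "j + 1 \<le> rdim H (Q j)" for j
  proof (induction j)
    case 0
    show ?case using H.rdim_pos[OF finQ yQ y(2), of 0] by simp
  next
    case (Suc j)
    have sub: "Q j \<subseteq> Q (Suc j)" unfolding Q_def by (rule prodspan_mono[OF A_mono]) simp
    have "rdim H (Q j) \<noteq> rdim H (Q (Suc j))"
    proof
      assume "rdim H (Q j) = rdim H (Q (Suc j))"
      then have eq: "Q j = Q (Suc j)"
        using H.rdim_eq_imp_eq[OF finQ _ sub] rsubspace_prodspan[of H "A j" Y] by (simp add: Q_def)
      have "a * v \<in> Q j" if a: "a \<in> A 1" and v: "v \<in> Q j" for a v
      proof -
        have "Q j \<subseteq> {u. a * u \<in> Q (Suc j)}" unfolding Q_def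
        proof (rule prodspan_minimal[OF rsubspace_lmult_preimage[OF rsubspace_prodspan]])
          fix b w assume "b \<in> A j" "w \<in> Y"
          then have "a * b * w \<in> prodspan H (A (Suc j)) Y" using A_mult[OF a, of b j] by (auto intro: prodspanI)
          then show "b * w \<in> {u. a * u \<in> prodspan H (A (Suc j)) Y}" by (simp add: mult.assoc)
        qed
        then show ?thesis using v eq by blast
      qed
      with stable_imp_finite[OF H(1) finQ _ yQ y(2) _ H(2), of j] inf show False
        using rsubspace_prodspan[of H "A j" Y] by (auto simp: Q_def)
    qed
    moreover have "rdim H (Q j) \<le> rdim H (Q (Suc j))" by (rule H.rdim_mono[OF finQ sub])
    ultimately show ?case using Suc by simp
  qed
  have "\<kappa> * (j + 1) \<le> \<kappa> * rdim H (Q j)" using grow[of j] \<kappa> by (intro mult_left_mono) (auto simp: of_nat_Suc[symmetric] simp del: of_nat_Suc)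
  with boundQ[of j] show ?thesis by (simp add: algebra_simps)
qed

text \<open>Multiplication by a common denominator moves the products with \<open>\<Omega>\<close> into a slightly later term of
  the filtration.\<close>

lemma almost_invariant:
  assumes "finite \<Omega>"
  shows "\<exists>c>0. \<forall>N. \<exists>n\<ge>N. real n * rdim Z (prodspan Z (A n) \<Omega>) \<le> (real n + 4 * c) * g n"
proof -
  from common_right_denominator[OF assms] obtain c s where
    s: "s \<in> A c" "s \<noteq> 0" "\<forall>w\<in>\<Omega>. w * s \<in> A c" by blast
  have sub: "(\<lambda>u. u * s) ` prodspan Z (A n) \<Omega> \<subseteq> A (n + c)" for n
  proof -
    have "prodspan Z (A n) \<Omega> \<subseteq> {u. u * s \<in> A (n + c)}"
      by (rule prodspan_minimal[OF rsubspace_rmult_preimage[OF A_sub central']])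
        (use s(3) A_mult in \<open>auto simp: mult.assoc\<close>)
    then show ?thesis by blast
  qed
  have le: "rdim Z (prodspan Z (A n) \<Omega>) \<le> g (n + Suc c)" for n
  proof -
    have "rfin Z (prodspan Z (A n) \<Omega>)" by (rule rfin_prodspan[OF A_fin assms central])
    from rmult_image(1)[OF this rsubspace_prodspan s(2) central'] 
    have "rdim Z (prodspan Z (A n) \<Omega>) = rdim Z ((\<lambda>u. u * s) ` prodspan Z (A n) \<Omega>)" by simp
    also have "\<dots> \<le> g (n + c)" by (rule rdim_mono[OF A_fin sub])
    also have "\<dots> \<le> g (n + Suc c)" by (rule g_mono) simp
    finally show ?thesis .
  qed
  show ?thesis
  proof (intro exI[of _ "real (Suc c)"] conjI allI)
    fix N
    from folner[of "Suc c" N] obtain n where n: "n \<ge> N" "real n * g (n + Suc c) \<le> (real n + 4 * Suc c) * g n" by auto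
    moreover have "real n * rdim Z (prodspan Z (A n) \<Omega>) \<le> real n * g (n + Suc c)"
      using le[of n] by (intro mult_left_mono) auto
    ultimately show "\<exists>n\<ge>N. real n * rdim Z (prodspan Z (A n) \<Omega>) \<le> (real n + 4 * real (Suc c)) * g n"
      by (intro exI[of _ n]) simp
  qed simp
qed

end

context filtered_growth
begin

lemma transcendental_ext_Z: "transc Z l \<Longrightarrow> transcendental_ext Z l"
  by unfold_locales (use central in auto)

text \<open>No finite-dimensional subspace other than zero is stable under a transcendental element.\<close>

lemma layer_gain_fracs:
  assumes l: "transc Z l" and X: "rfin Z X" "rsubspace Z X"
  shows "rdim Z X + rdim (fracs Z l) (rspan (fracs Z l) X) \<le> rdim Z (prodspan Z X {1, l})"
proof -
  interpret te: transcendental_ext Z l by (rule transcendental_ext_Z[OF l])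
  interpret K: division_subring "fracs Z l" by (rule te.division_subring_fracs)
  have ZK: "Z \<subseteq> fracs Z l" using te.const_fracs by blast
  have "T \<subseteq> {0}" if T: "rsubspace Z T" "rfin Z T" "\<And>t s. t \<in> T \<Longrightarrow> s \<in> {1, l} \<Longrightarrow> t * s \<in> T" for T
  proof -
    have pow: "t * l ^ i \<in> T" if "t \<in> T" for t i
    proof (induction i)
      case (Suc i)
      have "t * l ^ i * l \<in> T" by (rule T(3)[OF Suc]) simp
      then show ?case by (simp add: mult.assoc power_commutes)
    qed (use that in simp)
    have finT: "rfin (fracs Z l) (rspan (fracs Z l) T)" by (rule rfin_rspan_field[OF T(2) ZK])
    have fin: "rfin (fracs Z l) T" by (rule K.rfin_subset[OF finT rspan_superset])
    have "Suc (rdim Z T) * rdim (fracs Z l) (rspan (fracs Z l) T) \<le> rdim Z T"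
      by (rule te.dim_over_fracs_lower[OF fin T(2)]) (rule pow)
    then have 0: "rdim (fracs Z l) (rspan (fracs Z l) T) = 0" by (cases "rdim (fracs Z l) (rspan (fracs Z l) T)") auto
    from K.rdim_zero_imp[OF finT 0] show ?thesis using rspan_superset[of T "fracs Z l"] by simp
  qed
  then show ?thesis
    by (intro gain_per_layer[OF te.division_subring_fracs ZK _ _ _ central _ X])
      (use te.var_fracs K.one_mem in auto)
qed

text \<open>One linear factor of the growth is accounted for by the powers of \<open>l\<close>.\<close>

lemma subquadratic_over_fracs:
  assumes l: "transc Z l" and C: "0 < (C::real)"
  shows "\<exists>n\<ge>N. rdim (fracs Z l) (rspan (fracs Z l) (A n)) < C * real n ^ 2"
proof (rule ccontr)
  let ?r = "\<lambda>n. rdim (fracs Z l) (rspan (fracs Z l) (A n))"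
  assume "\<not> ?thesis"
  then have big: "C * real n ^ 2 \<le> ?r n" if "N \<le> n" for n using that by (meson not_le)
  from almost_invariant[of "{1, l}"] obtain c where
    c: "c > 0" "\<forall>N. \<exists>n\<ge>N. real n * rdim Z (prodspan Z (A n) {1, l}) \<le> (real n + 4 * c) * g n" by auto
  have "\<exists>n\<ge>M. C / (4 * c) * real n ^ 3 \<le> g (1 * n)" for M
  proof -
    from c(2) obtain n where n: "n \<ge> max M N" "real n * rdim Z (prodspan Z (A n) {1, l}) \<le> (real n + 4 * c) * g n" by blast
    have "real (g n + ?r n) \<le> rdim Z (prodspan Z (A n) {1, l})"
      using layer_gain_fracs[OF l A_fin A_sub, of n] by linarith
    then have "real n * (g n + ?r n) \<le> real n * rdim Z (prodspan Z (A n) {1, l})" by (rule mult_left_mono) simp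
    with n(2) have "real n * ?r n \<le> 4 * c * g n" by (simp add: algebra_simps)
    moreover have "real n * (C * real n ^ 2) \<le> real n * ?r n" using big n(1) by (intro mult_left_mono) auto
    ultimately have "C * real n ^ 3 \<le> 4 * c * g n" by (simp add: power2_eq_square power3_eq_cube mult_ac)
    then have "C / (4 * c) * real n ^ 3 \<le> g (1 * n)" using c(1) by (simp add: field_simps)
    with n(1) show ?thesis by (intro exI[of _ n]) simp
  qed
  then show False by (rule growth_bound) (use c(1) C in auto)
qed

text \<open>A subspace of a term of the filtration that grows least under multiplication by \<open>\<Omega>\<close>.\<close>

lemma least_growing_subspace:
  assumes "finite \<Omega>"
  shows "\<exists>X. \<exists>q::real. rsubspace Z X \<and> X \<subseteq> A n \<and> \<not> X \<subseteq> {0} \<and> 0 \<le> q \<and>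
    rdim Z (prodspan Z X \<Omega>) = q * rdim Z X \<and>
    (\<forall>Y. rsubspace Z Y \<longrightarrow> Y \<subseteq> A n \<longrightarrow> q * rdim Z Y \<le> rdim Z (prodspan Z Y \<Omega>))"
proof -
  define Adm where "Adm = (\<lambda>X. rsubspace Z X \<and> X \<subseteq> A n \<and> \<not> X \<subseteq> {0})"
  define P where "P = (\<lambda>X. (rdim Z (prodspan Z X \<Omega>), rdim Z X)) ` Collect Adm"
  have finO: "rfin Z (prodspan Z X \<Omega>)" if "X \<subseteq> A n" for X
    by (rule rfin_prodspan[OF rfin_subset[OF A_fin that] assms central])
  have "P \<subseteq> {..rdim Z (prodspan Z (A n) \<Omega>)} \<times> {..g n}"
  proof
    fix p assume "p \<in> P"
    then obtain X where X: "X \<subseteq> A n" "p = (rdim Z (prodspan Z X \<Omega>), rdim Z X)" by (auto simp: P_def Adm_def)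
    have "rdim Z (prodspan Z X \<Omega>) \<le> rdim Z (prodspan Z (A n) \<Omega>)"
      by (rule rdim_mono[OF finO prodspan_mono[OF X(1)]]) auto
    moreover have "rdim Z X \<le> g n" by (rule rdim_mono[OF A_fin X(1)])
    ultimately show "p \<in> {..rdim Z (prodspan Z (A n) \<Omega>)} \<times> {..g n}" using X(2) by simp
  qed
  then have finP: "finite P" by (rule finite_subset) simp
  have "\<not> A n \<subseteq> {0}" using subsetD[of "A n" "{0}" 1] one_A'[of n] by auto
  then have "Adm (A n)" unfolding Adm_def using A_sub[of n] by simp
  then have neP: "P \<noteq> {}" by (auto simp: P_def)
  define f where "f = (\<lambda>p::nat \<times> nat. real (fst p) / real (snd p))"
  note am = arg_min_if_finite[OF finP neP, of f]
  define p where "p = arg_min_on f P"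
  have pP: "p \<in> P" and pmin: "\<And>p'. p' \<in> P \<Longrightarrow> f p \<le> f p'" using am unfolding p_def by force+
  from pP obtain X where X: "Adm X" "p = (rdim Z (prodspan Z X \<Omega>), rdim Z X)" by (auto simp: P_def)
  have pos: "1 \<le> rdim Z Y" if Y: "Adm Y" for Y
  proof -
    from Y obtain y where "y \<in> Y" "y \<noteq> 0" by (auto simp: Adm_def)
    then show ?thesis using rdim_pos[OF rfin_subset[OF A_fin]] Y by (auto simp: Adm_def)
  qed
  have "f p * rdim Z Y \<le> rdim Z (prodspan Z Y \<Omega>)" if Y: "rsubspace Z Y" "Y \<subseteq> A n" for Y
  proof (cases "Y \<subseteq> {0}")
    case True
    have "rfin Z {0}" unfolding rfin_def by (intro exI[of _ "{0}"]) (auto intro: rspan_base)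
    then have "rdim Z Y = 0" using rdim_mono[OF _ True] by simp
    then show ?thesis by simp
  next
    case False
    then have Y': "Adm Y" using Y by (simp add: Adm_def)
    then have "f p \<le> f (rdim Z (prodspan Z Y \<Omega>), rdim Z Y)" by (intro pmin) (auto simp: P_def)
    then show ?thesis using pos[OF Y'] by (simp add: f_def field_simps)
  qed
  moreover have "rdim Z (prodspan Z X \<Omega>) = f p * rdim Z X" "0 \<le> f p" using pos[OF X(1)] by (simp_all add: f_def X(2))
  ultimately show ?thesis using X(1) unfolding Adm_def by (intro exI[of _ X] exI[of _ "f p"]) simp
qed

text \<open>Otherwise a least growing subspace \<open>X\<close> would have many layers over the centralizer: two
  applications of the layer gain, over \<open>Z\<close> and over \<open>Z(x)\<close>, show that its dimension is of order at
  least \<open>n\<^sup>2\<close> times its dimension over the centralizer, and spreading makes the growth cubic.\<close>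

lemma centralizer_locally_finite:
  assumes x: "transc Z x" and inf: "\<not> rfin (centralizer {x}) UNIV" and S: "finite S" "S \<subseteq> centralizer {x}"
  shows "\<exists>T. T \<subseteq> centralizer {x} \<and> rsubspace (fracs Z x) T \<and> rfin (fracs Z x) T \<and> \<not> T \<subseteq> {0} \<and> (\<forall>t\<in>T. \<forall>s\<in>S. t * s \<in> T)"
proof (rule ccontr)
  assume nope: "\<not> ?thesis"
  let ?K = "fracs Z x" and ?E = "centralizer {x}" and ?\<Omega> = "{1, x} \<union> S"
  interpret te: transcendental_ext Z x by (rule transcendental_ext_Z[OF x])
  interpret K: division_subring ?K by (rule te.division_subring_fracs)
  interpret E: division_subring ?E by (rule division_subring_centralizer)
  have ZK: "Z \<subseteq> ?K" using te.const_fracs by blast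
  have ZE: "Z \<subseteq> ?E" using central by (auto simp: centralizer_def)
  have KE: "?K \<subseteq> ?E" by (rule polys_subset(2)[OF division_subring_centralizer ZE]) (simp add: centralizer_def)
  have Kcomm: "\<forall>c\<in>?K. c * s = s * c" if "s \<in> ?E" for s
  proof -
    have 1: "Z \<subseteq> centralizer {s}" using central by (auto simp: centralizer_def)
    have 2: "x \<in> centralizer {s}" using that by (simp add: centralizer_def)
    have "?K \<subseteq> centralizer {s}" by (rule te.fracs_centralizer[OF 1 2])
    then show ?thesis by (auto simp: centralizer_def)
  qed
  have finO: "finite ?\<Omega>" using S(1) by simp
  have OE: "?\<Omega> \<subseteq> ?E" using S(2) by (auto simp: centralizer_def)
  from almost_invariant[OF finO] obtain c where
    c: "c > 0" "\<forall>N. \<exists>n\<ge>N. real n * rdim Z (prodspan Z (A n) ?\<Omega>) \<le> (real n + 4 * c) * g n" by (elim exE conjE)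
  have "\<exists>n\<ge>N. 1 / (16 * c\<^sup>2) * real n ^ 3 \<le> g (2 * n)" for N
  proof -
    from c(2) obtain n where n: "n \<ge> max N 1" "real n * rdim Z (prodspan Z (A n) ?\<Omega>) \<le> (real n + 4 * c) * g n" by blast
    from least_growing_subspace[OF finO, of n] obtain X and q :: real where
      X: "rsubspace Z X" "X \<subseteq> A n" "\<not> X \<subseteq> {0}" and q0: "0 \<le> q" and eq: "rdim Z (prodspan Z X ?\<Omega>) = q * rdim Z X"
      and least: "\<forall>Y. rsubspace Z Y \<longrightarrow> Y \<subseteq> A n \<longrightarrow> q * rdim Z Y \<le> rdim Z (prodspan Z Y ?\<Omega>)" by (elim exE conjE)
    have finX: "rfin Z X" by (rule rfin_subset[OF A_fin X(2)])
    have "q * g n \<le> rdim Z (prodspan Z (A n) ?\<Omega>)" using least A_sub by blast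
    then have "real n * (q * g n) \<le> real n * rdim Z (prodspan Z (A n) ?\<Omega>)" by (rule mult_left_mono) simp
    with n(2) have "(real n * q) * g n \<le> (real n + 4 * c) * g n" by simp
    then have q: "real n * q \<le> real n + 4 * c" using g_pos[of n] by (simp add: mult_le_cancel_right)
    let ?rK = "rdim ?K (rspan ?K X)" and ?rE = "rdim ?E (rspan ?E X)"
    have finXO: "rfin Z (prodspan Z X ?\<Omega>)" by (rule rfin_prodspan[OF finX finO central])
    have "rdim Z X + ?rK \<le> rdim Z (prodspan Z X {1, x})" by (rule layer_gain_fracs[OF x finX X(1)])
    also have "\<dots> \<le> rdim Z (prodspan Z X ?\<Omega>)" by (rule rdim_mono[OF finXO prodspan_mono]) auto
    finally have "real (rdim Z X + ?rK) \<le> q * rdim Z X" using eq by linarith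
    then have "real n * (rdim Z X + ?rK) \<le> real n * (q * rdim Z X)" by (rule mult_left_mono) simp
    also have "\<dots> \<le> (real n + 4 * c) * rdim Z X" using mult_right_mono[OF q, of "real (rdim Z X)"] by (simp add: mult.assoc)
    finally have 1: "real n * ?rK \<le> 4 * c * rdim Z X" by (simp add: algebra_simps)
    have least': "q * rdim Z Y \<le> rdim Z (prodspan Z Y ?\<Omega>)" if "rsubspace Z Y" "Y \<subseteq> X" for Y
      using least that X(2) by (meson order_trans)
    have comm_x: "y * x = x * y" if "y \<in> ?\<Omega>" for y using OE that by (auto simp: centralizer_def)
    have P: "rdim ?K (rspan ?K (prodspan Z X ?\<Omega>)) \<le> q * ?rK"
      by (rule te.petridis_over_fracs[OF Z_comm finX X(1) finO central comm_x least' eq_refl[OF eq] q0])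
    let ?U = "rspan ?K X" and ?W = "rspan ?K (prodspan Z X ?\<Omega>)"
    note fin_up = rfin_rspan_field[OF _ ZK]
    have "rdim ?K ?U + rdim ?E (rspan ?E ?U) \<le> rdim ?K (prodspan ?K ?U (insert 1 S))"
    proof (rule K.gain_per_layer[OF division_subring_centralizer KE _ _ _ _ _ fin_up[OF finX] rsubspace_rspan])
      show "finite (insert 1 S)" "insert 1 S \<subseteq> ?E" "1 \<in> insert 1 S" using S E.one_mem by auto
      show "c * s = s * c" if "c \<in> ?K" "s \<in> insert 1 S" for c s
        using Kcomm[of s] that S(2) E.one_mem by auto
      show "T \<subseteq> {0}" if T: "T \<subseteq> ?E" "rsubspace ?K T" "rfin ?K T" "\<And>t s. t \<in> T \<Longrightarrow> s \<in> insert 1 S \<Longrightarrow> t * s \<in> T" for T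
      proof (rule ccontr)
        assume "\<not> T \<subseteq> {0}"
        moreover have "\<forall>t\<in>T. \<forall>s\<in>S. t * s \<in> T" using T(4) by blast
        ultimately show False using nope T(1-3) by metis
      qed
    qed
    also have "rspan ?E ?U = rspan ?E X"
    proof
      show "rspan ?E ?U \<subseteq> rspan ?E X" by (rule rspan_minimal[OF rsubspace_rspan rspan_field_mono[OF KE]])
      show "rspan ?E X \<subseteq> rspan ?E ?U" by (rule rspan_mono[OF rspan_superset])
    qed
    also have "rdim ?K (prodspan ?K ?U (insert 1 S)) \<le> rdim ?K ?W"
    proof (rule K.rdim_mono[OF fin_up[OF finXO] prodspan_minimal[OF rsubspace_rspan]])
      fix u s assume u: "u \<in> ?U" and s: "s \<in> insert 1 S"
      have sE: "s \<in> ?E" using s S(2) E.one_mem by auto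
      have "?U \<subseteq> {u. u * s \<in> ?W}"
        by (rule rspan_minimal[OF rsubspace_rmult_preimage[OF rsubspace_rspan Kcomm[OF sE]]])
          (use s in \<open>auto intro!: rspan_base prodspanI\<close>)
      with u show "u * s \<in> ?W" by blast
    qed
    finally have "real (?rK + ?rE) \<le> q * ?rK" using P by linarith
    then have "real n * (?rK + ?rE) \<le> real n * (q * ?rK)" by (rule mult_left_mono) simp
    also have "\<dots> \<le> (real n + 4 * c) * ?rK" using mult_right_mono[OF q, of "real ?rK"] by (simp add: mult.assoc)
    finally have 2: "real n * ?rE \<le> 4 * c * ?rK" by (simp add: algebra_simps)
    have "real n * (real n * ?rE) \<le> real n * (4 * c * ?rK)" using 2 by (rule mult_left_mono) simp
    also have "\<dots> = 4 * c * (real n * ?rK)" by simp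
    also have "\<dots> \<le> 4 * c * (4 * c * rdim Z X)" using 1 c(1) by (intro mult_left_mono) auto
    finally have 3: "(real n)\<^sup>2 * ?rE \<le> 16 * c\<^sup>2 * rdim Z X" by (simp add: power2_eq_square mult_ac)
    define \<kappa> where "\<kappa> = (real n)\<^sup>2 / (16 * c\<^sup>2)"
    have \<kappa>: "\<kappa> * ?rE \<le> rdim Z X" "0 \<le> \<kappa>" using 3 c(1) by (simp_all add: \<kappa>_def field_simps)
    from X(3) obtain v where v: "v \<in> X" "v \<noteq> 0" by blast
    have "\<kappa> * (real n + 1) \<le> g (n + n)"
      by (rule spreading[OF division_subring_centralizer ZE inf \<kappa>(2) X(1,2) v \<kappa>(1)])
    moreover have "\<kappa> * n \<le> \<kappa> * (real n + 1)" using \<kappa>(2) by (intro mult_left_mono) auto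
    ultimately have "\<kappa> * n \<le> g (n + n)" by linarith
    then have "\<kappa> * n \<le> g (2 * n)" by (simp only: mult_2)
    then have "1 / (16 * c\<^sup>2) * real n ^ 3 \<le> g (2 * n)" by (simp add: \<kappa>_def power2_eq_square power3_eq_cube)
    with n(1) show ?thesis by (intro exI[of _ n]) simp
  qed
  then show False by (rule growth_bound) (use c(1) in auto)
qed

end

section \<open>Algebraic elements\<close>

lemma not_transcE:
  assumes "\<not> transc F a"
  shows "\<exists>n c. (\<forall>i<n. c i \<in> F) \<and> (\<Sum>i<n. a ^ i * c i) = 0 \<and> \<not> (\<forall>i<n. c i = 0)"
  using assms unfolding transc_def by (simp only: not_all not_imp)

lemma not_left_transcE:
  assumes "\<not> left_transc F a"
  shows "\<exists>n c. (\<forall>i<n. c i \<in> F) \<and> (\<Sum>i<n. c i * a ^ i) = 0 \<and> \<not> (\<forall>i<n. c i = 0)"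
  using assms unfolding left_transc_def by (simp only: not_all not_imp)

lemma top_nonzero:
  fixes c :: "nat \<Rightarrow> 'd::division_ring"
  assumes "\<not> (\<forall>i<n. c i = 0)" shows "\<exists>j<n. c j \<noteq> 0 \<and> (\<forall>i. j < i \<longrightarrow> i < n \<longrightarrow> c i = 0)"
proof -
  from assms obtain i where "i < n" "c i \<noteq> 0" by blast
  from ex_top_index[of i n "\<lambda>i. c i \<noteq> 0", OF this] show ?thesis by simp
qed

context division_subring
begin

lemma monic_relation:
  assumes "\<not> transc F a" shows "\<exists>n c. (\<forall>i<n. c i \<in> F) \<and> a ^ n = (\<Sum>i<n. a ^ i * c i)"
proof -
  from not_transcE[OF assms] obtain n c where
    c: "\<forall>i<n. c i \<in> F" "(\<Sum>i<n. a ^ i * c i) = 0" "\<not> (\<forall>i<n. c i = 0)" by (elim exE conjE)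
  from top_nonzero[OF c(3)] obtain j where j: "j < n" "c j \<noteq> 0" "\<forall>i. j < i \<longrightarrow> i < n \<longrightarrow> c i = 0" by blast
  have "(\<Sum>i<Suc j. a ^ i * c i) = (\<Sum>i<n. a ^ i * c i)"
    by (rule sum.mono_neutral_left) (use j in auto)
  then have "(\<Sum>i<j. a ^ i * c i) + a ^ j * c j = 0" using c(2) by simp
  then have e: "a ^ j * c j = - (\<Sum>i<j. a ^ i * c i)" by (simp add: eq_neg_iff_add_eq_0 add.commute)
  have "a ^ j = a ^ j * c j * inverse (c j)" using j(2) by (simp add: mult.assoc)
  also have "\<dots> = (\<Sum>i<j. a ^ i * - (c i * inverse (c j)))"
    unfolding e by (simp add: sum_distrib_right sum_negf mult.assoc)
  finally have "a ^ j = (\<Sum>i<j. a ^ i * - (c i * inverse (c j)))" .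
  moreover have "\<forall>i<j. - (c i * inverse (c j)) \<in> F"
    using c(1) j(1) by (auto intro!: uminus_mem mult_mem inverse_mem)
  ultimately show ?thesis by (intro exI[of _ j] exI[of _ "\<lambda>i. - (c i * inverse (c j))"]) simp
qed

lemma left_monic_relation:
  assumes "\<not> left_transc F a" shows "\<exists>n c. (\<forall>i<n. c i \<in> F) \<and> a ^ n = (\<Sum>i<n. c i * a ^ i)"
proof -
  from not_left_transcE[OF assms] obtain n c where
    c: "\<forall>i<n. c i \<in> F" "(\<Sum>i<n. c i * a ^ i) = 0" "\<not> (\<forall>i<n. c i = 0)" by (elim exE conjE)
  from top_nonzero[OF c(3)] obtain j where j: "j < n" "c j \<noteq> 0" "\<forall>i. j < i \<longrightarrow> i < n \<longrightarrow> c i = 0" by blast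
  have "(\<Sum>i<Suc j. c i * a ^ i) = (\<Sum>i<n. c i * a ^ i)"
    by (rule sum.mono_neutral_left) (use j in auto)
  then have "(\<Sum>i<j. c i * a ^ i) + c j * a ^ j = 0" using c(2) by simp
  then have e: "c j * a ^ j = - (\<Sum>i<j. c i * a ^ i)" by (simp add: eq_neg_iff_add_eq_0 add.commute)
  have "a ^ j = inverse (c j) * (c j * a ^ j)" using j(2) by (simp add: mult.assoc[symmetric])
  also have "\<dots> = (\<Sum>i<j. - (inverse (c j) * c i) * a ^ i)"
    unfolding e by (simp add: sum_distrib_left sum_negf mult.assoc)
  finally have "a ^ j = (\<Sum>i<j. - (inverse (c j) * c i) * a ^ i)" .
  moreover have "\<forall>i<j. - (inverse (c j) * c i) \<in> F"
    using c(1) j(1) by (auto intro!: uminus_mem mult_mem inverse_mem)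
  ultimately show ?thesis by (intro exI[of _ j] exI[of _ "\<lambda>i. - (inverse (c j) * c i)"]) simp
qed

end

section \<open>Words of low complexity\<close>

text \<open>Koenig's lemma.\<close>

lemma infinite_word_of_long_words:
  fixes N :: "nat list set"
  assumes factor: "\<And>p u s. p @ u @ s \<in> N \<Longrightarrow> u \<in> N" and letters: "\<And>w. w \<in> N \<Longrightarrow> set w \<subseteq> {..<k}"
    and long: "\<And>n. \<exists>w\<in>N. length w = n"
  shows "\<exists>s. \<forall>n. map s [0..<n] \<in> N"
proof -
  define good where "good = (\<lambda>w. \<forall>L. \<exists>t. length t = L \<and> w @ t \<in> N)"
  have good_Nil: "good []" using long by (auto simp: good_def)
  have step: "\<exists>a. good (w @ [a])" if w: "good w" for w
  proof (rule ccontr)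
    assume "\<nexists>a. good (w @ [a])"
    then have "\<forall>a. \<exists>L. \<forall>t. length t = L \<longrightarrow> (w @ [a]) @ t \<notin> N" unfolding good_def by blast
    then obtain L where L: "\<forall>a t. length t = L a \<longrightarrow> (w @ [a]) @ t \<notin> N" by metis
    define M where "M = Max (insert 0 (L ` {..<k}))"
    from w obtain t where t: "length t = Suc M" "w @ t \<in> N" unfolding good_def by blast
    then obtain a t' where t': "t = a # t'" "length t' = M" by (cases t) auto
    have "a < k" using letters[OF t(2)] t' by auto
    then have "L a \<le> M" unfolding M_def by (intro Max_ge) auto
    then have "length (take (L a) t') = L a" using t' by simp
    then have "(w @ [a]) @ take (L a) t' \<notin> N" using L by blast
    moreover have "[] @ ((w @ [a]) @ take (L a) t') @ drop (L a) t' \<in> N" using t t' by simp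
    ultimately show False using factor by blast
  qed
  have "\<exists>f. \<forall>n. (good (f n) \<and> length (f n) = n) \<and> (\<exists>a. f (Suc n) = f n @ [a])"
    by (rule dependent_nat_choice) (use good_Nil step in force)+
  then obtain f where f: "\<And>n. good (f n)" "\<And>n. \<exists>a. f (Suc n) = f n @ [a]" "\<And>n. length (f n) = n" by blast
  define s where "s = (\<lambda>n. last (f (Suc n)))"
  have "f n = map s [0..<n]" for n
  proof (induction n)
    case (Suc n)
    obtain a where "f (Suc n) = f n @ [a]" using f(2) by blast
    moreover from this have "s n = a" by (simp add: s_def)
    ultimately show ?case using Suc by simp
  qed (use f(3)[of 0] in simp)
  moreover have "f n \<in> N" for n using f(1)[of n] unfolding good_def by (elim allE[of _ 0]) simp
  ultimately show ?thesis by metis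
qed

text \<open>The argument of Morse and Hedlund: the number of factors of length \<open>n\<close> does not grow at every step
  up to \<open>m\<close>, so at some length each factor determines the next letter.\<close>

lemma eventually_periodic_of_low_complexity:
  fixes s :: "nat \<Rightarrow> nat"
  assumes letters: "\<And>i. s i < k" and low: "card (range (\<lambda>i. map s [i..<i + m])) \<le> m"
  shows "\<exists>q p. 0 < p \<and> (\<forall>t. s (q + p + t) = s (q + t))"
proof -
  define Fa where "Fa = (\<lambda>n. range (\<lambda>i. map s [i..<i + n]))"
  have fin: "finite (Fa n)" for n
  proof (rule finite_subset)
    show "Fa n \<subseteq> {w. set w \<subseteq> {..<k} \<and> length w = n}" using letters by (auto simp: Fa_def)
    show "finite {w. set w \<subseteq> {..<k} \<and> length w = n}" by (rule finite_lists_length_eq) simp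
  qed
  have "\<exists>n. card (Fa (Suc n)) \<le> card (Fa n)"
  proof (rule ccontr)
    assume "\<not> ?thesis"
    then have less: "card (Fa n) < card (Fa (Suc n))" for n by (simp add: not_le)
    have "n + 1 \<le> card (Fa n)" for n
    proof (induction n)
      case 0
      show ?case by (simp add: Fa_def)
    next
      case (Suc n)
      then show ?case using less[of n] by simp
    qed
    from this[of m] low show False by (simp add: Fa_def)
  qed
  then obtain n where n: "card (Fa (Suc n)) \<le> card (Fa n)" by blast
  have bl: "butlast (map s [i..<i + Suc n]) = map s [i..<i + n]" for i by (simp add: map_butlast[symmetric])
  have im: "butlast ` Fa (Suc n) = Fa n" unfolding Fa_def image_image bl ..
  have "card (butlast ` Fa (Suc n)) = card (Fa (Suc n))"
    using card_image_le[OF fin, of butlast "Suc n"] n unfolding im by simp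
  then have inj: "inj_on butlast (Fa (Suc n))" by (rule eq_card_imp_inj_on[OF fin])
  have shift: "s (i + n) = s (j + n) \<and> map s [Suc i..<Suc i + n] = map s [Suc j..<Suc j + n]"
    if eq: "map s [i..<i + n] = map s [j..<j + n]" for i j
  proof -
    have "butlast (map s [i..<i + Suc n]) = butlast (map s [j..<j + Suc n])" unfolding bl by (rule eq)
    then have eq': "map s [i..<i + Suc n] = map s [j..<j + Suc n]"
      by (rule inj_onD[OF inj]) (auto simp: Fa_def)
    then have "last (map s [i..<i + Suc n]) = last (map s [j..<j + Suc n])" "tl (map s [i..<i + Suc n]) = tl (map s [j..<j + Suc n])"
      by simp_all
    moreover have "tl [i..<i + Suc n] = [Suc i..<Suc i + n]" for i by (simp add: upt_rec)
    ultimately show ?thesis by (simp add: map_tl[symmetric] del: upt_Suc) (simp add: last_map)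
  qed
  have "\<not> inj (\<lambda>i. map s [i..<i + n])"
    using finite_imageD[of "\<lambda>i. map s [i..<i + n]" UNIV] fin[of n] by (auto simp: Fa_def)
  then obtain a b where "a \<noteq> b" "map s [a..<a + n] = map s [b..<b + n]" by (auto simp: inj_def)
  then obtain i j where ij: "i < j" "map s [i..<i + n] = map s [j..<j + n]" by (metis linorder_neqE_nat)
  have per: "map s [i + t..<i + t + n] = map s [j + t..<j + t + n]" for t
  proof (induction t)
    case (Suc t)
    then show ?case using shift[OF Suc] by simp
  qed (use ij in simp)
  have "s (i + n + (j - i) + t) = s (i + n + t)" for t
  proof -
    have "s (i + t + n) = s (j + t + n)" using shift[OF per] by blast
    then show ?thesis using ij(1) by (simp add: algebra_simps)
  qed
  then show ?thesis using ij(1) by (intro exI[of _ "i + n"] exI[of _ "j - i"]) simp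
qed

lemma powers_of_low_complexity:
  fixes N :: "nat list set"
  assumes factor: "\<And>p u s. p @ u @ s \<in> N \<Longrightarrow> u \<in> N" and letters: "\<And>w. w \<in> N \<Longrightarrow> set w \<subseteq> {..<k}"
    and long: "\<And>n. \<exists>w\<in>N. length w = n" and low: "card {w \<in> N. length w = m} \<le> m"
  shows "\<exists>u. u \<noteq> [] \<and> (\<forall>j. concat (replicate j u) \<in> N)"
proof -
  have "\<exists>s. \<forall>n. map s [0..<n] \<in> N"
    by (rule infinite_word_of_long_words[OF _ letters long]) (rule factor)
  then obtain s where s: "\<And>n. map s [0..<n] \<in> N" by blast
  have facs: "map s [i..<i + n] \<in> N" for i n
  proof -
    have "map s [0..<i] @ map s [i..<i + n] @ [] \<in> N" using s[of "i + n"] by (simp add: upt_add_eq_append[of 0 i n])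
    then show ?thesis by (rule factor)
  qed
  have sk: "s i < k" for i using letters[OF s[of "Suc i"]] by auto
  have "card (range (\<lambda>i. map s [i..<i + m])) \<le> card {w \<in> N. length w = m}"
  proof (rule card_mono)
    have "{w \<in> N. length w = m} \<subseteq> {w. set w \<subseteq> {..<k} \<and> length w = m}" using letters by blast
    then show "finite {w \<in> N. length w = m}" by (rule finite_subset) (rule finite_lists_length_eq, simp)
  qed (use facs in auto)
  with low have "card (range (\<lambda>i. map s [i..<i + m])) \<le> m" by linarith
  from eventually_periodic_of_low_complexity[OF sk this] obtain q p where
    p: "0 < p" "\<And>t. s (q + p + t) = s (q + t)" by blast
  have per: "s (q + p * j + t) = s (q + t)" for j t
  proof (induction j)
    case (Suc j)
    have "s (q + p * Suc j + t) = s (q + p + (p * j + t))" by (simp add: algebra_simps)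
    also have "\<dots> = s (q + p * j + t)" using p(2) by (simp add: add.assoc)
    finally show ?case using Suc by simp
  qed simp
  have "concat (replicate j (map s [q..<q + p])) = map s [q..<q + p * j]" for j
  proof (induction j)
    case (Suc j)
    have "map s [q + p * j..<q + p * j + p] = map s [q..<q + p]"
    proof (rule nth_equalityI)
      fix t assume "t < length (map s [q + p * j..<q + p * j + p])"
      then show "map s [q + p * j..<q + p * j + p] ! t = map s [q..<q + p] ! t" using per by simp
    qed simp
    moreover have "map s [q..<q + p * j + p] = map s [q..<q + p * j] @ map s [q + p * j..<q + p * j + p]"
      using upt_add_eq_append[of q "q + p * j" p] by simp
    moreover have "concat (replicate (Suc j) (map s [q..<q + p])) = concat (replicate j (map s [q..<q + p])) @ map s [q..<q + p]"
      unfolding replicate_Suc replicate_append_same[symmetric] concat_append by simp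
    ultimately show ?case using Suc by (simp add: algebra_simps)
  qed simp
  then show ?thesis using facs p(1) by (intro exI[of _ "map s [q..<q + p]"]) simp
qed

section \<open>Normal words\<close>

text \<open>Words in letters \<open>v 0, \<dots>, v (k - 1)\<close>, compared by length and then lexicographically. The
  assumption lets coefficients move to the right end of a word without changing its length.\<close>

locale normal_words = division_subring F for F :: "'d::division_ring set" +
  fixes v :: "nat \<Rightarrow> 'd" and k :: nat
  assumes letters: "c \<in> F \<Longrightarrow> i < k \<Longrightarrow> c * v i \<in> rspan F (v ` {..<k})"
begin

definition val :: "nat list \<Rightarrow> 'd" where "val w = prod_list (map v w)"
definition words :: "nat list set" where "words = lists {..<k}"
definition lower :: "nat list \<Rightarrow> nat list set" where "lower u = {w \<in> words. (w, u) \<in> lenlex less_than}"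
definition normal :: "nat list \<Rightarrow> bool" where "normal u \<longleftrightarrow> u \<in> words \<and> val u \<notin> rspan F (val ` lower u)"

lemma val_simps [simp]: "val [] = 1" "val (i # w) = v i * val w" "val (u @ w) = val u * val w"
  by (simp_all add: val_def)

lemma words_simps [simp]: "[] \<in> words" "i # w \<in> words \<longleftrightarrow> i < k \<and> w \<in> words" "u @ w \<in> words \<longleftrightarrow> u \<in> words \<and> w \<in> words"
  by (auto simp: words_def)

text \<open>Multiplication on the right by \<open>d\<close> is not \<open>F\<close>-linear. Quantifying over a coefficient in front of \<open>d\<close>
  makes the preimage of a subspace a subspace.\<close>

lemma rsubspace_sandwich:
  assumes "rsubspace F U" shows "rsubspace F {y. \<forall>c\<in>F. y * c * d \<in> U}"
proof (rule rsubspaceI)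
  fix u c assume u: "u \<in> {y. \<forall>c\<in>F. y * c * d \<in> U}" "c \<in> F"
  have "u * c * c' * d \<in> U" if "c' \<in> F" for c'
  proof -
    have "u * (c * c') * d \<in> U" using u(1) mult_mem[OF u(2) that] by blast
    then show ?thesis by (simp add: mult.assoc)
  qed
  then show "u * c \<in> {y. \<forall>c\<in>F. y * c * d \<in> U}" by blast
qed (use assms in \<open>auto simp: rsubspace_def distrib_right\<close>)

lemma coeff_val:
  assumes "w \<in> words" "c \<in> F" shows "c * val w \<in> rspan F (val ` {w' \<in> words. length w' = length w})"
  using assms
proof (induction w arbitrary: c)
  case Nil
  have "val [] \<in> rspan F (val ` {w' \<in> words. length w' = length ([]::nat list)})"
    by (intro rspan_base imageI) simp
  from rsubspace_scale[OF rsubspace_rspan this Nil(2)] show ?case by simp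
next
  case (Cons i w)
  let ?R = "rspan F (val ` {w' \<in> words. length w' = length (i # w)})"
  have "rspan F (v ` {..<k}) \<subseteq> {y. \<forall>c\<in>F. y * c * val w \<in> ?R}"
  proof (rule rspan_minimal[OF rsubspace_sandwich[OF rsubspace_rspan]], clarify)
    fix j c assume j: "j < k" and c: "c \<in> F"
    have "c * val w \<in> rspan F (val ` {w' \<in> words. length w' = length w})" by (rule Cons.IH) (use Cons.prems c in auto)
    moreover have "rspan F (val ` {w' \<in> words. length w' = length w}) \<subseteq> {y. v j * y \<in> ?R}"
    proof (rule rspan_minimal[OF rsubspace_lmult_preimage[OF rsubspace_rspan]], clarify)
      fix w' assume "w' \<in> words" "length w' = length w"
      then have "val (j # w') \<in> ?R" using j by (intro rspan_base imageI) simp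
      then show "v j * val w' \<in> ?R" by simp
    qed
    ultimately show "v j * c * val w \<in> ?R" by (auto simp: mult.assoc)
  qed
  moreover have "c * v i \<in> rspan F (v ` {..<k})" using letters Cons.prems by simp
  ultimately have "c * v i * 1 * val w \<in> ?R" using one_mem by blast
  then show ?case by (simp add: mult.assoc)
qed

lemma rspan_mult_val:
  assumes "y \<in> rspan F (val ` L)" "s \<in> words"
  shows "y * val s \<in> rspan F (val ` {w @ s' | w s'. w \<in> L \<and> s' \<in> words \<and> length s' = length s})" (is "_ \<in> ?R")
proof -
  have "rspan F (val ` L) \<subseteq> {y. \<forall>c\<in>F. y * c * val s \<in> ?R}"
  proof (rule rspan_minimal[OF rsubspace_sandwich[OF rsubspace_rspan]], clarify)
    fix w c assume w: "w \<in> L" and c: "c \<in> F"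
    have "rspan F (val ` {w' \<in> words. length w' = length s}) \<subseteq> {y. val w * y \<in> ?R}"
    proof (rule rspan_minimal[OF rsubspace_lmult_preimage[OF rsubspace_rspan]], clarify)
      fix s' assume "s' \<in> words" "length s' = length s"
      then have "val (w @ s') \<in> ?R" using w by (intro rspan_base imageI) blast
      then show "val w * val s' \<in> ?R" by simp
    qed
    with coeff_val[OF assms(2) c] show "val w * c * val s \<in> ?R" by (auto simp: mult.assoc)
  qed
  then have "y * 1 * val s \<in> ?R" using assms(1) one_mem by blast
  then show ?thesis by simp
qed

text \<open>Words are compared from the left, so a reduction of a factor remains one inside any word, even
  though moving its coefficients to the end changes the letters after it.\<close>

lemma normal_factor:
  assumes "normal (p @ u @ s)" shows "normal u"
proof (rule ccontr)
  assume "\<not> normal u"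
  with assms have u: "val u \<in> rspan F (val ` lower u)" and w: "p \<in> words" "u \<in> words" "s \<in> words" by (auto simp: normal_def)
  let ?R = "rspan F (val ` lower (p @ u @ s))"
  have "rspan F (val ` {w @ s' | w s'. w \<in> lower u \<and> s' \<in> words \<and> length s' = length s}) \<subseteq> {y. val p * y \<in> ?R}"
  proof (rule rspan_minimal[OF rsubspace_lmult_preimage[OF rsubspace_rspan]], clarify)
    fix w' s' assume w': "w' \<in> lower u" "s' \<in> words" "length s' = length s"
    have "(w' @ s', u @ s) \<in> lenlex less_than" by (rule lenlex_append1) (use w' in \<open>auto simp: lower_def\<close>)
    then have "(p @ w' @ s', p @ u @ s) \<in> lenlex less_than" by (subst lenlex_append2) (auto simp: irrefl_def)
    then have "val (p @ w' @ s') \<in> ?R" using w' w by (intro rspan_base imageI) (auto simp: lower_def)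
    then show "val p * val (w' @ s') \<in> ?R" by simp
  qed
  with rspan_mult_val[OF u w(3)] have "val (p @ u @ s) \<in> ?R" by auto
  with assms show False by (simp add: normal_def)
qed

lemma lenlex_maximal:
  assumes "finite P" "P \<noteq> {}" shows "\<exists>u\<in>P. \<forall>w\<in>P. w = u \<or> (w, u) \<in> lenlex less_than"
  using assms
proof (induction P rule: finite_ne_induct)
  case (insert a P)
  then obtain u where u: "u \<in> P" "\<forall>w\<in>P. w = u \<or> (w, u) \<in> lenlex less_than" by blast
  have "total (lenlex less_than)" by (rule total_lenlex[OF total_less_than])
  then consider "a = u" | "(a, u) \<in> lenlex less_than" | "(u, a) \<in> lenlex less_than" unfolding total_on_def by blast
  then show ?case
  proof cases
    case 3
    have "(w, a) \<in> lenlex less_than" if "w \<in> P" for w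
      using u(2) that 3 lenlex_trans[OF _ 3, of w] by auto
    then show ?thesis by blast
  qed (use u in blast)+
qed simp

text \<open>The largest word of a relation would be a combination of smaller ones.\<close>

lemma normal_independent:
  assumes N: "finite N" "\<And>w. w \<in> N \<Longrightarrow> normal w"
  shows "inj_on val N" "rindep F (val ` N)"
proof -
  have main: "\<forall>w\<in>N. c w = 0" if c: "\<And>w. w \<in> N \<Longrightarrow> c w \<in> F" "(\<Sum>w\<in>N. val w * c w) = 0" for c
  proof (rule ccontr)
    assume "\<not> ?thesis"
    then have "{w \<in> N. c w \<noteq> 0} \<noteq> {}" by blast
    moreover have "finite {w \<in> N. c w \<noteq> 0}" using N(1) by simp
    ultimately obtain u where u: "u \<in> N" "c u \<noteq> 0" "\<And>w. w \<in> N \<Longrightarrow> c w \<noteq> 0 \<Longrightarrow> w = u \<or> (w, u) \<in> lenlex less_than"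
      using lenlex_maximal[of "{w \<in> N. c w \<noteq> 0}"] by auto
    have "(\<Sum>w\<in>N - {u}. val w * c w) \<in> rspan F (val ` lower u)"
    proof (rule rsubspace_sum[OF rsubspace_rspan])
      fix w assume w: "w \<in> N - {u}"
      show "val w * c w \<in> rspan F (val ` lower u)"
      proof (cases "c w = 0")
        case False
        then have "w \<in> lower u" using u(3)[of w] w N(2)[of w] by (auto simp: lower_def normal_def)
        then show ?thesis using rsubspace_scale[OF rsubspace_rspan rspan_base c(1)] w by auto
      qed (simp add: rsubspace_0[OF rsubspace_rspan])
    qed
    moreover have "val u * c u = - (\<Sum>w\<in>N - {u}. val w * c w)"
      using c(2) sum.remove[OF N(1) u(1), of "\<lambda>w. val w * c w"] by (simp add: eq_neg_iff_add_eq_0)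
    ultimately have "val u * c u \<in> rspan F (val ` lower u)" using rsubspace_uminus[OF rsubspace_rspan] by simp
    then have "val u * c u * inverse (c u) \<in> rspan F (val ` lower u)"
      by (rule rsubspace_scale[OF rsubspace_rspan]) (rule inverse_mem[OF c(1)[OF u(1)]])
    then show False using N(2)[OF u(1)] u(2) by (simp add: normal_def mult.assoc)
  qed
  show "inj_on val N" by (rule rindep_family(1)[OF N(1) main])
  show "rindep F (val ` N)" by (rule rindep_family(2)[OF N(1) main])
qed

lemma words_span_of_no_normal:
  assumes no: "\<nexists>u. normal u \<and> length u = n" and w: "w \<in> words"
  shows "val w \<in> rspan F (val ` {w \<in> words. length w < n})"
  using w
proof (induction w rule: wf_induct_rule[OF wf_lenlex[OF wf_less_than]])
  case (1 w)
  let ?R = "rspan F (val ` {w \<in> words. length w < n})"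
  show ?case
  proof (cases "length w < n")
    case True
    then show ?thesis using 1(2) by (intro rspan_base imageI) simp
  next
    case False
    have "\<not> normal w"
    proof
      assume "normal w"
      then have "normal ([] @ take n w @ drop n w)" by simp
      then have "normal (take n w)" by (rule normal_factor)
      then show False using no False by auto
    qed
    then have "val w \<in> rspan F (val ` lower w)" using 1(2) by (simp add: normal_def)
    moreover have "rspan F (val ` lower w) \<subseteq> ?R"
      by (rule rspan_minimal[OF rsubspace_rspan]) (use 1(1) in \<open>auto simp: lower_def\<close>)
    ultimately show ?thesis by blast
  qed
qed

lemma val_power: "val (concat (replicate j u)) = val u ^ j"
  by (induction j) auto

lemma power_lower: "u \<noteq> [] \<Longrightarrow> u \<in> words \<Longrightarrow> i < j \<Longrightarrow> length w = length (concat (replicate i u)) \<Longrightarrow> w \<in> words \<Longrightarrow> w \<in> lower (concat (replicate j u))"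
  by (auto simp: lower_def lenlex_conv length_concat sum_list_replicate)

text \<open>In a relation between powers, on either side, the highest power would be a combination of
  shorter words.\<close>

lemma transc_of_normal_powers:
  assumes u: "u \<noteq> []" "\<And>j. normal (concat (replicate j u))"
  shows "transc F (val u)" "left_transc F (val u)"
proof -
  have pw: "concat (replicate j u) \<in> words" for j using u(2) by (simp add: normal_def)
  have uw: "u \<in> words" using pw[of 1] by simp
  let ?R = "\<lambda>j. rspan F (val ` lower (concat (replicate j u)))"
  have low: "w \<in> words \<Longrightarrow> length w = length (concat (replicate i u)) \<Longrightarrow> i < j \<Longrightarrow> val w \<in> ?R j" for w i j
    by (intro rspan_base imageI power_lower[OF u(1) uw])
  have notin: "val u ^ j \<notin> ?R j" for j using u(2)[of j] by (simp add: normal_def val_power)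
  show "transc F (val u)"
  proof (rule ccontr)
    assume "\<not> ?thesis"
    from monic_relation[OF this] obtain j c where
      c: "\<forall>i<j. c i \<in> F" "val u ^ j = (\<Sum>i<j. val u ^ i * c i)" by (elim exE conjE)
    have "(\<Sum>i<j. val u ^ i * c i) \<in> ?R j"
      by (rule rsubspace_sum[OF rsubspace_rspan])
        (use low[OF pw refl] c(1) in \<open>auto simp: val_power intro!: rsubspace_scale[OF rsubspace_rspan]\<close>)
    with notin[of j] c(2) show False by simp
  qed
  show "left_transc F (val u)"
  proof (rule ccontr)
    assume "\<not> ?thesis"
    from left_monic_relation[OF this] obtain j c where
      c: "\<forall>i<j. c i \<in> F" "val u ^ j = (\<Sum>i<j. c i * val u ^ i)" by (elim exE conjE)
    have "(\<Sum>i<j. c i * val u ^ i) \<in> ?R j"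
    proof (rule rsubspace_sum[OF rsubspace_rspan])
      fix i assume i: "i \<in> {..<j}"
      then have "c i \<in> F" using c(1) by simp
      from coeff_val[OF pw this, of i] have
        "c i * val u ^ i \<in> rspan F (val ` {w' \<in> words. length w' = length (concat (replicate i u))})"
        by (simp only: val_power)
      moreover have "rspan F (val ` {w' \<in> words. length w' = length (concat (replicate i u))}) \<subseteq> ?R j"
        by (rule rspan_minimal[OF rsubspace_rspan]) (use low i in auto)
      ultimately show "c i * val u ^ i \<in> ?R j" by blast
    qed
    with notin[of j] c(2) show False by simp
  qed
qed

end

context filtered_growth
begin

text \<open>Bergman's gap argument: subquadratic growth over \<open>F\<close> leaves too few normal words, so all powers
  of some word are normal.\<close>

lemma normal_power_exists:
  assumes F: "division_subring F" "Z \<subseteq> F" and inf: "\<not> rfin F UNIV"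
    and sub: "\<And>C N. 0 < C \<Longrightarrow> \<exists>n\<ge>N. rdim F (rspan F (A n)) < (C::real) * real n ^ 2"
    and B: "finite B" "B \<subseteq> A c" "A 1 \<subseteq> rspan F B" "\<And>k b. k \<in> F \<Longrightarrow> b \<in> B \<Longrightarrow> k * b \<in> rspan F B"
  shows "\<exists>m. \<exists>e\<in>A m. transc F e \<and> left_transc F e"
proof -
  interpret F: division_subring F by fact
  obtain v where v: "bij_betw v {..<card B} B" using ex_bij_betw_nat_finite[OF B(1)] by (auto simp: atLeast0LessThan)
  then have vB: "v ` {..<card B} = B" by (simp add: bij_betw_def)
  interpret normal_words F v "card B"
    by unfold_locales (unfold vB, use B(4) vB in auto)
  \<comment> \<open>A positive constant, so that division by it is meaningful.\<close>
  define c' where "c' = Suc c"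
  have Bc: "B \<subseteq> A c'" using B(2) A_mono by (auto simp: c'_def)
  have valA: "val w \<in> A (c' * length w)" if "w \<in> words" for w
    using that
  proof (induction w)
    case (Cons i w)
    then have "v i \<in> A c'" using vB Bc by auto
    from A_mult[OF this Cons.IH] Cons.prems show ?case by simp
  qed (use one_A in simp)
  have finN: "finite {w \<in> words. length w \<le> n}" for n
    unfolding words_def lists_eq_set using finite_lists_length_le[of "{..<card B}" n] by simp
  have finA: "rfin F (rspan F (A n))" for n by (rule rfin_rspan_field[OF A_fin F(2)])
  have long: "\<exists>w\<in>Collect normal. length w = n" for n
  proof (rule ccontr)
    assume "\<not> ?thesis"
    then have no: "\<nexists>u. normal u \<and> length u = n" by blast
    let ?R = "rspan F (val ` {w \<in> words. length w < n})"
    have W: "val w \<in> ?R" if "w \<in> words" for w by (rule words_span_of_no_normal[OF no that])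
    have "finite {w \<in> words. length w < n}" by (rule finite_subset[OF _ finN[of n]]) auto
    then have finR: "rfin F ?R" by (intro F.rfin_rspan) simp
    have stab: "a * u \<in> ?R" if a: "a \<in> A 1" and u: "u \<in> ?R" for a u
    proof -
      have "rspan F B \<subseteq> {y. \<forall>k\<in>F. y * k * val w \<in> ?R}" if w: "w \<in> words" for w
      proof (rule rspan_minimal[OF rsubspace_sandwich[OF rsubspace_rspan]], clarify)
        fix b k assume b: "b \<in> B" and k: "k \<in> F"
        from b vB obtain i where i: "i < card B" "b = v i" by auto
        have "rspan F (val ` {w' \<in> words. length w' = length w}) \<subseteq> {y. b * y \<in> ?R}"
        proof (rule rspan_minimal[OF rsubspace_lmult_preimage[OF rsubspace_rspan]], clarify)
          fix w' assume "w' \<in> words"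
          then have "val (i # w') \<in> ?R" using i by (intro W) simp
          then show "b * val w' \<in> ?R" using i by simp
        qed
        with coeff_val[OF w k] show "b * k * val w \<in> ?R" by (auto simp: mult.assoc)
      qed
      then have "a * 1 * val w \<in> ?R" if "w \<in> words" for w using a B(3) F.one_mem that by blast
      then have "?R \<subseteq> {y. a * y \<in> ?R}"
        by (intro rspan_minimal[OF rsubspace_lmult_preimage[OF rsubspace_rspan]]) auto
      then show ?thesis using u by blast
    qed
    have "val [] \<in> ?R" by (rule W) simp
    then have "1 \<in> ?R" by simp
    from stable_imp_finite[OF F(1) finR rsubspace_rspan this _ stab F(2)] inf show False by simp
  qed
  have "\<exists>m. card {w \<in> Collect normal. length w = m} \<le> m"
  proof (rule ccontr)
    assume "\<not> ?thesis"
    then have many: "Suc m \<le> card {w \<in> Collect normal. length w = m}" for m by (simp add: not_le Suc_le_eq)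
    define N where "N = (\<lambda>n. {w. normal w \<and> length w \<le> n})"
    have finN': "finite (N n)" for n by (rule finite_subset[OF _ finN[of n]]) (auto simp: N_def normal_def)
    have cardN: "(n + 1) * (n + 2) \<le> 2 * card (N n)" for n
    proof (induction n)
      case 0
      have "N 0 = {w \<in> Collect normal. length w = 0}" by (auto simp: N_def)
      then show ?case using many[of 0] by simp
    next
      case (Suc n)
      have "N (Suc n) = N n \<union> {w \<in> Collect normal. length w = Suc n}" by (auto simp: N_def)
      moreover have "card (N n \<union> {w \<in> Collect normal. length w = Suc n}) = card (N n) + card {w \<in> Collect normal. length w = Suc n}"
        by (rule card_Un_disjoint[OF finN']) (use finN'[of "Suc n"] in \<open>auto simp: N_def intro: rev_finite_subset\<close>)
      ultimately show ?case using Suc many[of "Suc n"] by simp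
    qed
    \<comment> \<open>Words of length \<open>h = n div c'\<close> lie in \<open>A n\<close>; more than \<open>(h + 1)\<^sup>2 / 2\<close> of those up to this length are normal.\<close>
    from sub[of "1 / (2 * real c' ^ 2)" 0] obtain n where
      n: "rdim F (rspan F (A n)) < 1 / (2 * real c' ^ 2) * real n ^ 2" by (auto simp: c'_def)
    define h where "h = n div c'"
    have c'0: "0 < c'" by (simp add: c'_def)
    have hn: "c' * h \<le> n" "n < c' * (h + 1)"
      using dividend_less_times_div[OF c'0, of n] by (simp_all add: h_def)
    note ni = normal_independent[OF finN'[of h]]
    have nor: "w \<in> N h \<Longrightarrow> normal w" for w by (simp add: N_def)
    have "val ` N h \<subseteq> rspan F (A n)"
    proof clarify
      fix w assume w: "w \<in> N h"
      then have "length w \<le> h" by (simp add: N_def)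
      then have "c' * length w \<le> n" using hn(1) mult_le_mono2[of "length w" h c'] by linarith
      then have "val w \<in> A n" using valA[of w] A_le[of "c' * length w" n] w by (auto simp: N_def normal_def)
      then show "val w \<in> rspan F (A n)" by (rule rspan_base)
    qed
    from F.rindep_card_le_rdim[OF finA this ni(2)[OF nor]] card_image[OF ni(1)[OF nor]]
    have "card (N h) \<le> rdim F (rspan F (A n))" by simp
    with cardN[of h] have "(h + 1) * (h + 2) \<le> 2 * rdim F (rspan F (A n))" by linarith
    then have "real ((h + 1) * (h + 2)) \<le> 2 * real (rdim F (rspan F (A n)))" by (metis of_nat_le_iff of_nat_mult of_nat_numeral)
    also have "\<dots> < real n ^ 2 / real c' ^ 2" using n by simp
    also have "\<dots> \<le> real (c' * (h + 1)) ^ 2 / real c' ^ 2"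
      using hn(2) by (intro divide_right_mono power_mono) (simp_all del: of_nat_mult)
    also have "\<dots> = real (h + 1) ^ 2" unfolding of_nat_mult power_mult_distrib using c'0 by simp
    finally show False by (simp add: power2_eq_square algebra_simps)
  qed
  then obtain m where m: "card {w \<in> Collect normal. length w = m} \<le> m" by blast
  have "\<exists>u. u \<noteq> [] \<and> (\<forall>j. concat (replicate j u) \<in> Collect normal)"
  proof (rule powers_of_low_complexity[OF _ _ long m])
    show "u \<in> Collect normal" if "p @ u @ s \<in> Collect normal" for p u s using normal_factor that by simp
    show "set w \<subseteq> {..<card B}" if "w \<in> Collect normal" for w using that by (auto simp: normal_def words_def)
  qed
  then obtain u where u: "u \<noteq> []" "\<And>j. normal (concat (replicate j u))" by blast
  have "u \<in> words" using u(2)[of 1] by (simp add: normal_def)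
  from valA[OF this] transc_of_normal_powers[OF u] show ?thesis by blast
qed

end

context division_subring
begin

text \<open>A monic relation over a ring reduces all powers to those below \<open>n\<close>.\<close>

lemma monic_power_span:
  assumes Bm: "\<And>b b'. b \<in> rspan F Y \<Longrightarrow> b' \<in> rspan F Y \<Longrightarrow> b * b' \<in> rspan F Y"
    and rel: "a ^ n = (\<Sum>i<n. a ^ i * b i)" "\<forall>i<n. b i \<in> rspan F Y" and d: "d \<in> rspan F Y"
  shows "a ^ j * d \<in> rspan F ((\<lambda>(i, y). a ^ i * y) ` ({..<n} \<times> Y))"
  using d
proof (induction j arbitrary: d rule: less_induct)
  case (less j)
  let ?M = "rspan F ((\<lambda>(i, y). a ^ i * y) ` ({..<n} \<times> Y))"
  show ?case
  proof (cases "j < n")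
    case True
    have "rspan F Y \<subseteq> {u. a ^ j * u \<in> ?M}"
      by (rule rspan_minimal[OF rsubspace_lmult_preimage[OF rsubspace_rspan]])
        (use True in \<open>auto intro!: rspan_base\<close>)
    then show ?thesis using less.prems by blast
  next
    case False
    have "a ^ j = a ^ (j - n) * a ^ n" using False by (simp add: power_add[symmetric])
    then have "a ^ j * d = a ^ (j - n) * (\<Sum>i<n. a ^ i * b i) * d" using rel(1) by simp
    also have "\<dots> = (\<Sum>i<n. a ^ (j - n + i) * (b i * d))"
      by (simp add: sum_distrib_left sum_distrib_right mult.assoc power_add)
    also have "\<dots> \<in> ?M"
    proof (rule rsubspace_sum[OF rsubspace_rspan])
      fix i assume i: "i \<in> {..<n}"
      show "a ^ (j - n + i) * (b i * d) \<in> ?M"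
        by (rule less.IH) (use i False rel(2) less.prems in \<open>auto intro!: Bm\<close>)
    qed
    finally show ?thesis .
  qed
qed

text \<open>Finitely many elements span all powers, so the powers are dependent over \<open>F\<close> itself.\<close>

lemma not_transc_of_monic:
  assumes Y: "finite Y" and Bm: "\<And>b b'. b \<in> rspan F Y \<Longrightarrow> b' \<in> rspan F Y \<Longrightarrow> b * b' \<in> rspan F Y"
    and one: "1 \<in> rspan F Y"
    and rel: "a ^ n = (\<Sum>i<n. a ^ i * b i)" "\<forall>i<n. b i \<in> rspan F Y"
  shows "\<not> transc F a"
proof
  assume tr: "transc F a"
  let ?G = "(\<lambda>(i, y). a ^ i * y) ` ({..<n} \<times> Y)"
  have fin: "finite ?G" using Y by simp
  have "a ^ j \<in> rspan F ?G" for j using monic_power_span[OF Bm rel one, of j] by simp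
  then have "\<exists>c. (\<forall>i\<in>{..<Suc (card ?G)}. c i \<in> F) \<and> (\<exists>i\<in>{..<Suc (card ?G)}. c i \<noteq> 0) \<and> (\<Sum>i\<in>{..<Suc (card ?G)}. a ^ i * c i) = 0"
    by (intro dependent_family[OF fin]) auto
  then obtain c i where c: "\<forall>i\<in>{..<Suc (card ?G)}. c i \<in> F" "i < Suc (card ?G)" "c i \<noteq> 0" "(\<Sum>i<Suc (card ?G). a ^ i * c i) = 0"
    by (elim exE conjE bexE) auto
  have "c i = 0" by (rule transcD[OF tr _ c(4,2)]) (use c(1) in simp)
  with c(3) show False ..
qed

text \<open>The mirror image; \<open>Y\<close> commutes with \<open>F\<close>, so that its span is a left space too.\<close>

lemma not_left_transc_of_monic:
  assumes Y: "finite Y" "\<And>c y. c \<in> F \<Longrightarrow> y \<in> Y \<Longrightarrow> c * y = y * c"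
    and Bm: "\<And>b b'. b \<in> rspan F Y \<Longrightarrow> b' \<in> rspan F Y \<Longrightarrow> b * b' \<in> rspan F Y"
    and one: "1 \<in> rspan F Y"
    and rel: "a ^ n = (\<Sum>i<n. b i * a ^ i)" "\<forall>i<n. b i \<in> rspan F Y"
  shows "\<not> left_transc F a"
proof
  assume tr: "left_transc F a"
  let ?I = "{..<n} \<times> Y"
  have finI: "finite ?I" using Y by simp
  define M where "M = (\<lambda>u. \<exists>k. (\<forall>p\<in>?I. k p \<in> F) \<and> u = (\<Sum>p\<in>?I. k p * (snd p * a ^ fst p)))"
  have M0: "M 0" unfolding M_def by (intro exI[of _ "\<lambda>_. 0"]) (simp add: zero_mem)
  have Madd: "M (u + w)" if "M u" "M w" for u w
  proof -
    from that(1) obtain k where k: "\<forall>p\<in>?I. k p \<in> F" "u = (\<Sum>p\<in>?I. k p * (snd p * a ^ fst p))" unfolding M_def by (elim exE conjE)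
    from that(2) obtain l where l: "\<forall>p\<in>?I. l p \<in> F" "w = (\<Sum>p\<in>?I. l p * (snd p * a ^ fst p))" unfolding M_def by (elim exE conjE)
    show ?thesis unfolding M_def k(2) l(2) using k(1) l(1)
      by (intro exI[of _ "\<lambda>p. k p + l p"]) (simp add: distrib_right sum.distrib add_mem)
  qed
  have Msum: "M (\<Sum>i\<in>J. f i)" if "\<And>i. i \<in> J \<Longrightarrow> M (f i)" for f and J :: "nat set"
    using that by (induction J rule: infinite_finite_induct) (auto intro: M0 Madd)
  have base: "M (d * a ^ i)" if d: "d \<in> rspan F Y" and i: "i < n" for d i
  proof -
    from d obtain k where k: "d = (\<Sum>y\<in>Y. y * k y)" "\<forall>y\<in>Y. k y \<in> F" unfolding rspan_finite[OF Y(1)] by blast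
    have "d * a ^ i = (\<Sum>y\<in>Y. k y * (y * a ^ i))"
      unfolding k(1) sum_distrib_right by (rule sum.cong) (use k(2) Y(2) in \<open>auto simp: mult.assoc[symmetric]\<close>)
    also have "\<dots> = (\<Sum>p\<in>(\<lambda>y. (i, y)) ` Y. k (snd p) * (snd p * a ^ fst p))"
      by (subst sum.reindex) (auto simp: inj_on_def)
    also have "\<dots> = (\<Sum>p\<in>?I. (if fst p = i then k (snd p) else 0) * (snd p * a ^ fst p))"
      by (rule sum.mono_neutral_cong_left) (use Y(1) i in auto)
    finally show ?thesis unfolding M_def using k(2)
      by (intro exI[of _ "\<lambda>p. if fst p = i then k (snd p) else 0"]) (auto simp: zero_mem)
  qed
  have all: "M (d * a ^ j)" if "d \<in> rspan F Y" for d j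
    using that
  proof (induction j arbitrary: d rule: less_induct)
    case (less j)
    show ?case
    proof (cases "j < n")
      case False
      have "a ^ j = a ^ n * a ^ (j - n)" using False by (simp add: power_add[symmetric])
      then have "d * a ^ j = d * (\<Sum>i<n. b i * a ^ i) * a ^ (j - n)" using rel(1) by (simp add: mult.assoc)
      also have "\<dots> = (\<Sum>i<n. d * b i * a ^ (i + (j - n)))"
        by (simp add: sum_distrib_left sum_distrib_right mult.assoc power_add)
      also have "M \<dots>"
      proof (rule Msum)
        fix i assume i: "i \<in> {..<n}"
        show "M (d * b i * a ^ (i + (j - n)))"
          by (rule less.IH) (use i False rel(2) less.prems in \<open>auto intro!: Bm\<close>)
      qed
      finally show ?thesis .
    qed (use less.prems base in blast)
  qed
  have "\<forall>j. \<exists>k. (\<forall>p\<in>?I. k p \<in> F) \<and> a ^ j = (\<Sum>p\<in>?I. k p * (snd p * a ^ fst p))"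
    using all[OF one] by (simp add: M_def)
  then obtain k where k: "\<forall>j. (\<forall>p\<in>?I. k j p \<in> F) \<and> a ^ j = (\<Sum>p\<in>?I. k j p * (snd p * a ^ fst p))" by metis
  let ?J = "{..<Suc (card ?I)}"
  have "\<exists>c. (\<forall>i\<in>?J. c i \<in> F) \<and> (\<exists>i\<in>?J. c i \<noteq> 0) \<and> (\<forall>p\<in>?I. (\<Sum>j\<in>?J. c j * k j p) = 0)"
    by (rule homogeneous_system_left[OF finI]) (use k in auto)
  then obtain c i where c: "\<forall>i\<in>?J. c i \<in> F" "i \<in> ?J" "c i \<noteq> 0" "\<forall>p\<in>?I. (\<Sum>j\<in>?J. c j * k j p) = 0"
    by (elim exE conjE bexE)
  have "(\<Sum>j\<in>?J. c j * a ^ j) = (\<Sum>j\<in>?J. c j * (\<Sum>p\<in>?I. k j p * (snd p * a ^ fst p)))"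
    by (rule sum.cong[OF refl]) (use k in metis)
  also have "\<dots> = (\<Sum>j\<in>?J. \<Sum>p\<in>?I. c j * k j p * (snd p * a ^ fst p))"
    by (simp add: sum_distrib_left mult.assoc)
  also have "\<dots> = (\<Sum>p\<in>?I. \<Sum>j\<in>?J. c j * k j p * (snd p * a ^ fst p))" by (rule sum.swap)
  also have "\<dots> = (\<Sum>p\<in>?I. (\<Sum>j\<in>?J. c j * k j p) * (snd p * a ^ fst p))"
    by (simp only: sum_distrib_right)
  also have "\<dots> = 0" by (rule sum.neutral) (use c(4) in simp)
  finally have s: "(\<Sum>j<Suc (card ?I). c j * a ^ j) = 0" .
  have "c i = 0" by (rule left_transcD[OF tr _ s]) (use c in auto)
  with c(3) show False ..
qed

text \<open>Finitely many central algebraic elements lie in a finite-dimensional subring.\<close>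

lemma finite_dimensional_subring:
  assumes central: "\<And>z d. z \<in> F \<Longrightarrow> z * d = d * z"
    and S: "finite S" "\<And>c. c \<in> S \<Longrightarrow> (\<forall>d. c * d = d * c) \<and> \<not> transc F c"
  shows "\<exists>Y. finite Y \<and> S \<subseteq> rspan F Y \<and> 1 \<in> rspan F Y \<and> (\<forall>b\<in>rspan F Y. \<forall>b'\<in>rspan F Y. b * b' \<in> rspan F Y)"
  using S
proof (induction S rule: finite_induct)
  case empty
  have "rspan F {1} = F"
  proof
    show "rspan F {1} \<subseteq> F" by (rule rspan_minimal[OF rsubspace_self]) (simp add: one_mem)
    show "F \<subseteq> rspan F {1}"
    proof
      fix c assume "c \<in> F"
      from rsubspace_scale[OF rsubspace_rspan rspan_base this, of 1 "{1}"] show "c \<in> rspan F {1}" by simp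
    qed
  qed
  then show ?case by (intro exI[of _ "{1}"]) (simp add: one_mem mult_mem)
next
  case (insert c S)
  then obtain Y where Y: "finite Y" "S \<subseteq> rspan F Y" "1 \<in> rspan F Y" "\<forall>b\<in>rspan F Y. \<forall>b'\<in>rspan F Y. b * b' \<in> rspan F Y"
    by (metis insertCI)
  have c: "\<And>d. c * d = d * c" "\<not> transc F c" using insert.prems by auto
  from monic_relation[OF c(2)] obtain n z where z: "\<forall>i<n. z i \<in> F" "c ^ n = (\<Sum>i<n. c ^ i * z i)" by (elim exE conjE)
  let ?G = "(\<lambda>(i, y). c ^ i * y) ` ({..<n} \<times> Y)"
  have zY: "\<forall>i<n. z i \<in> rspan F Y" using rsubspace_scale[OF rsubspace_rspan Y(3)] z(1) by fastforce
  have all: "c ^ j * d \<in> rspan F ?G" if "d \<in> rspan F Y" for j d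
    by (rule monic_power_span[OF _ z(2) zY that]) (use Y(4) in blast)
  have cpow: "d * c ^ j = c ^ j * d" for d j
    using power_commuting_commutes[of c d j] c(1)[of d] by simp
  have prod: "u * w \<in> rspan F ?G" if u: "u \<in> ?G" and w: "w \<in> ?G" for u w
  proof -
    from u obtain i y where iy: "u = c ^ i * y" "y \<in> Y" by auto
    from w obtain j y' where jy: "w = c ^ j * y'" "y' \<in> Y" by auto
    have "u * w = c ^ i * (y * c ^ j) * y'" by (simp add: iy jy mult.assoc)
    also have "\<dots> = c ^ (i + j) * (y * y')" unfolding cpow[of y j] by (simp add: power_add mult.assoc)
    finally have uw: "u * w = c ^ (i + j) * (y * y')" .
    have "y * y' \<in> rspan F Y" using Y(4) rspan_base[OF iy(2)] rspan_base[OF jy(2)] by blast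
    from all[OF this, of "i + j"] show ?thesis unfolding uw .
  qed
  have "b * b' \<in> rspan F ?G" if b: "b \<in> rspan F ?G" "b' \<in> rspan F ?G" for b b'
  proof -
    have "rspan F ?G \<subseteq> {b. u * b \<in> rspan F ?G}" if "u \<in> ?G" for u
      by (rule rspan_minimal[OF rsubspace_lmult_preimage[OF rsubspace_rspan]]) (use prod[OF that] in blast)
    then have "?G \<subseteq> {u. u * b' \<in> rspan F ?G}" using b(2) by blast
    then have "rspan F ?G \<subseteq> {u. u * b' \<in> rspan F ?G}"
      by (intro rspan_minimal[OF rsubspace_rmult_preimage[OF rsubspace_rspan]]) (use central in blast)+
    then show ?thesis using b(1) by blast
  qed
  moreover have "d \<in> rspan F ?G" if "d \<in> rspan F Y" for d using all[OF that, of 0] by simp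
  moreover have "c \<in> rspan F ?G" using all[OF Y(3), of 1] by simp
  ultimately show ?case using Y(1-3) by (intro exI[of _ ?G]) auto
qed

text \<open>If \<open>D\<close> is finite-dimensional over the centralizer of \<open>x\<close>, then the operators of multiplication by
  the powers of \<open>x\<close> on the right satisfy a linear relation with coefficients acting on the left. In
  a shortest relation the coefficients are central, so \<open>x\<close> is algebraic over the center.\<close>

lemma central_transcendental:
  assumes central: "\<And>z d. z \<in> F \<Longrightarrow> z * d = d * z" and x: "transc F x"
    and fin: "rfin (centralizer {x}) UNIV"
  shows "\<exists>z. (\<forall>d. z * d = d * z) \<and> transc F z"
proof (rule ccontr)
  assume no: "\<not> ?thesis"
  interpret D: division_subring "UNIV :: 'd set" by (rule division_subring_UNIV)
  interpret E: division_subring "centralizer {x}" by (rule division_subring_centralizer)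
  from fin obtain B where B: "finite B" "UNIV \<subseteq> rspan (centralizer {x}) B" by (auto simp: rfin_def)
  define n where "n = Suc (card B)"
  define Sol where "Sol = (\<lambda>c. \<forall>d. (\<Sum>i<n. c i * d * x ^ i) = 0)"
  have "\<exists>c. (\<forall>i\<in>{..<n}. c i \<in> UNIV) \<and> (\<exists>i\<in>{..<n}. c i \<noteq> 0) \<and> (\<forall>b\<in>B. (\<Sum>i\<in>{..<n}. c i * (b * x ^ i)) = 0)"
    by (rule D.homogeneous_system_left[OF B(1)]) (auto simp: n_def)
  then obtain c0 i0 where c0: "i0 < n" "c0 i0 \<noteq> 0" "\<forall>b\<in>B. (\<Sum>i<n. c0 i * (b * x ^ i)) = 0" by auto
  have "rspan (centralizer {x}) B \<subseteq> {d. (\<Sum>i<n. c0 i * d * x ^ i) = 0}"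
  proof (rule rspan_minimal)
    show "rsubspace (centralizer {x}) {d. (\<Sum>i<n. c0 i * d * x ^ i) = 0}"
    proof (rule rsubspaceI)
      fix u e assume u: "u \<in> {d. (\<Sum>i<n. c0 i * d * x ^ i) = 0}" and e: "e \<in> centralizer {x}"
      have "e * x ^ i = x ^ i * e" for i
        using power_commuting_commutes[of x e i] e by (simp add: centralizer_singleton)
      then have "(\<Sum>i<n. c0 i * (u * e) * x ^ i) = (\<Sum>i<n. c0 i * u * x ^ i) * e"
        by (simp add: sum_distrib_right mult.assoc)
      then show "u * e \<in> {d. (\<Sum>i<n. c0 i * d * x ^ i) = 0}" using u by simp
    qed (simp_all add: distrib_left distrib_right sum.distrib)
    show "B \<subseteq> {d. (\<Sum>i<n. c0 i * d * x ^ i) = 0}" using c0(3) by (auto simp: mult.assoc)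
  qed
  then have "Sol c0" using B(2) by (auto simp: Sol_def)
  define supp where "supp = (\<lambda>c :: nat \<Rightarrow> 'd. {i. i < n \<and> c i \<noteq> 0})"
  define P where "P = (\<lambda>c. Sol c \<and> supp c \<noteq> {})"
  have "P c0" using \<open>Sol c0\<close> c0(1,2) by (auto simp: P_def supp_def)
  from ex_has_least_nat[of P c0 "\<lambda>c. card (supp c)", OF this] obtain c1 where
    c1: "P c1" "\<forall>c'. P c' \<longrightarrow> card (supp c1) \<le> card (supp c')" by (elim exE conjE)
  from c1(1) obtain s where s: "s < n" "c1 s \<noteq> 0" by (auto simp: P_def supp_def)
  define c where "c = (\<lambda>i. inverse (c1 s) * c1 i)"
  have Solc: "Sol c"
  proof -
    have "(\<Sum>i<n. c i * d * x ^ i) = inverse (c1 s) * (\<Sum>i<n. c1 i * d * x ^ i)" for d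
      by (simp add: c_def sum_distrib_left mult.assoc)
    then show ?thesis using c1(1) by (simp add: P_def Sol_def)
  qed
  have cs: "c s = 1" using s by (simp add: c_def)
  have suppc: "supp c = supp c1" using s by (auto simp: supp_def c_def)
  have c_central: "c i * r = r * c i" if i: "i < n" for i r
  proof (rule ccontr)
    assume ne: "c i * r \<noteq> r * c i"
    define e where "e = (\<lambda>i. c i * r - r * c i)"
    have "(\<Sum>i<n. e i * d * x ^ i) = 0" for d
    proof -
      have "(\<Sum>i<n. e i * d * x ^ i) = (\<Sum>i<n. c i * (r * d) * x ^ i) - r * (\<Sum>i<n. c i * d * x ^ i)"
        by (simp add: e_def left_diff_distrib sum_subtractf sum_distrib_left mult.assoc)
      then show ?thesis using Solc by (simp add: Sol_def)
    qed
    then have "Sol e" by (simp add: Sol_def)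
    moreover have "i \<in> supp e" using i ne by (simp add: supp_def e_def)
    ultimately have "P e" unfolding P_def by blast
    have "card (supp c1) \<le> card (supp e)" by (rule mp[OF spec[OF c1(2)] \<open>P e\<close>])
    moreover have "supp e \<subset> supp c"
    proof
      show "supp e \<subseteq> supp c"
      proof
        fix i assume "i \<in> supp e"
        then have "i < n" "e i \<noteq> 0" by (simp_all add: supp_def)
        moreover have "c i \<noteq> 0"
        proof
          assume "c i = 0"
          then have "e i = 0" by (simp add: e_def)
          with \<open>e i \<noteq> 0\<close> show False ..
        qed
        ultimately show "i \<in> supp c" by (simp add: supp_def)
      qed
      have "s \<in> supp c" "s \<notin> supp e" using cs s(1) by (simp_all add: supp_def e_def)
      then show "supp e \<noteq> supp c" by blast
    qed
    then have "card (supp e) < card (supp c)" by (rule psubset_card_mono[rotated]) (simp add: supp_def)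
    ultimately show False using suppc by simp
  qed
  have "\<not> (\<forall>i<n. c i = 0)" using cs s(1) by auto
  from top_nonzero[OF this] obtain j where j: "j < n" "c j \<noteq> 0" "\<forall>i. j < i \<longrightarrow> i < n \<longrightarrow> c i = 0" by blast
  have "(\<Sum>i<n. c i * 1 * x ^ i) = 0" using Solc unfolding Sol_def by blast
  moreover have "(\<Sum>i<Suc j. c i * 1 * x ^ i) = (\<Sum>i<n. c i * 1 * x ^ i)"
    by (rule sum.mono_neutral_left) (use j in auto)
  ultimately have "(\<Sum>i<j. c i * x ^ i) + c j * x ^ j = 0" by simp
  then have e: "c j * x ^ j = - (\<Sum>i<j. c i * x ^ i)" by (simp add: eq_neg_iff_add_eq_0 add.commute)
  define b where "b = (\<lambda>i. - (inverse (c j) * c i))"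
  have inv_central: "inverse (c j) * r = r * inverse (c j)" for r
  proof -
    have "inverse (c j) * r = inverse (c j) * (r * c j) * inverse (c j)" using j(2) by (simp add: mult.assoc)
    also have "\<dots> = inverse (c j) * (c j * r) * inverse (c j)" using c_central[OF j(1), of r] by simp
    also have "\<dots> = r * inverse (c j)" using j(2) by (simp add: mult.assoc[symmetric])
    finally show ?thesis .
  qed
  have b_central: "b i * r = r * b i" if "i < j" for i r
  proof -
    have "inverse (c j) * c i * r = inverse (c j) * (r * c i)" using c_central[of i r] that j(1) by (simp add: mult.assoc)
    also have "\<dots> = inverse (c j) * r * c i" by (simp add: mult.assoc)
    also have "\<dots> = r * (inverse (c j) * c i)" by (simp only: inv_central[of r] mult.assoc)
    finally show ?thesis by (simp add: b_def)
  qed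
  have "x ^ j = inverse (c j) * (c j * x ^ j)" using j(2) by (simp add: mult.assoc[symmetric])
  also have "\<dots> = (\<Sum>i<j. b i * x ^ i)" unfolding e by (simp add: b_def sum_distrib_left sum_negf mult.assoc)
  also have "\<dots> = (\<Sum>i<j. x ^ i * b i)" by (rule sum.cong) (use b_central in auto)
  finally have rel: "x ^ j = (\<Sum>i<j. x ^ i * b i)" .
  have "\<exists>Y. finite Y \<and> b ` {..<j} \<subseteq> rspan F Y \<and> 1 \<in> rspan F Y \<and> (\<forall>b\<in>rspan F Y. \<forall>b'\<in>rspan F Y. b * b' \<in> rspan F Y)"
  proof (rule finite_dimensional_subring[OF central])
    fix z assume "z \<in> b ` {..<j}"
    then have "\<forall>d. z * d = d * z" using b_central by auto
    then show "(\<forall>d. z * d = d * z) \<and> \<not> transc F z" using no by blast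
  qed (assumption, rule finite_imageI[OF finite_lessThan])
  then obtain Y where Y: "finite Y" "b ` {..<j} \<subseteq> rspan F Y" "1 \<in> rspan F Y" "\<forall>b\<in>rspan F Y. \<forall>b'\<in>rspan F Y. b * b' \<in> rspan F Y"
    by (elim exE conjE)
  have "\<not> transc F x" by (rule not_transc_of_monic[OF Y(1) _ Y(3) rel]) (use Y(2,4) in auto)
  then show False using x by simp
qed

end

section \<open>Bimodules over a field of fractions\<close>

context transcendental_ext
begin

text \<open>Nonzero polynomials in \<open>l\<close> act injectively on a finite-dimensional space and so bijectively.\<close>

lemma fracs_stable:
  assumes U: "rsubspace (fracs F l) U" "rfin (fracs F l) U" "\<And>u. u \<in> U \<Longrightarrow> l * u \<in> U"
    and central: "\<And>c d. c \<in> F \<Longrightarrow> c * d = d * c" and k: "k \<in> fracs F l" and u: "u \<in> U"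
  shows "k * u \<in> U"
proof -
  interpret K: division_subring "fracs F l" by (rule division_subring_fracs)
  have pow: "l ^ i * u \<in> U" if "u \<in> U" for u i
    using that by (induction i) (auto simp: mult.assoc U(3))
  have poly: "p * u \<in> U" if p: "p \<in> polys F l" and u: "u \<in> U" for p u
  proof -
    from p obtain n where "p \<in> polyb F l n" by (rule polys_cases)
    then obtain c where c: "\<forall>i. c i \<in> F" "p = (\<Sum>i<n. l ^ i * c i)" by (auto simp: polyb_iff)
    have "p * u = (\<Sum>i<n. l ^ i * u * c i)" unfolding c(2) sum_distrib_right
      by (rule sum.cong[OF refl]) (use central[of _ u] c(1) in \<open>simp add: mult.assoc\<close>)
    also have "\<dots> \<in> U"
      by (rule rsubspace_sum[OF U(1)], rule rsubspace_scale[OF U(1)]) (use pow u const_fracs c(1) in auto)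
    finally show ?thesis .
  qed
  from k obtain q where q: "q \<in> polys F l" "q \<noteq> 0" "k * q \<in> polys F l" by (auto simp: fracs_def)
  have sub: "(*) q ` U \<subseteq> U" using poly[OF q(1)] by blast
  note lm = K.lmult_image[OF U(2,1) q(2)]
  have "(*) q ` U = U" by (rule K.rdim_eq_imp_eq[OF U(2) lm(3) sub eq_refl[OF lm(1)[symmetric]]])
  with u obtain u' where "u' \<in> U" "u = q * u'" by blast
  then show ?thesis using poly[OF q(3)] by (simp add: mult.assoc[symmetric])
qed

end

context filtered_growth
begin

text \<open>The elements acting on the stable subspace \<open>T\<close> from the right form a ring, which embeds in \<open>T\<close>
  through its action on one vector.\<close>

lemma locally_finite_ring:
  assumes x: "transc Z x" and inf: "\<not> rfin (centralizer {x}) UNIV" and S: "finite S" "S \<subseteq> centralizer {x}"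
  shows "\<exists>Y. finite Y \<and> Y \<subseteq> centralizer {x} \<and> S \<subseteq> rspan (fracs Z x) Y \<and> 1 \<in> rspan (fracs Z x) Y \<and>
    (\<forall>b\<in>rspan (fracs Z x) Y. \<forall>b'\<in>rspan (fracs Z x) Y. b * b' \<in> rspan (fracs Z x) Y)"
proof -
  let ?K = "fracs Z x" and ?E = "centralizer {x}"
  interpret te: transcendental_ext Z x by (rule transcendental_ext_Z[OF x])
  interpret K: division_subring ?K by (rule te.division_subring_fracs)
  interpret E: division_subring ?E by (rule division_subring_centralizer)
  have ZE: "Z \<subseteq> ?E" using central by (auto simp: centralizer_def)
  have KE: "?K \<subseteq> ?E" by (rule polys_subset(2)[OF division_subring_centralizer ZE]) (simp add: centralizer_def)
  from centralizer_locally_finite[OF x inf S] obtain T where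
    T: "T \<subseteq> ?E" "rsubspace ?K T" "rfin ?K T" "\<not> T \<subseteq> {0}" "\<forall>t\<in>T. \<forall>s\<in>S. t * s \<in> T" by (elim exE conjE)
  from T(4) obtain t where t: "t \<in> T" "t \<noteq> 0" by blast
  define B where "B = {e \<in> ?E. \<forall>t\<in>T. t * e \<in> T}"
  have subB: "rsubspace ?K B"
  proof (rule rsubspaceI)
    fix u c assume u: "u \<in> B" and c: "c \<in> ?K"
    then have "t * u * c \<in> T" if "t \<in> T" for t using rsubspace_scale[OF T(2)] that by (auto simp: B_def)
    then show "u * c \<in> B" using u c KE E.mult_mem by (auto simp: B_def mult.assoc)
  qed (use rsubspace_0[OF T(2)] rsubspace_add[OF T(2)] E.zero_mem E.add_mem in \<open>auto simp: B_def distrib_left\<close>)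
  have "B \<subseteq> (*) (inverse t) ` T"
  proof
    fix b assume "b \<in> B"
    then have "t * b \<in> T" using t(1) by (simp add: B_def)
    moreover have "b = inverse t * (t * b)" using t(2) by (simp add: mult.assoc[symmetric])
    ultimately show "b \<in> (*) (inverse t) ` T" by blast
  qed
  moreover have "inverse t \<noteq> 0" using t(2) by simp
  ultimately have finB: "rfin ?K B" using K.rfin_subset[OF K.lmult_image(2)[OF T(3,2)]] by blast
  from K.rbasis[OF finB subB] obtain Y where Y: "Y \<subseteq> B" "rindep ?K Y" "B = rspan ?K Y" by metis
  have "b * b' \<in> B" if b: "b \<in> B" "b' \<in> B" for b b'
  proof -
    have "t * (b * b') \<in> T" if "t \<in> T" for t
    proof -
      have "t * b \<in> T" using b(1) that by (simp add: B_def)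
      then have "t * b * b' \<in> T" using b(2) by (simp add: B_def)
      then show ?thesis by (simp add: mult.assoc)
    qed
    then show ?thesis using b E.mult_mem by (simp add: B_def)
  qed
  moreover have "1 \<in> B" "S \<subseteq> B" using E.one_mem S(2) T(5) by (auto simp: B_def)
  moreover have "Y \<subseteq> ?E" using Y(1) by (auto simp: B_def)
  ultimately show ?thesis using K.rindep_finite[OF Y(2)] unfolding Y(3) by blast
qed

lemma algebraic_over_fracs:
  assumes x: "transc Z x" and inf: "\<not> rfin (centralizer {x}) UNIV"
    and alg: "\<And>a. \<not> transc (centralizer {x}) a \<or> \<not> left_transc (centralizer {x}) a"
  shows "\<not> transc (fracs Z x) a \<or> \<not> left_transc (fracs Z x) a"
proof -
  let ?K = "fracs Z x" and ?E = "centralizer {x}"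
  interpret te: transcendental_ext Z x by (rule transcendental_ext_Z[OF x])
  interpret K: division_subring ?K by (rule te.division_subring_fracs)
  interpret E: division_subring ?E by (rule division_subring_centralizer)
  from alg show ?thesis
  proof
    assume "\<not> transc ?E a"
    from E.monic_relation[OF this] obtain n e where e: "\<forall>i<n. e i \<in> ?E" "a ^ n = (\<Sum>i<n. a ^ i * e i)" by (elim exE conjE)
    have "e ` {..<n} \<subseteq> ?E" using e(1) by blast
    from locally_finite_ring[OF x inf _ this] obtain Y where
      Y: "finite Y" "e ` {..<n} \<subseteq> rspan ?K Y" "1 \<in> rspan ?K Y" "\<forall>b\<in>rspan ?K Y. \<forall>b'\<in>rspan ?K Y. b * b' \<in> rspan ?K Y" by auto
    have "\<not> transc ?K a" by (rule K.not_transc_of_monic[OF Y(1) _ Y(3) e(2)]) (use Y(2,4) in auto)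
    then show ?thesis ..
  next
    assume "\<not> left_transc ?E a"
    from E.left_monic_relation[OF this] obtain n e where e: "\<forall>i<n. e i \<in> ?E" "a ^ n = (\<Sum>i<n. e i * a ^ i)" by (elim exE conjE)
    have "e ` {..<n} \<subseteq> ?E" using e(1) by blast
    from locally_finite_ring[OF x inf _ this] obtain Y where
      Y: "finite Y" "Y \<subseteq> ?E" "e ` {..<n} \<subseteq> rspan ?K Y" "1 \<in> rspan ?K Y" "\<forall>b\<in>rspan ?K Y. \<forall>b'\<in>rspan ?K Y. b * b' \<in> rspan ?K Y" by auto
    have comm: "c * y = y * c" if "c \<in> ?K" "y \<in> Y" for c y
    proof -
      have 1: "Z \<subseteq> centralizer {y}" using central by (auto simp: centralizer_def)
      have 2: "x \<in> centralizer {y}" using that(2) Y(2) by (auto simp: centralizer_def)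
      show ?thesis using te.fracs_centralizer[OF 1 2] that(1) by (auto simp: centralizer_def)
    qed
    have "\<not> left_transc ?K a" by (rule K.not_left_transc_of_monic[OF Y(1) comm _ Y(4) e(2)]) (use Y(3,5) in auto)
    then show ?thesis ..
  qed
qed

text \<open>These are the elements generating a bimodule over \<open>Z(x)\<close> of finite right dimension. They turn out
  to be all of \<open>D\<close>.\<close>

definition bifinite :: "'d \<Rightarrow> 'd \<Rightarrow> bool" where
  "bifinite x a \<longleftrightarrow> (\<exists>U. rsubspace (fracs Z x) U \<and> rfin (fracs Z x) U \<and> a \<in> U \<and> (\<forall>u\<in>U. x * u \<in> U))"

lemma bifinite_simultaneous:
  assumes x: "transc Z x" and S: "finite S" "\<And>s. s \<in> S \<Longrightarrow> bifinite x s"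
  shows "\<exists>U. rsubspace (fracs Z x) U \<and> rfin (fracs Z x) U \<and> S \<subseteq> U \<and> (\<forall>u\<in>U. x * u \<in> U)"
  using S
proof (induction S rule: finite_induct)
  case empty
  have "rfin (fracs Z x) {0}" unfolding rfin_def by (intro exI[of _ "{0}"]) (auto intro: rspan_base)
  then show ?case using rsubspace_zero by (intro exI[of _ "{0}"]) simp
next
  case (insert s S)
  interpret te: transcendental_ext Z x by (rule transcendental_ext_Z[OF x])
  interpret K: division_subring "fracs Z x" by (rule te.division_subring_fracs)
  from insert.IH insert.prems obtain U where
    U: "rsubspace (fracs Z x) U" "rfin (fracs Z x) U" "S \<subseteq> U" "\<forall>u\<in>U. x * u \<in> U" by (metis insertCI)
  from insert.prems[of s] obtain W where
    W: "rsubspace (fracs Z x) W" "rfin (fracs Z x) W" "s \<in> W" "\<forall>u\<in>W. x * u \<in> W" unfolding bifinite_def by auto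
  have "x * u \<in> K.ssum U W" if "u \<in> K.ssum U W" for u
    using that U(4) W(4) by (force simp: K.ssum_def distrib_left)
  then show ?case using K.rsubspace_ssum[OF U(1) W(1)] K.rfin_ssum[OF U(2) W(2)] K.ssum_superset[OF U(1) W(1)] U(3) W(3)
    by (intro exI[of _ "K.ssum U W"]) auto
qed

lemma bifinite_add:
  assumes "transc Z x" "bifinite x a" "bifinite x b" shows "bifinite x (a + b)"
proof -
  have "\<exists>U. rsubspace (fracs Z x) U \<and> rfin (fracs Z x) U \<and> {a, b} \<subseteq> U \<and> (\<forall>u\<in>U. x * u \<in> U)"
    by (rule bifinite_simultaneous[OF assms(1)]) (use assms in auto)
  then obtain U where U: "rsubspace (fracs Z x) U" "rfin (fracs Z x) U" "{a, b} \<subseteq> U" "\<forall>u\<in>U. x * u \<in> U" by (elim exE conjE)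
  then show ?thesis unfolding bifinite_def using rsubspace_add[OF U(1)] by (intro exI[of _ U]) auto
qed

text \<open>Stability of the second space moves coefficients of the first one across.\<close>

lemma bifinite_mult:
  assumes x: "transc Z x" and "bifinite x a" "bifinite x b" shows "bifinite x (a * b)"
proof -
  let ?K = "fracs Z x"
  interpret te: transcendental_ext Z x by (rule transcendental_ext_Z[OF x])
  interpret K: division_subring ?K by (rule te.division_subring_fracs)
  from assms(2) obtain U where U: "rsubspace ?K U" "rfin ?K U" "a \<in> U" "\<forall>u\<in>U. x * u \<in> U" unfolding bifinite_def by (elim exE conjE)
  from assms(3) obtain W where W: "rsubspace ?K W" "rfin ?K W" "b \<in> W" "\<forall>u\<in>W. x * u \<in> W" unfolding bifinite_def by (elim exE conjE)
  from U(2) obtain Y where Y: "finite Y" "U \<subseteq> rspan ?K Y" by (auto simp: rfin_def)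
  from W(2) obtain Y' where Y': "finite Y'" "W \<subseteq> rspan ?K Y'" by (auto simp: rfin_def)
  let ?G = "(\<lambda>(y, y'). y * y') ` (Y \<times> Y')"
  have WK: "k * w \<in> W" if "k \<in> ?K" "w \<in> W" for k w
    by (rule te.fracs_stable[OF W(1,2) _ central that]) (use W(4) in blast)
  have yW: "y * w \<in> rspan ?K ?G" if "y \<in> Y" "w \<in> W" for y w
  proof -
    have "rspan ?K Y' \<subseteq> {w. y * w \<in> rspan ?K ?G}"
      by (rule rspan_minimal[OF rsubspace_lmult_preimage[OF rsubspace_rspan]])
        (use that(1) in \<open>auto intro!: rspan_base\<close>)
    then show ?thesis using Y'(2) that(2) by blast
  qed
  have sub: "rsubspace ?K {u. \<forall>w\<in>W. u * w \<in> rspan ?K ?G}"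
  proof (rule rsubspaceI)
    fix u c assume u: "u \<in> {u. \<forall>w\<in>W. u * w \<in> rspan ?K ?G}" and c: "c \<in> ?K"
    have "u * c * w \<in> rspan ?K ?G" if "w \<in> W" for w
      using u WK[OF c that] by (simp add: mult.assoc)
    then show "u * c \<in> {u. \<forall>w\<in>W. u * w \<in> rspan ?K ?G}" by blast
  qed (auto simp: distrib_right rsubspace_0[OF rsubspace_rspan] intro: rsubspace_add[OF rsubspace_rspan])
  have "rspan ?K Y \<subseteq> {u. \<forall>w\<in>W. u * w \<in> rspan ?K ?G}"
    by (rule rspan_minimal[OF sub]) (use yW in blast)
  then have "prodspan ?K U W \<subseteq> rspan ?K ?G"
    by (intro prodspan_minimal[OF rsubspace_rspan]) (use Y(2) in blast)
  moreover have "finite ?G" using Y(1) Y'(1) by simp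
  ultimately have fin: "rfin ?K (prodspan ?K U W)" unfolding rfin_def by blast
  have "prodspan ?K U W \<subseteq> {u. x * u \<in> prodspan ?K U W}"
  proof (rule prodspan_minimal[OF rsubspace_lmult_preimage[OF rsubspace_prodspan]])
    fix u w assume "u \<in> U" "w \<in> W"
    then have "x * u * w \<in> prodspan ?K U W" using U(4) by (intro prodspanI) auto
    then show "u * w \<in> {u. x * u \<in> prodspan ?K U W}" by (simp add: mult.assoc)
  qed
  with fin show ?thesis unfolding bifinite_def
    using rsubspace_prodspan prodspanI[OF U(3) W(3)] by (intro exI[of _ "prodspan ?K U W"]) auto
qed

lemma bifinite_fracs:
  assumes x: "transc Z x" and k: "k \<in> fracs Z x" shows "bifinite x k"
proof -
  interpret te: transcendental_ext Z x by (rule transcendental_ext_Z[OF x])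
  interpret K: division_subring "fracs Z x" by (rule te.division_subring_fracs)
  have "fracs Z x \<subseteq> rspan (fracs Z x) {1}"
  proof
    fix c assume "c \<in> fracs Z x"
    from rsubspace_scale[OF rsubspace_rspan rspan_base this, of 1 "{1}"] show "c \<in> rspan (fracs Z x) {1}" by simp
  qed
  then have "rfin (fracs Z x) (fracs Z x)" unfolding rfin_def by blast
  then show ?thesis unfolding bifinite_def
    using K.rsubspace_self K.mult_mem[OF te.var_fracs] k by (intro exI[of _ "fracs Z x"]) auto
qed

lemma bifinite_sum:
  assumes x: "transc Z x" and "\<And>i. i \<in> I \<Longrightarrow> bifinite x (f i)" shows "bifinite x (\<Sum>i\<in>I. f i)"
proof -
  interpret te: transcendental_ext Z x by (rule transcendental_ext_Z[OF x])
  interpret K: division_subring "fracs Z x" by (rule te.division_subring_fracs)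
  show ?thesis using assms(2)
    by (induction I rule: infinite_finite_induct) (auto intro: bifinite_fracs[OF x] K.zero_mem bifinite_add[OF x])
qed

lemma bifinite_power:
  assumes x: "transc Z x" and "bifinite x a" shows "bifinite x (a ^ n)"
proof -
  interpret te: transcendental_ext Z x by (rule transcendental_ext_Z[OF x])
  interpret K: division_subring "fracs Z x" by (rule te.division_subring_fracs)
  show ?thesis by (induction n) (auto intro: bifinite_fracs[OF x] K.one_mem bifinite_mult[OF x] assms(2))
qed

lemma bifinite_of_relation:
  assumes x: "transc Z x" and q: "\<forall>i<n. q i \<in> fracs Z x" "(\<Sum>i<n. x ^ i * p * q i) = 0" "\<not> (\<forall>i<n. q i = 0)"
  shows "bifinite x p"
proof -
  let ?K = "fracs Z x"
  interpret te: transcendental_ext Z x by (rule transcendental_ext_Z[OF x])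
  interpret K: division_subring ?K by (rule te.division_subring_fracs)
  from top_nonzero[OF q(3)] obtain j where j: "j < n" "q j \<noteq> 0" "\<forall>i. j < i \<longrightarrow> i < n \<longrightarrow> q i = 0" by blast
  have "(\<Sum>i<Suc j. x ^ i * p * q i) = (\<Sum>i<n. x ^ i * p * q i)"
    by (rule sum.mono_neutral_left) (use j in auto)
  then have "(\<Sum>i<j. x ^ i * p * q i) + x ^ j * p * q j = 0" using q(2) by simp
  then have e: "x ^ j * p * q j = - (\<Sum>i<j. x ^ i * p * q i)" by (simp add: eq_neg_iff_add_eq_0 add.commute)
  let ?U = "rspan ?K ((\<lambda>i. x ^ i * p) ` {..<j})"
  have base: "x ^ i * p \<in> ?U" if "i < j" for i using that by (intro rspan_base) auto
  have "(\<Sum>i<j. x ^ i * p * q i) \<in> ?U"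
    by (rule rsubspace_sum[OF rsubspace_rspan], rule rsubspace_scale[OF rsubspace_rspan base]) (use q(1) j(1) in auto)
  then have "x ^ j * p * q j \<in> ?U" unfolding e by (rule K.rsubspace_uminus[OF rsubspace_rspan])
  then have "x ^ j * p * q j * inverse (q j) \<in> ?U"
    by (rule rsubspace_scale[OF rsubspace_rspan]) (use K.inverse_mem q(1) j(1) in blast)
  then have top: "x ^ j * p \<in> ?U" using j(2) by (simp add: mult.assoc)
  have "x * (x ^ i * p) \<in> ?U" if "i < j" for i
  proof -
    have "x ^ Suc i * p \<in> ?U"
    proof (cases "Suc i = j")
      case True
      with top show ?thesis by (simp only:)
    next
      case False
      then show ?thesis using that by (intro base) simp
    qed
    then show ?thesis by (simp add: mult.assoc)
  qed
  then have "?U \<subseteq> {u. x * u \<in> ?U}"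
    by (intro rspan_minimal[OF rsubspace_lmult_preimage[OF rsubspace_rspan]]) auto
  moreover have "p \<in> ?U" using base[of 0] top by (cases "j = 0") auto
  moreover have "rfin ?K ?U" by (rule K.rfin_rspan) simp
  ultimately show ?thesis unfolding bifinite_def using rsubspace_rspan by (intro exI[of _ ?U]) blast
qed

text \<open>A relation for the conjugate \<open>a\<^sup>-\<^sup>1 x a\<close> with coefficients on either side is, up to clearing
  denominators, a relation for \<open>a\<close> or \<open>a\<^sup>-\<^sup>1\<close> between \<open>x\<close> acting on both sides.\<close>

lemma bifinite_or_inverse:
  assumes x: "transc Z x" and a: "a \<noteq> 0"
    and alg: "\<not> transc (fracs Z x) (inverse a * x * a) \<or> \<not> left_transc (fracs Z x) (inverse a * x * a)"
  shows "bifinite x a \<or> bifinite x (inverse a)"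
proof -
  let ?K = "fracs Z x" and ?b = "inverse a * x * a"
  interpret te: transcendental_ext Z x by (rule transcendental_ext_Z[OF x])
  interpret K: division_subring ?K by (rule te.division_subring_fracs)
  have pow: "?b ^ i = inverse a * x ^ i * a" for i
  proof (induction i)
    case (Suc i)
    have "?b ^ Suc i = ?b * (inverse a * x ^ i * a)" by (simp only: power_Suc Suc)
    also have "\<dots> = inverse a * x * (a * inverse a) * x ^ i * a" by (simp only: mult.assoc)
    also have "\<dots> = inverse a * x ^ Suc i * a" using a by (simp add: mult.assoc)
    finally show ?case .
  qed (use a in simp)
  from alg show ?thesis
  proof
    assume "\<not> transc ?K ?b"
    from not_transcE[OF this] obtain n k where
      k: "\<forall>i<n. k i \<in> ?K" "(\<Sum>i<n. ?b ^ i * k i) = 0" "\<not> (\<forall>i<n. k i = 0)" by (elim exE conjE)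
    have "(\<Sum>i<n. x ^ i * a * k i) = a * (\<Sum>i<n. ?b ^ i * k i)"
      unfolding sum_distrib_left pow
    proof (rule sum.cong[OF refl])
      fix i
      have "a * (inverse a * x ^ i * a * k i) = (a * inverse a) * (x ^ i * a * k i)" by (simp only: mult.assoc)
      then show "x ^ i * a * k i = a * (inverse a * x ^ i * a * k i)" using a by simp
    qed
    then have "(\<Sum>i<n. x ^ i * a * k i) = 0" using k(2) by simp
    from bifinite_of_relation[OF x k(1) this k(3)] show ?thesis ..
  next
    assume "\<not> left_transc ?K ?b"
    from not_left_transcE[OF this] obtain n k where
      k: "\<forall>i<n. k i \<in> ?K" "(\<Sum>i<n. k i * ?b ^ i) = 0" "\<not> (\<forall>i<n. k i = 0)" by (elim exE conjE)
    let ?p = "inverse a"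
    have "(\<Sum>i<n. k i * ?b ^ i) * ?p = (\<Sum>i<n. k i * ?p * x ^ i)"
      unfolding sum_distrib_right pow
    proof (rule sum.cong[OF refl])
      fix i
      have "k i * (?p * x ^ i * a) * ?p = k i * ?p * x ^ i * (a * ?p)" by (simp only: mult.assoc)
      then show "k i * (?p * x ^ i * a) * ?p = k i * ?p * x ^ i" using a by simp
    qed
    then have rel: "(\<Sum>i<n. k i * ?p * x ^ i) = 0" using k(2) by simp
    have "\<exists>q\<in>polys Z x. q \<noteq> 0 \<and> (\<forall>i\<in>{..<n}. k i * q \<in> polys Z x)"
      by (rule te.common_denominator) (use k(1) in auto)
    then obtain q where q: "q \<in> polys Z x" "q \<noteq> 0" "\<forall>i<n. k i * q \<in> polys Z x" by auto
    then have "\<forall>i. \<exists>m. i < n \<longrightarrow> k i * q \<in> polyb Z x m" by (auto simp: polys_def)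
    then obtain m where m: "\<And>i. i < n \<Longrightarrow> k i * q \<in> polyb Z x (m i)" by metis
    define M where "M = Max (insert 0 (m ` {..<n}))"
    have "k i * q \<in> polyb Z x M" if "i < n" for i
    proof -
      have "m i \<le> M" unfolding M_def using that by (intro Max_ge) auto
      then show ?thesis using m[OF that] polyb_mono[of "m i" M Z x] by blast
    qed
    then have "\<forall>i. \<exists>c. i < n \<longrightarrow> (\<forall>j. c j \<in> Z) \<and> k i * q = (\<Sum>j<M. x ^ j * c j)" by (auto simp: polyb_iff)
    then obtain z where z: "\<And>i. i < n \<Longrightarrow> (\<forall>j. z i j \<in> Z) \<and> k i * q = (\<Sum>j<M. x ^ j * z i j)" by metis
    have qK: "q \<in> ?K" by (rule te.polys_fracs[OF q(1)])
    have comm: "q * k i = k i * q" if "i < n" for i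
      using te.fracs_commutative[OF Z_comm] qK k(1) that by (auto simp: centralizer_def)
    define r where "r = (\<lambda>j. \<Sum>i<n. x ^ i * z i j)"
    have rK: "\<forall>j<M. r j \<in> ?K"
      using z by (auto simp: r_def intro!: te.polys_fracs subsetD[OF polyb_subset_polys polybI])
    have "(\<Sum>j<M. x ^ j * ?p * r j) = (\<Sum>j<M. \<Sum>i<n. x ^ j * z i j * ?p * x ^ i)"
      unfolding r_def sum_distrib_left
    proof (intro sum.cong refl)
      fix j i assume "i \<in> {..<n}"
      then have zc: "\<And>d. z i j * d = d * z i j" using z central by simp
      have "x ^ j * z i j * ?p * x ^ i = x ^ j * (z i j * (?p * x ^ i))" by (simp only: mult.assoc)
      also have "\<dots> = x ^ j * (?p * x ^ i * z i j)" by (simp only: zc)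
      finally show "x ^ j * ?p * (x ^ i * z i j) = x ^ j * z i j * ?p * x ^ i" by (simp only: mult.assoc)
    qed
    also have "\<dots> = (\<Sum>i<n. \<Sum>j<M. x ^ j * z i j * ?p * x ^ i)" by (rule sum.swap)
    also have "\<dots> = (\<Sum>i<n. q * (k i * ?p * x ^ i))"
    proof (rule sum.cong[OF refl])
      fix i assume "i \<in> {..<n}"
      then have i: "i < n" by simp
      have "(\<Sum>j<M. x ^ j * z i j * ?p * x ^ i) = k i * q * ?p * x ^ i"
        using z[OF i] by (simp add: sum_distrib_right)
      then show "(\<Sum>j<M. x ^ j * z i j * ?p * x ^ i) = q * (k i * ?p * x ^ i)"
        using comm[OF i] by (simp add: mult.assoc[symmetric])
    qed
    also have "\<dots> = 0" using rel by (simp add: sum_distrib_left[symmetric])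
    finally have r0: "(\<Sum>j<M. x ^ j * ?p * r j) = 0" .
    have "\<not> (\<forall>j<M. r j = 0)"
    proof
      assume all0: "\<forall>j<M. r j = 0"
      have "k i = 0" if i: "i < n" for i
      proof -
        have "z i j = 0" if j: "j < M" for j
        proof (rule transcD[OF x _ _ i, of "\<lambda>i. z i j"])
          show "(\<Sum>i<n. x ^ i * z i j) = 0" using all0 j by (simp add: r_def)
        qed (use z in blast)
        then have "k i * q = 0" using z[OF i] by simp
        then show ?thesis using q(2) by simp
      qed
      with k(3) show False by blast
    qed
    from bifinite_of_relation[OF x rK r0 this] show ?thesis ..
  qed
qed

text \<open>The bifinite elements form a ring containing \<open>Z(x)\<close>. When \<open>a\<^sup>-\<^sup>1\<close> is bifinite, a monic relation for
  \<open>a\<close>, multiplied by a power of \<open>a\<^sup>-\<^sup>1\<close>, expresses \<open>a\<close> in this ring.\<close>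

lemma bifinite_all:
  assumes x: "transc Z x" and alg: "\<And>a. \<not> transc (fracs Z x) a \<or> \<not> left_transc (fracs Z x) a"
  shows "bifinite x a"
proof (cases "a = 0")
  case True
  interpret te: transcendental_ext Z x by (rule transcendental_ext_Z[OF x])
  interpret K: division_subring "fracs Z x" by (rule te.division_subring_fracs)
  show ?thesis using True bifinite_fracs[OF x K.zero_mem] by simp
next
  case a0: False
  interpret te: transcendental_ext Z x by (rule transcendental_ext_Z[OF x])
  interpret K: division_subring "fracs Z x" by (rule te.division_subring_fracs)
  have "bifinite x a" if inv: "bifinite x (inverse a)"
  proof -
    have red: "inverse a ^ n' * a ^ n' = 1" "a ^ n' * inverse a ^ n' = 1" for n'
      using a0 by (simp_all add: power_inverse)
    have low: "inverse a ^ n * a ^ i = inverse a ^ (n - i)" "a ^ i * inverse a ^ n = inverse a ^ (n - i)" if "i \<le> n" for i n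
    proof -
      have "inverse a ^ n = inverse a ^ (n - i) * inverse a ^ i" "inverse a ^ n = inverse a ^ i * inverse a ^ (n - i)"
        using that by (simp_all add: power_add[symmetric])
      then show "inverse a ^ n * a ^ i = inverse a ^ (n - i)" "a ^ i * inverse a ^ n = inverse a ^ (n - i)"
        using red[of i] by (metis mult.assoc mult_1_right) (metis \<open>inverse a ^ n = inverse a ^ i * inverse a ^ (n - i)\<close> red(2) mult.assoc mult_1_left)
    qed
    from alg[of a] show ?thesis
    proof
      assume "\<not> transc (fracs Z x) a"
      from K.monic_relation[OF this] obtain n c where c: "\<forall>i<n. c i \<in> fracs Z x" "a ^ n = (\<Sum>i<n. a ^ i * c i)" by (elim exE conjE)
      have n0: "n \<noteq> 0" using c(2) by (cases n) auto
      have "a = inverse a ^ (n - 1) * a ^ n"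
      proof -
        have "a ^ n = a ^ (n - 1) * a" using n0 by (metis power_minus_mult not_gr_zero)
        then show ?thesis using red(1)[of "n - 1"] by (simp add: mult.assoc[symmetric])
      qed
      also have "\<dots> = (\<Sum>i<n. inverse a ^ (n - 1) * a ^ i * c i)" unfolding c(2) by (simp add: sum_distrib_left mult.assoc)
      also have "\<dots> = (\<Sum>i<n. inverse a ^ (n - 1 - i) * c i)"
        by (rule sum.cong[OF refl]) (use low(1) in auto)
      also have "bifinite x \<dots>"
        by (intro bifinite_sum[OF x] bifinite_mult[OF x] bifinite_power[OF x inv] bifinite_fracs[OF x]) (use c(1) in auto)
      finally show ?thesis .
    next
      assume "\<not> left_transc (fracs Z x) a"
      from K.left_monic_relation[OF this] obtain n c where c: "\<forall>i<n. c i \<in> fracs Z x" "a ^ n = (\<Sum>i<n. c i * a ^ i)" by (elim exE conjE)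
      have n0: "n \<noteq> 0" using c(2) by (cases n) auto
      have "a = a ^ n * inverse a ^ (n - 1)"
      proof -
        have "a ^ n = a * a ^ (n - 1)" using n0 by (metis power_eq_if)
        then show ?thesis using red(2)[of "n - 1"] by (simp add: mult.assoc)
      qed
      also have "\<dots> = (\<Sum>i<n. c i * (a ^ i * inverse a ^ (n - 1)))" unfolding c(2) by (simp add: sum_distrib_right mult.assoc)
      also have "\<dots> = (\<Sum>i<n. c i * inverse a ^ (n - 1 - i))"
        by (rule sum.cong[OF refl]) (use low(2) in auto)
      also have "bifinite x \<dots>"
        by (intro bifinite_sum[OF x] bifinite_mult[OF x] bifinite_power[OF x inv] bifinite_fracs[OF x]) (use c(1) in auto)
      finally show ?thesis .
    qed
  qed
  then show ?thesis using bifinite_or_inverse[OF x a0 alg] by blast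
qed

text \<open>The bimodule generated by the generators \<open>s\<close> is finite-dimensional and spanned by elements \<open>x\<^sup>i s\<close>,
  which lie in the filtration. These are the letters for the gap argument over \<open>Z(x)\<close>.\<close>

lemma finite_over_centralizer:
  assumes x: "transc Z x" "x \<in> A m"
    and alg: "\<And>a. \<not> transc (centralizer {x}) a \<or> \<not> left_transc (centralizer {x}) a"
  shows "rfin (centralizer {x}) UNIV"
proof (rule ccontr)
  assume inf: "\<not> ?thesis"
  let ?K = "fracs Z x"
  interpret te: transcendental_ext Z x by (rule transcendental_ext_Z[OF x(1)])
  interpret K: division_subring ?K by (rule te.division_subring_fracs)
  have ZK: "Z \<subseteq> ?K" using te.const_fracs by blast
  have ZE: "Z \<subseteq> centralizer {x}" using central by (auto simp: centralizer_def)
  have KE: "?K \<subseteq> centralizer {x}" by (rule polys_subset(2)[OF division_subring_centralizer ZE]) (simp add: centralizer_def)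
  have infK: "\<not> rfin ?K UNIV"
  proof
    assume "rfin ?K UNIV"
    then have "rfin (centralizer {x}) UNIV" using rspan_field_mono[OF KE] unfolding rfin_def by blast
    with inf show False ..
  qed
  have algK: "\<not> transc ?K a \<or> \<not> left_transc ?K a" for a by (rule algebraic_over_fracs[OF x(1) inf alg])
  from rbasis[OF A_fin A_sub, of 1] obtain S where S: "S \<subseteq> A 1" "rindep Z S" "A 1 = rspan Z S" by metis
  have finS: "finite S" by (rule rindep_finite[OF S(2)])
  from bifinite_simultaneous[OF x(1) finS bifinite_all[OF x(1) algK]] obtain U where
    U: "rsubspace ?K U" "rfin ?K U" "S \<subseteq> U" "\<forall>u\<in>U. x * u \<in> U" by (elim exE conjE)
  define G where "G = {x ^ i * s | i s. s \<in> S}"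
  have xU: "x ^ i * u \<in> U" if "u \<in> U" for i u using that U(4) by (induction i) (auto simp: mult.assoc)
  have "G \<subseteq> U" using xU U(3) by (auto simp: G_def)
  then have finG: "rfin ?K G" by (rule K.rfin_subset[OF U(2)])
  from K.rindep_extend_basis[OF finG empty_subsetI K.rindep_empty] obtain B where
    B: "B \<subseteq> G" "rindep ?K B" "G \<subseteq> rspan ?K B" by metis
  have finB: "finite B" by (rule K.rindep_finite[OF B(2)])
  have "G \<subseteq> (\<Union>n. A n)"
  proof
    fix d assume "d \<in> G"
    then obtain i s where d: "d = x ^ i * s" "s \<in> S" by (auto simp: G_def)
    have "x ^ i \<in> A (m * i)"
    proof (induction i)
      case (Suc i)
      from A_mult[OF x(2) Suc] show ?case by simp
    qed (use one_A in simp)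
    from A_mult[OF this, of s 1] d S(1) show "d \<in> (\<Union>n. A n)" by auto
  qed
  then have "\<forall>b\<in>B. \<exists>n. b \<in> A n" using B(1) by blast
  then obtain nb where nb: "\<forall>b\<in>B. b \<in> A (nb b)" by metis
  define c where "c = Max (insert 0 (nb ` B))"
  have Bc: "B \<subseteq> A c"
  proof
    fix b assume b: "b \<in> B"
    then have "nb b \<le> c" unfolding c_def using finB by (intro Max_ge) auto
    then show "b \<in> A c" using A_le nb b by blast
  qed
  have GK: "rspan ?K B \<subseteq> {u. x * u \<in> rspan ?K B}"
  proof (rule rspan_minimal[OF rsubspace_lmult_preimage[OF rsubspace_rspan]])
    have "x * u \<in> G" if "u \<in> G" for u
    proof -
      from that obtain i s where "u = x ^ i * s" "s \<in> S" by (auto simp: G_def)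
      then have "x * u = x ^ Suc i * s" by (simp add: mult.assoc)
      then show ?thesis using \<open>s \<in> S\<close> unfolding G_def by blast
    qed
    then show "B \<subseteq> {u. x * u \<in> rspan ?K B}" using B(1,3) by blast
  qed
  have KB: "k * b \<in> rspan ?K B" if "k \<in> ?K" "b \<in> B" for k b
    by (rule te.fracs_stable[OF rsubspace_rspan K.rfin_rspan[OF finB] _ central that(1) rspan_base[OF that(2)]])
      (use GK in blast)
  have "S \<subseteq> G"
  proof
    fix s assume "s \<in> S"
    then have "x ^ 0 * s \<in> G" unfolding G_def by blast
    then show "s \<in> G" by simp
  qed
  then have "A 1 \<subseteq> rspan ?K B" unfolding S(3)
    by (intro rspan_minimal[OF rsubspace_subfield[OF rsubspace_rspan ZK]]) (use B(3) in blast)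
  from normal_power_exists[OF te.division_subring_fracs ZK infK subquadratic_over_fracs[OF x(1)] finB Bc this KB] algK
  show False by blast
qed

end

section \<open>Division rings that are finite over a commutative subfield\<close>

context filtered_growth
begin

text \<open>A stable span would be a finite-dimensional space stable under the generators.\<close>

lemma spans_grow:
  assumes H: "division_subring H" "Z \<subseteq> H" and inf: "\<not> rfin H UNIV"
  shows "j + 1 \<le> rdim H (rspan H (A j))"
proof (induction j)
  interpret H: division_subring H by fact
  have fin: "rfin H (rspan H (A n))" for n by (rule rfin_rspan_field[OF A_fin H(2)])
  have one: "1 \<in> rspan H (A n)" for n by (rule rspan_base[OF one_A'])
  case 0
  show ?case using H.rdim_pos[OF fin one, of 0] by simp
  case (Suc j)
  have sub: "rspan H (A j) \<subseteq> rspan H (A (Suc j))" by (rule rspan_mono[OF A_mono])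
  have "rdim H (rspan H (A j)) \<noteq> rdim H (rspan H (A (Suc j)))"
  proof
    assume "rdim H (rspan H (A j)) = rdim H (rspan H (A (Suc j)))"
    then have eq: "rspan H (A j) = rspan H (A (Suc j))"
      by (intro H.rdim_eq_imp_eq[OF fin rsubspace_rspan sub]) simp
    have stab: "a * u \<in> rspan H (A j)" if a: "a \<in> A 1" and u: "u \<in> rspan H (A j)" for a u
    proof -
      have "rspan H (A j) \<subseteq> {u. a * u \<in> rspan H (A (Suc j))}"
        by (rule rspan_minimal[OF rsubspace_lmult_preimage[OF rsubspace_rspan]])
          (use A_mult[OF a, of _ j] in \<open>auto intro!: rspan_base\<close>)
      then show ?thesis using u eq by blast
    qed
    from stable_imp_finite[OF H(1) fin rsubspace_rspan one _ stab H(2)] inf show False by simp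
  qed
  moreover have "rdim H (rspan H (A j)) \<le> rdim H (rspan H (A (Suc j)))" by (rule H.rdim_mono[OF fin sub])
  ultimately show ?case using Suc by simp
qed

text \<open>A second transcendental element exhausts the growth: over \<open>Z(z)\<close> it is already subquadratic,
  so no element can be transcendental over \<open>Z(z)\<close> while \<open>D\<close> is infinite over the field it generates.\<close>

lemma finite_over_commutative:
  assumes z: "transc Z z" and zc: "\<And>d. z * d = d * z"
  shows "\<exists>L :: 'd set. division_subring L \<and> L \<subseteq> centralizer L \<and> rfin L UNIV"
proof -
  let ?F = "fracs Z z"
  interpret te: transcendental_ext Z z by (rule transcendental_ext_Z[OF z])
  interpret F: division_subring ?F by (rule te.division_subring_fracs)
  have ZF: "Z \<subseteq> ?F" using te.const_fracs by blast
  have Fcomm: "?F \<subseteq> centralizer ?F" by (rule te.fracs_commutative[OF Z_comm])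
  have Fc: "k * d = d * k" if "k \<in> ?F" for k d
  proof -
    have 1: "Z \<subseteq> centralizer {d}" using central by (auto simp: centralizer_def)
    have 2: "z \<in> centralizer {d}" using zc by (simp add: centralizer_def)
    show ?thesis using te.fracs_centralizer[OF 1 2] that by (auto simp: centralizer_def)
  qed
  have finF: "rfin ?F (rspan ?F (A n))" for n by (rule rfin_rspan_field[OF A_fin ZF])
  show ?thesis
  proof (cases "rfin ?F UNIV")
    case True
    then show ?thesis using te.division_subring_fracs Fcomm by blast
  next
    case False
    from rbasis[OF A_fin A_sub, of 1] obtain B where B: "B \<subseteq> A 1" "rindep Z B" "A 1 = rspan Z B" by metis
    have A1: "A 1 \<subseteq> rspan ?F B" unfolding B(3) by (rule rspan_field_mono[OF ZF])
    have FB: "k * b \<in> rspan ?F B" if "k \<in> ?F" "b \<in> B" for k b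
      unfolding Fc[OF that(1)] by (rule rsubspace_scale[OF rsubspace_rspan rspan_base[OF that(2)] that(1)])
    from normal_power_exists[OF te.division_subring_fracs ZF False subquadratic_over_fracs[OF z] rindep_finite[OF B(2)] B(1) A1 FB]
    obtain m e where e: "e \<in> A m" "transc ?F e" by blast
    interpret te2: transcendental_ext ?F e by unfold_locales (use Fc e(2) in auto)
    let ?L = "fracs ?F e"
    have ZL: "Z \<subseteq> ?L" using ZF te2.const_fracs by blast
    have "rfin ?L UNIV"
    proof (rule ccontr)
      assume inf: "\<not> rfin ?L UNIV"
      define M where "M = Suc m"
      have M0: "0 < M" by (simp add: M_def)
      have pow: "e ^ i \<in> A (m * i)" for i
      proof (induction i)
        case (Suc i)
        from A_mult[OF e(1) Suc] show ?case by simp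
      qed (use one_A in simp)
      have fr: "j * rdim ?L (rspan ?L (A j)) \<le> rdim ?F (rspan ?F (A (M * j)))" for j
      proof (rule te2.dim_over_fracs_lower[OF _ finF])
        from A_fin obtain Y where Y: "finite Y" "A j \<subseteq> rspan Z Y" by (auto simp: rfin_def)
        then show "rfin ?L (A j)" using rspan_field_mono[OF ZL, of Y] by (auto simp: rfin_def)
        fix y i assume y: "y \<in> A j" and i: "i < j"
        have "y * e ^ i \<in> A (j + m * i)" by (rule A_mult[OF y pow])
        moreover have "j + m * i \<le> M * j" using i by (simp add: M_def)
        ultimately show "y * e ^ i \<in> rspan ?F (A (M * j))" using A_le by (intro rspan_base) blast
      qed
      have quad: "j * (j + 1) \<le> rdim ?F (rspan ?F (A (M * j)))" for j
        using fr[of j] mult_le_mono2[OF spans_grow[OF te2.division_subring_fracs ZL inf, of j], of j] by linarith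
      from subquadratic_over_fracs[OF z, of "1 / (4 * real M ^ 2)" M] M0 obtain n where
        n: "M \<le> n" "rdim ?F (rspan ?F (A n)) < 1 / (4 * real M ^ 2) * real n ^ 2" by auto
      define j where "j = n div M"
      have j: "M * j \<le> n" "n < M * (j + 1)" "1 \<le> j"
        using dividend_less_times_div[OF M0, of n] n(1) M0 by (simp_all add: j_def div_greater_zero_iff Suc_le_eq)
      have "rdim ?F (rspan ?F (A (M * j))) \<le> rdim ?F (rspan ?F (A n))"
        by (rule F.rdim_mono[OF finF rspan_mono[OF A_le[OF j(1)]]])
      with quad[of j] have "j * (j + 1) \<le> rdim ?F (rspan ?F (A n))" by linarith
      then have "real (j * (j + 1)) \<le> real (rdim ?F (rspan ?F (A n)))" by (simp only: of_nat_le_iff)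
      also have "\<dots> < real n ^ 2 / (4 * real M ^ 2)" using n(2) by simp
      also have "\<dots> \<le> real (M * (j + 1)) ^ 2 / (4 * real M ^ 2)"
        using j(2) by (intro divide_right_mono power_mono) (simp_all del: of_nat_mult)
      also have "\<dots> = real (j + 1) ^ 2 / 4" unfolding of_nat_mult power_mult_distrib using M0 by simp
      also have "\<dots> = (real j + 1) * (real j + 1) / 4" by (simp add: power2_eq_square add.commute)
      finally have "real j * (real j + 1) < (real j + 1) * (real j + 1) / 4" by (simp add: distrib_left add.commute)
      then have "(real j + 1) * (4 * real j) < (real j + 1) * (real j + 1)" by (simp add: algebra_simps)
      then have "4 * real j < real j + 1" by (simp only: mult_less_cancel_left_pos[of "real j + 1"])
      then show False using j(3) by simp
    qed
    then show ?thesis using te2.division_subring_fracs te2.fracs_commutative[OF Fcomm] by blast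
  qed
qed

end

section \<open>The standard identity\<close>

definition standard_sum :: "nat \<Rightarrow> (nat \<Rightarrow> 'a::ring_1) \<Rightarrow> 'a" where
  "standard_sum N a = (\<Sum>\<pi> | \<pi> permutes {..<N}. of_int (sign \<pi>) * prod_list (map a (map \<pi> [0..<N])))"

text \<open>Even and odd permutations are paired by composition with a transposition. The pairing avoids
  division by two, so it works in every characteristic.\<close>

lemma standard_sum_alternating:
  fixes a :: "nat \<Rightarrow> 'a::ring_1"
  assumes st: "s < N" "t < N" "s \<noteq> t" "a s = a t"
  shows "standard_sum N a = 0"
proof -
  let ?P = "{\<pi>. \<pi> permutes {..<N}}" and ?t = "Transposition.transpose s t"
  define Q where "Q = (\<lambda>\<pi>. prod_list (map a (map \<pi> [0..<N])))"
  have fin: "finite ?P" by (rule finite_permutations) simp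
  have tp: "?t permutes {..<N}" by (rule permutes_swap_id) (use st in auto)
  have at: "a (?t i) = a i" for i using st(4) by (simp add: Transposition.transpose_def)
  have Qt: "Q (?t \<circ> \<pi>) = Q \<pi>" for \<pi> by (simp add: Q_def at comp_def)
  have ev: "evenperm (?t \<circ> \<pi>) \<longleftrightarrow> \<not> evenperm \<pi>" if "\<pi> permutes {..<N}" for \<pi>
  proof -
    have "permutation \<pi>" "permutation ?t" using that tp permutes_imp_permutation[of "{..<N}"] by auto
    then show ?thesis using evenperm_comp[of ?t \<pi>] evenperm_swap[of s t] st(3) by simp
  qed
  have tt: "?t \<circ> (?t \<circ> \<pi>) = \<pi>" for \<pi> by (simp add: o_assoc)
  have "(\<Sum>\<pi> | \<pi> \<in> ?P \<and> evenperm \<pi>. Q \<pi>) = (\<Sum>\<pi> | \<pi> \<in> ?P \<and> \<not> evenperm \<pi>. Q \<pi>)"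
    by (rule sum.reindex_bij_witness[of _ "\<lambda>\<pi>. ?t \<circ> \<pi>" "\<lambda>\<pi>. ?t \<circ> \<pi>"])
      (use tt ev Qt permutes_compose[OF _ tp] in auto)
  moreover have "standard_sum N a = (\<Sum>\<pi>\<in>?P. if evenperm \<pi> then Q \<pi> else - Q \<pi>)"
    unfolding standard_sum_def by (rule sum.cong) (auto simp: sign_def Q_def)
  moreover have "\<dots> = (\<Sum>\<pi> | \<pi> \<in> ?P \<and> evenperm \<pi>. Q \<pi>) + (\<Sum>\<pi> | \<pi> \<in> ?P \<and> \<not> evenperm \<pi>. - Q \<pi>)"
    by (subst sum.If_cases[OF fin]) (simp add: Int_def conj_commute)
  ultimately show ?thesis by (simp add: sum_negf)
qed

lemma prod_list_expand_slot:
  fixes a :: "nat \<Rightarrow> 'a::ring_1"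
  assumes as: "\<And>d. a s * d = (\<Sum>t\<in>T. a t * d * e t)" and xs: "distinct xs" "s \<in> set xs"
  shows "prod_list (map a xs) = (\<Sum>t\<in>T. prod_list (map (a(s := a t)) xs) * e t)"
  using xs
proof (induction xs)
  case (Cons x xs)
  show ?case
  proof (cases "x = s")
    case True
    then have eq: "map (a(s := d)) xs = map a xs" for d using Cons.prems by (intro map_fun_upd) simp
    have "prod_list (map (a(s := a t)) (x # xs)) = a t * prod_list (map a xs)" for t
      by (simp only: list.map prod_list.Cons eq) (simp add: True)
    then show ?thesis using True as[of "prod_list (map a xs)"] by (simp only: list.map prod_list.Cons)
  next
    case False
    have IH: "prod_list (map a xs) = (\<Sum>t\<in>T. prod_list (map (a(s := a t)) xs) * e t)"
      by (rule Cons.IH) (use Cons.prems False in auto)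
    have "prod_list (map (a(s := a t)) (x # xs)) = a x * prod_list (map (a(s := a t)) xs)" for t
      using False by simp
    then show ?thesis by (simp only: list.map prod_list.Cons IH sum_distrib_left mult.assoc)
  qed
qed simp

text \<open>Left multiplications commute with the right action of \<open>L\<close>. Among more than \<open>m\<^sup>2\<close> of them, where
  \<open>m\<close> is the dimension, one is a combination of the others with coefficients from \<open>L\<close> on the right,
  and the alternating sum vanishes when it is expanded.\<close>

lemma standard_identity:
  fixes L :: "'d::division_ring set"
  assumes L: "division_subring L" "L \<subseteq> centralizer L" and fin: "rfin L UNIV"
  shows "\<exists>N. \<forall>a :: nat \<Rightarrow> 'd. standard_sum N a = 0"
proof -
  interpret L: division_subring L by fact
  from fin obtain B where B: "finite B" "UNIV \<subseteq> rspan L B" by (auto simp: rfin_def)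
  have "\<forall>d. \<exists>\<mu>. (\<forall>b\<in>B. \<mu> b \<in> L) \<and> d = (\<Sum>b\<in>B. b * \<mu> b)"
    using B(2) unfolding L.rspan_finite[OF B(1)] by blast
  then obtain \<mu> where \<mu>: "\<forall>d. (\<forall>b\<in>B. \<mu> d b \<in> L) \<and> d = (\<Sum>b\<in>B. b * \<mu> d b)" by metis
  \<comment> \<open>One more than the number of coordinates of a left multiplication.\<close>
  define N where "N = Suc (card (B \<times> B))"
  have "standard_sum N a = 0" for a :: "nat \<Rightarrow> 'd"
  proof -
    have "\<exists>c. (\<forall>t\<in>{..<N}. c t \<in> L) \<and> (\<exists>t\<in>{..<N}. c t \<noteq> 0) \<and>
      (\<forall>p\<in>B \<times> B. (\<Sum>t\<in>{..<N}. \<mu> (a t * fst p) (snd p) * c t) = 0)"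
      by (rule L.homogeneous_system_right) (use B(1) \<mu> in \<open>auto simp: N_def\<close>)
    then obtain c s where c: "\<forall>t\<in>{..<N}. c t \<in> L" "s < N" "c s \<noteq> 0"
      "\<forall>p\<in>B \<times> B. (\<Sum>t\<in>{..<N}. \<mu> (a t * fst p) (snd p) * c t) = 0" by auto
    have onB: "(\<Sum>t<N. a t * b * c t) = 0" if b: "b \<in> B" for b
    proof -
      have "(\<Sum>t<N. a t * b * c t) = (\<Sum>t<N. (\<Sum>b'\<in>B. b' * \<mu> (a t * b) b') * c t)"
        by (rule sum.cong[OF refl]) (use \<mu> in metis)
      also have "\<dots> = (\<Sum>t<N. \<Sum>b'\<in>B. b' * (\<mu> (a t * b) b' * c t))" by (simp add: sum_distrib_right mult.assoc)
      also have "\<dots> = (\<Sum>b'\<in>B. \<Sum>t<N. b' * (\<mu> (a t * b) b' * c t))" by (rule sum.swap)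
      also have "\<dots> = (\<Sum>b'\<in>B. b' * (\<Sum>t<N. \<mu> (a t * b) b' * c t))" by (simp add: sum_distrib_left)
      also have "\<dots> = 0" by (rule sum.neutral) (use c(4) b in auto)
      finally show ?thesis .
    qed
    have "rspan L B \<subseteq> {d. (\<Sum>t<N. a t * d * c t) = 0}"
    proof (rule rspan_minimal)
      show "rsubspace L {d. (\<Sum>t<N. a t * d * c t) = 0}"
      proof (rule rsubspaceI)
        fix u l assume u: "u \<in> {d. (\<Sum>t<N. a t * d * c t) = 0}" and l: "l \<in> L"
        have "(\<Sum>t<N. a t * (u * l) * c t) = (\<Sum>t<N. a t * u * c t) * l"
          unfolding sum_distrib_right
        proof (rule sum.cong[OF refl])
          fix t assume "t \<in> {..<N}"
          then have "l * c t = c t * l" using c(1) l L(2) by (auto simp: centralizer_def)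
          then show "a t * (u * l) * c t = a t * u * c t * l" by (simp add: mult.assoc)
        qed
        then show "u * l \<in> {d. (\<Sum>t<N. a t * d * c t) = 0}" using u by simp
      qed (simp_all add: distrib_left distrib_right sum.distrib)
      show "B \<subseteq> {d. (\<Sum>t<N. a t * d * c t) = 0}" using onB by blast
    qed
    then have all: "(\<Sum>t<N. a t * d * c t) = 0" for d using B(2) by blast
    define e where "e = (\<lambda>t. - (c t * inverse (c s)))"
    let ?T = "{..<N} - {s}"
    have as: "a s * d = (\<Sum>t\<in>?T. a t * d * e t)" for d
    proof -
      have "a s * d * c s + (\<Sum>t\<in>?T. a t * d * c t) = 0"
        using all[of d] sum.remove[of "{..<N}" s "\<lambda>t. a t * d * c t"] c(2) by simp
      then have "a s * d * c s = - (\<Sum>t\<in>?T. a t * d * c t)" by (simp add: eq_neg_iff_add_eq_0)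
      then have "a s * d * c s * inverse (c s) = (\<Sum>t\<in>?T. a t * d * e t)"
        by (simp add: e_def sum_distrib_right sum_negf mult.assoc)
      then show ?thesis using c(3) by (simp add: mult.assoc)
    qed
    have "standard_sum N a = (\<Sum>\<pi> | \<pi> permutes {..<N}. \<Sum>t\<in>?T.
        of_int (sign \<pi>) * prod_list (map (a(s := a t)) (map \<pi> [0..<N])) * e t)"
      unfolding standard_sum_def
    proof (rule sum.cong[OF refl])
      fix \<pi> assume "\<pi> \<in> {\<pi>. \<pi> permutes {..<N}}"
      then have \<pi>: "\<pi> permutes {..<N}" by simp
      have "distinct (map \<pi> [0..<N])" using permutes_inj_on[OF \<pi>] by (simp add: distinct_map)
      moreover have "s \<in> set (map \<pi> [0..<N])" using permutes_image[OF \<pi>] c(2) by (simp add: atLeast0LessThan)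
      ultimately have "prod_list (map a (map \<pi> [0..<N])) = (\<Sum>t\<in>?T. prod_list (map (a(s := a t)) (map \<pi> [0..<N])) * e t)"
        by (rule prod_list_expand_slot[OF as])
      then show "of_int (sign \<pi>) * prod_list (map a (map \<pi> [0..<N])) =
          (\<Sum>t\<in>?T. of_int (sign \<pi>) * prod_list (map (a(s := a t)) (map \<pi> [0..<N])) * e t)"
        by (simp only: sum_distrib_left mult.assoc)
    qed
    also have "\<dots> = (\<Sum>t\<in>?T. standard_sum N (a(s := a t)) * e t)"
      unfolding standard_sum_def sum_distrib_right by (rule sum.swap)
    also have "\<dots> = 0"
    proof (rule sum.neutral, rule ballI)
      fix t assume "t \<in> ?T"
      then have "standard_sum N (a(s := a t)) = 0" using c(2) by (intro standard_sum_alternating[of s N t]) auto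
      then show "standard_sum N (a(s := a t)) * e t = 0" by simp
    qed
    finally show ?thesis .
  qed
  then show ?thesis by blast
qed

lemma (in k_algebra) polynomial_identity_of_standard:
  assumes "\<And>y. standard_sum N y = (0::'a)"
  shows satisfies_polynomial_identity
proof -
  let ?P = "{\<pi>. \<pi> permutes {..<N}}"
  define w where "w = (\<lambda>\<pi>::nat \<Rightarrow> nat. map \<pi> [0..<N])"
  define f :: "nat list \<Rightarrow>\<^sub>0 'k" where "f = (\<Sum>\<pi>\<in>?P. Poly_Mapping.single (w \<pi>) (of_int (sign \<pi>)))"
  have fin: "finite ?P" by (rule finite_permutations) simp
  have inj: "\<pi> = \<sigma>" if "\<pi> \<in> ?P" "\<sigma> \<in> ?P" "w \<pi> = w \<sigma>" for \<pi> \<sigma>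
  proof
    fix i
    show "\<pi> i = \<sigma> i"
    proof (cases "i < N")
      case True
      then show ?thesis using that(3) by (simp add: w_def)
    next
      case False
      then show ?thesis using permutes_not_in[of \<pi> "{..<N}" i] permutes_not_in[of \<sigma> "{..<N}" i] that(1,2) by simp
    qed
  qed
  have look: "Poly_Mapping.lookup f (w \<pi>) = of_int (sign \<pi>)" if p: "\<pi> \<in> ?P" for \<pi>
  proof -
    have "Poly_Mapping.lookup f (w \<pi>) = (\<Sum>\<sigma>\<in>?P. if \<sigma> = \<pi> then of_int (sign \<sigma>) else 0)"
      unfolding f_def lookup_sum by (rule sum.cong[OF refl]) (use inj p in \<open>auto simp: lookup_single when_def\<close>)
    then show ?thesis using p fin by (simp add: sum.delta)
  qed
  have keys: "Poly_Mapping.keys f \<subseteq> w ` ?P"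
  proof
    fix v assume "v \<in> Poly_Mapping.keys f"
    then have "(\<Sum>\<sigma>\<in>?P. Poly_Mapping.lookup (Poly_Mapping.single (w \<sigma>) (of_int (sign \<sigma>) :: 'k)) v) \<noteq> 0"
      by (simp add: in_keys_iff f_def lookup_sum)
    then obtain \<sigma> where "\<sigma> \<in> ?P" "Poly_Mapping.lookup (Poly_Mapping.single (w \<sigma>) (of_int (sign \<sigma>) :: 'k)) v \<noteq> 0"
      by (rule sum.not_neutral_contains_not_neutral)
    then show "v \<in> w ` ?P" by (auto simp: lookup_single when_def split: if_splits)
  qed
  have "id \<in> ?P" by (simp add: permutes_id)
  from look[OF this] have "Poly_Mapping.lookup f (w id) = 1" by simp
  then have "f \<noteq> 0" by auto
  moreover have "nc_eval y f = 0" for y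
  proof -
    have "nc_eval y f = (\<Sum>v\<in>w ` ?P. scale (Poly_Mapping.lookup f v) (prod_list (map y v)))"
      unfolding nc_eval_def by (rule sum.mono_neutral_left) (use fin keys in \<open>auto simp: in_keys_iff\<close>)
    also have "\<dots> = (\<Sum>\<pi>\<in>?P. scale (Poly_Mapping.lookup f (w \<pi>)) (prod_list (map y (w \<pi>))))"
      by (subst sum.reindex) (use inj in \<open>auto simp: inj_on_def\<close>)
    also have "\<dots> = standard_sum N y" unfolding standard_sum_def
    proof (rule sum.cong[OF refl])
      fix \<pi> assume "\<pi> \<in> ?P"
      from look[OF this]
      show "scale (Poly_Mapping.lookup f (w \<pi>)) (prod_list (map y (w \<pi>))) = of_int (sign \<pi>) * prod_list (map y (map \<pi> [0..<N]))"
        by (cases "evenperm \<pi>") (simp_all add: sign_def w_def)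
    qed
    finally show ?thesis using assms by simp
  qed
  ultimately show ?thesis unfolding satisfies_polynomial_identity_def by blast
qed

section \<open>The filtration of the quotient division ring\<close>

context ore_quotient
begin

abbreviation kD :: "'d set" where "kD \<equiv> range (\<lambda>c. scaleD c 1)"

lemma scaleD_left: "scaleD c d = scaleD c 1 * d"
  by (simp add: D.scale_mult_left)

lemma scaleD_right: "scaleD c d = d * scaleD c 1"
  by (simp add: D.scale_mult_right)

lemma kD_central: "z \<in> kD \<Longrightarrow> z * d = d * z"
  by (auto simp: D.scale_mult_left D.scale_mult_right)

lemma kD_mult: "scaleD a 1 * scaleD b 1 = scaleD (a * b) 1"
  by (simp add: D.scale_mult_left)

lemma division_subring_kD: "division_subring kD"
proof
  show "1 \<in> kD" by (rule range_eqI[of _ _ 1]) simp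
  fix a b assume "a \<in> kD" "b \<in> kD"
  then obtain c d where cd: "a = scaleD c 1" "b = scaleD d 1" by auto
  show "a - b \<in> kD" by (rule range_eqI[of _ _ "c - d"]) (simp add: cd D.scale_left_diff_distrib)
  show "a * b \<in> kD" by (rule range_eqI[of _ _ "c * d"]) (simp add: cd kD_mult)
next
  fix a assume "a \<in> kD"
  then obtain c where c: "a = scaleD c 1" by auto
  show "inverse a \<in> kD"
  proof (cases "c = 0")
    case True
    then show ?thesis using c by (intro range_eqI[of _ _ 0]) simp
  next
    case False
    then have "a * scaleD (inverse c) 1 = 1" using c by (simp add: kD_mult)
    then have "inverse a = scaleD (inverse c) 1" by (rule inverse_unique)
    then show ?thesis by blast
  qed
qed

lemma emb_zero: "\<iota> 0 = 0"
  using emb_add[of 0 0] by simp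

lemma emb_sum: "\<iota> (\<Sum>i\<in>I. f i) = (\<Sum>i\<in>I. \<iota> (f i))"
  by (induction I rule: infinite_finite_induct) (simp_all add: emb_zero emb_add)

lemma emb_minus: "\<iota> (- a) = - \<iota> a"
  using emb_add[of a "- a"] by (simp add: emb_zero eq_neg_iff_add_eq_0 add.commute)

lemma emb_power: "\<iota> (a ^ n) = \<iota> a ^ n"
  by (induction n) (simp_all add: emb_one emb_mult)

lemma emb_prod_list: "\<iota> (prod_list xs) = prod_list (map \<iota> xs)"
  by (induction xs) (simp_all add: emb_one emb_mult)

lemma emb_eq_0: "\<iota> a = 0 \<longleftrightarrow> a = 0"
  using emb_inj emb_zero by (metis injD)

lemma transc_emb:
  assumes "\<not> A.algebraic_elem x" shows "transc kD (\<iota> x)"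
  unfolding transc_def
proof (rule allI, rule allI, rule impI, rule impI, rule ccontr)
  fix n c assume c: "\<forall>i<n. c i \<in> kD" "(\<Sum>i<n. \<iota> x ^ i * c i) = 0" and nz: "\<not> (\<forall>i<n. c i = 0)"
  have "\<forall>i. \<exists>k. i < n \<longrightarrow> c i = scaleD k 1" using c(1) by blast
  from choice[OF this] obtain k where k: "\<forall>i. i < n \<longrightarrow> c i = scaleD (k i) 1" by (elim exE)
  have "\<iota> (\<Sum>i<n. scaleA (k i) (x ^ i)) = (\<Sum>i<n. \<iota> x ^ i * c i)"
    unfolding emb_sum by (rule sum.cong) (use k in \<open>simp_all add: emb_scale emb_power D.scale_mult_right\<close>)
  then have s: "(\<Sum>i<n. scaleA (k i) (x ^ i)) = 0" using c(2) emb_eq_0 by simp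
  define p where "p = (\<Sum>i<n. monom (k i) i)"
  have co: "coeff p j = (if j < n then k j else 0)" for j
    by (simp add: p_def coeff_sum)
  from nz obtain i where "i < n" "c i \<noteq> 0" by blast
  then have "coeff p i \<noteq> 0" using k co by auto
  then have "p \<noteq> 0" by auto
  moreover have "(\<Sum>i\<le>degree p. scaleA (coeff p i) (x ^ i)) = 0"
  proof -
    have "(\<Sum>i\<le>degree p. scaleA (coeff p i) (x ^ i)) = (\<Sum>i<n + Suc (degree p). scaleA (coeff p i) (x ^ i))"
      by (rule sum.mono_neutral_left) (auto simp: coeff_eq_0)
    also have "\<dots> = (\<Sum>i<n. scaleA (k i) (x ^ i))"
      by (rule sum.mono_neutral_cong_right) (auto simp: co)
    finally show ?thesis using s by simp
  qed
  ultimately show False using assms unfolding A.algebraic_elem_def by blast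
qed

lemma free_on_of_free_pair:
  assumes "free_pair kD y z" shows "D.free_on y z"
  unfolding D.free_on_def
proof (rule injI)
  let ?v = "\<lambda>b. if b then y else z"
  fix f h :: "bool list \<Rightarrow>\<^sub>0 'k" assume eq: "D.nc_eval ?v f = D.nc_eval ?v h"
  define n where "n = Max (insert 0 (length ` (Poly_Mapping.keys f \<union> Poly_Mapping.keys h)))"
  have fin: "finite (words_upto n)"
    using finite_lists_length_le[of "UNIV :: bool set" n] by (simp add: words_upto_def)
  have sub: "Poly_Mapping.keys f \<union> Poly_Mapping.keys h \<subseteq> words_upto n"
  proof
    fix w assume "w \<in> Poly_Mapping.keys f \<union> Poly_Mapping.keys h"
    then have "length w \<le> n" unfolding n_def by (intro Max_ge) auto
    then show "w \<in> words_upto n" by (simp add: words_upto_def)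
  qed
  have ev: "D.nc_eval ?v g = (\<Sum>w\<in>words_upto n. scaleD (Poly_Mapping.lookup g w) (prod_list (map ?v w)))"
    if "Poly_Mapping.keys g \<subseteq> words_upto n" for g
    unfolding D.nc_eval_def by (rule sum.mono_neutral_left) (use that fin in \<open>auto simp: in_keys_iff\<close>)
  define c where "c = (\<lambda>w. scaleD (Poly_Mapping.lookup f w - Poly_Mapping.lookup h w) 1)"
  have "(\<Sum>w\<in>words_upto n. c w * prod_list (map ?v w)) = D.nc_eval ?v f - D.nc_eval ?v h"
  proof -
    have "c w * d = scaleD (Poly_Mapping.lookup f w) d - scaleD (Poly_Mapping.lookup h w) d" for w d
      unfolding c_def scaleD_left[symmetric] by (rule D.scale_left_diff_distrib)
    then show ?thesis using ev[of f] ev[of h] sub by (simp add: sum_subtractf)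
  qed
  also have "\<dots> = 0" using eq by simp
  finally have s0: "(\<Sum>w\<in>words_upto n. c w * prod_list (map ?v w)) = 0" .
  have "\<forall>w. c w \<in> kD" by (simp add: c_def)
  from assms[unfolded free_pair_def, THEN spec, THEN spec, THEN mp, THEN mp, OF this s0]
  have "\<forall>w\<in>words_upto n. c w = 0" .
  then have "Poly_Mapping.lookup f w = Poly_Mapping.lookup h w" if "w \<in> words_upto n" for w
    using that by (auto simp: c_def)
  moreover have "Poly_Mapping.lookup f w = Poly_Mapping.lookup h w" if "w \<notin> words_upto n" for w
  proof -
    have "w \<notin> Poly_Mapping.keys f" "w \<notin> Poly_Mapping.keys h" using sub that by auto
    then show ?thesis by (simp add: in_keys_iff)
  qed
  ultimately show "f = h" by (intro poly_mapping_eqI) blast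
qed

definition products :: "'a set \<Rightarrow> nat \<Rightarrow> 'a set" where
  "products S n = {prod_list w | w. set w \<subseteq> S \<and> length w \<le> n}"

lemma finite_products: "finite S \<Longrightarrow> finite (products S n)"
proof -
  assume "finite S"
  from finite_imageI[OF finite_lists_length_le[OF this, of n], of prod_list]
  show ?thesis unfolding products_def by (rule rev_finite_subset) auto
qed

text \<open>A basis of the growth space spans the image.\<close>

lemma dim_filtration_le:
  assumes S: "finite S"
  shows "rdim kD (rspan kD (\<iota> ` products S n)) \<le> A.dim (A.growth_space S n)"
proof -
  interpret kD: division_subring kD by (rule division_subring_kD)
  have gs: "A.growth_space S n = A.span (products S n)" by (simp add: A.growth_space_def products_def)
  obtain B where B: "B \<subseteq> A.growth_space S n" "\<not> A.dependent B" "A.growth_space S n \<subseteq> A.span B" "card B = A.dim (A.growth_space S n)"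
    using A.basis_exists by blast
  have finB: "finite B" using A.independent_span_bound[OF finite_products[OF S] B(2)] B(1) gs by auto
  have "A.subspace {a. \<iota> a \<in> rspan kD (\<iota> ` B)}"
  proof (rule A.subspaceI)
    fix c a assume "a \<in> {a. \<iota> a \<in> rspan kD (\<iota> ` B)}"
    then have "\<iota> a * scaleD c 1 \<in> rspan kD (\<iota> ` B)" by (auto intro: rsubspace_scale[OF rsubspace_rspan])
    then show "scaleA c a \<in> {a. \<iota> a \<in> rspan kD (\<iota> ` B)}" by (simp add: emb_scale scaleD_right[of c "\<iota> a"])
  qed (auto simp: emb_zero emb_add rsubspace_0[OF rsubspace_rspan] intro: rsubspace_add[OF rsubspace_rspan])
  then have "A.span B \<subseteq> {a. \<iota> a \<in> rspan kD (\<iota> ` B)}" by (rule A.span_minimal[rotated]) (auto intro: rspan_base)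
  moreover have "products S n \<subseteq> A.span B" using B(3) A.span_superset[of "products S n"] gs by auto
  ultimately have "rspan kD (\<iota> ` products S n) \<subseteq> rspan kD (\<iota> ` B)" by (intro rspan_minimal[OF rsubspace_rspan]) blast
  then have "rdim kD (rspan kD (\<iota> ` products S n)) \<le> card (\<iota> ` B)" by (rule kD.rdim_le_card[rotated]) (use finB in simp)
  also have "\<dots> \<le> card B" by (rule card_image_le[OF finB])
  finally show ?thesis using B(4) by simp
qed

lemma filtered_growth_products:
  assumes S: "finite S" "A.subalgebra hull S = UNIV" and gk: "A.gk_dim < 3"
  shows "\<exists>\<gamma>. filtered_growth kD (\<lambda>n. rspan kD (\<iota> ` products S n)) \<gamma>"
proof -
  let ?A = "\<lambda>n. rspan kD (\<iota> ` products S n)"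
  interpret kD: division_subring kD by (rule division_subring_kD)
  have mono: "?A m \<subseteq> ?A n" if "m \<le> n" for m n
    by (intro rspan_mono image_mono) (unfold products_def, use that in \<open>blast intro: order_trans\<close>)
  have mult: "a * b \<in> ?A (m + n)" if ab: "a \<in> ?A m" "b \<in> ?A n" for a b m n
  proof -
    have pq: "\<iota> p * \<iota> q \<in> ?A (m + n)" if pq: "p \<in> products S m" "q \<in> products S n" for p q
    proof -
      from pq obtain v w where vw: "p = prod_list v" "q = prod_list w" "set v \<subseteq> S" "set w \<subseteq> S" "length v \<le> m" "length w \<le> n"
        by (auto simp: products_def)
      then have "p * q \<in> products S (m + n)" unfolding products_def by (intro CollectI exI[of _ "v @ w"]) auto
      then show ?thesis unfolding emb_mult[symmetric] by (intro rspan_base imageI)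
    qed
    have pb: "\<iota> p * b \<in> ?A (m + n)" if "p \<in> products S m" for p
    proof -
      have "?A n \<subseteq> {b. \<iota> p * b \<in> ?A (m + n)}"
        by (rule rspan_minimal[OF rsubspace_lmult_preimage[OF rsubspace_rspan]]) (use pq[OF that] in auto)
      then show ?thesis using ab(2) by blast
    qed
    have "?A m \<subseteq> {a. a * b \<in> ?A (m + n)}"
      by (rule rspan_minimal[OF rsubspace_rmult_preimage[OF rsubspace_rspan]]) (use pb kD_central in auto)
    then show ?thesis using ab(1) by blast
  qed
  have exhaust: "\<exists>n. \<iota> a \<in> ?A n" for a
  proof -
    let ?T = "{a. \<exists>n. \<iota> a \<in> ?A n}"
    have "A.subalgebra ?T" unfolding A.subalgebra_def
    proof (intro conjI ballI)
      show "A.subspace ?T"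
      proof (rule A.subspaceI)
        show "0 \<in> ?T" by (simp add: emb_zero rsubspace_0[OF rsubspace_rspan])
        fix a b assume "a \<in> ?T" "b \<in> ?T"
        then obtain m n where "\<iota> a \<in> ?A m" "\<iota> b \<in> ?A n" by blast
        then have "\<iota> a \<in> ?A (m + n)" "\<iota> b \<in> ?A (m + n)" using mono[of m "m + n"] mono[of n "m + n"] by auto
        then have "\<iota> (a + b) \<in> ?A (m + n)" unfolding emb_add by (rule rsubspace_add[OF rsubspace_rspan])
        then show "a + b \<in> ?T" by blast
      next
        fix c a assume "a \<in> ?T"
        then obtain n where "\<iota> a \<in> ?A n" by blast
        then have "\<iota> a * scaleD c 1 \<in> ?A n" by (auto intro: rsubspace_scale[OF rsubspace_rspan])
        then have "\<iota> (scaleA c a) \<in> ?A n" by (simp add: emb_scale scaleD_right[of c "\<iota> a"])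
        then show "scaleA c a \<in> ?T" by blast
      qed
      have "1 \<in> products S 0" by (auto simp: products_def)
      then have "\<iota> 1 \<in> ?A 0" by (intro rspan_base imageI)
      then show "1 \<in> ?T" by blast
      fix a b assume "a \<in> ?T" "b \<in> ?T"
      then obtain m n where "\<iota> a \<in> ?A m" "\<iota> b \<in> ?A n" by blast
      then have "\<iota> (a * b) \<in> ?A (m + n)" unfolding emb_mult by (rule mult)
      then show "a * b \<in> ?T" by blast
    qed
    moreover have "S \<subseteq> ?T"
    proof
      fix s assume "s \<in> S"
      then have "s \<in> products S 1" unfolding products_def by (intro CollectI exI[of _ "[s]"]) simp
      then have "\<iota> s \<in> ?A 1" by (intro rspan_base imageI)
      then show "s \<in> ?T" by blast
    qed
    ultimately have "A.subalgebra hull S \<subseteq> ?T" by (simp add: hull_minimal)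
    then show ?thesis using S(2) by blast
  qed
  have "limsup (\<lambda>n. ereal (ln (real (A.dim (A.growth_space S n))) / ln (real n))) \<le> A.gk_dim"
    unfolding A.gk_dim_def by (rule SUP_upper) (simp add: S(1))
  then have "limsup (\<lambda>n. ereal (ln (real (A.dim (A.growth_space S n))) / ln (real n))) < ereal 3" using gk by simp
  from ereal_dense2[OF this] obtain \<gamma> where
    \<gamma>: "limsup (\<lambda>n. ereal (ln (real (A.dim (A.growth_space S n))) / ln (real n))) < ereal \<gamma>" "\<gamma> < 3" by auto
  from Limsup_lessD[OF \<gamma>(1)] obtain n1 where
    n1: "\<And>n. n1 \<le> n \<Longrightarrow> ln (real (A.dim (A.growth_space S n))) / ln (real n) < \<gamma>"
    by (auto simp: eventually_sequentially)
  have bound: "rdim kD (?A n) \<le> real n powr \<gamma>" if n: "n \<ge> max n1 2" for n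
  proof -
    let ?d = "real (A.dim (A.growth_space S n))"
    have "?d \<le> real n powr \<gamma>"
    proof (cases "?d = 0")
      case False
      have "0 < ln (real n)" using n by simp
      then have "ln ?d < \<gamma> * ln (real n)" using n1[of n] n by (simp add: divide_less_eq)
      then have "exp (ln ?d) < exp (\<gamma> * ln (real n))" by simp
      then show ?thesis using False n by (simp add: powr_def)
    qed simp
    then show ?thesis using dim_filtration_le[OF S(1), of n] by linarith
  qed
  have "filtered_growth kD ?A \<gamma>"
  proof
    show "z * d = d * z" if "z \<in> kD" for z d using kD_central[OF that] .
    show "rsubspace kD (?A n)" for n by (rule rsubspace_rspan)
    show "rfin kD (?A n)" for n by (rule kD.rfin_rspan) (simp add: finite_products[OF S(1)])
    have "1 \<in> products S n" for n unfolding products_def by (intro CollectI exI[of _ "[]"]) simp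
    then have one: "1 \<in> ?A n" for n using rspan_base[OF imageI, of 1 "products S n" \<iota> kD] by (simp add: emb_one)
    then show "1 \<in> ?A 0" .
    show "?A n \<subseteq> ?A (Suc n)" for n by (rule mono) simp
    show "a * b \<in> ?A (m + n)" if "a \<in> ?A m" "b \<in> ?A n" for a b m n by (rule mult[OF that])
    show "?A (Suc n) \<subseteq> U" if U: "rsubspace kD U" "\<And>a b. a \<in> ?A 1 \<Longrightarrow> b \<in> ?A n \<Longrightarrow> a * b \<in> U" for U n
    proof (rule rspan_minimal[OF U(1)], clarify)
      fix p assume "p \<in> products S (Suc n)"
      then obtain w where w: "p = prod_list w" "set w \<subseteq> S" "length w \<le> Suc n" by (auto simp: products_def)
      show "\<iota> p \<in> U"
      proof (cases w)
        case Nil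
        then show ?thesis using U(2)[OF one one] w by (simp add: emb_one)
      next
        case (Cons s v)
        have "s \<in> products S 1" unfolding products_def using w Cons by (intro CollectI exI[of _ "[s]"]) simp
        moreover have "prod_list v \<in> products S n" unfolding products_def using w Cons by (intro CollectI exI[of _ v]) simp
        ultimately have "\<iota> s * \<iota> (prod_list v) \<in> U" by (intro U(2) rspan_base imageI)
        then show ?thesis using w Cons by (simp add: emb_mult)
      qed
    qed
    show "\<exists>n. \<exists>s\<in>?A n. s \<noteq> 0 \<and> d * s \<in> ?A n" for d
    proof -
      obtain a s where as: "s \<noteq> 0" "d = \<iota> a * inverse (\<iota> s)" using fractions by blast
      obtain m n where mn: "\<iota> a \<in> ?A m" "\<iota> s \<in> ?A n" using exhaust by blast
      have "\<iota> s \<noteq> 0" using as(1) emb_eq_0 by simp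
      then have "d * \<iota> s = \<iota> a" using as(2) by (simp add: mult.assoc)
      then show ?thesis using mn mono[of m "m + n"] mono[of n "m + n"] \<open>\<iota> s \<noteq> 0\<close>
        by (intro exI[of _ "m + n"] bexI[of _ "\<iota> s"]) auto
    qed
    show "\<gamma> < 3" by fact
    show "\<exists>n0. \<forall>n\<ge>n0. real (rdim kD (?A n)) \<le> real n powr \<gamma>" using bound by blast
  qed
  then show ?thesis ..
qed

lemma emb_standard_sum: "\<iota> (standard_sum N y) = standard_sum N (\<lambda>i. \<iota> (y i))"
proof -
  have "\<iota> (of_int (sign \<pi>) * p) = of_int (sign \<pi>) * \<iota> p" for \<pi> :: "nat \<Rightarrow> nat" and p
    by (simp add: sign_def emb_minus)
  then show ?thesis by (simp add: standard_sum_def emb_sum emb_prod_list comp_def)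
qed

end

theorem theorem6p4:
  fixes scaleA :: "'k::field \<Rightarrow> 'a::ring_1_no_zero_divisors \<Rightarrow> 'a"
    and scaleD :: "'k \<Rightarrow> 'd::division_ring \<Rightarrow> 'd"
    and \<iota> :: "'a \<Rightarrow> 'd"
    and x :: 'a
  assumes "uncountable (UNIV :: 'k set)"
    and "k_algebra scaleA"
    and "k_algebra.finitely_generated scaleA"
    and "k_algebra.gk_dim scaleA < 3"
    and "\<not> k_algebra.algebraic_algebra scaleA"
    and "\<not> k_algebra.algebraic_elem scaleA x"
    and "ore_quotient scaleA scaleD \<iota>"
    and "CHAR('k) > 0 \<Longrightarrow> \<not> (\<exists>u. \<iota> x * u * inverse (\<iota> x) = u + 1)"
    and "\<not> k_algebra.satisfies_polynomial_identity scaleA"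
  shows "k_algebra.contains_free_algebra scaleD"
proof (rule ccontr)
  interpret ore_quotient scaleA scaleD \<iota> by fact
  assume "\<not> k_algebra.contains_free_algebra scaleD"
  then have no_free: "\<not> free_pair kD y z" for y z
    using free_on_of_free_pair[of y z] D.contains_free_algebra_def by blast
  interpret kD: division_subring kD by (rule division_subring_kD)
  have tx: "transc kD (\<iota> x)" by (rule transc_emb) fact
  have x0: "\<iota> x \<noteq> 0" by (rule transc_nonzero[OF tx kD.one_mem kD.zero_mem])
  have unc: "uncountable kD"
  proof
    assume "countable kD"
    moreover have "inj (\<lambda>c. scaleD c 1)" by (rule injI) (simp add: D.scale_right_imp_eq[of 1])
    ultimately show False using assms(1) countable_image_inj_on by blast
  qed
  have no_shift: "\<not> (\<exists>u. \<iota> x * u * inverse (\<iota> x) = u + 1)"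
  proof (cases "CHAR('k) > 0")
    case False
    show ?thesis
    proof
      assume "\<exists>u. \<iota> x * u * inverse (\<iota> x) = u + 1"
      then obtain u where u: "\<iota> x * u * inverse (\<iota> x) = u + 1" ..
      have "\<iota> x * u = (u + 1) * \<iota> x" unfolding u[symmetric] using x0 by (simp add: mult.assoc)
      then interpret shift_pair "\<lambda>c. scaleD c 1" "\<iota> x" u
        using False x0 kD_mult kD_central by unfold_locales (auto simp: D.scale_left_distrib)
      from free_pair_of_shift[unfolded Z_def] no_free show False by blast
    qed
  qed (use assms(8) in blast)
  have alg: "\<not> transc (centralizer {\<iota> x}) a \<or> \<not> left_transc (centralizer {\<iota> x}) a" for a
    by (rule algebraic_over_centralizer[OF division_subring_kD kD_central unc tx no_free no_shift])
  from assms(3) obtain S where S: "finite S" "A.subalgebra hull S = UNIV" unfolding A.finitely_generated_def by blast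
  have "A.subalgebra hull insert x S = UNIV" using hull_mono[of S "insert x S" A.subalgebra] S(2) by auto
  from filtered_growth_products[OF _ this assms(4)] S(1) obtain \<gamma> where
    "filtered_growth kD (\<lambda>n. rspan kD (\<iota> ` products (insert x S) n)) \<gamma>" by auto
  then interpret filtered_growth kD "\<lambda>n. rspan kD (\<iota> ` products (insert x S) n)" \<gamma> .
  have "x \<in> products (insert x S) 1" unfolding products_def by (intro CollectI exI[of _ "[x]"]) simp
  then have "\<iota> x \<in> rspan kD (\<iota> ` products (insert x S) 1)" by (intro rspan_base imageI)
  from finite_over_centralizer[OF tx this alg] have "rfin (centralizer {\<iota> x}) UNIV" .
  from kD.central_transcendental[OF kD_central tx this] obtain z where
    z: "\<And>d. z * d = d * z" "transc kD z" by blast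
  from finite_over_commutative[OF z(2,1)] obtain L :: "'d set" where
    L: "division_subring L" "L \<subseteq> centralizer L" "rfin L UNIV" by blast
  from standard_identity[OF L] obtain N where N: "\<And>a :: nat \<Rightarrow> 'd. standard_sum N a = 0" by blast
  have "standard_sum N y = 0" for y :: "nat \<Rightarrow> 'a"
    using N[of "\<lambda>i. \<iota> (y i)"] emb_standard_sum[of N y] emb_eq_0 by simp
  from A.polynomial_identity_of_standard[OF this] assms(9) show False by blast
qed

end
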